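(* Let $A$ be a cofibrant connective cdga over $\mathbb{C}$ and let $\mathfrak{g}$ be a cofibrant dg-Lie algebroid over $A$. Then the canonical surjection $$\mathrm{Sym}_A^{\mathrm{gr}}(\mathfrak{g})\to\mathrm{gr}(U(\mathfrak{g})^{\mathrm{PBW}})$$ of graded dg-$A$-algebras (where $\mathfrak{g}$ is in weight $1$) is a ($1$-categorical, i.e. degreewise) isomorphism. Moreover, in such a case, $U(\mathfrak{g})$ has an underlying graded projective left $A$-module (i.e. after forgetting differentials).
   Context: All notions here are $1$-categorical (differential graded), with cohomological grading; connective means concentrated in degrees $\le0$; "weight" refers to an additional grading. $\mathbb{T}_A$ is the dg-$A$-module of $\mathbb{C}$-linear derivations of $A$ with commutator bracket. A dg-Lie algebroid over $A$ is a dg-$A$-module $\mathfrak{g}$ with $\mathbb{C}$-linear dg-Lie algebra structure and an anchor map $\rho\colon\mathfrak{g}\to\mathbb{T}_A$, a map of dg-$A$-modules and of dg-Lie algebras over $\mathbb{C}$, such that $[e,ae']=(-1)^{|e||a|}a[e,e']+\rho(e)(a)e'$. Cofibrant refers to the semi-model structure on dg-Lie algebroids over $A$ with quasi-isomorphisms as weak equivalences and degreewise surjections as fibrations. $U(\mathfrak{g})$: give $A\oplus\mathfrak{g}$ the dg-Lie bracket over $\mathbb{C}$ $[a+g,a'+g']=(\rho(g)(a')-(-1)^{|g'||a|}\rho(g')(a))+[g,g']$, let $U(A\oplus\mathfrak{g})^+=U(A\oplus\mathfrak{g})/\mathbb{C}$, and let $U(\mathfrak{g})$ be its quotient by the two-sided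 ideal generated by $\overline{a}\cdot\overline{(a'+g')}-\overline{(aa'+ag')}$. It contains $A$ (not centrally). The PBW filtration has $U(\mathfrak{g})^{\le n}$ spanned by words with at most $n$ elements of $\mathfrak{g}$, with $U(\mathfrak{g})^{\le0}=A$; it makes $U(\mathfrak{g})$ a filtered algebra in dg-$(A,A)$-bimodules whose associated graded $\mathrm{gr}(U(\mathfrak{g})^{\mathrm{PBW}})$ is a graded dg-$A$-algebra. The canonical map in the claim is induced by the map of graded dg-$A$-modules from $\mathfrak{g}$ (in weight $1$) to $\mathrm{gr}(U(\mathfrak{g})^{\mathrm{PBW}})$. *)

theory Defs
  imports "HOL-Algebra.Module" "HOL-Algebra.QuotRing" Complex_Main
begin

section \<open>Graded objects\<close>

text \<open>
  A \<open>\<int>\<close>-graded (cohomologically graded) object is represented by its total object: an abelian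
  group that is the internal direct sum of the subgroups \<open>hpart M n\<close>. The record extends the
  library record \<open>module\<close>, with scalars of type \<open>'r\<close> acting from the left. For \<open>\<complex>\<close>-algebras
  the scalars are complex numbers; for modules and Lie algebras the inherited fields \<open>mult\<close> and
  \<open>one\<close> carry no meaning and are never constrained (as in the library).
\<close>

record ('r, 'm) gmod = "('r, 'm) module" +
  hpart :: "int \<Rightarrow> 'm set"

record ('r, 'm) dgmod = "('r, 'm) gmod" +
  dif :: "'m \<Rightarrow> 'm"

record ('r, 'l) dgla = "('r, 'l) dgmod" +
  bracket :: "'l \<Rightarrow> 'l \<Rightarrow> 'l"

record ('a, 'g) algebroid = "('a, 'g) dgla" +
  anchor :: "'g \<Rightarrow> 'a \<Rightarrow> 'a"

record ('a, 's) wdga = "('a, 's) dgmod" +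
  wpart :: "nat \<Rightarrow> 's set"

definition ksign :: "('m, 'z) ring_scheme \<Rightarrow> int \<Rightarrow> 'm \<Rightarrow> 'm" where
  "ksign M k x = (if even k then x else \<ominus>\<^bsub>M\<^esub> x)"

definition hdecomp :: "('r, 'm, 'z) gmod_scheme \<Rightarrow> 'm \<Rightarrow> (int \<Rightarrow> 'm) \<Rightarrow> bool" where
  "hdecomp M x f \<longleftrightarrow> (\<forall>n. f n \<in> hpart M n) \<and> finite {n. f n \<noteq> \<zero>\<^bsub>M\<^esub>} \<and>
     x = (\<Oplus>\<^bsub>M\<^esub>n\<in>{n. f n \<noteq> \<zero>\<^bsub>M\<^esub>}. f n)"

definition hcomp :: "('r, 'm, 'z) gmod_scheme \<Rightarrow> 'm \<Rightarrow> int \<Rightarrow> 'm" where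
  "hcomp M x = (THE f. hdecomp M x f)"

definition hsupp :: "('r, 'm, 'z) gmod_scheme \<Rightarrow> 'm \<Rightarrow> int set" where
  "hsupp M x = {n. hcomp M x n \<noteq> \<zero>\<^bsub>M\<^esub>}"

definition graded_group :: "('r, 'm, 'z) gmod_scheme \<Rightarrow> bool" where
  "graded_group M \<longleftrightarrow> abelian_group M \<and>
     (\<forall>n. subgroup (hpart M n) (add_monoid M)) \<and>
     (\<forall>x\<in>carrier M. \<exists>!f. hdecomp M x f)"

text \<open>Left modules; the library locale \<open>module\<close> needs strictly commutative scalars.\<close>

definition graded_module ::
  "('k, 'r, 'y) gmod_scheme \<Rightarrow> ('r, 'm, 'z) gmod_scheme \<Rightarrow> bool" where
  "graded_module R M \<longleftrightarrow> graded_group M \<and>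
     (\<forall>a\<in>carrier R. \<forall>x\<in>carrier M. a \<odot>\<^bsub>M\<^esub> x \<in> carrier M) \<and>
     (\<forall>a\<in>carrier R. \<forall>b\<in>carrier R. \<forall>x\<in>carrier M.
        (a \<oplus>\<^bsub>R\<^esub> b) \<odot>\<^bsub>M\<^esub> x = a \<odot>\<^bsub>M\<^esub> x \<oplus>\<^bsub>M\<^esub> b \<odot>\<^bsub>M\<^esub> x) \<and>
     (\<forall>a\<in>carrier R. \<forall>x\<in>carrier M. \<forall>y\<in>carrier M.
        a \<odot>\<^bsub>M\<^esub> (x \<oplus>\<^bsub>M\<^esub> y) = a \<odot>\<^bsub>M\<^esub> x \<oplus>\<^bsub>M\<^esub> a \<odot>\<^bsub>M\<^esub> y) \<and>
     (\<forall>a\<in>carrier R. \<forall>b\<in>carrier R. \<forall>x\<in>carrier M.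
        (a \<otimes>\<^bsub>R\<^esub> b) \<odot>\<^bsub>M\<^esub> x = a \<odot>\<^bsub>M\<^esub> (b \<odot>\<^bsub>M\<^esub> x)) \<and>
     (\<forall>x\<in>carrier M. \<one>\<^bsub>R\<^esub> \<odot>\<^bsub>M\<^esub> x = x) \<and>
     (\<forall>n m. \<forall>a\<in>hpart R n. \<forall>x\<in>hpart M m. a \<odot>\<^bsub>M\<^esub> x \<in> hpart M (n + m))"

definition graded_module_hom ::
  "('k, 'r, 'y) gmod_scheme \<Rightarrow> ('r, 'm, 'z) gmod_scheme \<Rightarrow> ('r, 'n, 'w) gmod_scheme
    \<Rightarrow> ('m \<Rightarrow> 'n) \<Rightarrow> bool" where
  "graded_module_hom R M N f \<longleftrightarrow>
     (\<forall>n. \<forall>x\<in>hpart M n. f x \<in> hpart N n) \<and>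
     (\<forall>x\<in>carrier M. \<forall>y\<in>carrier M. f (x \<oplus>\<^bsub>M\<^esub> y) = f x \<oplus>\<^bsub>N\<^esub> f y) \<and>
     (\<forall>a\<in>carrier R. \<forall>x\<in>carrier M. f (a \<odot>\<^bsub>M\<^esub> x) = a \<odot>\<^bsub>N\<^esub> f x)"

definition degreewise_surj ::
  "('r, 'm, 'z) gmod_scheme \<Rightarrow> ('r, 'n, 'w) gmod_scheme \<Rightarrow> ('m \<Rightarrow> 'n) \<Rightarrow> bool" where
  "degreewise_surj M N f \<longleftrightarrow> (\<forall>n. f ` hpart M n = hpart N n)"

text \<open>
  Projective objects of the category of graded left \<open>R\<close>-modules and maps of degree \<open>0\<close>. The
  carriers of the test modules lie in \<open>'p\<close> and \<open>'q\<close>; a theorem that concludes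
  \<open>graded_projective TYPE('p) TYPE('q) R M\<close> for type variables \<open>'p\<close>, \<open>'q\<close>
  gives the lifting property against all graded modules.
\<close>

definition graded_projective ::
  "'p itself \<Rightarrow> 'q itself \<Rightarrow> ('k, 'r, 'y) gmod_scheme \<Rightarrow> ('r, 'm, 'z) gmod_scheme \<Rightarrow> bool" where
  "graded_projective _ _ R M \<longleftrightarrow> graded_module R M \<and>
     (\<forall>(N :: ('r, 'p) gmod) (Q :: ('r, 'q) gmod) p f.
        graded_module R N \<and> graded_module R Q \<and>
        graded_module_hom R N Q p \<and> degreewise_surj N Q p \<and> graded_module_hom R M Q f \<longrightarrow>
        (\<exists>h. graded_module_hom R M N h \<and> (\<forall>x\<in>carrier M. p (h x) = f x)))"


section \<open>Differential graded modules and quasi-isomorphisms\<close>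

definition dg_module :: "('k, 'r, 'y) dgmod_scheme \<Rightarrow> ('r, 'm, 'z) dgmod_scheme \<Rightarrow> bool" where
  "dg_module R M \<longleftrightarrow> graded_module R M \<and>
     (\<forall>n. \<forall>x\<in>hpart M n. dif M x \<in> hpart M (n + 1)) \<and>
     (\<forall>x\<in>carrier M. \<forall>y\<in>carrier M. dif M (x \<oplus>\<^bsub>M\<^esub> y) = dif M x \<oplus>\<^bsub>M\<^esub> dif M y) \<and>
     (\<forall>x\<in>carrier M. dif M (dif M x) = \<zero>\<^bsub>M\<^esub>) \<and>
     (\<forall>n. \<forall>a\<in>hpart R n. \<forall>x\<in>carrier M.
        dif M (a \<odot>\<^bsub>M\<^esub> x) = dif R a \<odot>\<^bsub>M\<^esub> x \<oplus>\<^bsub>M\<^esub> ksign M n (a \<odot>\<^bsub>M\<^esub> dif M x))"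

definition dg_module_hom ::
  "('k, 'r, 'y) dgmod_scheme \<Rightarrow> ('r, 'm, 'z) dgmod_scheme \<Rightarrow> ('r, 'n, 'w) dgmod_scheme
    \<Rightarrow> ('m \<Rightarrow> 'n) \<Rightarrow> bool" where
  "dg_module_hom R M N f \<longleftrightarrow> graded_module_hom R M N f \<and>
     (\<forall>x\<in>carrier M. f (dif M x) = dif N (f x))"

definition cocycles :: "('r, 'm, 'z) dgmod_scheme \<Rightarrow> int \<Rightarrow> 'm set" where
  "cocycles M n = {x \<in> hpart M n. dif M x = \<zero>\<^bsub>M\<^esub>}"

definition coboundaries :: "('r, 'm, 'z) dgmod_scheme \<Rightarrow> int \<Rightarrow> 'm set" where
  "coboundaries M n = dif M ` hpart M (n - 1)"

definition cohomology :: "('r, 'm, 'z) dgmod_scheme \<Rightarrow> int \<Rightarrow> 'm set set" where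
  "cohomology M n = (\<lambda>z. coboundaries M n +>\<^bsub>M\<^esub> z) ` cocycles M n"

definition quasi_iso ::
  "('r, 'm, 'z) dgmod_scheme \<Rightarrow> ('r, 'n, 'w) dgmod_scheme \<Rightarrow> ('m \<Rightarrow> 'n) \<Rightarrow> bool" where
  "quasi_iso M N f \<longleftrightarrow>
     (\<forall>n. bij_betw (\<lambda>C. coboundaries N n <+>\<^bsub>N\<^esub> (f ` C)) (cohomology M n) (cohomology N n))"


section \<open>Commutative differential graded algebras over the complex numbers\<close>

definition CC :: "(complex, complex) dgmod" where
  "CC = \<lparr>carrier = UNIV, mult = (*), one = 1, zero = 0, add = (+), smult = (*),
         hpart = (\<lambda>n. if n = 0 then UNIV else {0}), dif = (\<lambda>_. 0)\<rparr>"

definition dg_algebra :: "(complex, 'a, 'z) dgmod_scheme \<Rightarrow> bool" where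
  "dg_algebra A \<longleftrightarrow> ring A \<and> dg_module CC A \<and>
     \<one>\<^bsub>A\<^esub> \<in> hpart A 0 \<and>
     (\<forall>n m. \<forall>a\<in>hpart A n. \<forall>b\<in>hpart A m. a \<otimes>\<^bsub>A\<^esub> b \<in> hpart A (n + m)) \<and>
     (\<forall>c. \<forall>a\<in>carrier A. \<forall>b\<in>carrier A.
        c \<odot>\<^bsub>A\<^esub> (a \<otimes>\<^bsub>A\<^esub> b) = (c \<odot>\<^bsub>A\<^esub> a) \<otimes>\<^bsub>A\<^esub> b \<and>
        c \<odot>\<^bsub>A\<^esub> (a \<otimes>\<^bsub>A\<^esub> b) = a \<otimes>\<^bsub>A\<^esub> (c \<odot>\<^bsub>A\<^esub> b)) \<and>
     (\<forall>n. \<forall>a\<in>hpart A n. \<forall>b\<in>carrier A.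
        dif A (a \<otimes>\<^bsub>A\<^esub> b) = dif A a \<otimes>\<^bsub>A\<^esub> b \<oplus>\<^bsub>A\<^esub> ksign A n (a \<otimes>\<^bsub>A\<^esub> dif A b))"

definition cdga :: "(complex, 'a, 'z) dgmod_scheme \<Rightarrow> bool" where
  "cdga A \<longleftrightarrow> dg_algebra A \<and>
     (\<forall>n m. \<forall>a\<in>hpart A n. \<forall>b\<in>hpart A m. a \<otimes>\<^bsub>A\<^esub> b = ksign A (n * m) (b \<otimes>\<^bsub>A\<^esub> a))"

definition connective :: "('r, 'm, 'z) gmod_scheme \<Rightarrow> bool" where
  "connective M \<longleftrightarrow> (\<forall>n>0. hpart M n = {\<zero>\<^bsub>M\<^esub>})"

definition cdga_hom ::
  "(complex, 'a, 'z) dgmod_scheme \<Rightarrow> (complex, 'b, 'w) dgmod_scheme \<Rightarrow> ('a \<Rightarrow> 'b) \<Rightarrow> bool" where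
  "cdga_hom A B f \<longleftrightarrow> f \<in> ring_hom A B \<and> dg_module_hom CC A B f"

text \<open>
  An object is cofibrant if the map from the initial object lifts against all trivial fibrations
  (degreewise surjective quasi-isomorphisms). HOL cannot quantify over the types of the test
  objects inside a definition, so their carriers are taken in the type \<open>'x universe\<close> of sets
  of words in \<open>\<complex>\<close> and \<open>'x\<close>. This is no restriction: the cellular replacement \<open>Q \<rightarrow> X\<close>
  produced by the small object argument consists of equivalence classes of terms in \<open>\<complex>\<close> and
  the elements of \<open>X\<close>, so it has a copy in \<open>'x universe\<close>, and lifting the identity of \<open>X\<close>
  against it exhibits \<open>X\<close> as a retract of the cellular object \<open>Q\<close>.

  For connective \<open>A\<close>, lifting against trivial fibrations of unbounded or of connective cdgas is
  the same condition, by passing to the truncation in degrees \<open>\<le> 0\<close>.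
\<close>

type_synonym 'x "universe" = "(complex + 'x) list set"

definition cofibrant_cdga :: "(complex, 'a) dgmod \<Rightarrow> bool" where
  "cofibrant_cdga A \<longleftrightarrow> cdga A \<and>
     (\<forall>(E :: (complex, 'a universe) dgmod) (B :: (complex, 'a universe) dgmod) p f.
        cdga E \<and> cdga B \<and> cdga_hom E B p \<and> degreewise_surj E B p \<and> quasi_iso E B p \<and>
        cdga_hom A B f \<longrightarrow>
        (\<exists>h. cdga_hom A E h \<and> (\<forall>a\<in>carrier A. p (h a) = f a)))"


section \<open>dg-Lie algebras and dg-Lie algebroids\<close>

definition dg_lie :: "(complex, 'l, 'z) dgla_scheme \<Rightarrow> bool" where
  "dg_lie L \<longleftrightarrow> dg_module CC L \<and>
     (\<forall>n m. \<forall>x\<in>hpart L n. \<forall>y\<in>hpart L m. bracket L x y \<in> hpart L (n + m)) \<and>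
     (\<forall>x\<in>carrier L. \<forall>y\<in>carrier L. \<forall>z\<in>carrier L.
        bracket L (x \<oplus>\<^bsub>L\<^esub> y) z = bracket L x z \<oplus>\<^bsub>L\<^esub> bracket L y z \<and>
        bracket L x (y \<oplus>\<^bsub>L\<^esub> z) = bracket L x y \<oplus>\<^bsub>L\<^esub> bracket L x z) \<and>
     (\<forall>c. \<forall>x\<in>carrier L. \<forall>y\<in>carrier L.
        bracket L (c \<odot>\<^bsub>L\<^esub> x) y = c \<odot>\<^bsub>L\<^esub> bracket L x y \<and>
        bracket L x (c \<odot>\<^bsub>L\<^esub> y) = c \<odot>\<^bsub>L\<^esub> bracket L x y) \<and>
     (\<forall>n m. \<forall>x\<in>hpart L n. \<forall>y\<in>hpart L m.
        bracket L x y = \<ominus>\<^bsub>L\<^esub> ksign L (n * m) (bracket L y x)) \<and>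
     (\<forall>n m. \<forall>x\<in>hpart L n. \<forall>y\<in>hpart L m. \<forall>z\<in>carrier L.
        bracket L x (bracket L y z) =
          bracket L (bracket L x y) z \<oplus>\<^bsub>L\<^esub> ksign L (n * m) (bracket L y (bracket L x z))) \<and>
     (\<forall>n. \<forall>x\<in>hpart L n. \<forall>y\<in>carrier L.
        dif L (bracket L x y) =
          bracket L (dif L x) y \<oplus>\<^bsub>L\<^esub> ksign L n (bracket L x (dif L y)))"

text \<open>Restriction of scalars along the unit \<open>\<complex> \<rightarrow> A\<close>.\<close>

definition over_CC ::
  "(complex, 'a, 'y) dgmod_scheme \<Rightarrow> ('a, 'l, 'z) dgla_scheme \<Rightarrow> (complex, 'l) dgla" where
  "over_CC A L =
     \<lparr>carrier = carrier L, mult = mult L, one = one L, zero = zero L, add = add L,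
      smult = (\<lambda>c x. (c \<odot>\<^bsub>A\<^esub> \<one>\<^bsub>A\<^esub>) \<odot>\<^bsub>L\<^esub> x),
      hpart = hpart L, dif = dif L, bracket = bracket L\<rparr>"

text \<open>
  Homogeneous \<open>\<complex>\<close>-linear derivations of degree \<open>n\<close>. They are extensional functions on
  \<open>carrier A\<close>, so that equality of functions is equality of derivations.
\<close>

definition derivations :: "(complex, 'a, 'z) dgmod_scheme \<Rightarrow> int \<Rightarrow> ('a \<Rightarrow> 'a) set" where
  "derivations A n = {D \<in> extensional (carrier A).
     (\<forall>k. \<forall>a\<in>hpart A k. D a \<in> hpart A (n + k)) \<and>
     (\<forall>a\<in>carrier A. \<forall>b\<in>carrier A. D (a \<oplus>\<^bsub>A\<^esub> b) = D a \<oplus>\<^bsub>A\<^esub> D b) \<and>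
     (\<forall>c. \<forall>a\<in>carrier A. D (c \<odot>\<^bsub>A\<^esub> a) = c \<odot>\<^bsub>A\<^esub> D a) \<and>
     (\<forall>k. \<forall>a\<in>hpart A k. \<forall>b\<in>carrier A.
        D (a \<otimes>\<^bsub>A\<^esub> b) = D a \<otimes>\<^bsub>A\<^esub> b \<oplus>\<^bsub>A\<^esub> ksign A (n * k) (a \<otimes>\<^bsub>A\<^esub> D b))}"

definition tangent_graded :: "(complex, 'a, 'z) dgmod_scheme \<Rightarrow> ('a, 'a \<Rightarrow> 'a) gmod" where
  "tangent_graded A =
     \<lparr>carrier = {\<lambda>a\<in>carrier A. \<Oplus>\<^bsub>A\<^esub>n\<in>S. f n a | f S. finite S \<and> (\<forall>n. f n \<in> derivations A n)},
      mult = (\<lambda>_ _. undefined), one = undefined,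
      zero = (\<lambda>a\<in>carrier A. \<zero>\<^bsub>A\<^esub>),
      add = (\<lambda>D E. \<lambda>a\<in>carrier A. D a \<oplus>\<^bsub>A\<^esub> E a),
      smult = (\<lambda>b D. \<lambda>a\<in>carrier A. b \<otimes>\<^bsub>A\<^esub> D a),
      hpart = derivations A\<rparr>"

text \<open>
  The tangent module. On homogeneous derivations the differential is
  \<open>d \<circ> D - (-1)\<^bsup>|D|\<^esup> D \<circ> d\<close> and the bracket is \<open>D \<circ> E - (-1)\<^bsup>|D||E|\<^esup> E \<circ> D\<close>.
\<close>

definition tangent :: "(complex, 'a, 'z) dgmod_scheme \<Rightarrow> ('a, 'a \<Rightarrow> 'a) dgla" where
  "tangent A = (let T = tangent_graded A in
     \<lparr>carrier = carrier T, mult = mult T, one = one T, zero = zero T, add = add T,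
      smult = smult T, hpart = hpart T,
      dif = (\<lambda>D. \<lambda>a\<in>carrier A. dif A (D a) \<ominus>\<^bsub>A\<^esub>
               (\<Oplus>\<^bsub>A\<^esub>i\<in>hsupp T D. ksign A i (hcomp T D i (dif A a)))),
      bracket = (\<lambda>D E. \<lambda>a\<in>carrier A. D (E a) \<ominus>\<^bsub>A\<^esub>
               (\<Oplus>\<^bsub>A\<^esub>ij\<in>hsupp T D \<times> hsupp T E.
                  ksign A (fst ij * snd ij) (hcomp T E (snd ij) (hcomp T D (fst ij) a))))\<rparr>)"

definition dg_lie_algebroid ::
  "(complex, 'a, 'z) dgmod_scheme \<Rightarrow> ('a, 'g, 'w) algebroid_scheme \<Rightarrow> bool" where
  "dg_lie_algebroid A G \<longleftrightarrow> dg_module A G \<and> dg_lie (over_CC A G) \<and>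
     dg_module_hom A G (tangent A) (anchor G) \<and>
     (\<forall>x\<in>carrier G. \<forall>y\<in>carrier G.
        anchor G (bracket G x y) = bracket (tangent A) (anchor G x) (anchor G y)) \<and>
     (\<forall>n m. \<forall>x\<in>hpart G n. \<forall>a\<in>hpart A m. \<forall>y\<in>carrier G.
        bracket G x (a \<odot>\<^bsub>G\<^esub> y) =
          ksign G (n * m) (a \<odot>\<^bsub>G\<^esub> bracket G x y) \<oplus>\<^bsub>G\<^esub> anchor G x a \<odot>\<^bsub>G\<^esub> y)"

definition algebroid_hom ::
  "(complex, 'a, 'z) dgmod_scheme \<Rightarrow> ('a, 'g, 'w) algebroid_scheme
    \<Rightarrow> ('a, 'h, 'v) algebroid_scheme \<Rightarrow> ('g \<Rightarrow> 'h) \<Rightarrow> bool" where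
  "algebroid_hom A G H f \<longleftrightarrow> dg_module_hom A G H f \<and>
     (\<forall>x\<in>carrier G. \<forall>y\<in>carrier G. f (bracket G x y) = bracket H (f x) (f y)) \<and>
     (\<forall>x\<in>carrier G. anchor H (f x) = anchor G x)"

definition cofibrant_lie_algebroid ::
  "(complex, 'a, 'z) dgmod_scheme \<Rightarrow> ('a, 'g) algebroid \<Rightarrow> bool" where
  "cofibrant_lie_algebroid A G \<longleftrightarrow> dg_lie_algebroid A G \<and>
     (\<forall>(E :: ('a, ('a + 'g) universe) algebroid) (B :: ('a, ('a + 'g) universe) algebroid) p f.
        dg_lie_algebroid A E \<and> dg_lie_algebroid A B \<and> algebroid_hom A E B p \<and>
        degreewise_surj E B p \<and> quasi_iso E B p \<and> algebroid_hom A G B f \<longrightarrow>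
        (\<exists>h. algebroid_hom A G E h \<and> (\<forall>x\<in>carrier G. p (h x) = f x)))"


section \<open>Words and quotients\<close>

text \<open>
  The free \<open>\<complex>\<close>-algebra on the homogeneous elements of \<open>V\<close>: finitely supported functions on
  words, a letter \<open>(n, x)\<close> being an element \<open>x\<close> of degree \<open>n\<close>. Each letter records its degree,
  so Koszul signs make sense on words. The letters are not yet linear in \<open>x\<close>; dividing by
  \<open>linear_rels V\<close> gives the tensor algebra of \<open>V\<close>, and only then does the differential
  square to zero.
\<close>

definition wdeg :: "(int \<times> 'v) list \<Rightarrow> int" where
  "wdeg w = sum_list (map fst w)"

definition word :: "(int \<times> 'v) list \<Rightarrow> (int \<times> 'v) list \<Rightarrow> complex" where
  "word w = (\<lambda>v. if v = w then 1 else 0)"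

definition letter :: "int \<Rightarrow> 'v \<Rightarrow> (int \<times> 'v) list \<Rightarrow> complex" where
  "letter n x = word [(n, x)]"

definition word_carrier ::
  "(complex, 'v, 'z) dgmod_scheme \<Rightarrow> ((int \<times> 'v) list \<Rightarrow> complex) set" where
  "word_carrier V = {f. finite {w. f w \<noteq> 0} \<and>
     (\<forall>w. f w \<noteq> 0 \<longrightarrow> (\<forall>l\<in>set w. snd l \<in> hpart V (fst l)))}"

definition word_dif ::
  "(complex, 'v, 'z) dgmod_scheme \<Rightarrow> (int \<times> 'v) list \<Rightarrow> (int \<times> 'v) list \<Rightarrow> complex" where
  "word_dif V w = (\<lambda>v. \<Sum>i<length w. (if even (wdeg (take i w)) then 1 else -1) *
     word (w[i := (fst (w ! i) + 1, dif V (snd (w ! i)))]) v)"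

definition words ::
  "(complex, 'v, 'z) dgmod_scheme \<Rightarrow> (complex, (int \<times> 'v) list \<Rightarrow> complex) dgmod" where
  "words V =
     \<lparr>carrier = word_carrier V,
      mult = (\<lambda>f g w. \<Sum>k\<le>length w. f (take k w) * g (drop k w)),
      one = word [],
      zero = (\<lambda>_. 0),
      add = (\<lambda>f g w. f w + g w),
      smult = (\<lambda>c f w. c * f w),
      hpart = (\<lambda>n. {f \<in> word_carrier V. \<forall>w. f w \<noteq> 0 \<longrightarrow> wdeg w = n}),
      dif = (\<lambda>f v. \<Sum>w\<in>{w. f w \<noteq> 0}. f w * word_dif V w v)\<rparr>"

definition linear_rels ::
  "(complex, 'v, 'z) dgmod_scheme \<Rightarrow> ((int \<times> 'v) list \<Rightarrow> complex) set" where
  "linear_rels V =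
     {letter n (x \<oplus>\<^bsub>V\<^esub> y) \<ominus>\<^bsub>words V\<^esub> (letter n x \<oplus>\<^bsub>words V\<^esub> letter n y) | n x y.
        x \<in> hpart V n \<and> y \<in> hpart V n} \<union>
     {letter n (c \<odot>\<^bsub>V\<^esub> x) \<ominus>\<^bsub>words V\<^esub> (c \<odot>\<^bsub>words V\<^esub> letter n x) | n c x. x \<in> hpart V n}"

text \<open>
  The quotient by a homogeneous two-sided ideal stable under the differential; the operations
  on cosets are induced from representatives, as in \<open>R Quot I\<close>.
\<close>

definition dg_quot :: "('r, 'm, 'z) dgmod_scheme \<Rightarrow> 'm set \<Rightarrow> ('r, 'm set) dgmod" where
  "dg_quot R I =
     \<lparr>carrier = a_rcosets\<^bsub>R\<^esub> I,
      mult = rcoset_mult R I,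
      one = I +>\<^bsub>R\<^esub> \<one>\<^bsub>R\<^esub>,
      zero = I,
      add = set_add R,
      smult = (\<lambda>c C. \<Union>x\<in>C. I +>\<^bsub>R\<^esub> (c \<odot>\<^bsub>R\<^esub> x)),
      hpart = (\<lambda>n. (\<lambda>x. I +>\<^bsub>R\<^esub> x) ` hpart R n),
      dif = (\<lambda>C. \<Union>x\<in>C. I +>\<^bsub>R\<^esub> dif R x)\<rparr>"

definition env_ideal :: "(complex, 'l, 'z) dgla_scheme \<Rightarrow> ((int \<times> 'l) list \<Rightarrow> complex) set" where
  "env_ideal L = Idl\<^bsub>words L\<^esub> (linear_rels L \<union>
     {letter n x \<otimes>\<^bsub>words L\<^esub> letter m y \<ominus>\<^bsub>words L\<^esub>
        (ksign (words L) (n * m) (letter m y \<otimes>\<^bsub>words L\<^esub> letter n x) \<oplus>\<^bsub>words L\<^esub>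
         letter (n + m) (bracket L x y)) | n m x y. x \<in> hpart L n \<and> y \<in> hpart L m})"

definition env ::
  "(complex, 'l, 'z) dgla_scheme \<Rightarrow> (complex, ((int \<times> 'l) list \<Rightarrow> complex) set) dgmod" where
  "env L = dg_quot (words L) (env_ideal L)"

definition env_letter ::
  "(complex, 'l, 'z) dgla_scheme \<Rightarrow> int \<Rightarrow> 'l \<Rightarrow> ((int \<times> 'l) list \<Rightarrow> complex) set" where
  "env_letter L n x = env_ideal L +>\<^bsub>words L\<^esub> letter n x"

text \<open>
  \<open>U(L)\<^sup>+ = U(L)/\<complex>\<close> is realised as the augmentation ideal: it is a complement of \<open>\<complex>\<close>
  and carries the (non-unital) multiplication.
\<close>

definition env_plus ::
  "(complex, 'l, 'z) dgla_scheme \<Rightarrow> ((int \<times> 'l) list \<Rightarrow> complex) set set" where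
  "env_plus L = Idl\<^bsub>env L\<^esub> {env_letter L n x | n x. x \<in> hpart L n}"


section \<open>The enveloping algebra of a dg-Lie algebroid\<close>

definition dsum ::
  "(complex, 'a, 'y) dgmod_scheme \<Rightarrow> ('a, 'm, 'z) dgmod_scheme \<Rightarrow> (complex, 'a \<times> 'm) dgmod" where
  "dsum A M =
     \<lparr>carrier = carrier A \<times> carrier M,
      mult = (\<lambda>_ _. undefined), one = undefined,
      zero = (\<zero>\<^bsub>A\<^esub>, \<zero>\<^bsub>M\<^esub>),
      add = (\<lambda>u v. (fst u \<oplus>\<^bsub>A\<^esub> fst v, snd u \<oplus>\<^bsub>M\<^esub> snd v)),
      smult = (\<lambda>c u. (c \<odot>\<^bsub>A\<^esub> fst u, (c \<odot>\<^bsub>A\<^esub> \<one>\<^bsub>A\<^esub>) \<odot>\<^bsub>M\<^esub> snd u)),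
      hpart = (\<lambda>n. hpart A n \<times> hpart M n),
      dif = (\<lambda>u. (dif A (fst u), dif M (snd u)))\<rparr>"

text \<open>
  The dg-Lie algebra \<open>A \<oplus> \<gg>\<close>, with bracket
  \<open>[a + x, b + y] = (\<rho>(x)(b) - (-1)\<^bsup>|y||a|\<^esup> \<rho>(y)(a)) + [x, y]\<close> on homogeneous elements.
\<close>

definition semidirect ::
  "(complex, 'a, 'y) dgmod_scheme \<Rightarrow> ('a, 'g, 'z) algebroid_scheme \<Rightarrow> (complex, 'a \<times> 'g) dgla" where
  "semidirect A G = dgmod.extend (dsum A G) (dgla.fields
     (\<lambda>(a, x) (b, y).
        (anchor G x b \<ominus>\<^bsub>A\<^esub> (\<Oplus>\<^bsub>A\<^esub>ij\<in>hsupp A a \<times> hsupp G y.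
           ksign A (fst ij * snd ij) (anchor G (hcomp G y (snd ij)) (hcomp A a (fst ij)))),
         bracket G x y)))"

text \<open>
  The ideal of relations \<open>a \<cdot> (b + y) - (ab + ay)\<close>. Since \<open>U(L) = \<complex> \<oplus> U(L)\<^sup>+\<close>, the ideal
  generated in \<open>U(L)\<close> is the ideal of the non-unital \<open>\<complex>\<close>-algebra \<open>U(L)\<^sup>+\<close> generated by the
  same elements.
\<close>

definition algebroid_ideal ::
  "(complex, 'a, 'y) dgmod_scheme \<Rightarrow> ('a, 'g, 'z) algebroid_scheme
    \<Rightarrow> ((int \<times> 'a \<times> 'g) list \<Rightarrow> complex) set set" where
  "algebroid_ideal A G = (let L = semidirect A G in
     Idl\<^bsub>env L\<^esub> {env_letter L n (a, \<zero>\<^bsub>G\<^esub>) \<otimes>\<^bsub>env L\<^esub> env_letter L m (b, y) \<ominus>\<^bsub>env L\<^esub>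
                 env_letter L (n + m) (a \<otimes>\<^bsub>A\<^esub> b, a \<odot>\<^bsub>G\<^esub> y) | n m a b y.
                 a \<in> hpart A n \<and> b \<in> hpart A m \<and> y \<in> hpart G m})"

text \<open>
  \<open>U(\<gg>)\<close> as a ring with left \<open>A\<close>-action, the action being left multiplication by the image
  of \<open>A\<close>. The unit is the image of the unit of \<open>A\<close>, as \<open>env_plus\<close> itself is not unital.
\<close>

definition UEA ::
  "(complex, 'a, 'y) dgmod_scheme \<Rightarrow> ('a, 'g, 'z) algebroid_scheme
    \<Rightarrow> ('a, ((int \<times> 'a \<times> 'g) list \<Rightarrow> complex) set set) dgmod" where
  "UEA A G = (let L = semidirect A G; E = env L; J = algebroid_ideal A G in
     \<lparr>carrier = (\<lambda>u. J +>\<^bsub>E\<^esub> u) ` env_plus L,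
      mult = rcoset_mult E J,
      one = J +>\<^bsub>E\<^esub> env_letter L 0 (\<one>\<^bsub>A\<^esub>, \<zero>\<^bsub>G\<^esub>),
      zero = J,
      add = set_add E,
      smult = (\<lambda>a C. \<Union>u\<in>C. J +>\<^bsub>E\<^esub>
        ((\<Oplus>\<^bsub>E\<^esub>n\<in>hsupp A a. env_letter L n (hcomp A a n, \<zero>\<^bsub>G\<^esub>)) \<otimes>\<^bsub>E\<^esub> u)),
      hpart = (\<lambda>n. (\<lambda>u. J +>\<^bsub>E\<^esub> u) ` (env_plus L \<inter> hpart E n)),
      dif = (\<lambda>C. \<Union>u\<in>C. J +>\<^bsub>E\<^esub> dif E u)\<rparr>)"

definition UEA_proj ::
  "(complex, 'a, 'y) dgmod_scheme \<Rightarrow> ('a, 'g, 'z) algebroid_scheme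
    \<Rightarrow> ((int \<times> 'a \<times> 'g) list \<Rightarrow> complex) \<Rightarrow> ((int \<times> 'a \<times> 'g) list \<Rightarrow> complex) set set" where
  "UEA_proj A G f = (let L = semidirect A G in
     algebroid_ideal A G +>\<^bsub>env L\<^esub> (env_ideal L +>\<^bsub>words L\<^esub> f))"


section \<open>The PBW filtration and its associated graded\<close>

text \<open>A letter of \<open>dsum A M\<close> with \<open>M\<close>-component zero counts as a letter in \<open>A\<close>.\<close>

definition pure_word ::
  "(complex, 'a, 'y) dgmod_scheme \<Rightarrow> ('a, 'm, 'z) dgmod_scheme \<Rightarrow> (int \<times> 'a \<times> 'm) list \<Rightarrow> bool" where
  "pure_word A M w \<longleftrightarrow> (\<forall>(k, a, x)\<in>set w. a = \<zero>\<^bsub>A\<^esub> \<or> x = \<zero>\<^bsub>M\<^esub>)"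

definition weight :: "('a, 'm, 'z) dgmod_scheme \<Rightarrow> (int \<times> 'a \<times> 'm) list \<Rightarrow> nat" where
  "weight M w = length (filter (\<lambda>(k, a, x). x \<noteq> \<zero>\<^bsub>M\<^esub>) w)"

text \<open>The empty word is excluded because \<open>U(\<gg>)\<close> is a quotient of \<open>env_plus\<close>.\<close>

definition PBW ::
  "(complex, 'a, 'y) dgmod_scheme \<Rightarrow> ('a, 'g, 'z) algebroid_scheme
    \<Rightarrow> nat \<Rightarrow> ((int \<times> 'a \<times> 'g) list \<Rightarrow> complex) set set set" where
  "PBW A G n = UEA_proj A G ` {f \<in> carrier (words (dsum A G)).
     \<forall>w. f w \<noteq> 0 \<longrightarrow> w \<noteq> [] \<and> pure_word A G w \<and> weight G w \<le> n}"

definition PBW_below ::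
  "(complex, 'a, 'y) dgmod_scheme \<Rightarrow> ('a, 'g, 'z) algebroid_scheme
    \<Rightarrow> nat \<Rightarrow> ((int \<times> 'a \<times> 'g) list \<Rightarrow> complex) set set set" where
  "PBW_below A G n = (if n = 0 then {\<zero>\<^bsub>UEA A G\<^esub>} else PBW A G (n - 1))"

text \<open>
  An element of the associated graded is a family \<open>\<gamma>\<close> of cosets
  \<open>\<gamma> n \<in> U\<^bsup>\<le>n\<^esup>/U\<^bsup>\<le>n-1\<^esup>\<close>, almost all of them zero.
\<close>

definition grU ::
  "(complex, 'a, 'y) dgmod_scheme \<Rightarrow> ('a, 'g, 'z) algebroid_scheme
    \<Rightarrow> ('a, nat \<Rightarrow> ((int \<times> 'a \<times> 'g) list \<Rightarrow> complex) set set set) wdga" where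
  "grU A G = (let U = UEA A G; F = PBW A G; B = PBW_below A G;
       K = {\<gamma>. (\<forall>n. \<exists>u\<in>F n. \<gamma> n = B n +>\<^bsub>U\<^esub> u) \<and> finite {n. \<gamma> n \<noteq> B n}} in
     \<lparr>carrier = K,
      mult = (\<lambda>\<gamma> \<delta> n. \<Union>u\<in>Pi UNIV \<gamma>. \<Union>v\<in>Pi UNIV \<delta>.
                B n +>\<^bsub>U\<^esub> (\<Oplus>\<^bsub>U\<^esub>i\<in>{..n}. u i \<otimes>\<^bsub>U\<^esub> v (n - i))),
      one = B(0 := B 0 +>\<^bsub>U\<^esub> \<one>\<^bsub>U\<^esub>),
      zero = B,
      add = (\<lambda>\<gamma> \<delta> n. \<gamma> n <+>\<^bsub>U\<^esub> \<delta> n),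
      smult = (\<lambda>a \<gamma> n. \<Union>u\<in>\<gamma> n. B n +>\<^bsub>U\<^esub> (a \<odot>\<^bsub>U\<^esub> u)),
      hpart = (\<lambda>k. {\<gamma> \<in> K. \<forall>n. \<exists>u\<in>F n \<inter> hpart U k. \<gamma> n = B n +>\<^bsub>U\<^esub> u}),
      dif = (\<lambda>\<gamma> n. \<Union>u\<in>\<gamma> n. B n +>\<^bsub>U\<^esub> dif U u),
      wpart = (\<lambda>n. {\<gamma> \<in> K. \<forall>m. m \<noteq> n \<longrightarrow> \<gamma> m = B m})\<rparr>)"


section \<open>The symmetric algebra and the canonical map\<close>

text \<open>
  \<open>Sym\<^sub>A(M)\<close> is the graded-commutative \<open>A\<close>-algebra generated by the \<open>A\<close>-module \<open>M\<close>: the tensor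
  algebra over \<open>\<complex>\<close> of \<open>A \<oplus> M\<close> modulo graded commutativity, the identification of the units,
  and the multiplications \<open>A \<times> A \<rightarrow> A\<close> and \<open>A \<times> M \<rightarrow> M\<close>.
\<close>

definition sym_ideal ::
  "(complex, 'a, 'y) dgmod_scheme \<Rightarrow> ('a, 'm, 'z) dgmod_scheme
    \<Rightarrow> ((int \<times> 'a \<times> 'm) list \<Rightarrow> complex) set" where
  "sym_ideal A M = (let V = dsum A M; W = words V in
     Idl\<^bsub>W\<^esub> (linear_rels V \<union>
       {letter n u \<otimes>\<^bsub>W\<^esub> letter m v \<ominus>\<^bsub>W\<^esub> ksign W (n * m) (letter m v \<otimes>\<^bsub>W\<^esub> letter n u) | n m u v.
          u \<in> hpart V n \<and> v \<in> hpart V m} \<union>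
       {letter 0 (\<one>\<^bsub>A\<^esub>, \<zero>\<^bsub>M\<^esub>) \<ominus>\<^bsub>W\<^esub> \<one>\<^bsub>W\<^esub>} \<union>
       {letter n (a, \<zero>\<^bsub>M\<^esub>) \<otimes>\<^bsub>W\<^esub> letter m (b, y) \<ominus>\<^bsub>W\<^esub> letter (n + m) (a \<otimes>\<^bsub>A\<^esub> b, a \<odot>\<^bsub>M\<^esub> y) | n m a b y.
          a \<in> hpart A n \<and> b \<in> hpart A m \<and> y \<in> hpart M m}))"

definition Sym ::
  "(complex, 'a, 'y) dgmod_scheme \<Rightarrow> ('a, 'm, 'z) dgmod_scheme
    \<Rightarrow> ('a, ((int \<times> 'a \<times> 'm) list \<Rightarrow> complex) set) wdga" where
  "Sym A M = (let W = words (dsum A M); I = sym_ideal A M; S = dg_quot W I in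
     \<lparr>carrier = carrier S, mult = mult S, one = one S, zero = zero S, add = add S,
      smult = (\<lambda>a C. \<Union>f\<in>C. I +>\<^bsub>W\<^esub>
        ((\<Oplus>\<^bsub>W\<^esub>n\<in>hsupp A a. letter n (hcomp A a n, \<zero>\<^bsub>M\<^esub>)) \<otimes>\<^bsub>W\<^esub> f)),
      hpart = hpart S, dif = dif S,
      wpart = (\<lambda>n. (\<lambda>f. I +>\<^bsub>W\<^esub> f) `
        {f \<in> carrier W. \<forall>w. f w \<noteq> 0 \<longrightarrow> pure_word A M w \<and> weight M w = n})\<rparr>)"

text \<open>Graded dg-\<open>A\<close>-algebras: here ``graded'' refers to the weight grading \<open>wpart\<close>.\<close>

definition graded_dg_algebra_hom ::
  "(complex, 'a, 'y) dgmod_scheme \<Rightarrow> ('a, 's, 'z) wdga_scheme \<Rightarrow> ('a, 't, 'w) wdga_scheme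
    \<Rightarrow> ('s \<Rightarrow> 't) \<Rightarrow> bool" where
  "graded_dg_algebra_hom A S T \<phi> \<longleftrightarrow> \<phi> \<in> ring_hom S T \<and> dg_module_hom A S T \<phi> \<and>
     (\<forall>n. \<forall>s\<in>wpart S n. \<phi> s \<in> wpart T n)"

definition graded_dg_algebra_iso ::
  "(complex, 'a, 'y) dgmod_scheme \<Rightarrow> ('a, 's, 'z) wdga_scheme \<Rightarrow> ('a, 't, 'w) wdga_scheme
    \<Rightarrow> ('s \<Rightarrow> 't) \<Rightarrow> bool" where
  "graded_dg_algebra_iso A S T \<phi> \<longleftrightarrow> graded_dg_algebra_hom A S T \<phi> \<and>
     bij_betw \<phi> (carrier S) (carrier T) \<and>
     (\<forall>n k. bij_betw \<phi> (wpart S n \<inter> hpart S k) (wpart T n \<inter> hpart T k))"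

text \<open>
  The map is determined by its values on \<open>\<gg>\<close> only on the carrier, hence extensionality.
  The right-hand side below is the class of \<open>x\<close> in weight \<open>1\<close>.
\<close>

definition canonical_map ::
  "(complex, 'a, 'y) dgmod_scheme \<Rightarrow> ('a, 'g, 'z) algebroid_scheme
    \<Rightarrow> (((int \<times> 'a \<times> 'g) list \<Rightarrow> complex) set
        \<Rightarrow> nat \<Rightarrow> ((int \<times> 'a \<times> 'g) list \<Rightarrow> complex) set set set) \<Rightarrow> bool" where
  "canonical_map A G \<phi> \<longleftrightarrow> \<phi> \<in> extensional (carrier (Sym A G)) \<and>
     graded_dg_algebra_hom A (Sym A G) (grU A G) \<phi> \<and>
     (\<forall>k. \<forall>x\<in>hpart G k.
        \<phi> (sym_ideal A G +>\<^bsub>words (dsum A G)\<^esub> letter k (\<zero>\<^bsub>A\<^esub>, x)) =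
        (PBW_below A G)(1 := PBW A G 0 +>\<^bsub>UEA A G\<^esub> UEA_proj A G (letter k (\<zero>\<^bsub>A\<^esub>, x))))"

end

theory Submission
  imports Defs "HOL-Library.Function_Algebras" "HOL-Library.Poly_Mapping" "HOL-Library.Product_Plus"
begin

text \<open>
  Only surjectivity of \<open>Sym \<rightarrow> gr U\<close> is formal. Suppose that \<open>N\<close> is a graded \<open>A\<close>-module with a flat
  \<open>\<gg>\<close>-connection and that \<open>j\<close> is an \<open>A\<close>-linear split injection of \<open>\<gg>\<close> into \<open>N\<close> which is torsion free:
  \<open>x j(y) - (-1)\<^bsup>|x||y|\<^esup> y j(x) = j[x, y]\<close>. Let \<open>x\<close> act on \<open>Sym(N)\<close> by multiplication by \<open>j(x)\<close> plus the
  derivation extending the connection. This is an action of \<open>U\<close>, and the leading term of \<open>u \<cdot> 1\<close> is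
  the image under \<open>j\<close> of the symbol of \<open>u\<close>; as \<open>j\<close> splits, \<open>Sym \<rightarrow> gr U\<close> is injective.

  Cofibrancy supplies \<open>N\<close>. Let \<open>Y\<close> be the algebra generated by \<open>A\<close> and the homogeneous elements of \<open>\<gg>\<close>
  as free letters, subject to \<open>v a = \<rho>\<^sub>v(a) + (-1)\<^bsup>|v||a|\<^esup> a v\<close>; it is free over \<open>A\<close> on words. The \<open>A\<close>-span
  \<open>F\<close> of the Lie monomials is a Lie algebroid without differential, and Dynkin's operator divided by
  the word length restricts to a Lie map \<open>F \<rightarrow> \<gg>\<close>. The dg-Lie algebroid cofreely generated by \<open>F\<close> over
  \<open>\<gg>\<close> is a trivial fibration over \<open>\<gg>\<close>, so the identity of \<open>\<gg>\<close> lifts to it and \<open>F \<rightarrow> \<gg>\<close> has a section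
  \<open>s\<close> compatible with brackets. Now \<open>N\<close> is the left ideal of \<open>Y\<close> of elements without constant term, \<open>x\<close>
  acts by left multiplication with \<open>s(x)\<close>, and \<open>j = s\<close>. Letting \<open>U\<close> act on \<open>Y\<close> in the same way, \<open>u \<mapsto> u \<cdot> 1\<close> exhibits
  \<open>U\<close> as a retract of the free module \<open>Y\<close>.
\<close>

text \<open>Different trees may give the same element of Y, so a map from F to \<gg> cannot be
  prescribed monomial by monomial. Dynkin's operator is given by a formula on words and is defined
  on all of Y; by the theorem of Dynkin, Specht and Wever it multiplies the value of a Lie monomial
  by its length. Hence the division by the length, which is where characteristic 0 enters. Taking
  every homogeneous element of \<gg> as a letter makes F surjective onto \<gg> in each degree
  without a choice of generators. F carries no differential; adjoining one cofreely, by pairs f + f'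
  \<epsilon>, makes the kernel over \<gg> contractible for formal reasons, so that no cohomology of
  F has to be computed. The lifting property only tests objects on a fixed type, so Y is built from
  coefficient functions on words, which are then coded as sets of words. Modelling A and \<gg>
  inside function spaces, with operations defined everywhere, turns identities in Y into identities
  in abelian groups, free of carrier conditions.\<close>

abbreviation add_in ("(_ \<oplus>\<^sub>_/ _)" [65, 1000, 66] 65) where "x \<oplus>\<^sub>M y \<equiv> add M x y"
abbreviation mult_in ("(_ \<otimes>\<^sub>_/ _)" [70, 1000, 71] 70) where "x \<otimes>\<^sub>M y \<equiv> mult M x y"
abbreviation smult_in ("(_ \<odot>\<^sub>_/ _)" [70, 1000, 71] 70) where "x \<odot>\<^sub>M y \<equiv> smult M x y"
abbreviation minus_in ("(_ \<ominus>\<^sub>_/ _)" [65, 1000, 66] 65) where "x \<ominus>\<^sub>M y \<equiv> a_minus M x y"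
abbreviation a_inv_in ("\<ominus>\<^sub>_ _" [1000, 81] 80) where "\<ominus>\<^sub>M x \<equiv> a_inv M x"
abbreviation zero_in ("\<zero>\<^sub>_" [1000] 1000) where "\<zero>\<^sub>M \<equiv> zero M"
abbreviation one_in ("\<one>\<^sub>_" [1000] 1000) where "\<one>\<^sub>M \<equiv> one M"
abbreviation "car \<equiv> carrier"
abbreviation "hp \<equiv> hpart"
abbreviation "lookup \<equiv> Poly_Mapping.lookup"
abbreviation "single \<equiv> Poly_Mapping.single"
abbreviation "keys \<equiv> Poly_Mapping.keys"


section \<open>The free algebra on words: product, ideals, derivations and degrees\<close>

section \<open>Finitely supported functions on words\<close>

type_synonym 'v wfun = "(int \<times> 'v) list => complex"

text \<open>The product of the free algebra, taken out of the record and defined on all functions. A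
  word has only finitely many factorisations, so the ring laws hold without a carrier
  condition.\<close>

definition cm :: "'v wfun => 'v wfun => 'v wfun" (infixl "**" 70) where
 "f ** g = (%w. \<Sum>k\<le>length w. f (take k w) * g (drop k w))"

definition sc :: "complex => ('i => complex) => 'i => complex" where
 "sc c f = (%w. c * f w)"

text \<open>Signs occur in three forms: \<open>ksign\<close> in the given structures,
  \<open>sg\<close> as a scalar of the free algebra, and \<open>sgm\<close> below in arbitrary
  abelian groups.\<close>

definition sg :: "int => complex" where
 "sg k = (if even k then 1 else -1)"

lemma sg_simps [simp]: "sg 0 = 1" "sg k * sg k = 1" "sg k * (sg k * c) = c" "sg (- k) = sg k"
 "sg (2 * k) = 1" "sg 1 = -1"
 by (auto simp: sg_def)

lemma sg_add: "sg (k + l) = sg k * sg l"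
 by (auto simp: sg_def)

lemma sc_apply: "sc c f w = c * f w"
 by (simp add: sc_def)

text \<open>With pointwise evaluation switched off, \<open>simp\<close> treats functions as elements
  of an additive group; \<open>fapp\<close> brings the values back where they are wanted.\<close>

declare plus_fun_apply [simp del] zero_fun_apply [simp del] minus_apply [simp del] uminus_apply [simp del]

lemmas fapp = plus_fun_apply zero_fun_apply minus_apply uminus_apply sc_apply

lemma sc_simps [simp]: "sc 0 f = 0" "sc 1 f = f" "sc c 0 = 0" "sc c (sc d f) = sc (c * d) f"
 "sc (-1) f = - f"
 by (auto simp: fun_eq_iff fapp)

lemma sc_add: "sc c (f + g) = sc c f + sc c g"
 and sc_diff: "sc c (f - g) = sc c f - sc c g"
 and sc_minus: "sc c (- f) = - sc c f"
 and sc_add_left: "sc (c + d) f = sc c f + sc d f"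
 and sc_minus_left: "sc (- c) f = - sc c f"
 by (auto simp: fun_eq_iff fapp algebra_simps)

lemma sc_sum: "sc c (sum f S) = (\<Sum>x\<in>S. sc c (f x))"
 by (induction S rule: infinite_finite_induct) (simp_all add: sc_add)

lemma fun_sum_apply: "(sum f S) w = (\<Sum>x\<in>S. f x w)"
 by (induction S rule: infinite_finite_induct) (auto simp: fapp)

lemma cm_Nil: "(f ** g) [] = f [] * g []"
 by (simp add: cm_def)

lemma cm_Cons: "(f ** g) (x # w) = f [] * g (x # w) + ((%u. f (x # u)) ** g) w"
 unfolding cm_def by (simp only: length_Cons sum.atMost_Suc_shift) simp

lemma cm_add_left: "(f + g) ** h = f ** h + g ** h"
 and cm_add_right: "h ** (f + g) = h ** f + h ** g"
 by (auto simp: fun_eq_iff fapp cm_def algebra_simps sum.distrib)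

lemma cm_sc_left: "sc c f ** h = sc c (f ** h)"
 and cm_sc_right: "h ** sc c f = sc c (h ** f)"
 by (auto simp: fun_eq_iff fapp cm_def algebra_simps sum_distrib_left)

lemma cm_zero [simp]: "0 ** f = 0" "f ** 0 = 0"
 by (auto simp: fun_eq_iff fapp cm_def)

lemma cm_minus_left: "(- f) ** h = - (f ** h)"
 and cm_minus_right: "h ** (- f) = - (h ** f)"
 using cm_sc_left[of "-1" f h] cm_sc_right[of h "-1" f] by simp_all

lemma cm_diff_left: "(f - g) ** h = f ** h - g ** h"
 and cm_diff_right: "h ** (f - g) = h ** f - h ** g"
 using cm_add_left[of f "- g" h] cm_add_right[of h f "- g"]
 by (simp_all add: cm_minus_left cm_minus_right)

lemmas cm_distrib = cm_add_left cm_add_right cm_diff_left cm_diff_right cm_minus_left cm_minus_right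
 cm_sc_left cm_sc_right

text \<open>Removing a first letter x obeys a Leibniz rule:
  \<open>(f ** g)_x = f [] * g_x + f_x ** g\<close>, where \<open>f_x u = f (x # u)\<close>.
  Induction on the word therefore reduces associativity to constant terms.\<close>

lemma cm_assoc: "(f ** g) ** h = f ** (g ** h)"
proof
 fix w
 show "((f ** g) ** h) w = (f ** (g ** h)) w"
 proof (induction w arbitrary: f g)
  case Nil
  show ?case by (simp add: cm_Nil)
 next
  case (Cons x w)
  have "(%u. (f ** g) (x # u)) = sc (f []) (%u. g (x # u)) + (%u. f (x # u)) ** g"
   by (simp add: fun_eq_iff fapp cm_Cons)
  note e = this
  show ?case using Cons
   unfolding cm_Cons[of "f ** g"] cm_Cons[of f "g ** h"] e
   by (simp add: cm_Cons cm_Nil cm_add_left cm_sc_left algebra_simps fapp)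
 qed
qed

lemma word_apply: "word w v = (if v = w then 1 else 0)"
 by (simp add: word_def)

lemma word_cm_Cons: "word (x # u) ** f = word [x] ** (word u ** f)"
 and word_Nil_cm [simp]: "word [] ** f = f"
 and word_cm_word: "word u ** word v = word (u @ v)"
 and cm_word_Nil [simp]: "f ** word [] = f"
proof -
 show 1: "word [] ** f = f" for f :: "'a wfun"
 proof
  fix w show "(word [] ** f) w = f w"
   by (cases w) (auto simp: cm_Nil cm_Cons word_apply cm_zero(1)[unfolded zero_fun_def])
 qed
 have 2: "word [x] ** f = (%w. case w of [] => 0 | y # v => if y = x then f v else 0)"
  for x and f :: "'a wfun"
 proof
  fix w
  show "(word [x] ** f) w = (case w of [] => 0 | y # v => if y = x then f v else 0)"
  proof (cases w)
   case (Cons y v)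
   have "(%u. word [x] (y # u)) = (if y = x then word [] else 0)"
    by (auto simp: fun_eq_iff fapp word_apply)
   with Cons 1 show ?thesis by (simp add: cm_Cons word_apply fapp)
  qed (simp add: cm_Nil word_apply)
 qed
 have 3: "word [x] ** word u = word (x # u)" for x :: "int \<times> 'a" and u
  unfolding 2 by (simp add: fun_eq_iff fapp word_apply split: list.split)
 show 4: "word (x # u) ** f = word [x] ** (word u ** f)" for f :: "'a wfun" and x u
  by (metis 3 cm_assoc)
 show "word u ** word v = word (u @ v)" for u v :: "(int \<times> 'a) list"
 proof (induction u)
  case (Cons x u)
  then show ?case using 3[of x "u @ v"] by (subst 4) simp
 qed (simp add: 1)
 show "f ** word [] = f"
 proof
  fix w show "(f ** word []) w = f w"
   unfolding cm_def by (subst sum.remove[of _ "length w"]) (auto simp: word_apply intro!: sum.neutral)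
 qed
qed

definition fs :: "('i => 'b::zero) => bool" where
 "fs f \<longleftrightarrow> finite {w. f w ~= 0}"

lemma fs_zero [simp]: "fs 0" and fs_word [simp]: "fs (word w)"
 by (auto simp: fs_def word_def fapp)

lemma fs_add [simp]: "fs f ==> fs g ==> fs (f + g)" for f g :: "'i => 'b::monoid_add"
 unfolding fs_def by (rule finite_subset[of _ "{w. f w ~= 0} \<union> {w. g w ~= 0}"]) (auto simp: fapp)

lemma fs_sc [simp]: "fs f ==> fs (sc c f)"
 unfolding fs_def by (rule finite_subset[of _ "{w. f w ~= 0}"]) (auto simp: fapp)

lemma fs_minus [simp]: "fs (- f) \<longleftrightarrow> fs f" for f :: "'i => 'b::group_add"
 by (simp add: fs_def fapp)

lemma fs_diff [simp]: "fs f ==> fs g ==> fs (f - g)" for f g :: "'i => 'b::ab_group_add"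
 using fs_add[of f "- g"] by simp

lemma fs_sum [simp]: "(!!x. x : S ==> fs (f x)) ==> fs (sum f S)" for f :: "'j => 'i => 'b::comm_monoid_add"
 by (induction S rule: infinite_finite_induct) auto

text \<open>Linear extension of a map given on words. The sum runs over the support, so additivity
  asks for two finite supports, while compatibility with \<open>sc\<close> holds for every
  function.\<close>

definition lin :: "('i => 'j => complex) => ('i => complex) => 'j => complex" where
 "lin T f = (\<Sum>w\<in>{w. f w ~= 0}. sc (f w) (T w))"

lemma lin_superset: "finite S ==> {w. f w ~= 0} <= S ==> lin T f = (\<Sum>w\<in>S. sc (f w) (T w))"
 unfolding lin_def by (rule sum.mono_neutral_left) (auto simp: fapp)

lemma lin_zero [simp]: "lin T 0 = 0"
 by (simp add: lin_def fapp)

lemma lin_add: "fs f ==> fs g ==> lin T (f + g) = lin T f + lin T g"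
 by (subst (1 2 3) lin_superset[of "{w. f w ~= 0} \<union> {w. g w ~= 0}"])
   (auto simp: fs_def sc_add_left sum.distrib fapp)

lemma lin_sc [simp]: "lin T (sc c f) = sc c (lin T f)"
 by (cases "c = 0") (simp_all add: lin_def sc_sum fapp)

lemma lin_minus [simp]: "lin T (- f) = - lin T f"
 using lin_sc[of T "-1" f] by simp

lemma lin_diff: "fs f ==> fs g ==> lin T (f - g) = lin T f - lin T g"
 using lin_add[of f "- g" T] by simp

lemma lin_word [simp]: "lin T (word w) = T w"
 by (subst lin_superset[of "{w}"]) (auto simp: word_apply)

lemma word_carrier_iff:
 "f : word_carrier V \<longleftrightarrow> fs f & (\<forall>w. f w ~= 0 --> (\<forall>l\<in>set w. snd l : hp V (fst l)))"
 by (simp add: word_carrier_def fs_def)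

definition valid :: "(complex, 'v, 'z) dgmod_scheme => (int \<times> 'v) list => bool" where
 "valid V w \<longleftrightarrow> (\<forall>l\<in>set w. snd l : hp V (fst l))"

lemma valid_simps [simp]: "valid V []" "valid V (l # w) \<longleftrightarrow> snd l : hp V (fst l) & valid V w"
 "valid V (u @ w) \<longleftrightarrow> valid V u & valid V w"
 by (auto simp: valid_def)

text \<open>The summands are restrictions of f to smaller sets of words. The two clauses on supports
  let validity, purity or weight of the words of f pass to the summands.\<close>

lemma fun_fs_induct [consumes 1, case_names zero word add]:
 fixes f :: "'i => 'b::monoid_add"
 assumes "fs f" "P 0" "!!w. f w ~= 0 ==> P (%v. if v = w then f w else 0)"
  "!!g h. fs g ==> fs h ==> (!!w. g w ~= 0 ==> f w ~= 0) ==> (!!w. h w ~= 0 ==> f w ~= 0) ==>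
    P g ==> P h ==> P (g + h)"
 shows "P f"
proof -
 have "P (%w. if w : S then f w else 0)" if "finite S" "S <= {w. f w ~= 0}" for S
  using that
 proof (induction S rule: finite_induct)
  case empty
  then show ?case using assms(2) by (simp add: zero_fun_def)
 next
  case (insert w S)
  have "(%v. if v : insert w S then f v else 0) =
    (%v. if v = w then f w else 0) + (%v. if v : S then f v else 0)"
   using insert by (auto simp: fun_eq_iff fapp)
  moreover have "fs (%v. if v = w then f w else 0)"
   unfolding fs_def by (rule finite_subset[of _ "{w}"]) auto
  moreover have "fs (%v. if v : S then f v else 0)"
   unfolding fs_def by (rule finite_subset[of _ S]) (use insert in auto)
  ultimately show ?case using insert
   by (auto intro!: assms(3,4) split: if_splits)
 qed
 from this[of "{w. f w ~= 0}"] have "P (%w. if f w ~= 0 then f w else 0)"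
  using assms(1) by (simp add: fs_def)
 moreover have "(%w. if f w ~= 0 then f w else 0) = f" by auto
 ultimately show ?thesis by simp
qed

lemma FS_induct [consumes 1, case_names zero word add]:
 assumes "f : word_carrier V" "P 0" "!!c w. valid V w ==> P (sc c (word w))"
  "!!g h. g : word_carrier V ==> h : word_carrier V ==> P g ==> P h ==> P (g + h)"
 shows "P f"
proof -
 have "fs f" using assms(1) by (simp add: word_carrier_iff)
 then have "f : word_carrier V --> P f"
 proof (induction rule: fun_fs_induct)
  case (word w)
  have "(%v. if v = w then f w else 0) = sc (f w) (word w)"
   by (auto simp: word_apply fapp)
  with word assms(1) show ?case by (auto simp: word_carrier_iff valid_def intro!: assms(3))
 next
  case (add g h)
  then have "g : word_carrier V" "h : word_carrier V"
   using assms(1) by (auto simp: word_carrier_iff fapp)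
  with add show ?case by (auto intro: assms(4))
 qed (auto intro: assms(2))
 with assms(1) show ?thesis by simp
qed

lemma FS_fs: "f : word_carrier V ==> fs f"
 by (simp add: word_carrier_iff)

lemma FS_zero [simp]: "0 : word_carrier V" and FS_word [simp]: "word w : word_carrier V \<longleftrightarrow> valid V w"
 by (auto simp: word_carrier_iff valid_def word_apply fapp)

lemma FS_sc [simp]: "f : word_carrier V ==> sc c f : word_carrier V"
 by (auto simp: word_carrier_iff fapp)

lemma FS_add [simp]: "f : word_carrier V ==> g : word_carrier V ==> f + g : word_carrier V"
 unfolding word_carrier_iff by (metis add.right_neutral fs_add plus_fun_apply)

lemma FS_minus [simp]: "f : word_carrier V ==> - f : word_carrier V"
 by (auto simp: word_carrier_iff fapp)

lemma FS_diff [simp]: "f : word_carrier V ==> g : word_carrier V ==> f - g : word_carrier V"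
 using FS_add[of f V "- g"] by simp

lemma FS_cm [simp]: "f : word_carrier V ==> g : word_carrier V ==> f ** g : word_carrier V"
proof (induction f rule: FS_induct)
 case (word c w)
 from word(2,1) show ?case
  by (induction g rule: FS_induct) (auto simp: cm_distrib word_cm_word)
qed (auto simp: cm_distrib)

lemma FS_sum [simp]: "(!!x. x : S ==> f x : word_carrier V) ==> sum f S : word_carrier V"
 by (induction S rule: infinite_finite_induct) auto

lemma FS_lin: "f : word_carrier V ==> (!!w. valid V w ==> T w : word_carrier V') ==> lin T f : word_carrier V'"
 by (induction f rule: FS_induct) (auto simp: lin_add FS_fs)

lemma words_sel: "carrier (words V) = word_carrier V" "mult (words V) = (**)" "one (words V) = word []"
 "zero (words V) = 0" "add (words V) = (+)" "smult (words V) = sc"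
 by (auto simp: words_def cm_def fun_eq_iff fapp sc_def)

lemma words_ring: "ring (words V)"
proof (rule ringI)
 show "abelian_group (words V)"
 proof (rule abelian_groupI)
  fix x assume "x : carrier (words V)"
  then show "\<exists>y\<in>carrier (words V). y \<oplus>\<^bsub>words V\<^esub> x = \<zero>\<^bsub>words V\<^esub>"
   by (intro bexI[of _ "- x"]) (auto simp: words_sel)
 qed (auto simp: words_sel algebra_simps)
 show "Group.monoid (words V)"
  by (rule monoidI) (auto simp: words_sel cm_assoc)
qed (auto simp: words_sel cm_distrib)

lemma words_a_inv: "f : word_carrier V ==> \<ominus>\<^bsub>words V\<^esub> f = - f"
proof -
 assume f: "f : word_carrier V"
 interpret ring "words V" by (rule words_ring)
 show ?thesis using minus_equality[of "- f" f] f by (simp add: words_sel)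
qed

lemma words_minus: "g : word_carrier V ==> f \<ominus>\<^bsub>words V\<^esub> g = f - g"
 by (simp add: a_minus_def words_a_inv) (simp add: words_sel)

lemma words_ksign: "f : word_carrier V ==> ksign (words V) k f = sc (sg k) f"
 by (simp add: ksign_def words_a_inv sg_def)

text \<open>Two-sided ideals in terms of the function operations. Stability under scalars and
  negation is implied, since \<open>sc c (word [])\<close> is an element of the algebra.\<close>

definition wideal :: "(complex, 'v, 'z) dgmod_scheme => 'v wfun set => bool" where
 "wideal V I \<longleftrightarrow> I <= word_carrier V & 0 : I & (\<forall>f\<in>I. \<forall>g\<in>I. f + g : I) \<and>
   (\<forall>f\<in>I. \<forall>h\<in>word_carrier V. h ** f : I & f ** h : I)"

lemma wideal_add: "wideal V I ==> f : I ==> g : I ==> f + g : I"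
 and wideal_zero: "wideal V I ==> 0 : I"
 and wideal_left: "wideal V I ==> f : I ==> h : word_carrier V ==> h ** f : I"
 and wideal_right: "wideal V I ==> f : I ==> h : word_carrier V ==> f ** h : I"
 and wideal_FS: "wideal V I ==> f : I ==> f : word_carrier V"
 by (auto simp: wideal_def)

lemma wideal_sc: "wideal V I ==> f : I ==> sc c f : I"
 using wideal_left[of V I f "sc c (word [])"] by (simp add: cm_sc_left)

lemma wideal_minus: "wideal V I ==> f : I ==> - f : I"
 using wideal_sc[of V I f "-1"] by simp

lemma wideal_diff: "wideal V I ==> f : I ==> g : I ==> f - g : I"
 using wideal_add[of V I f "- g"] by (simp add: wideal_minus)

lemma wideal_sum: "wideal V I ==> (!!x. x : S ==> f x : I) ==> sum f S : I"
 by (induction S rule: infinite_finite_induct) (auto simp: wideal_add wideal_zero)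

lemma wideal_iff: "wideal V I \<longleftrightarrow> ideal I (words V)"
proof
 assume *: "wideal V I"
 show "ideal I (words V)"
 proof (rule idealI[OF words_ring])
  show "subgroup I (add_monoid (words V))"
  proof
   fix x assume x: "x : I"
   have "inv\<^bsub>add_monoid (words V)\<^esub> x = - x"
    using words_a_inv[OF wideal_FS[OF * x]] by (simp add: a_inv_def)
   then show "inv\<^bsub>add_monoid (words V)\<^esub> x : I"
    using x * by (simp add: wideal_minus)
  qed (use * in \<open>auto simp: words_sel wideal_def\<close>)
 qed (use * in \<open>auto simp: words_sel wideal_def\<close>)
next
 assume "ideal I (words V)"
 then interpret ideal I "words V" .
 show "wideal V I"
  unfolding wideal_def
  using a_subset additive_subgroup.a_closed[OF additive_subgroup_axioms]
   additive_subgroup.zero_closed[OF additive_subgroup_axioms] I_l_closed I_r_closed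
  unfolding words_sel by auto
qed

text \<open>The algebra is spanned by words, and multiplication by a word is done letter by
  letter.\<close>

lemma wideal_letters:
 assumes "I <= word_carrier V" "0 : I" "!!f g. f : I ==> g : I ==> f + g : I"
  "!!c f. f : I ==> sc c f : I"
  "!!l f. f : I ==> valid V [l] ==> word [l] ** f : I"
  "!!l f. f : I ==> valid V [l] ==> f ** word [l] : I"
 shows "wideal V I"
proof -
 have l: "word w ** f : I" if "f : I" "valid V w" for f w
  using that(2)
 proof (induction w)
  case (Cons l w)
  then show ?case using assms(5)[of "word w ** f" l] by (subst word_cm_Cons) auto
 qed (use that in simp)
 have r: "f ** word w : I" if "f : I" "valid V w" for f w
  using that
 proof (induction w arbitrary: f)
  case (Cons l w)
  have "f ** word (l # w) = (f ** word [l]) ** word w"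
   using word_cm_word[of "[l]" w] by (simp add: cm_assoc)
  then show ?case using Cons assms(6)[of f l] by simp
 qed simp
 have "h ** f : I & f ** h : I" if "f : I" "h : word_carrier V" for f h
  using that(2) by (induction h rule: FS_induct) (auto simp: cm_distrib assms that l r)
 with assms show ?thesis by (auto simp: wideal_def)
qed

lemma Idl_wideal: "S <= word_carrier V ==> wideal V (Idl\<^bsub>words V\<^esub> S)"
 and Idl_self: "S <= word_carrier V ==> S <= Idl\<^bsub>words V\<^esub> S"
 and Idl_minimal: "wideal V I ==> S <= I ==> Idl\<^bsub>words V\<^esub> S <= I"
proof -
 interpret ring "words V" by (rule words_ring)
 show "S <= word_carrier V ==> wideal V (Idl\<^bsub>words V\<^esub> S)"
  using genideal_ideal by (simp add: wideal_iff words_sel)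
 show "S <= word_carrier V ==> S <= Idl\<^bsub>words V\<^esub> S"
  using genideal_self by (simp add: words_sel)
 show "wideal V I ==> S <= I ==> Idl\<^bsub>words V\<^esub> S <= I"
  by (simp add: wideal_iff genideal_minimal)
qed

subsection \<open>Derivations of the free algebra\<close>

text \<open>The derivation of degree \<open>e\<close> with prescribed values on letters. Letters are
  free symbols, so any function \<delta> extends; additivity of \<delta> matters only for stability
  of the linear relations.\<close>

fun wder :: "int => ('v => 'v) => (int \<times> 'v) list => 'v wfun" where
 "wder e \<delta> [] = 0"
| "wder e \<delta> (l # w) = word ((fst l + e, \<delta> (snd l)) # w) + sc (sg (e * fst l)) (word [l] ** wder e \<delta> w)"

definition der :: "int => ('v => 'v) => 'v wfun => 'v wfun" where
 "der e \<delta> f = lin (wder e \<delta>) f"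

lemma wdeg_simps [simp]: "wdeg [] = 0" "wdeg (l # w) = fst l + wdeg w" "wdeg (u @ w) = wdeg u + wdeg w"
 by (auto simp: wdeg_def)

text \<open>The summand \<open>i = 0\<close> differentiates the first letter. In the other summands
  the differential passes that letter and acquires its sign, which is the recursion of
  \<open>wder\<close> in degree 1.\<close>

lemma word_dif_wder: "word_dif V w = wder 1 (dif V) w"
proof (induction w)
 case Nil
 show ?case by (simp add: word_dif_def zero_fun_def)
next
 case (Cons l w)
 define s where "s u i = (if even (wdeg (take i u)) then 1 else (-1::complex))" for u :: "(int \<times> 'a) list" and i
 have e: "word_dif V u = (\<Sum>i<length u. sc (s u i) (word (u[i := (fst (u ! i) + 1, dif V (snd (u ! i)))])))" for u
  by (simp add: fun_eq_iff fapp word_dif_def s_def fun_sum_apply)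
 have "word_dif V (l # w) = word ((fst l + 1, dif V (snd l)) # w) +
   (\<Sum>i<length w. sc (sg (fst l)) (word [l] ** sc (s w i) (word (w[i := (fst (w ! i) + 1, dif V (snd (w ! i)))]))))"
  unfolding e
  by (simp only: length_Cons sum.lessThan_Suc_shift)
    (auto simp add: s_def sg_def cm_sc_right word_cm_word sc_minus_left intro!: sum.cong)
 also have "\<dots> = word ((fst l + 1, dif V (snd l)) # w) + sc (sg (fst l)) (word [l] ** word_dif V w)"
 proof -
  have "word [l] ** sum f S = (\<Sum>i\<in>S. word [l] ** f i)" for f and S :: "nat set"
   by (induction S rule: infinite_finite_induct) (auto simp: cm_distrib)
  then show ?thesis by (simp add: e sc_sum)
 qed
 finally show ?case using Cons by simp
qed

lemma words_dif: "dif (words V) f = der 1 (dif V) f"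
 by (simp add: words_def der_def lin_def fun_eq_iff fapp fun_sum_apply word_dif_wder)

text \<open>The automorphism \<open>(-1)^(e * deg)\<close>; with it the Leibniz rule
  \<open>der_cm\<close> can be stated for elements that are not homogeneous.\<close>

definition tw :: "int => 'v wfun => 'v wfun" where
 "tw e f = (%w. sg (e * wdeg w) * f w)"

lemma tw_simps [simp]: "tw e 0 = 0" "tw e (f + g) = tw e f + tw e g" "tw e (sc c f) = sc c (tw e f)"
 "tw e (word w) = sc (sg (e * wdeg w)) (word w)" "tw e (- f) = - tw e f" "tw e (f - g) = tw e f - tw e g"
 "tw e (tw e f) = f"
 by (auto simp: tw_def fun_eq_iff fapp word_apply algebra_simps)

lemma FS_tw [simp]: "f : word_carrier V ==> tw e f : word_carrier V"
 by (auto simp: word_carrier_iff tw_def fs_def sg_def)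

lemma der_zero [simp]: "der e \<delta> 0 = 0" and der_sc [simp]: "der e \<delta> (sc c f) = sc c (der e \<delta> f)"
 and der_word [simp]: "der e \<delta> (word w) = wder e \<delta> w" and der_minus [simp]: "der e \<delta> (- f) = - der e \<delta> f"
 and der_add [simp]: "f : word_carrier V ==> g : word_carrier V ==> der e \<delta> (f + g) = der e \<delta> f + der e \<delta> g"
 and der_diff [simp]: "f : word_carrier V ==> g : word_carrier V ==> der e \<delta> (f - g) = der e \<delta> f - der e \<delta> g"
 by (auto simp: der_def lin_add lin_diff FS_fs)

lemma der_letter_left: "f : word_carrier V ==>
 der e \<delta> (word [l] ** f) = word [(fst l + e, \<delta> (snd l))] ** f + sc (sg (e * fst l)) (word [l] ** der e \<delta> f)"
proof (induction f rule: FS_induct)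
 case (add g h)
 then have "valid V [l] | \<not> valid V [l]" by simp
 have "fs (word [l] ** g)" "fs (word [l] ** h)"
 proof -
  have "fs (word [l] ** f)" if "f : word_carrier V" for f
   using that by (induction f rule: FS_induct) (auto simp: cm_distrib word_cm_word)
  with add show "fs (word [l] ** g)" "fs (word [l] ** h)" by auto
 qed
 then have "der e \<delta> (word [l] ** g + word [l] ** h) = der e \<delta> (word [l] ** g) + der e \<delta> (word [l] ** h)"
  by (simp add: der_def lin_add)
 with add show ?case by (simp add: cm_distrib sc_add algebra_simps)
qed (auto simp: cm_distrib word_cm_word sc_add mult.commute)

lemma FS_wder: "(!!n x. x : hp V n ==> \<delta> x : hp V (n + e)) ==> valid V w ==> wder e \<delta> w : word_carrier V"
 by (induction w) auto

lemma FS_der: "f : word_carrier V ==> (!!n x. x : hp V n ==> \<delta> x : hp V (n + e)) ==> der e \<delta> f : word_carrier V"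
 unfolding der_def by (erule FS_lin) (rule FS_wder)

lemma wder_append: "wder e \<delta> (u @ w) = wder e \<delta> u ** word w + sc (sg (e * wdeg u)) (word u ** wder e \<delta> w)"
proof (induction u)
 case (Cons l u)
 then show ?case
  by (simp add: cm_distrib sc_add cm_assoc word_cm_word sg_add ring_distribs)
    (simp add: cm_assoc[symmetric] word_cm_word)
qed simp

lemma der_cm:
 assumes "f : word_carrier V" "g : word_carrier V"
 shows "der e \<delta> (f ** g) = der e \<delta> f ** g + tw e f ** der e \<delta> g"
 using assms
proof (induction f rule: FS_induct)
 case (word c w)
 from word(2,1) show ?case
  by (induction g rule: FS_induct)
    (auto simp: cm_distrib word_cm_word wder_append sc_add algebra_simps der_add[of _ V])
next
 case (add g' h)
 then show ?case by (simp add: cm_distrib der_add[of _ V])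
qed simp

text \<open>The Leibniz rule for a right multiple of f involves \<open>tw e f\<close>, so stability
  under the derivation alone is not preserved by multiplication. The elements whose twist and
  derivative both stay in the ideal do form an ideal, and it contains the generators.\<close>

lemma der_Idl:
 assumes S: "S <= word_carrier V" and \<delta>: "!!n x. x : hp V n ==> \<delta> x : hp V (n + e)"
  and d: "!!g. g : S ==> der e \<delta> g : Idl\<^bsub>words V\<^esub> S"
  and t: "!!g. g : S ==> tw e g : Idl\<^bsub>words V\<^esub> S"
  and f: "f : Idl\<^bsub>words V\<^esub> S"
 shows "der e \<delta> f : Idl\<^bsub>words V\<^esub> S"
proof -
 let ?I = "Idl\<^bsub>words V\<^esub> S"
 have I: "wideal V ?I" using S by (rule Idl_wideal)
 note I' = wideal_FS[OF I] wideal_add[OF I] wideal_zero[OF I] wideal_left[OF I] wideal_right[OF I] wideal_sc[OF I]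
 have "wideal V {f : ?I. tw e f : ?I & der e \<delta> f : ?I}"
 proof (rule wideal_letters)
  fix l f assume f: "f : {f : ?I. tw e f : ?I & der e \<delta> f : ?I}" and l: "valid V [l]"
  have m: "tw e (g ** h) = tw e g ** tw e h" if "g : word_carrier V" "h : word_carrier V" for g h
   using that
  proof (induction g rule: FS_induct)
   case (word c w)
   from word(2,1) show ?case
    by (induction h rule: FS_induct)
     (auto simp: cm_distrib word_cm_word sg_add ring_distribs mult_ac)
  qed (auto simp: cm_distrib)
  show "word [l] ** f : {f : ?I. tw e f : ?I & der e \<delta> f : ?I}"
   using f l I' FS_der[OF I'(1) \<delta>] by (auto simp: der_cm[of _ V] m \<delta> cm_sc_left)
  show "f ** word [l] : {f : ?I. tw e f : ?I & der e \<delta> f : ?I}"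
   using f l I' FS_der[OF I'(1) \<delta>] by (auto simp: der_cm[of _ V] m \<delta> cm_sc_right)
 qed (use I' in \<open>auto simp: der_add[of _ V]\<close>)
 then have "?I <= {f : ?I. tw e f : ?I & der e \<delta> f : ?I}"
  by (rule Idl_minimal) (use Idl_self[OF S] d t in auto)
 with f show ?thesis by auto
qed

subsection \<open>Homogeneous components\<close>

definition hc :: "int => 'v wfun => 'v wfun" where
 "hc n f = (%w. if wdeg w = n then f w else 0)"

lemma hc_simps [simp]: "hc n 0 = 0" "hc n (f + g) = hc n f + hc n g" "hc n (sc c f) = sc c (hc n f)"
 "hc n (- f) = - hc n f" "hc n (f - g) = hc n f - hc n g"
 by (auto simp: hc_def fun_eq_iff fapp)

lemma hc_word: "hc n (word w) = (if wdeg w = n then word w else 0)"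
 by (auto simp: hc_def fun_eq_iff fapp word_apply)

lemma FS_hc [simp]: "f : word_carrier V ==> hc n f : word_carrier V"
 by (auto simp: word_carrier_iff hc_def fs_def intro: finite_subset)

lemma words_hpart: "f : hpart (words V) n \<longleftrightarrow> f : word_carrier V & hc n f = f"
 by (auto simp: words_def hc_def fun_eq_iff fapp)

lemma hc_hc: "hc n (hc m f) = (if n = m then hc m f else 0)"
 by (auto simp: hc_def fun_eq_iff fapp)

lemma hc_letter_left: "f : word_carrier V ==> hc n (word [l] ** f) = word [l] ** hc (n - fst l) f"
 and hc_letter_right: "f : word_carrier V ==> hc n (f ** word [l]) = hc (n - fst l) f ** word [l]"
 by (induction f rule: FS_induct) (auto simp: cm_distrib word_cm_word hc_word)

lemma hc_sum: "f : word_carrier V ==> \<exists>S. finite S & f = (\<Sum>n\<in>S. hc n f)"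
proof -
 assume "f : word_carrier V"
 then have "finite {w. f w ~= 0}" by (simp add: word_carrier_iff fs_def)
 let ?S = "wdeg ` {w. f w ~= 0}"
 have "f = (\<Sum>n\<in>?S. hc n f)"
 proof
  fix w
  show "f w = (\<Sum>n\<in>?S. hc n f) w"
   unfolding fun_sum_apply hc_def using \<open>finite {w. f w ~= 0}\<close>
   by (subst sum.delta') auto
 qed
 with \<open>finite {w. f w ~= 0}\<close> show ?thesis by blast
qed

text \<open>The elements all of whose components lie in the ideal form an ideal themselves, because
  multiplication by a letter only shifts the components.\<close>

lemma hc_Idl:
 assumes S: "S <= word_carrier V" and h: "!!g. g : S ==> \<exists>m. hc m g = g" and f: "f : Idl\<^bsub>words V\<^esub> S"
 shows "hc n f : Idl\<^bsub>words V\<^esub> S"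
proof -
 let ?I = "Idl\<^bsub>words V\<^esub> S"
 have I: "wideal V ?I" using S by (rule Idl_wideal)
 note I' = wideal_FS[OF I] wideal_add[OF I] wideal_zero[OF I] wideal_left[OF I] wideal_right[OF I] wideal_sc[OF I]
 have "wideal V {f : ?I. \<forall>n. hc n f : ?I}"
  by (rule wideal_letters) (use I' in \<open>auto simp: hc_letter_left[of _ V] hc_letter_right[of _ V]\<close>)
 moreover have "S <= {f : ?I. \<forall>n. hc n f : ?I}"
  using Idl_self[OF S] I' h by (smt (verit) hc_hc mem_Collect_eq subset_eq)
 ultimately have "?I <= {f : ?I. \<forall>n. hc n f : ?I}" by (rule Idl_minimal)
 with f show ?thesis by auto
qed

lemma tw_hc: "hc m g = g ==> tw e g = sc (sg (e * m)) g"
 by (auto simp: tw_def hc_def fun_eq_iff fapp) (metis mult_zero_right)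

section \<open>Gradings, the tangent module and the algebroid axioms on homogeneous elements\<close>

section \<open>Graded groups and modules\<close>

lemma graded_group_abelian: "graded_group M ==> abelian_group M"
 by (simp add: graded_group_def)

lemma hpart_carrier: "graded_group M ==> x : hp M n ==> x : car M"
 and hpart_zero: "graded_group M ==> \<zero>\<^sub>M : hp M n"
 and hpart_add: "graded_group M ==> x : hp M n ==> y : hp M n ==> x \<oplus>\<^sub>M y : hp M n"
 and hpart_a_inv: "graded_group M ==> x : hp M n ==> \<ominus>\<^sub>M x : hp M n"
proof -
 assume "graded_group M"
 then have s: "subgroup (hp M n) (add_monoid M)"
  by (simp add: graded_group_def)
 show "x : hp M n ==> x : car M"
  using subgroup.mem_carrier[OF s] by auto
 show "\<zero>\<^sub>M : hp M n"
  using subgroup.one_closed[OF s] by simp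
 show "x : hp M n ==> y : hp M n ==> x \<oplus>\<^sub>M y : hp M n"
  using subgroup.m_closed[OF s] by simp
 show "x : hp M n ==> \<ominus>\<^sub>M x : hp M n"
  using subgroup.m_inv_closed[OF s] by (simp add: a_inv_def)
qed

lemma hpart_ksign: "graded_group M ==> x : hp M n ==> ksign M k x : hp M n"
 by (simp add: ksign_def hpart_a_inv)

lemma hpart_minus: "graded_group M ==> x : hp M n ==> y : hp M n ==> x \<ominus>\<^sub>M y : hp M n"
 by (simp add: a_minus_def hpart_a_inv hpart_add)

lemma finsum_eqI: "car M = car N ==> add M = add N ==> zero M = zero N ==> finsum M f S = finsum N f S"
 by (simp add: finsum_def finprod_def)

lemma hdecompI:
 assumes "abelian_group M" "finite S" "{n. f n ~= \<zero>\<^sub>M} <= S" "!!n. f n : hp M n"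
  "!!n. f n : car M" "x = (\<Oplus>\<^bsub>M\<^esub>n\<in>S. f n)"
 shows "hdecomp M x f"
proof -
 interpret abelian_group M by fact
 have "(\<Oplus>\<^bsub>M\<^esub>n\<in>{n. f n ~= \<zero>\<^sub>M}. f n) = (\<Oplus>\<^bsub>M\<^esub>n\<in>S. f n)"
  by (rule add.finprod_mono_neutral_cong_left) (use assms in auto)
 with assms show ?thesis by (auto simp: hdecomp_def intro: finite_subset)
qed

lemma hcomp_hdecomp: "graded_group M ==> x : car M ==> hdecomp M x (hcomp M x)"
 unfolding hcomp_def graded_group_def by (metis (mono_tags, lifting) theI')

lemma hcomp_unique: "graded_group M ==> x : car M ==> hdecomp M x f ==> hcomp M x = f"
 using hcomp_hdecomp[of M x] unfolding graded_group_def by blast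

lemma hcomp_hpart: "graded_group M ==> x : car M ==> hcomp M x n : hp M n"
 and finite_hsupp: "graded_group M ==> x : car M ==> finite (hsupp M x)"
 and hcomp_sum: "graded_group M ==> x : car M ==> x = (\<Oplus>\<^bsub>M\<^esub>n\<in>hsupp M x. hcomp M x n)"
 using hcomp_hdecomp[of M x] by (auto simp: hdecomp_def hsupp_def)

lemma hcomp_carrier: "graded_group M ==> x : car M ==> hcomp M x n : car M"
 by (rule hpart_carrier[OF _ hcomp_hpart])

lemma hcomp_sum_superset:
 assumes "graded_group M" "x : car M" "finite S" "hsupp M x <= S"
 shows "x = (\<Oplus>\<^bsub>M\<^esub>n\<in>S. hcomp M x n)"
proof -
 interpret abelian_group M using assms by (simp add: graded_group_abelian)
 have "(\<Oplus>\<^bsub>M\<^esub>n\<in>hsupp M x. hcomp M x n) = (\<Oplus>\<^bsub>M\<^esub>n\<in>S. hcomp M x n)"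
  by (rule add.finprod_mono_neutral_cong_left)
    (use assms hcomp_carrier[OF assms(1,2)] in \<open>auto simp: hsupp_def\<close>)
 with hcomp_sum[OF assms(1,2)] show ?thesis by simp
qed

lemma hcomp_hom:
 assumes "graded_group M" "x : hp M n"
 shows "hcomp M x = (%k. if k = n then x else \<zero>\<^sub>M)"
  and "hsupp M x = (if x = \<zero>\<^sub>M then {} else {n})"
proof -
 interpret abelian_group M using assms by (simp add: graded_group_abelian)
 have x: "x : car M" using assms by (simp add: hpart_carrier)
 show 1: "hcomp M x = (%k. if k = n then x else \<zero>\<^sub>M)"
 proof (rule hcomp_unique[OF assms(1) x hdecompI[of _ "{n}"]])
  show "x = (\<Oplus>\<^bsub>M\<^esub>k\<in>{n}. if k = n then x else \<zero>\<^sub>M)" using x by simp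
 qed (use assms x graded_group_abelian in \<open>auto simp: hpart_zero\<close>)
 show "hsupp M x = (if x = \<zero>\<^sub>M then {} else {n})"
  by (auto simp: hsupp_def 1)
qed

lemma hcomp_add:
 assumes "graded_group M" "x : car M" "y : car M"
 shows "hcomp M (x \<oplus>\<^sub>M y) = (%n. hcomp M x n \<oplus>\<^sub>M hcomp M y n)"
proof -
 interpret abelian_group M using assms by (simp add: graded_group_abelian)
 note h = hcomp_hpart[OF assms(1)] and c = hcomp_carrier[OF assms(1)]
 let ?S = "hsupp M x \<union> hsupp M y"
 show ?thesis
 proof (rule hcomp_unique[OF assms(1) _ hdecompI[of _ ?S]])
  have "x = (\<Oplus>\<^bsub>M\<^esub>n\<in>?S. hcomp M x n)" "y = (\<Oplus>\<^bsub>M\<^esub>n\<in>?S. hcomp M y n)"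
   using assms by (auto intro!: hcomp_sum_superset simp: finite_hsupp)
  moreover have "(\<Oplus>\<^bsub>M\<^esub>n\<in>?S. hcomp M x n \<oplus>\<^sub>M hcomp M y n) =
    (\<Oplus>\<^bsub>M\<^esub>n\<in>?S. hcomp M x n) \<oplus>\<^sub>M (\<Oplus>\<^bsub>M\<^esub>n\<in>?S. hcomp M y n)"
   by (rule finsum_addf) (use assms h c in auto)
  ultimately show "x \<oplus>\<^sub>M y = (\<Oplus>\<^bsub>M\<^esub>n\<in>?S. hcomp M x n \<oplus>\<^sub>M hcomp M y n)"
   by simp
 next
  show "{n. hcomp M x n \<oplus>\<^sub>M hcomp M y n ~= \<zero>\<^sub>M} <= ?S"
   by (auto simp: hsupp_def)
 qed (use assms h c graded_group_abelian in \<open>auto simp: hpart_add finite_hsupp\<close>)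
qed

lemma graded_induct [consumes 2, case_names zero hom add]:
 assumes "graded_group M" "x : car M" "P \<zero>\<^sub>M" "!!n y. y : hp M n ==> P y"
  "!!y z. y : car M ==> z : car M ==> P y ==> P z ==> P (y \<oplus>\<^sub>M z)"
 shows "P x"
proof -
 interpret abelian_group M using assms by (simp add: graded_group_abelian)
 note h = hcomp_hpart[OF assms(1,2)] and c = hcomp_carrier[OF assms(1,2)]
 have "finite S ==> P (\<Oplus>\<^bsub>M\<^esub>n\<in>S. hcomp M x n)" for S
 proof (induction S rule: finite_induct)
  case (insert n S)
  then show ?case
   using c by (subst finsum_insert) (auto intro!: assms(5) finsum_closed assms(4)[OF h])
 qed (simp add: assms)
 then show ?thesis
  using hcomp_sum[OF assms(1,2)] finite_hsupp[OF assms(1,2)] by metis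
qed

lemma additive_finsum:
 assumes "abelian_group M" "abelian_group N" "finite S" "!!i. i : S ==> g i : car M"
  "!!x. x : car M ==> f x : car N"
  "!!x y. x : car M ==> y : car M ==> f (x \<oplus>\<^sub>M y) = f x \<oplus>\<^sub>N f y"
 shows "f (\<Oplus>\<^bsub>M\<^esub>i\<in>S. g i) = (\<Oplus>\<^bsub>N\<^esub>i\<in>S. f (g i))" and "f \<zero>\<^sub>M = \<zero>\<^sub>N"
proof -
 interpret M: abelian_group M by fact
 interpret N: abelian_group N by fact
 have "f \<zero>\<^sub>M \<oplus>\<^sub>N f \<zero>\<^sub>M = f \<zero>\<^sub>M" using assms(6)[of "\<zero>\<^sub>M" "\<zero>\<^sub>M"] by simp
 then show z: "f \<zero>\<^sub>M = \<zero>\<^sub>N" using N.add.l_cancel_one' assms(5) by (metis M.zero_closed)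
 from assms(3,4) show "f (\<Oplus>\<^bsub>M\<^esub>i\<in>S. g i) = (\<Oplus>\<^bsub>N\<^esub>i\<in>S. f (g i))"
 proof (induction S rule: finite_induct)
  case (insert x F)
  then show ?case
   by (subst M.finsum_insert, simp, simp, simp, simp, subst N.finsum_insert)
     (auto simp: assms(5,6) intro!: M.finsum_closed)
 qed (simp add: z)
qed

text \<open>Applied to any decomposition, the additive projections \<open>pr\<close> return its
  members, which gives uniqueness; existence is the assumption \<open>e\<close>.\<close>

lemma graded_groupI:
 assumes "abelian_group M" and s: "!!n. subgroup (hp M n) (add_monoid M)"
  and p: "!!n x. x : car M ==> pr n x : car M"
   "!!n x y. x : car M ==> y : car M ==> pr n (x \<oplus>\<^sub>M y) = pr n x \<oplus>\<^sub>M pr n y"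
   "!!n m x. x : hp M m ==> pr n x = (if m = n then x else \<zero>\<^sub>M)"
  and e: "!!x. x : car M ==> \<exists>S f. finite S & (\<forall>n\<in>S. f n : hp M n) & x = (\<Oplus>\<^bsub>M\<^esub>n\<in>S. f n)"
 shows "graded_group M" and "!!x n. x : car M ==> hcomp M x n = pr n x"
proof -
 interpret abelian_group M by fact
 have c: "x : hp M n ==> x : car M" for x n
  using subgroup.mem_carrier[OF s] by auto
 have z: "\<zero>\<^sub>M : hp M n" for n using subgroup.one_closed[OF s] by simp
 have pr: "pr n x = g n" if "hdecomp M x g" for x g n
 proof -
  from that have g: "g k : hp M k" "finite {n. g n ~= \<zero>\<^sub>M}"
   and x: "x = (\<Oplus>\<^bsub>M\<^esub>n\<in>{n. g n ~= \<zero>\<^sub>M}. g n)" for k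
   by (auto simp: hdecomp_def)
  have "pr n x = (\<Oplus>\<^bsub>M\<^esub>k\<in>{n. g n ~= \<zero>\<^sub>M}. pr n (g k))"
   unfolding x by (rule additive_finsum) (use g c p assms(1) in auto)
  also have "\<dots> = (\<Oplus>\<^bsub>M\<^esub>k\<in>{n. g n ~= \<zero>\<^sub>M}. if n = k then g k else \<zero>\<^sub>M)"
   using c[OF g(1)] p(3)[OF g(1)] by (intro finsum_cong') auto
  also have "\<dots> = g n"
  proof (cases "g n = \<zero>\<^sub>M")
   case True
   then have "(\<Oplus>\<^bsub>M\<^esub>k\<in>{n. g n ~= \<zero>\<^sub>M}. if n = k then g k else \<zero>\<^sub>M) = (\<Oplus>\<^bsub>M\<^esub>k\<in>{n. g n ~= \<zero>\<^sub>M}. \<zero>\<^sub>M)"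
    by (intro finsum_cong') auto
   with True show ?thesis by simp
  next
   case False
   then show ?thesis using g(2) c[OF g(1)] by (intro finsum_singleton) auto
  qed
  finally show ?thesis .
 qed
 have ex: "hdecomp M x (%n. pr n x)" if x: "x : car M" for x
 proof -
  obtain S f where f: "finite S" "!!n. n : S ==> f n : hp M n" and xs: "x = (\<Oplus>\<^bsub>M\<^esub>n\<in>S. f n)"
   using e[OF x] by blast
  let ?g = "%n. if n : S then f n else \<zero>\<^sub>M"
  have "hdecomp M x ?g"
  proof (rule hdecompI[OF assms(1) f(1)])
   show "x = (\<Oplus>\<^bsub>M\<^esub>n\<in>S. ?g n)" unfolding xs by (intro finsum_cong') (simp_all add: c[OF f(2)] Pi_def)
  qed (use f z in \<open>simp_all add: c[OF f(2)]\<close>, auto)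
  moreover from pr[OF this] have "?g = (%n. pr n x)" by auto
  ultimately show ?thesis by simp
 qed
 have u: "g = (%n. pr n x)" if "hdecomp M x g" for x g
  using pr[OF that] by auto
 show "graded_group M"
  unfolding graded_group_def using assms(1) s ex u by blast
 then show "hcomp M x n = pr n x" if "x : car M" for x n
  using ex[OF that] that hcomp_unique by metis
qed

section \<open>Algebras and algebroids\<close>

lemma (in abelian_group) ksign_closed [simp]: "x : car G ==> ksign G k x : car G"
 by (simp add: ksign_def)

lemma dg_moduleD:
 assumes "dg_module R M"
 shows "graded_group M" "abelian_group M"
  "a : carrier R ==> x : car M ==> a \<odot>\<^sub>M x : car M"
  "a : carrier R ==> b : carrier R ==> x : car M ==> (a \<oplus>\<^sub>R b) \<odot>\<^sub>M x = a \<odot>\<^sub>M x \<oplus>\<^sub>M b \<odot>\<^sub>M x"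
  "a : carrier R ==> x : car M ==> y : car M ==> a \<odot>\<^sub>M (x \<oplus>\<^sub>M y) = a \<odot>\<^sub>M x \<oplus>\<^sub>M a \<odot>\<^sub>M y"
  "a : carrier R ==> b : carrier R ==> x : car M ==> (a \<otimes>\<^sub>R b) \<odot>\<^sub>M x = a \<odot>\<^sub>M (b \<odot>\<^sub>M x)"
  "x : car M ==> \<one>\<^sub>R \<odot>\<^sub>M x = x"
  "a : hpart R n ==> x : hp M m ==> a \<odot>\<^sub>M x : hp M (n + m)"
  "x : hp M n ==> dif M x : hp M (n + 1)"
  "x : car M ==> y : car M ==> dif M (x \<oplus>\<^sub>M y) = dif M x \<oplus>\<^sub>M dif M y"
  "x : car M ==> dif M (dif M x) = \<zero>\<^sub>M"
  "a : hpart R n ==> x : car M ==> dif M (a \<odot>\<^sub>M x) = dif R a \<odot>\<^sub>M x \<oplus>\<^sub>M ksign M n (a \<odot>\<^sub>M dif M x)"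
 using assms unfolding dg_module_def graded_module_def by (simp_all add: graded_group_abelian)

lemma dif_carrier: "dg_module R M ==> x : car M ==> dif M x : car M"
proof -
 assume M: "dg_module R M" and x: "x : car M"
 interpret abelian_group M using dg_moduleD(2)[OF M] .
 have "dif M \<zero>\<^sub>M : car M"
  by (rule hpart_carrier[OF dg_moduleD(1)[OF M] dg_moduleD(9)[OF M hpart_zero[OF dg_moduleD(1)[OF M]]]])
 with dg_moduleD(1)[OF M] x show ?thesis
  by (induction x rule: graded_induct)
    (auto simp: dg_moduleD(10)[OF M] intro: hpart_carrier[OF dg_moduleD(1)[OF M] dg_moduleD(9)[OF M]])
qed

lemma CC_sel [simp]: "carrier CC = UNIV" "mult CC = (*)" "one CC = 1" "zero CC = 0" "add CC = (+)"
 "dif CC = (%_. 0)" "hpart CC n = (if n = 0 then UNIV else {0})"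
 by (auto simp: CC_def)

lemma dsum_sel [simp]: "carrier (dsum A M) = car A \<times> car M" "zero (dsum A M) = (\<zero>\<^sub>A, \<zero>\<^sub>M)"
 "add (dsum A M) = (%u v. (fst u \<oplus>\<^sub>A fst v, snd u \<oplus>\<^sub>M snd v))"
 "smult (dsum A M) = (%c u. (c \<odot>\<^sub>A fst u, (c \<odot>\<^sub>A \<one>\<^sub>A) \<odot>\<^sub>M snd u))"
 "hpart (dsum A M) = (%n. hp A n \<times> hp M n)"
 "dif (dsum A M) = (%u. (dif A (fst u), dif M (snd u)))"
 by (auto simp: dsum_def)

locale cdga_loc =
 fixes A :: "(complex, 'a) dgmod" (structure)
 assumes cdgaA: "cdga A"
begin

lemma dgA: "dg_algebra A" and modA: "dg_module CC A" and ringA: "ring A" and grA: "graded_group A"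
proof -
 show "dg_algebra A" using cdgaA by (simp add: cdga_def)
 then show M: "dg_module CC A" "ring A" by (simp_all add: dg_algebra_def)
 show "graded_group A" using dg_moduleD(1)[OF M(1)] .
qed

sublocale A: ring A by (rule ringA)

lemmas A_mod = dg_moduleD[OF modA] and A_hpart = hpart_carrier[OF grA] hpart_zero[OF grA] hpart_add[OF grA]
 hpart_a_inv[OF grA] hpart_ksign[OF grA] hpart_minus[OF grA]

lemma A_hcarr [simp]: "a : hp A n ==> a : car A"
 by (rule A_hpart)

lemma A_one [simp]: "\<one> : hp A 0"
 and A_mult: "a : hp A n ==> b : hp A m ==> a \<otimes> b : hp A (n + m)"
 and A_sc1: "a : car A ==> b : car A ==> c \<odot> (a \<otimes> b) = (c \<odot> a) \<otimes> b"
 and A_sc2: "a : car A ==> b : car A ==> c \<odot> (a \<otimes> b) = a \<otimes> (c \<odot> b)"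
 and A_dif_mult: "a : hp A n ==> b : car A ==>
  dif A (a \<otimes> b) = dif A a \<otimes> b \<oplus> ksign A n (a \<otimes> dif A b)"
 and A_comm: "a : hp A n ==> b : hp A m ==> a \<otimes> b = ksign A (n * m) (b \<otimes> a)"
 using cdgaA unfolding cdga_def dg_algebra_def by blast+

lemma A_smult_closed [simp]: "a : car A ==> c \<odot> a : car A"
 using A_mod(3) by simp

lemma A_smult_hpart: "a : hp A n ==> c \<odot> a : hp A n"
 using A_mod(8)[of c 0 a n] by simp

lemma A_dif [simp]: "a : car A ==> dif A a : car A"
 using dif_carrier[OF modA] .

text \<open>As a scalar, the sign can be moved by the rules for complex linearity.\<close>

lemma A_ksign: "a : car A ==> ksign A k a = sg k \<odot> a"
proof -
 assume a: "a : car A"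
 have "(0::complex) \<odot> a \<oplus> 0 \<odot> a = 0 \<odot> a"
  using A_mod(4)[of 0 0 a] a by simp
 then have z: "(0::complex) \<odot> a = \<zero>"
  using a A.add.l_cancel_one' A_smult_closed by metis
 have "(- 1 :: complex) \<odot> a \<oplus> a = \<zero>"
  using A_mod(4)[of "-1" 1 a] A_mod(7)[of a] a z by simp
 then have "(- 1 :: complex) \<odot> a = \<ominus> a"
  using a A.minus_equality A_smult_closed by metis
 then show ?thesis using A_mod(7)[of a] a by (auto simp: ksign_def sg_def)
qed

lemma A_smult_zero [simp]: "c \<odot> \<zero> = \<zero>"
 using A_mod(5)[of c "\<zero>" "\<zero>"] by (metis A.add.l_cancel_one' A.zero_closed A.l_zero A_smult_closed CC_sel(1) UNIV_I)

lemma A_sc_assoc: "a : car A ==> c \<odot> (d \<odot> a) = (c * d) \<odot> a"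
 using A_mod(6)[of c d a] by simp

subsection \<open>The tangent module\<close>

lemma derD:
 assumes "D : derivations A n"
 shows "a : hp A k ==> D a : hp A (n + k)"
  "a : car A ==> b : car A ==> D (a \<oplus> b) = D a \<oplus> D b"
  "a : car A ==> D (c \<odot> a) = c \<odot> D a"
  "a : hp A k ==> b : car A ==> D (a \<otimes> b) = D a \<otimes> b \<oplus> ksign A (n * k) (a \<otimes> D b)"
  "D : extensional (car A)"
 using assms unfolding derivations_def by auto

lemma der_zero_A: "D : derivations A n ==> D \<zero> = \<zero>"
proof -
 assume D: "D : derivations A n"
 have "D \<zero> \<oplus> D \<zero> = D \<zero>" "D \<zero> : car A"
  using derD(2)[OF D, of "\<zero>" "\<zero>"] derD(1)[OF D A_hpart(2)[of 0]] by auto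
 then show ?thesis by (metis A.add.l_cancel_one')
qed

lemma der_carrier [simp]: "D : derivations A n ==> a : car A ==> D a : car A"
 using grA by (erule_tac graded_induct) (auto simp: der_zero_A derD(2) intro: A_hcarr derD(1))

lemma der_add_closed: "D : derivations A n ==> E : derivations A n ==>
 (\<lambda>a\<in>car A. D a \<oplus> E a) : derivations A n"
 by (subst derivations_def)
   (auto simp: derD A_hpart A.a_ac A.ring_simprules A_ksign A_mod(5) A_mult A_mod(3))

definition zder :: "'a => 'a" where "zder = (\<lambda>a\<in>car A. \<zero>)"

lemma zder: "zder : derivations A n"
 by (subst derivations_def) (auto simp: zder_def A_hpart A_ksign A_mult A_smult_zero)

lemma A_finsum: "finite S ==> (!!n. n : S ==> f n : car A) ==> (\<Oplus>\<^bsub>A\<^esub>n\<in>S. f n) : car A"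
 by (intro A.finsum_closed) auto

lemma tangent_sel [simp]: "zero (tangent_graded A) = zder" "add (tangent_graded A) = (%D E. \<lambda>a\<in>car A. D a \<oplus> E a)"
 "hpart (tangent_graded A) = derivations A" "smult (tangent_graded A) = (%b D. \<lambda>a\<in>car A. b \<otimes> D a)"
 by (auto simp: tangent_graded_def zder_def)

lemma tangent_carrier: "D : carrier (tangent_graded A) \<longleftrightarrow>
 (\<exists>f S. finite S & (\<forall>n. f n : derivations A n) & D = (\<lambda>a\<in>car A. \<Oplus>\<^bsub>A\<^esub>n\<in>S. f n a))"
 by (auto simp: tangent_graded_def)

lemma tangent_carrierD:
 assumes "D : carrier (tangent_graded A)"
 shows "D : extensional (car A)" "a : car A ==> D a : car A"
  "a : car A ==> b : car A ==> D (a \<oplus> b) = D a \<oplus> D b"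
proof -
 obtain f S where f: "finite S" "!!n. f n : derivations A n" and D: "D = (\<lambda>a\<in>car A. \<Oplus>\<^bsub>A\<^esub>n\<in>S. f n a)"
  using assms by (auto simp: tangent_carrier)
 have c: "a : car A ==> f n a : car A" for a n using f(2) der_carrier by blast
 show "D : extensional (car A)" by (simp add: D)
 show "a : car A ==> D a : car A"
  using c f(1) by (simp add: D A_finsum)
 show "a : car A ==> b : car A ==> D (a \<oplus> b) = D a \<oplus> D b"
  using c f(1) by (simp add: D derD(2)[OF f(2)] A.finsum_addf Pi_def)
qed

lemma derivation_tangent: "D : derivations A n ==> D : carrier (tangent_graded A)"
proof -
 assume D: "D : derivations A n"
 let ?f = "%k. if k = n then D else zder"
 have "D = (\<lambda>a\<in>car A. \<Oplus>\<^bsub>A\<^esub>k\<in>{n}. ?f k a)"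
  using D derD(5)[OF D] by (auto simp: fun_eq_iff extensional_def)
 moreover have "\<forall>k. ?f k : derivations A k" using D zder by auto
 ultimately show ?thesis
  unfolding tangent_carrier by (intro exI[of _ ?f] exI[of _ "{n}"] conjI) auto
qed

text \<open>Two finite families of derivations with different index sets are padded by the zero
  derivation to families over the union, where they can be added term by term.\<close>

lemma tangent_add_closed:
 assumes "D : carrier (tangent_graded A)" "E : carrier (tangent_graded A)"
 shows "(\<lambda>a\<in>car A. D a \<oplus> E a) : carrier (tangent_graded A)"
proof -
 have *: "\<exists>f. (\<forall>n. f n : derivations A n) & D = (\<lambda>a\<in>car A. \<Oplus>\<^bsub>A\<^esub>n\<in>T. f n a)"
  if "finite T" "S <= T" "!!n. f n : derivations A n" "D = (\<lambda>a\<in>car A. \<Oplus>\<^bsub>A\<^esub>n\<in>S. f n a)" for f S T D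
 proof -
  let ?f = "%n. if n : S then f n else zder"
  have c: "a : car A ==> f n a : car A" for a n using that(3) der_carrier by blast
  have "(\<Oplus>\<^bsub>A\<^esub>n\<in>S. f n a) = (\<Oplus>\<^bsub>A\<^esub>n\<in>T. ?f n a)" if "a : car A" for a
   by (rule A.add.finprod_mono_neutral_cong_left)
     (use \<open>finite T\<close> \<open>S <= T\<close> that c in \<open>auto simp: zder_def\<close>)
  then have "D = (\<lambda>a\<in>car A. \<Oplus>\<^bsub>A\<^esub>n\<in>T. ?f n a)"
   unfolding that(4) by (intro restrict_ext) auto
  moreover have "\<forall>n. ?f n : derivations A n" using that(3) zder by auto
  ultimately show ?thesis by (intro exI[of _ ?f] conjI)
 qed
 obtain f S g S' where f: "finite S" "!!n. f n : derivations A n" "D = (\<lambda>a\<in>car A. \<Oplus>\<^bsub>A\<^esub>n\<in>S. f n a)"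
  and g: "finite S'" "!!n. g n : derivations A n" "E = (\<lambda>a\<in>car A. \<Oplus>\<^bsub>A\<^esub>n\<in>S'. g n a)"
  using assms unfolding tangent_carrier by blast
 from f g obtain f' g' where f': "!!n. f' n : derivations A n" "D = (\<lambda>a\<in>car A. \<Oplus>\<^bsub>A\<^esub>n\<in>S \<union> S'. f' n a)"
  and g': "!!n. g' n : derivations A n" "E = (\<lambda>a\<in>car A. \<Oplus>\<^bsub>A\<^esub>n\<in>S \<union> S'. g' n a)"
  using *[of "S \<union> S'" S f D] *[of "S \<union> S'" S' g E] by auto
 let ?h = "%n. \<lambda>a\<in>car A. f' n a \<oplus> g' n a"
 have "(\<Oplus>\<^bsub>A\<^esub>n\<in>S \<union> S'. f' n a \<oplus> g' n a) = (\<Oplus>\<^bsub>A\<^esub>n\<in>S \<union> S'. f' n a) \<oplus> (\<Oplus>\<^bsub>A\<^esub>n\<in>S \<union> S'. g' n a)"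
  if "a : car A" for a
  by (rule A.finsum_addf) (use that f'(1) g'(1) der_carrier in blast)+
 then have "(\<lambda>a\<in>car A. D a \<oplus> E a) = (\<lambda>a\<in>car A. \<Oplus>\<^bsub>A\<^esub>n\<in>S \<union> S'. ?h n a)"
  by (auto simp: f'(2) g'(2) fun_eq_iff)
 moreover have "\<forall>n. ?h n : derivations A n" using f'(1) g'(1) der_add_closed by blast
 ultimately show ?thesis
  unfolding tangent_carrier using f(1) g(1) by (intro exI[of _ ?h] exI[of _ "S \<union> S'"] conjI) auto
qed

lemma tangent_monoid: "abelian_monoid (tangent_graded A)"
proof (rule abelian_monoidI)
 show "\<zero>\<^bsub>tangent_graded A\<^esub> : carrier (tangent_graded A)"
  using derivation_tangent[OF zder] by simp
next
 fix D E assume "D : carrier (tangent_graded A)" "E : carrier (tangent_graded A)"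
 then show "D \<oplus>\<^bsub>tangent_graded A\<^esub> E : carrier (tangent_graded A)"
  "D \<oplus>\<^bsub>tangent_graded A\<^esub> E = E \<oplus>\<^bsub>tangent_graded A\<^esub> D"
  using tangent_carrierD(2) by (auto simp: tangent_add_closed A.a_comm intro!: restrict_ext)
next
 fix D E F assume "D : carrier (tangent_graded A)" "E : carrier (tangent_graded A)" "F : carrier (tangent_graded A)"
 then show "D \<oplus>\<^bsub>tangent_graded A\<^esub> E \<oplus>\<^bsub>tangent_graded A\<^esub> F = D \<oplus>\<^bsub>tangent_graded A\<^esub> (E \<oplus>\<^bsub>tangent_graded A\<^esub> F)"
  using tangent_carrierD(2) by (auto simp: A.a_assoc intro!: restrict_ext)
next
 fix D assume "D : carrier (tangent_graded A)"
 then show "\<zero>\<^bsub>tangent_graded A\<^esub> \<oplus>\<^bsub>tangent_graded A\<^esub> D = D"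
  using tangent_carrierD(1)[of D] tangent_carrierD(2)[of D]
  by (auto simp: zder_def fun_eq_iff extensional_def)
qed

lemma tangent_finsum:
 assumes "finite S" "!!n. n : S ==> f n : carrier (tangent_graded A)"
 shows "(\<Oplus>\<^bsub>tangent_graded A\<^esub>n\<in>S. f n) = (\<lambda>a\<in>car A. \<Oplus>\<^bsub>A\<^esub>n\<in>S. f n a)"
proof -
 interpret T: abelian_monoid "tangent_graded A" by (rule tangent_monoid)
 from assms show ?thesis
 proof (induction S rule: finite_induct)
  case (insert n S)
  then have "(\<Oplus>\<^bsub>A\<^esub>k\<in>insert n S. f k a) = f n a \<oplus> (\<Oplus>\<^bsub>A\<^esub>k\<in>S. f k a)" if "a : car A" for a
   using tangent_carrierD(2) that by (intro A.finsum_insert) auto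
  with insert show ?case
   by (subst T.finsum_insert) (auto simp: fun_eq_iff)
 qed (simp add: zder_def)
qed

text \<open>\<open>hcomp\<close> is a definite description, so the bracket and the differential of
  \<open>tangent\<close> can be computed only after uniqueness of the decomposition is known.
  Evaluating a decomposition of D at a homogeneous element gives one in A, where uniqueness
  holds.\<close>

lemma hcomp_tangent:
 assumes D: "D : derivations A n"
 shows "hcomp (tangent_graded A) D = (%k. if k = n then D else zder)"
  and "hsupp (tangent_graded A) D = (if D = zder then {} else {n})"
proof -
 interpret T: abelian_monoid "tangent_graded A" by (rule tangent_monoid)
 let ?g = "%k. if k = n then D else zder"
 have "(\<Oplus>\<^bsub>tangent_graded A\<^esub>k\<in>{k. ?g k ~= zder}. ?g k) = D"
 proof (cases "D = zder")
  case True
  then show ?thesis using T.finsum_empty by simp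
 next
  case False
  then have "{k. ?g k ~= zder} = {n}" by auto
  then show ?thesis using derivation_tangent[OF D] derD(5)[OF D] D
   by (auto simp: zder_def fun_eq_iff extensional_def)
 qed
 then have ex: "hdecomp (tangent_graded A) D ?g"
  using D zder by (auto simp: hdecomp_def)
 have un: "f = ?g" if "hdecomp (tangent_graded A) D f" for f
 proof
  fix k
  from that have f: "f k : derivations A k" "finite {k. f k ~= zder}"
   and Df: "D = (\<Oplus>\<^bsub>tangent_graded A\<^esub>k\<in>{k. f k ~= zder}. f k)" for k
   by (auto simp: hdecomp_def)
  have *: "f k a = (if k = n then D a else \<zero>)" if a: "a : hp A m" for a m
  proof -
   let ?S = "{k. f k ~= zder}"
   have fc: "f i a : car A" for i using f(1)[of i] a by simp
   have Da: "D a = (\<Oplus>\<^bsub>A\<^esub>k\<in>?S. f k a)"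
    unfolding Df using a f derivation_tangent by (subst tangent_finsum) auto
   have "(\<Oplus>\<^bsub>A\<^esub>k\<in>(%k. k + m) ` ?S. f (k - m) a) = (\<Oplus>\<^bsub>A\<^esub>k\<in>?S. f k a)"
    by (subst A.finsum_reindex) (auto simp: inj_on_def fc)
   with Da have Da': "D a = (\<Oplus>\<^bsub>A\<^esub>k\<in>(%k. k + m) ` ?S. f (k - m) a)" by simp
   \<comment> \<open>The derivation \<open>f k\<close> maps degree m to degree \<open>k + m\<close>,
     so the component of \<open>D a\<close> in degree k is the value of
     \<open>f (k - m)\<close>.\<close>
   have "hdecomp A (D a) (%k. f (k - m) a)"
   proof (rule hdecompI[OF _ _ _ _ _ Da'])
    show "{i. f (i - m) a ~= \<zero>} <= (%k. k + m) ` ?S"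
    proof
     fix i assume "i : {i. f (i - m) a ~= \<zero>}"
     then have "f (i - m) ~= zder" using a by (auto simp: zder_def)
     then show "i : (%k. k + m) ` ?S" by (intro image_eqI[of _ _ "i - m"]) auto
    qed
    show "f (i - m) a : hp A i" for i using derD(1)[OF f(1)[of "i - m"] a] by simp
   qed (use f(2) fc in \<open>auto simp: A.is_abelian_group A.abelian_group_axioms\<close>)
   then have "hcomp A (D a) = (%k. f (k - m) a)"
    using hcomp_unique[OF grA] D a by auto
   moreover have "hcomp A (D a) = (%k. if k = n + m then D a else \<zero>)"
    using hcomp_hom(1)[OF grA derD(1)[OF D a]] .
   ultimately show ?thesis by (metis add_diff_cancel_right' diff_add_cancel)
  qed
  have "f k a = ?g k a" if "a : car A" for a
   using grA that
  proof (induction a rule: graded_induct)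
   case zero
   show ?case using *[OF A_hpart(2)[of 0]] D by (auto simp: zder_def der_zero_A)
  next
   case (hom m y)
   then show ?case using * by (simp add: zder_def)
  next
   case (add y z)
   then show ?case using derD(2)[OF f(1)] derD(2)[OF D] by (auto simp: zder_def)
  qed
  moreover have "f k : extensional (car A)" "?g k : extensional (car A)"
   using derD(5)[OF f(1)] derD(5)[OF D] derD(5)[OF zder[of k]] by auto
  ultimately show "f k = ?g k" by (intro extensionalityI)
 qed
 show *: "hcomp (tangent_graded A) D = ?g"
  unfolding hcomp_def using ex un by blast
 show "hsupp (tangent_graded A) D = (if D = zder then {} else {n})"
  by (auto simp: hsupp_def *)
qed

lemma tangent_full_sel: "hsupp (tangent A) D = hsupp (tangent_graded A) D" "hcomp (tangent A) D = hcomp (tangent_graded A) D"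
 "add (tangent A) = add (tangent_graded A)" "smult (tangent A) = smult (tangent_graded A)" "hpart (tangent A) = derivations A"
 "carrier (tangent A) = carrier (tangent_graded A)"
proof -
 have [simp]: "zero (tangent A) = zder" "add (tangent A) = add (tangent_graded A)" "hpart (tangent A) = derivations A"
   "carrier (tangent A) = carrier (tangent_graded A)"
  by (simp_all add: tangent_def Let_def)
 have "finsum (tangent A) f S = finsum (tangent_graded A) f S" for f :: "int => 'a => 'a" and S
  by (rule finsum_eqI) simp_all
 then have "hdecomp (tangent A) = hdecomp (tangent_graded A)" by (simp add: hdecomp_def fun_eq_iff)
 then show "hcomp (tangent A) D = hcomp (tangent_graded A) D" by (simp add: hcomp_def)
 then show "hsupp (tangent A) D = hsupp (tangent_graded A) D" by (simp add: hsupp_def)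
qed (simp_all add: tangent_def Let_def)

lemma tangent_dif:
 assumes D: "D : derivations A n" and a: "a : car A"
 shows "dif (tangent A) D a = dif A (D a) \<ominus> ksign A n (D (dif A a))"
proof -
 have "dif (tangent A) D a = dif A (D a) \<ominus> (\<Oplus>\<^bsub>A\<^esub>i\<in>hsupp (tangent_graded A) D. ksign A i (hcomp (tangent_graded A) D i (dif A a)))"
  using a by (simp add: tangent_def Let_def)
 then show ?thesis using D a by (auto simp: hcomp_tangent[OF D] zder_def ksign_def)
qed

lemma tangent_bracket:
 assumes D: "D : derivations A n" and E: "E : derivations A m" and a: "a : car A"
 shows "bracket (tangent A) D E a = D (E a) \<ominus> ksign A (n * m) (E (D a))"
proof -
 have "bracket (tangent A) D E a = D (E a) \<ominus> (\<Oplus>\<^bsub>A\<^esub>ij\<in>hsupp (tangent_graded A) D \<times> hsupp (tangent_graded A) E.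
   ksign A (fst ij * snd ij) (hcomp (tangent_graded A) E (snd ij) (hcomp (tangent_graded A) D (fst ij) a)))"
  using a by (simp add: tangent_def Let_def)
 then show ?thesis using D E a der_zero_A[OF E] by (auto simp: hcomp_tangent[OF D] hcomp_tangent[OF E] zder_def ksign_def)
qed

end

locale algebroid_loc = cdga_loc A for A :: "(complex, 'a) dgmod" (structure) +
 fixes G :: "('a, 'g) algebroid"
 assumes algG: "dg_lie_algebroid A G"
begin

lemma modG: "dg_module A G" and lieG: "dg_lie (over_CC A G)"
 using algG by (auto simp: dg_lie_algebroid_def)

lemmas G_mod = dg_moduleD[OF modG]
lemmas grG = G_mod(1)

sublocale G: abelian_group G by (rule G_mod(2))

lemmas G_hpart = hpart_carrier[OF grG] hpart_zero[OF grG] hpart_add[OF grG]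
 hpart_a_inv[OF grG] hpart_ksign[OF grG] hpart_minus[OF grG]

lemma G_hcarr [simp]: "x : hp G n ==> x : car G"
 by (rule G_hpart)

lemma G_dif [simp]: "x : car G ==> dif G x : car G"
 by (rule dif_carrier[OF modG])

definition csm :: "complex => 'g => 'g" where
 "csm c x = (c \<odot> \<one>) \<odot>\<^sub>G x"

lemma csm_hpart: "x : hp G n ==> csm c x : hp G n"
 unfolding csm_def using G_mod(8)[of "c \<odot> \<one>" 0 x n] by (simp add: A_smult_hpart)

lemma over_CC_sel [simp]: "carrier (over_CC A G) = car G" "zero (over_CC A G) = zero G" "add (over_CC A G) = add G"
 "smult (over_CC A G) = csm" "hpart (over_CC A G) = hp G" "dif (over_CC A G) = dif G" "bracket (over_CC A G) = bracket G"
 by (auto simp: over_CC_def csm_def fun_eq_iff)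

lemma over_CC_ops [simp]: "a_inv (over_CC A G) = a_inv G" "ksign (over_CC A G) = ksign G"
proof -
 show 1: "a_inv (over_CC A G) = a_inv G" by (simp add: a_inv_def m_inv_def fun_eq_iff)
 show "ksign (over_CC A G) = ksign G" by (simp add: ksign_def fun_eq_iff 1)
qed

lemma over_CC_mod: "dg_module CC (over_CC A G)"
 using lieG by (simp add: dg_lie_def)

lemmas GC_mod = dg_moduleD[OF over_CC_mod, simplified]

lemma csm_closed [simp]: "x : car G ==> csm c x : car G"
 using GC_mod(3) by simp

lemma bracket_hpart: "x : hp G n ==> y : hp G m ==> bracket G x y : hp G (n + m)"
 and bracket_add: "x : car G ==> y : car G ==> z : car G ==> bracket G (x \<oplus>\<^sub>G y) z = bracket G x z \<oplus>\<^sub>G bracket G y z"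
  "x : car G ==> y : car G ==> z : car G ==> bracket G x (y \<oplus>\<^sub>G z) = bracket G x y \<oplus>\<^sub>G bracket G x z"
 and bracket_csm: "x : car G ==> y : car G ==> bracket G (csm c x) y = csm c (bracket G x y)"
  "x : car G ==> y : car G ==> bracket G x (csm c y) = csm c (bracket G x y)"
 and bracket_antisym: "x : hp G n ==> y : hp G m ==> bracket G x y = \<ominus>\<^sub>G ksign G (n * m) (bracket G y x)"
 and bracket_jacobi: "x : hp G n ==> y : hp G m ==> z : car G ==>
   bracket G x (bracket G y z) = bracket G (bracket G x y) z \<oplus>\<^sub>G ksign G (n * m) (bracket G y (bracket G x z))"
 and bracket_dif: "x : hp G n ==> y : car G ==>
   dif G (bracket G x y) = bracket G (dif G x) y \<oplus>\<^sub>G ksign G n (bracket G x (dif G y))"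
proof -
 note L = lieG[unfolded dg_lie_def over_CC_sel over_CC_ops]
 note L1 = L[THEN conjunct2] note L2 = L1[THEN conjunct2] note L3 = L2[THEN conjunct2]
 note L4 = L3[THEN conjunct2] note L5 = L4[THEN conjunct2]
 show "x : hp G n ==> y : hp G m ==> bracket G x y : hp G (n + m)"
  by (rule L1[THEN conjunct1, rule_format])
 show "x : car G ==> y : car G ==> z : car G ==> bracket G (x \<oplus>\<^sub>G y) z = bracket G x z \<oplus>\<^sub>G bracket G y z"
  "x : car G ==> y : car G ==> z : car G ==> bracket G x (y \<oplus>\<^sub>G z) = bracket G x y \<oplus>\<^sub>G bracket G x z"
  using L2[THEN conjunct1] by auto
 show "x : car G ==> y : car G ==> bracket G (csm c x) y = csm c (bracket G x y)"
  "x : car G ==> y : car G ==> bracket G x (csm c y) = csm c (bracket G x y)"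
  using L3[THEN conjunct1] by auto
 show "x : hp G n ==> y : hp G m ==> bracket G x y = \<ominus>\<^sub>G ksign G (n * m) (bracket G y x)"
  by (rule L4[THEN conjunct1, rule_format])
 show "x : hp G n ==> y : hp G m ==> z : car G ==>
   bracket G x (bracket G y z) = bracket G (bracket G x y) z \<oplus>\<^sub>G ksign G (n * m) (bracket G y (bracket G x z))"
  by (rule L5[THEN conjunct1, rule_format])
 show "x : hp G n ==> y : car G ==>
   dif G (bracket G x y) = bracket G (dif G x) y \<oplus>\<^sub>G ksign G n (bracket G x (dif G y))"
  by (rule L5[THEN conjunct2, rule_format])
qed

lemma anchor_der: "x : hp G n ==> anchor G x : derivations A n"
 and anchor_add: "x : car G ==> y : car G ==> a : car A ==> anchor G (x \<oplus>\<^sub>G y) a = anchor G x a \<oplus> anchor G y a"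
 and anchor_smult: "b : car A ==> x : car G ==> a : car A ==> anchor G (b \<odot>\<^sub>G x) a = b \<otimes> anchor G x a"
 and anchor_dif: "x : hp G n ==> a : car A ==> anchor G (dif G x) a = dif A (anchor G x a) \<ominus> ksign A n (anchor G x (dif A a))"
 and anchor_bracket: "x : hp G n ==> y : hp G m ==> a : car A ==>
  anchor G (bracket G x y) a = anchor G x (anchor G y a) \<ominus> ksign A (n * m) (anchor G y (anchor G x a))"
 and bracket_smult: "x : hp G n ==> a : hp A m ==> y : car G ==> bracket G x (a \<odot>\<^sub>G y) =
  ksign G (n * m) (a \<odot>\<^sub>G bracket G x y) \<oplus>\<^sub>G anchor G x a \<odot>\<^sub>G y"
proof -
 have h: "graded_module_hom A G (tangent A) (anchor G)" "\<forall>x\<in>car G. anchor G (dif G x) = dif (tangent A) (anchor G x)"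
  "\<forall>x\<in>car G. \<forall>y\<in>car G. anchor G (bracket G x y) = bracket (tangent A) (anchor G x) (anchor G y)"
  using algG by (auto simp: dg_lie_algebroid_def dg_module_hom_def)
 show 1: "x : hp G n ==> anchor G x : derivations A n" for x n
  using h(1) by (simp add: graded_module_hom_def tangent_full_sel)
 show "x : car G ==> y : car G ==> a : car A ==> anchor G (x \<oplus>\<^sub>G y) a = anchor G x a \<oplus> anchor G y a"
  and "b : car A ==> x : car G ==> a : car A ==> anchor G (b \<odot>\<^sub>G x) a = b \<otimes> anchor G x a"
  using h(1) by (simp_all add: graded_module_hom_def tangent_full_sel)
 show "x : hp G n ==> a : car A ==> anchor G (dif G x) a = dif A (anchor G x a) \<ominus> ksign A n (anchor G x (dif A a))"
  using h(2) tangent_dif[OF 1] by simp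
 show "x : hp G n ==> y : hp G m ==> a : car A ==>
  anchor G (bracket G x y) a = anchor G x (anchor G y a) \<ominus> ksign A (n * m) (anchor G y (anchor G x a))"
  using h(3) tangent_bracket[OF 1 1] by simp
 show "x : hp G n ==> a : hp A m ==> y : car G ==> bracket G x (a \<odot>\<^sub>G y) =
  ksign G (n * m) (a \<odot>\<^sub>G bracket G x y) \<oplus>\<^sub>G anchor G x a \<odot>\<^sub>G y"
  using algG by (simp add: dg_lie_algebroid_def)
qed

lemma anchor_closed [simp]: "x : car G ==> a : car A ==> anchor G x a : car A"
proof -
 have z: "\<zero>\<^sub>G : hp G 0" by (rule G_hpart)
 show "x : car G ==> a : car A ==> anchor G x a : car A"
  using grG by (erule_tac graded_induct) (auto simp: anchor_add intro: der_carrier[OF anchor_der] der_carrier[OF anchor_der[OF z]])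
qed

lemma bracket_closed [simp]: "x : car G ==> y : car G ==> bracket G x y : car G"
proof -
 have z: "\<zero>\<^sub>G : hp G 0" by (rule G_hpart)
 have 1: "y : car G ==> x : hp G n ==> bracket G x y : car G" for x y n
  using grG by (erule_tac graded_induct) (auto simp: bracket_add intro: G_hpart(1)[OF bracket_hpart] G_hpart(1)[OF bracket_hpart[OF _ z]])
 show "x : car G ==> y : car G ==> bracket G x y : car G"
  using grG by (erule_tac graded_induct) (auto simp: bracket_add intro: 1 1[OF _ z])
qed

end

section \<open>The symmetric algebra as a quotient of the free algebra, its derivations and its
  weights\<close>

section \<open>The symmetric algebra\<close>

text \<open>The conditions concern homogeneous elements, as these are the letters, and leave the
  field \<open>dif\<close> of M open. Instances are \<gg> and the module of the flat connection,
  whose differential is a placeholder.\<close>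

locale wmod = cdga_loc A for A :: "(complex, 'a) dgmod" (structure) +
 fixes M :: "('a, 'm, 'z) dgmod_scheme"
 assumes M_zero [simp]: "!!n. \<zero>\<^sub>M : hp M n"
  and M_add: "!!n x y. x : hp M n ==> y : hp M n ==> x \<oplus>\<^sub>M y : hp M n"
  and M_smult: "!!n m a x. a : hp A n ==> x : hp M m ==> a \<odot>\<^sub>M x : hp M (n + m)"
  and M_l_zero: "!!n x. x : hp M n ==> \<zero>\<^sub>M \<oplus>\<^sub>M x = x"
  and M_r_zero: "!!n x. x : hp M n ==> x \<oplus>\<^sub>M \<zero>\<^sub>M = x"
  and M_smult_zero: "!!n a. a : hp A n ==> a \<odot>\<^sub>M \<zero>\<^sub>M = \<zero>\<^sub>M"
begin

abbreviation "V \<equiv> dsum A M"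
abbreviation "FS \<equiv> word_carrier V"

definition sm :: "complex => 'm => 'm" where "sm c x = (c \<odot> \<one>) \<odot>\<^sub>M x"

lemma c_one [simp]: "c \<odot> \<one> : hp A 0"
 by (simp add: A_smult_hpart)

lemma sm_hpart [simp]: "x : hp M n ==> sm c x : hp M n"
 unfolding sm_def using M_smult[OF c_one] by simp

lemma sm_zero [simp]: "sm c \<zero>\<^sub>M = \<zero>\<^sub>M"
 by (simp add: sm_def M_smult_zero[OF c_one])

lemma A_zero [simp]: "\<zero> : hp A n"
 by (rule A_hpart)

lemma linear_rels_V: "linear_rels V =
  {word [(n, (a \<oplus> b, x \<oplus>\<^sub>M y))] - (word [(n, (a, x))] + word [(n, (b, y))]) | n a b x y.
   a : hp A n & b : hp A n & x : hp M n & y : hp M n} \<union>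
  {word [(n, (c \<odot> a, sm c x))] - sc c (word [(n, (a, x))]) | n c a x. a : hp A n & x : hp M n}"
proof -
 have "letter n u : FS" if "u : hp V n" for n u
  using that by (simp add: letter_def)
 then have *: "letter n w \<ominus>\<^bsub>words V\<^esub> (letter n u \<oplus>\<^bsub>words V\<^esub> letter n v) = word [(n, w)] - (word [(n, u)] + word [(n, v)])"
  "letter n w \<ominus>\<^bsub>words V\<^esub> (c \<odot>\<^bsub>words V\<^esub> letter n u) = word [(n, w)] - sc c (word [(n, u)])"
  if "u : hp V n" "v : hp V n" for n u v w c
  using that by (subst words_minus; simp add: words_sel letter_def)+
 have 1: "{letter n (x \<oplus>\<^sub>V y) \<ominus>\<^bsub>words V\<^esub> (letter n x \<oplus>\<^bsub>words V\<^esub> letter n y) | n x y. x : hp V n & y : hp V n} =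
  {word [(n, x \<oplus>\<^sub>V y)] - (word [(n, x)] + word [(n, y)]) | n x y. x : hp V n & y : hp V n}"
  using *(1) by (intro Collect_cong ex_cong1) (metis (no_types, lifting))
 have 2: "{letter n (c \<odot>\<^sub>V x) \<ominus>\<^bsub>words V\<^esub> (c \<odot>\<^bsub>words V\<^esub> letter n x) | n c x. x : hp V n} =
  {word [(n, c \<odot>\<^sub>V x)] - sc c (word [(n, x)]) | n c x. x : hp V n}"
  using *(2) by (intro Collect_cong ex_cong1) (metis (no_types, lifting))
 show ?thesis unfolding linear_rels_def 1 2
  by (rule arg_cong2[where f = "(\<union>)"]) (auto simp: sm_def; blast)+
qed

lemma linear_rels_FS: "linear_rels V <= FS"
 by (auto simp: linear_rels_V A_hpart M_add A_smult_hpart)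

subsection \<open>Consequences of the linear relations\<close>

context
 fixes I assumes I: "wideal V I" and lI: "linear_rels V <= I"
begin

text \<open>Here and in the rules that follow, I is any ideal containing the linear relations: the
  ideals of \<open>Sym\<close> and of \<open>U\<close> and the intersection of the two all
  occur.\<close>

lemma lr_add: "a : hp A n ==> b : hp A n ==> x : hp M n ==> y : hp M n ==>
 word [(n, (a \<oplus> b, x \<oplus>\<^sub>M y))] - (word [(n, (a, x))] + word [(n, (b, y))]) : I"
 apply (rule subsetD[OF lI])
 unfolding linear_rels_V
 by (rule UnI1, rule CollectI, intro exI conjI, rule refl)

lemma lr_sc: "a : hp A n ==> x : hp M n ==>
 word [(n, (c \<odot> a, sm c x))] - sc c (word [(n, (a, x))]) : I"
 apply (rule subsetD[OF lI])
 unfolding linear_rels_V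
 by (rule UnI2, rule CollectI, intro exI conjI, rule refl)

text \<open>The additivity relation for 0 + 0 is the negative of the zero letter.\<close>

lemma lr_zero: "word [(n, (\<zero>, \<zero>\<^sub>M))] : I"
proof -
 have "word [(n, (\<zero>, \<zero>\<^sub>M))] - (word [(n, (\<zero>, \<zero>\<^sub>M))] + word [(n, (\<zero>, \<zero>\<^sub>M))]) : I"
  using lr_add[of "\<zero>" n "\<zero>" "\<zero>\<^sub>M" "\<zero>\<^sub>M"] by (simp add: M_l_zero[OF M_zero])
 from wideal_minus[OF I this] show ?thesis by simp
qed

lemma lr_split: "a : hp A n ==> x : hp M n ==>
 word [(n, (a, x))] - (word [(n, (a, \<zero>\<^sub>M))] + word [(n, (\<zero>, x))]) : I"
 using lr_add[of a n "\<zero>" "\<zero>\<^sub>M" x] by (simp add: M_l_zero)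

end

lemma FS_letter [simp]: "a : hp A n ==> x : hp M n ==> word [(n, (a, x))] : FS"
 by simp

subsection \<open>The ideal of the symmetric algebra\<close>

definition sym_gens where
 "sym_gens = linear_rels V \<union>
   {word [(n, u)] ** word [(m, v)] - sc (sg (n * m)) (word [(m, v)] ** word [(n, u)]) | n m u v.
    u : hp V n & v : hp V m} \<union>
   {word [(0, (\<one>, \<zero>\<^sub>M))] - word []} \<union>
   {word [(n, (a, \<zero>\<^sub>M))] ** word [(m, (b, y))] - word [(n + m, (a \<otimes> b, a \<odot>\<^sub>M y))] | n m a b y.
    a : hp A n & b : hp A m & y : hp M m}"

lemma sym_ideal_eq: "sym_ideal A M = Idl\<^bsub>words V\<^esub> sym_gens"
proof -
 have 1: "{letter n u \<otimes>\<^bsub>words V\<^esub> letter m v \<ominus>\<^bsub>words V\<^esub> ksign (words V) (n * m) (letter m v \<otimes>\<^bsub>words V\<^esub> letter n u) | n m u v.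
     u : hp V n & v : hp V m} =
   {word [(n, u)] ** word [(m, v)] - sc (sg (n * m)) (word [(m, v)] ** word [(n, u)]) | n m u v.
    u : hp V n & v : hp V m}"
 proof -
  have "letter n u \<otimes>\<^bsub>words V\<^esub> letter m v \<ominus>\<^bsub>words V\<^esub> ksign (words V) (n * m) (letter m v \<otimes>\<^bsub>words V\<^esub> letter n u) =
   word [(n, u)] ** word [(m, v)] - sc (sg (n * m)) (word [(m, v)] ** word [(n, u)])"
   if "u : hp V n" "v : hp V m" for n m u v
   using that by (subst words_ksign; (subst words_minus)?; simp add: words_sel letter_def)+
  then show ?thesis by (intro Collect_cong ex_cong1) (metis (no_types, lifting))
 qed
 have 2: "letter 0 (\<one>, \<zero>\<^sub>M) \<ominus>\<^bsub>words V\<^esub> \<one>\<^bsub>words V\<^esub> = word [(0, (\<one>, \<zero>\<^sub>M))] - word []"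
  by (subst words_minus) (simp_all add: words_sel letter_def)
 have 3: "{letter n (a, \<zero>\<^sub>M) \<otimes>\<^bsub>words V\<^esub> letter m (b, y) \<ominus>\<^bsub>words V\<^esub> letter (n + m) (a \<otimes> b, a \<odot>\<^sub>M y) | n m a b y.
     a : hp A n & b : hp A m & y : hp M m} =
   {word [(n, (a, \<zero>\<^sub>M))] ** word [(m, (b, y))] - word [(n + m, (a \<otimes> b, a \<odot>\<^sub>M y))] | n m a b y.
    a : hp A n & b : hp A m & y : hp M m}"
 proof -
  have "letter n (a, \<zero>\<^sub>M) \<otimes>\<^bsub>words V\<^esub> letter m (b, y) \<ominus>\<^bsub>words V\<^esub> letter (n + m) (a \<otimes> b, a \<odot>\<^sub>M y) =
   word [(n, (a, \<zero>\<^sub>M))] ** word [(m, (b, y))] - word [(n + m, (a \<otimes> b, a \<odot>\<^sub>M y))]"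
   if "a : hp A n" "b : hp A m" "y : hp M m" for n m a b y
   using that by (subst words_minus) (simp_all add: words_sel letter_def A_mult M_smult)
  then show ?thesis by (intro Collect_cong ex_cong1) (metis (no_types, lifting))
 qed
 show ?thesis unfolding sym_ideal_def Let_def 1 2 3 sym_gens_def ..
qed

lemma sym_gens_FS: "sym_gens <= FS"
proof -
 have "{word [(n, u)] ** word [(m, v)] - sc (sg (n * m)) (word [(m, v)] ** word [(n, u)]) | n m u v.
    u : hp V n & v : hp V m} <= FS" by auto
 moreover have "{word [(n, (a, \<zero>\<^sub>M))] ** word [(m, (b, y))] - word [(n + m, (a \<otimes> b, a \<odot>\<^sub>M y))] | n m a b y.
    a : hp A n & b : hp A m & y : hp M m} <= FS" by (auto simp: A_mult M_smult)
 ultimately show ?thesis using linear_rels_FS unfolding sym_gens_def by simp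
qed

abbreviation "S \<equiv> sym_ideal A M"

lemma S_ideal: "wideal V S"
 unfolding sym_ideal_eq using sym_gens_FS by (rule Idl_wideal)

lemma gens_S: "sym_gens <= S"
 unfolding sym_ideal_eq using sym_gens_FS by (rule Idl_self)

lemma lin_S: "linear_rels V <= S"
 using gens_S by (simp add: sym_gens_def)

lemmas S_add = wideal_add[OF S_ideal] and S_diff = wideal_diff[OF S_ideal] and S_minus = wideal_minus[OF S_ideal]
 and S_sc = wideal_sc[OF S_ideal] and S_left = wideal_left[OF S_ideal] and S_right = wideal_right[OF S_ideal]
 and S_zero = wideal_zero[OF S_ideal] and S_FS = wideal_FS[OF S_ideal] and S_sum = wideal_sum[OF S_ideal]

lemma S_comm: "u : hp V n ==> v : hp V m ==>
  word [(n, u)] ** word [(m, v)] - sc (sg (n * m)) (word [(m, v)] ** word [(n, u)]) : S"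
 and S_one: "word [(0, (\<one>, \<zero>\<^sub>M))] - word [] : S"
 and S_mult: "a : hp A n ==> b : hp A m ==> y : hp M m ==>
  word [(n, (a, \<zero>\<^sub>M))] ** word [(m, (b, y))] - word [(n + m, (a \<otimes> b, a \<odot>\<^sub>M y))] : S"
 apply (rule subsetD[OF gens_S], unfold sym_gens_def)
 apply (rule UnI1, rule UnI1, rule UnI2, rule CollectI, intro exI conjI, rule refl, assumption+)
 apply (rule subsetD[OF gens_S], unfold sym_gens_def)
 apply (rule UnI1, rule UnI2, rule singletonI)
 apply (rule subsetD[OF gens_S], unfold sym_gens_def)
 apply (rule UnI2, rule CollectI, intro exI conjI, rule refl, assumption+)
 done

lemma hc_gens: "g : sym_gens ==> \<exists>m. hc m g = g"
proof -
 assume "g : sym_gens"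
 then consider n a b x y where "g = word [(n, (a \<oplus> b, x \<oplus>\<^sub>M y))] - (word [(n, (a, x))] + word [(n, (b, y))])"
  | n c a x where "g = word [(n, (c \<odot> a, sm c x))] - sc c (word [(n, (a, x))])"
  | n m u v where "g = word [(n, u)] ** word [(m, v)] - sc (sg (n * m)) (word [(m, v)] ** word [(n, u)])"
  | "g = word [(0, (\<one>, \<zero>\<^sub>M))] - word []"
  | n m a b y where "g = word [(n, (a, \<zero>\<^sub>M))] ** word [(m, (b, y))] - word [(n + m, (a \<otimes> b, a \<odot>\<^sub>M y))]"
  unfolding sym_gens_def linear_rels_V by blast
 then show ?thesis
 proof cases
  case (1 n a b x y) then show ?thesis by (intro exI[of _ n]) (simp add: hc_word)
 next
  case (2 n c a x) then show ?thesis by (intro exI[of _ n]) (simp add: hc_word)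
 next
  case (3 n m u v) then show ?thesis by (intro exI[of _ "n + m"]) (simp add: hc_word word_cm_word)
 next
  case 4 then show ?thesis by (intro exI[of _ 0]) (simp add: hc_word)
 next
  case (5 n m a b y) then show ?thesis by (intro exI[of _ "n + m"]) (simp add: hc_word word_cm_word)
 qed
qed

subsection \<open>Derivations of the symmetric algebra\<close>

context
 fixes e :: int and dA :: "'a => 'a" and dM :: "'m => 'm"
 assumes dA: "!!n a. a : hp A n ==> dA a : hp A (n + e)"
   "!!n a b. a : hp A n ==> b : hp A n ==> dA (a \<oplus> b) = dA a \<oplus> dA b"
   "!!n a c. a : hp A n ==> dA (c \<odot> a) = c \<odot> dA a"
   "!!n m a b. a : hp A n ==> b : hp A m ==>
     dA (a \<otimes> b) = dA a \<otimes> b \<oplus> (sg (e * n) \<odot> a) \<otimes> dA b"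
  and dM: "!!n x. x : hp M n ==> dM x : hp M (n + e)"
   "!!n x y. x : hp M n ==> y : hp M n ==> dM (x \<oplus>\<^sub>M y) = dM x \<oplus>\<^sub>M dM y"
   "!!n x c. x : hp M n ==> dM (sm c x) = sm c (dM x)"
   "!!n m a x. a : hp A n ==> x : hp M m ==>
     dM (a \<odot>\<^sub>M x) = dA a \<odot>\<^sub>M x \<oplus>\<^sub>M (sg (e * n) \<odot> a) \<odot>\<^sub>M dM x"
   "dM \<zero>\<^sub>M = \<zero>\<^sub>M"
begin

abbreviation "dV \<equiv> map_prod dA dM"

lemma dV_hpart: "u : hp V n ==> dV u : hp V (n + e)"
 using dA(1) dM(1) by auto

lemma dA_one: "dA \<one> = \<zero>"
proof -
 have c: "dA \<one> : car A" using dA(1)[OF A_one] by simp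
 have "dA \<one> = dA \<one> \<oplus> dA \<one>"
  using dA(4)[OF A_one A_one] c by (simp add: A_mod(7)[simplified])
 then show ?thesis using c by (metis A.add.l_cancel_one')
qed

text \<open>A derivation turns relations into relations of the same kind. For the relation between
  the product of a and \<open>(b, y)\<close> and the letter \<open>(ab, ay)\<close>, these are the
  relations for \<open>(dA a, b)\<close> and \<open>(a, dA b)\<close>, a linear one that moves the
  sign into the coefficient, and an additivity relation that joins the two terms of the Leibniz
  rule.\<close>

lemma der_gens: "g : sym_gens ==> der e dV g : S"
proof -
 assume "g : sym_gens"
 then consider n a b x y where "g = word [(n, (a \<oplus> b, x \<oplus>\<^sub>M y))] - (word [(n, (a, x))] + word [(n, (b, y))])"
    "a : hp A n" "b : hp A n" "x : hp M n" "y : hp M n"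
  | n c a x where "g = word [(n, (c \<odot> a, sm c x))] - sc c (word [(n, (a, x))])" "a : hp A n" "x : hp M n"
  | n m u v where "g = word [(n, u)] ** word [(m, v)] - sc (sg (n * m)) (word [(m, v)] ** word [(n, u)])"
    "u : hp V n" "v : hp V m"
  | "g = word [(0, (\<one>, \<zero>\<^sub>M))] - word []"
  | n m a b y where "g = word [(n, (a, \<zero>\<^sub>M))] ** word [(m, (b, y))] - word [(n + m, (a \<otimes> b, a \<odot>\<^sub>M y))]"
    "a : hp A n" "b : hp A m" "y : hp M m"
  unfolding sym_gens_def linear_rels_V by blast
 then show ?thesis
 proof cases
  case (1 n a b x y)
  then have "der e dV g = word [(n + e, (dA a \<oplus> dA b, dM x \<oplus>\<^sub>M dM y))] -
    (word [(n + e, (dA a, dM x))] + word [(n + e, (dA b, dM y))])"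
   using A_hpart(3)[OF 1(2,3)] M_add[OF 1(4,5)]
   by (simp add: der_diff[of _ V] der_add[of _ V] dA(2)[OF 1(2,3)] dM(2)[OF 1(4,5)])
  then show ?thesis using lr_add[OF S_ideal lin_S] 1 dA(1) dM(1) by simp
 next
  case (2 n c a x)
  then have "der e dV g = word [(n + e, (c \<odot> dA a, sm c (dM x)))] - sc c (word [(n + e, (dA a, dM x))])"
   by (simp add: der_diff[of _ V] A_smult_hpart dA(3)[OF 2(2)] dM(3)[OF 2(3)])
  then show ?thesis using lr_sc[OF S_ideal lin_S] 2 dA(1) dM(1) by simp
 next
  case (3 n m u v)
  have d: "der e dV (word [(n, u)] ** word [(m, v)]) = word [(n + e, dV u)] ** word [(m, v)] +
    sc (sg (e * n)) (word [(n, u)] ** word [(m + e, dV v)])"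
   if "u : hp V n" "v : hp V m" for n m u v
   using that by (simp add: der_letter_left[of _ V])
  have "der e dV g = (word [(n + e, dV u)] ** word [(m, v)] - sc (sg ((n + e) * m)) (word [(m, v)] ** word [(n + e, dV u)])) +
    sc (sg (e * n)) (word [(n, u)] ** word [(m + e, dV v)] - sc (sg (n * (m + e))) (word [(m + e, dV v)] ** word [(n, u)]))"
   unfolding 3(1) using 3(2,3)
   by (simp add: der_diff[of _ V] d sc_add sc_diff sg_add ring_distribs mult_ac)
  then show ?thesis using S_comm dV_hpart 3 by (auto intro!: S_add S_sc)
 next
  case 4
  then have "der e dV g = word [(e, (\<zero>, \<zero>\<^sub>M))]"
   by (simp add: der_diff[of _ V] dA_one dM(5))
  then show ?thesis using lr_zero[OF S_ideal lin_S] by simp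
 next
  case (5 n m a b y)
  let ?a = "sg (e * n) \<odot> a"
  have h: "dA a : hp A (n + e)" "dA b : hp A (m + e)" "dM y : hp M (m + e)" "?a : hp A n"
   using 5 dA(1) dM(1) A_smult_hpart by auto
  let ?k = "n + m + e"
  have h2: "dA a \<otimes> b : hp A ?k" "?a \<otimes> dA b : hp A ?k" "dA a \<odot>\<^sub>M y : hp M ?k" "?a \<odot>\<^sub>M dM y : hp M ?k"
   using A_mult[OF h(1) 5(3)] A_mult[OF h(4,2)] M_smult[OF h(1) 5(4)] M_smult[OF h(4,3)] by (simp_all add: algebra_simps)
  have 1: "der e dV g = word [(n + e, (dA a, \<zero>\<^sub>M))] ** word [(m, (b, y))] +
    sc (sg (e * n)) (word [(n, (a, \<zero>\<^sub>M))] ** word [(m + e, (dA b, dM y))]) -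
    word [(?k, (dA a \<otimes> b \<oplus> ?a \<otimes> dA b, dA a \<odot>\<^sub>M y \<oplus>\<^sub>M ?a \<odot>\<^sub>M dM y))]"
   unfolding 5(1) using 5(2-)
   by (simp add: der_diff[of _ V] der_letter_left[of _ V] A_mult M_smult dM(5) dA(4)[OF 5(2,3)] dM(4)[OF 5(2,4)])
  have r1: "word [(n + e, (dA a, \<zero>\<^sub>M))] ** word [(m, (b, y))] - word [(?k, (dA a \<otimes> b, dA a \<odot>\<^sub>M y))] : S"
   using S_mult[OF h(1) 5(3,4)] by (simp add: algebra_simps)
  have r2: "word [(n, (?a, \<zero>\<^sub>M))] ** word [(m + e, (dA b, dM y))] - word [(?k, (?a \<otimes> dA b, ?a \<odot>\<^sub>M dM y))] : S"
   using S_mult[OF h(4,2,3)] by (simp add: algebra_simps)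
  have r3: "(word [(n, (?a, \<zero>\<^sub>M))] - sc (sg (e * n)) (word [(n, (a, \<zero>\<^sub>M))])) ** word [(m + e, (dA b, dM y))] : S"
   using lr_sc[OF S_ideal lin_S 5(2) M_zero, of "sg (e * n)"] h by (intro S_right) auto
  have r4: "word [(?k, (dA a \<otimes> b \<oplus> ?a \<otimes> dA b, dA a \<odot>\<^sub>M y \<oplus>\<^sub>M ?a \<odot>\<^sub>M dM y))] -
    (word [(?k, (dA a \<otimes> b, dA a \<odot>\<^sub>M y))] + word [(?k, (?a \<otimes> dA b, ?a \<odot>\<^sub>M dM y))]) : S"
   by (rule lr_add[OF S_ideal lin_S h2])
  from S_diff[OF S_add[OF r1 S_diff[OF r2 r3]] r4] show ?thesis
   unfolding 1 by (simp add: cm_distrib algebra_simps)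
 qed
qed

text \<open>This serves twice: for the differential, with \<open>e = 1\<close>, and for the
  derivation by an element of \<gg> of degree \<open>e\<close>, which acts on A by the anchor and on
  a module by a connection.\<close>

lemma der_S: "f : S ==> der e dV f : S"
 unfolding sym_ideal_eq
proof (rule der_Idl[OF sym_gens_FS dV_hpart])
 fix g assume g: "g : sym_gens"
 then show "der e dV g : Idl\<^bsub>words V\<^esub> sym_gens" using der_gens by (simp add: sym_ideal_eq)
 obtain m where "hc m g = g" using hc_gens[OF g] by blast
 then show "tw e g : Idl\<^bsub>words V\<^esub> sym_gens"
  using gens_S g S_sc by (auto simp: tw_hc sym_ideal_eq)
qed

end

subsection \<open>Components for the weight grading\<close>

text \<open>A letter \<open>(a, x)\<close> stands for the sum of \<open>(a, 0)\<close> and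
  \<open>(0, x)\<close>. Expanding the word accordingly, \<open>spw n\<close> collects the terms
  that take the second summand n times. Weight components are thereby available in the free algebra,
  before any quotient is taken and for words that are not pure.\<close>

fun spw :: "nat => (int \<times> 'a \<times> 'm) list => ('a \<times> 'm) wfun" where
 "spw n [] = (if n = 0 then word [] else 0)"
| "spw n (l # w) = word [(fst l, (fst (snd l), \<zero>\<^sub>M))] ** spw n w +
   (case n of 0 => 0 | Suc m => word [(fst l, (\<zero>, snd (snd l)))] ** spw m w)"

definition sp :: "nat => ('a \<times> 'm) wfun => ('a \<times> 'm) wfun" where
 "sp n f = lin (spw n) f"

abbreviation "lA l \<equiv> word [(fst l, (fst (snd l), \<zero>\<^sub>M))]"
abbreviation "lM l \<equiv> word [(fst l, (\<zero>, snd (snd l)))]"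

lemma sp_simps [simp]: "sp n 0 = 0" "sp n (sc c f) = sc c (sp n f)" "sp n (word w) = spw n w" "sp n (- f) = - sp n f"
 and sp_add [simp]: "f : FS ==> g : FS ==> sp n (f + g) = sp n f + sp n g"
 and sp_diff [simp]: "f : FS ==> g : FS ==> sp n (f - g) = sp n f - sp n g"
 by (auto simp: sp_def lin_add lin_diff FS_fs)

lemma valid_lAM [simp]: "valid V [l] ==> lA l : FS" "valid V [l] ==> lM l : FS"
 by auto

lemma FS_spw: "valid V w ==> spw n w : FS"
 by (induction w arbitrary: n) (auto split: nat.split)

lemma FS_sp [simp]: "f : FS ==> sp n f : FS"
 unfolding sp_def by (erule FS_lin) (rule FS_spw)

lemma sp_left: "f : FS ==> valid V [l] ==>
 sp n (word [l] ** f) = lA l ** sp n f + (case n of 0 => 0 | Suc m => lM l ** sp m f)"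
 by (induction f rule: FS_induct) (auto simp: cm_distrib word_cm_word sc_add split: nat.split)

lemma spw_snoc: "spw n (w @ [l]) = spw n w ** lA l + (case n of 0 => 0 | Suc m => spw m w ** lM l)"
 by (induction w arbitrary: n) (auto simp: cm_distrib cm_assoc algebra_simps split: nat.split)

lemma sp_right: "f : FS ==> valid V [l] ==>
 sp n (f ** word [l]) = sp n f ** lA l + (case n of 0 => 0 | Suc m => sp m f ** lM l)"
 by (induction f rule: FS_induct) (auto simp: cm_distrib word_cm_word sc_add spw_snoc split: nat.split)

text \<open>The target is a family \<open>Q\<close> indexed by the weight. It is constant when the
  ideal of \<open>Sym\<close> is shown to be stable, and it is the PBW filtration when the canonical
  map is shown to be well defined.\<close>

lemma sp_Idl:
 assumes T: "T <= FS" and g: "!!g n. g : T ==> sp n g : Q n"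
  and Q: "!!n. Q n <= FS" "!!n. 0 : Q n" "!!n f h. f : Q n ==> h : Q n ==> f + h : Q n"
   "!!n f c. f : Q n ==> sc c f : Q n"
   "!!n f k a. f : Q n ==> a : hp A k ==> word [(k, (a, \<zero>\<^sub>M))] ** f : Q n"
   "!!n f k a. f : Q n ==> a : hp A k ==> f ** word [(k, (a, \<zero>\<^sub>M))] : Q n"
   "!!n f k x. f : Q n ==> x : hp M k ==> word [(k, (\<zero>, x))] ** f : Q (Suc n)"
   "!!n f k x. f : Q n ==> x : hp M k ==> f ** word [(k, (\<zero>, x))] : Q (Suc n)"
  and f: "f : Idl\<^bsub>words V\<^esub> T"
 shows "sp n f : Q n"
proof -
 have "wideal V {f : FS. \<forall>n. sp n f : Q n}"
 proof (rule wideal_letters)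
  fix l f assume "f : {f : FS. \<forall>n. sp n f : Q n}" and "valid V [l]"
  then show "word [l] ** f : {f : FS. \<forall>n. sp n f : Q n}" "f ** word [l] : {f : FS. \<forall>n. sp n f : Q n}"
   using Q by (auto simp: sp_left sp_right split: nat.split)
 qed (use Q in auto)
 then have "Idl\<^bsub>words V\<^esub> T <= {f : FS. \<forall>n. sp n f : Q n}"
  by (rule Idl_minimal) (use T g in auto)
 with f show ?thesis by auto
qed

lemma sp_gens_lin: "g : linear_rels V ==> wideal V I ==> linear_rels V <= I ==> sp n g : I"
proof -
 assume I: "wideal V I" "linear_rels V <= I" and "g : linear_rels V"
 then consider n a b x y where "g = word [(n, (a \<oplus> b, x \<oplus>\<^sub>M y))] - (word [(n, (a, x))] + word [(n, (b, y))])"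
    "a : hp A n" "b : hp A n" "x : hp M n" "y : hp M n"
  | n c a x where "g = word [(n, (c \<odot> a, sm c x))] - sc c (word [(n, (a, x))])" "a : hp A n" "x : hp M n"
  unfolding linear_rels_V by blast
 then show ?thesis
 proof cases
  case (1 k a b x y)
  note l = lr_add[OF I, of a k b "\<zero>\<^sub>M" "\<zero>\<^sub>M"] lr_add[OF I, of "\<zero>" k "\<zero>" x y]
  show ?thesis using 1(2-) l wideal_zero[OF I(1)]
   by (auto simp: 1(1) A_hpart M_add M_l_zero[OF M_zero] cm_distrib split: nat.split)
 next
  case (2 k c a x)
  note l = lr_sc[OF I, of a k "\<zero>\<^sub>M" c] lr_sc[OF I, of "\<zero>" k x c]
  show ?thesis using 2(2-) l wideal_zero[OF I(1)]
   by (auto simp: 2(1) A_smult_hpart cm_distrib split: nat.split)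
 qed
qed

lemma sp_S: "f : S ==> sp n f : S"
 unfolding sym_ideal_eq
proof (rule sp_Idl[OF sym_gens_FS, where Q = "%_. Idl\<^bsub>words V\<^esub> sym_gens"], unfold sym_ideal_eq[symmetric])
 fix g n assume "g : sym_gens"
 then consider "g : linear_rels V"
  | k m u v where "g = word [(k, u)] ** word [(m, v)] - sc (sg (k * m)) (word [(m, v)] ** word [(k, u)])"
    "u : hp V k" "v : hp V m"
  | "g = word [(0, (\<one>, \<zero>\<^sub>M))] - word []"
  | k m a b y where "g = word [(k, (a, \<zero>\<^sub>M))] ** word [(m, (b, y))] - word [(k + m, (a \<otimes> b, a \<odot>\<^sub>M y))]"
    "a : hp A k" "b : hp A m" "y : hp M m"
  unfolding sym_gens_def by blast
 then show "sp n g : S"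
 proof cases
  case 1
  then show ?thesis by (rule sp_gens_lin[OF _ S_ideal lin_S])
 next
  case (2 k m u v)
  let ?c = "%u v. word [(k, u)] ** word [(m, v)] - sc (sg (k * m)) (word [(m, v)] ** word [(k, u)])"
  let ?A = "%u. (fst u, \<zero>\<^sub>M)" and ?M = "%u. (\<zero>, snd u)"
  \<comment> \<open>The components of a commutator in weights 0, 1 and 2 are sums of commutators of
    the two parts of the letters.\<close>
  have "sp n g = (if n = 0 then ?c (?A u) (?A v) else if n = 1 then ?c (?A u) (?M v) + ?c (?M u) (?A v)
    else if n = 2 then ?c (?M u) (?M v) else 0)"
   using 2(2,3) by (auto simp: 2(1) sp_left cm_distrib sc_add algebra_simps numeral_2_eq_2 split: nat.split)
  then show ?thesis using 2(2,3) S_comm S_zero by (auto intro!: S_add)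
 next
  case 3
  then have "sp n g = (if n = 0 then g else if n = 1 then word [(0, (\<zero>, \<zero>\<^sub>M))] else 0)"
   by (auto split: nat.split)
  then show ?thesis using S_one S_zero 3 lr_zero[OF S_ideal lin_S] by auto
 next
  case (4 k m a b y)
  have "sp n g = (if n = 0 then word [(k, (a, \<zero>\<^sub>M))] ** word [(m, (b, \<zero>\<^sub>M))] - word [(k + m, (a \<otimes> b, a \<odot>\<^sub>M \<zero>\<^sub>M))]
    else if n = 1 then word [(k, (a, \<zero>\<^sub>M))] ** word [(m, (\<zero>, y))] - word [(k + m, (a \<otimes> \<zero>, a \<odot>\<^sub>M y))]
     + word [(k, (\<zero>, \<zero>\<^sub>M))] ** word [(m, (b, \<zero>\<^sub>M))]
    else if n = 2 then word [(k, (\<zero>, \<zero>\<^sub>M))] ** word [(m, (\<zero>, y))] else 0)"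
   using 4(2-) by (auto simp: 4(1) sp_left cm_distrib A_mult M_smult M_smult_zero[OF 4(2)] numeral_2_eq_2 split: nat.split)
  then show ?thesis using 4(2-) S_mult[OF 4(2,3) M_zero] S_mult[OF 4(2) A_zero 4(4)]
    lr_zero[OF S_ideal lin_S, of k] S_zero by (auto intro!: S_add S_right)
 qed
qed (use S_FS S_zero S_add S_sc S_left S_right in auto)

lemma spw_big: "length w < n ==> spw n w = 0"
 by (induction w arbitrary: n) (auto split: nat.split)

text \<open>Modulo the linear relations each letter is the sum of its two parts, so the expanded
  product is the word again; the sum stops at the length because \<open>spw n\<close> vanishes
  beyond it.\<close>

lemma sum_spw: "valid V w ==> wideal V I ==> linear_rels V <= I ==> word w - (\<Sum>n\<le>length w. spw n w) : I"
proof (induction w)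
 case (Cons l w)
 note I = Cons(3,4)
 let ?s = "\<Sum>n\<le>length w. spw n w"
 have d: "(\<Sum>n\<in>T. g ** f n) = g ** (\<Sum>n\<in>T. f n)" for g f and T :: "nat set"
  by (induction T rule: infinite_finite_induct) (auto simp: cm_distrib)
 have "(\<Sum>n\<le>length (l # w). spw n (l # w)) = (\<Sum>n\<le>Suc (length w). lA l ** spw n w) + (\<Sum>n\<le>length w. lM l ** spw n w)"
  by (simp only: length_Cons spw.simps sum.distrib) (simp add: sum.atMost_Suc_shift del: sum.atMost_Suc)
 also have "\<dots> = (lA l + lM l) ** ?s"
  by (simp add: spw_big d cm_distrib)
 finally have e: "word (l # w) - (\<Sum>n\<le>length (l # w). spw n (l # w)) =
   (word [l] - (lA l + lM l)) ** ?s + word [l] ** (word w - ?s)"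
  by (simp add: cm_distrib word_cm_word)
 have "?s : FS" using Cons(2) FS_spw by auto
 moreover have "word [l] - (lA l + lM l) : I"
  using lr_split[OF I, of "fst (snd l)" "fst l" "snd (snd l)"] Cons(2) by auto
 ultimately show ?case
  unfolding e
  by (intro wideal_add[OF I(1)] wideal_left[OF I(1)] wideal_right[OF I(1)]) (use Cons in auto)
qed (simp add: wideal_zero)

text \<open>Both claims are made for all sufficiently large indices, so that in the addition case
  the two bounds can be replaced by their maximum.\<close>

lemma sum_sp:
 assumes f: "f : FS" and I: "wideal V I" "linear_rels V <= I"
 shows "\<exists>N0. (\<forall>n\<ge>N0. sp n f = 0) & (\<forall>N\<ge>N0. f - (\<Sum>n<N. sp n f) : I)"
 using f
proof (induction f rule: FS_induct)
 case (word c w)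
 have "word w - (\<Sum>n<N. spw n w) : I" if "N \<ge> Suc (length w)" for N
 proof -
  have "(\<Sum>n<N. spw n w) = (\<Sum>n\<le>length w. spw n w)"
   by (rule sum.mono_neutral_right) (use that in \<open>auto simp: spw_big\<close>)
  then show ?thesis using sum_spw[OF word I] by simp
 qed
 then have "sc c (word w) - (\<Sum>n<N. sp n (sc c (word w))) : I" if "N \<ge> Suc (length w)" for N
  using wideal_sc[OF I(1), of "word w - (\<Sum>n<N. spw n w)" c] that by (simp add: sc_diff sc_sum)
 then show ?case by (intro exI[of _ "Suc (length w)"]) (auto simp: spw_big)
next
 case (add g h)
 then obtain N1 N2 where N: "\<forall>n\<ge>N1. sp n g = 0" "\<forall>N\<ge>N1. g - (\<Sum>n<N. sp n g) : I"
  "\<forall>n\<ge>N2. sp n h = 0" "\<forall>N\<ge>N2. h - (\<Sum>n<N. sp n h) : I" by blast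
 have E: "g + h - (\<Sum>n<N. sp n (g + h)) = (g - (\<Sum>n<N. sp n g)) + (h - (\<Sum>n<N. sp n h))" for N
  using add by (simp add: sum.distrib algebra_simps)
 show ?case
 proof (intro exI[of _ "max N1 N2"] conjI allI impI)
  fix N assume "max N1 N2 \<le> N"
  then show "g + h - (\<Sum>n<N. sp n (g + h)) : I"
   unfolding E using N by (intro wideal_add[OF I(1)]) auto
 qed (use add N in auto)
qed (auto simp: wideal_zero[OF I(1)])

lemma sp_hc: "f : FS ==> hc k (sp n f) = sp n (hc k f)"
proof -
 have *: "hc k (spw n w) = (if wdeg w = k then spw n w else 0)" if "valid V w" for w
  using that by (induction w arbitrary: n k) (auto simp: hc_word hc_letter_left[OF FS_spw] split: nat.split)
 assume "f : FS"
 then show ?thesis by (induction f rule: FS_induct) (auto simp: * hc_word)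
qed

subsection \<open>Pure words\<close>

definition Wle :: "nat => ('a \<times> 'm) wfun set" where
 "Wle n = {f : FS. \<forall>w. f w ~= 0 --> pure_word A M w & weight M w \<le> n}"

definition Weq :: "nat => ('a \<times> 'm) wfun set" where
 "Weq n = {f : FS. \<forall>w. f w ~= 0 --> pure_word A M w & weight M w = n}"

lemma pure_simps [simp]: "pure_word A M []" "pure_word A M (l # w) \<longleftrightarrow> (fst (snd l) = \<zero> | snd (snd l) = \<zero>\<^sub>M) & pure_word A M w"
 "weight M [] = 0" "weight M (l # w) = (if snd (snd l) = \<zero>\<^sub>M then 0 else 1) + weight M w"
 "pure_word A M (u @ w) \<longleftrightarrow> pure_word A M u & pure_word A M w" "weight M (u @ w) = weight M u + weight M w"
 by (auto simp: pure_word_def weight_def split: prod.splits)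

lemma Wle_simps [simp]: "0 : Wle n" "f : Wle n ==> sc c f : Wle n" "f : Wle n ==> - f : Wle n"
 by (auto simp: Wle_def fapp)

lemma Wle_add [simp]: "f : Wle n ==> g : Wle n ==> f + g : Wle n"
 unfolding Wle_def by (auto simp: fapp) (metis add.right_neutral)+

lemma Wle_diff [simp]: "f : Wle n ==> g : Wle n ==> f - g : Wle n"
 using Wle_add[of f n "- g"] by simp

lemma Wle_sum [simp]: "(!!x. x : T ==> f x : Wle n) ==> sum f T : Wle n"
 by (induction T rule: infinite_finite_induct) auto

lemma Wle_FS: "f : Wle n ==> f : FS"
 by (simp add: Wle_def)

lemma Wle_mono: "f : Wle n ==> n \<le> m ==> f : Wle m"
 by (auto simp: Wle_def)

lemma Wle_induct [consumes 1, case_names zero word add]: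
 assumes "f : Wle n" "P 0" "!!c w. valid V w ==> pure_word A M w ==> weight M w \<le> n ==> P (sc c (word w))"
  "!!g h. g : Wle n ==> h : Wle n ==> P g ==> P h ==> P (g + h)"
 shows "P f"
proof -
 have "fs f" using assms(1) FS_fs[of f V] by (simp add: Wle_def)
 then have "f : Wle n --> P f"
 proof (induction rule: fun_fs_induct)
  case (word w)
  have "(%v. if v = w then f w else 0) = sc (f w) (word w)"
   by (auto simp: word_apply fapp)
  with word assms(1) show ?case by (auto simp: Wle_def word_carrier_iff valid_def intro!: assms(3))
 next
  case (add g h)
  then have "g : Wle n" "h : Wle n"
   using assms(1) by (auto simp: Wle_def word_carrier_iff)
  with add show ?case by (auto intro: assms(4))
 qed (use assms in auto)
 with assms(1) show ?thesis by simp
qed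

lemma Wle_word: "word w : Wle n \<longleftrightarrow> valid V w & pure_word A M w & weight M w \<le> n"
 by (auto simp: Wle_def word_apply)

lemma Wle_cm: "f : Wle n ==> g : Wle m ==> f ** g : Wle (n + m)"
proof (induction f rule: Wle_induct)
 case (word c w)
 from word(4,1-3) show ?case
  by (induction g rule: Wle_induct) (auto simp: cm_distrib word_cm_word Wle_word)
qed (auto simp: cm_distrib)

lemma spw_Wle: "valid V w ==> spw n w : Wle n"
proof (induction w arbitrary: n)
 case (Cons l w)
 have "lA l ** spw n w : Wle (0 + n)"
  by (rule Wle_cm) (use Cons in \<open>auto simp: Wle_word\<close>)
 moreover have "lM l ** spw m w : Wle (1 + m)" for m
  by (rule Wle_cm) (use Cons in \<open>auto simp: Wle_word\<close>)
 ultimately show ?case by (auto split: nat.split)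
qed (auto simp: Wle_word)

lemma sp_Wle: "f : FS ==> sp n f : Wle n"
 by (induction f rule: FS_induct) (auto simp: spw_Wle)

lemma hc_Wle: "f : Wle n ==> hc k f : Wle n"
 by (auto simp: Wle_def hc_def word_carrier_iff fs_def intro: finite_subset)

text \<open>Every letter of a pure word has a part that is zero, so all terms of the expansion but
  one contain a zero letter, and zero letters lie in I.\<close>

lemma spw_pure:
 assumes I: "wideal V I" "linear_rels V <= I"
 shows "valid V w ==> pure_word A M w ==> spw n w - (if weight M w = n then word w else 0) : I"
proof (induction w arbitrary: n)
 case (Cons l w)
 obtain k a x where l: "l = (k, (a, x))" by (cases l) auto
 have h: "a : hp A k" "x : hp M k" "valid V w" "pure_word A M w" "a = \<zero> | x = \<zero>\<^sub>M"
  using Cons(2,3) by (auto simp: l)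
 note z = wideal_right[OF I(1) lr_zero[OF I] FS_spw[OF h(3)]]
 note IH = wideal_left[OF I(1) Cons.IH[OF h(3,4)] FS_letter[OF h(1,2)]]
 show ?case
 proof (cases "x = \<zero>\<^sub>M")
  case True
  show ?thesis using IH[of n] z[of k]
   by (auto simp: l True cm_distrib word_cm_word add.commute diff_add_eq[symmetric] split: nat.split intro!: wideal_add[OF I(1)])
 next
  case False
  with h have a: "a = \<zero>" by simp
  show ?thesis
  proof (cases n)
   case 0
   then show ?thesis using z[of k n] False by (simp add: l a)
  next
   case (Suc m)
   have "spw n (l # w) - (if weight M (l # w) = n then word (l # w) else 0) =
     word [(k, (\<zero>, \<zero>\<^sub>M))] ** spw n w + word [(k, (a, x))] ** (spw m w - (if weight M w = m then word w else 0))"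
    using False by (simp add: l a Suc cm_distrib word_cm_word)
   then show ?thesis using wideal_add[OF I(1) z[of k n] IH[of m]] by simp
  qed
 qed
qed (auto simp: wideal_zero[OF I(1)])

lemma sp_Weq:
 assumes I: "wideal V I" "linear_rels V <= I" and f: "f : Weq n"
 shows "sp m f - (if m = n then f else 0) : I"
proof -
 have "fs f" using f FS_fs[of f V] by (simp add: Weq_def)
 then have "f : Weq n --> sp m f - (if m = n then f else 0) : I"
 proof (induction rule: fun_fs_induct)
  case (word w)
  have e: "(%v. if v = w then f w else 0) = sc (f w) (word w)"
   by (auto simp: word_apply fapp)
  have w: "valid V w" "pure_word A M w" "weight M w = n"
   using f word by (auto simp: Weq_def word_carrier_iff valid_def)
  show ?case unfolding e
   using wideal_sc[OF I(1) spw_pure[OF I w(1,2), of m], of "f w"] w(3) by (auto simp: sc_diff)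
 next
  case (add g h)
  then have gh: "g : Weq n" "h : Weq n"
   using f by (auto simp: Weq_def word_carrier_iff)
  then have FS: "g : FS" "h : FS" by (auto simp: Weq_def)
  have "sp m (g + h) - (if m = n then g + h else 0) = (sp m g - (if m = n then g else 0)) + (sp m h - (if m = n then h else 0))"
   using FS by simp
  with add gh show ?case by (auto intro!: wideal_add[OF I(1)] simp del: sp_add)
 qed (simp add: wideal_zero[OF I(1)])
 with f show ?thesis by simp
qed

text \<open>A word occurring in \<open>sp n f\<close> has weight below n only if one of its letters
  from M is zero, and then it lies in I. Keeping the words of weight exactly n thus changes nothing
  modulo I, and it commutes with taking components of a given degree.\<close>

lemma Wle_Weq:
 assumes I: "wideal V I" "linear_rels V <= I" and f: "f : FS"
 shows "\<exists>g\<in>Weq n. sp n f - g : I & (hc k f = f --> hc k g = g)"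
proof -
 define rw where "rw n f = (%w. if weight M w = n then f w else 0)" for n and f :: "('a \<times> 'm) wfun"
 have rw: "rw n (f + g) = rw n f + rw n g" "rw n (sc c f) = sc c (rw n f)" "rw n 0 = 0"
  "rw n (word w) = (if weight M w = n then word w else 0)" for n f g c w
  by (auto simp: rw_def fun_eq_iff fapp word_apply)
 have rwFS: "f : FS ==> rw n f : FS" for n f
  by (auto simp: rw_def word_carrier_iff fs_def intro: finite_subset)
 have rwl: "f : FS ==> rw n (word [l] ** f) = (if snd (snd l) = \<zero>\<^sub>M then word [l] ** rw n f
   else case n of 0 => 0 | Suc m => word [l] ** rw m f)" for n f l
  by (induction f rule: FS_induct) (auto simp: rw cm_distrib word_cm_word sc_add split: nat.split)
 have *: "spw n w - rw n (spw n w) : I" if "valid V w" for w n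
  using that
 proof (induction w arbitrary: n)
  case (Cons l w)
  then have FSw: "spw n w : FS" for n by (simp add: FS_spw)
  have vl: "valid V w" "lA l : FS" "lM l : FS" using Cons(2) by auto
  have 1: "lA l ** spw n w - rw n (lA l ** spw n w) : I" for n
   using wideal_left[OF I(1) Cons.IH[OF vl(1)] vl(2), of n] by (simp add: rwl[OF FSw] cm_distrib)
  have 2: "lM l ** spw n w - rw (Suc n) (lM l ** spw n w) : I" for n
  proof (cases "snd (snd l) = \<zero>\<^sub>M")
   case True
   have "lM l ** (spw n w - rw (Suc n) (spw n w)) : I"
    unfolding True by (rule wideal_right[OF I(1) lr_zero[OF I]]) (simp add: FSw rwFS)
   then show ?thesis by (simp add: rwl[OF FSw] True cm_distrib)
  next
   case False
   then show ?thesis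
    using wideal_left[OF I(1) Cons.IH[OF vl(1)] vl(3), of n] by (simp add: rwl[OF FSw] cm_distrib)
  qed
  show ?case
  proof (cases n)
   case (Suc m)
   have "spw n (l # w) - rw n (spw n (l # w)) = (lA l ** spw n w - rw n (lA l ** spw n w)) + (lM l ** spw m w - rw (Suc m) (lM l ** spw m w))"
    by (simp add: Suc rw)
   then show ?thesis using 1 2 wideal_add[OF I(1)] by metis
  qed (use 1[of 0] in simp)
 qed (auto simp: rw wideal_zero[OF I(1)])
 have "sp n f - rw n (sp n f) : I"
  using f
 proof (induction f rule: FS_induct)
  case (word c w)
  then show ?case using wideal_sc[OF I(1) *[OF word, of n], of c] by (simp add: rw sc_diff)
 next
  case (add g h)
  have "sp n (g + h) - rw n (sp n (g + h)) = (sp n g - rw n (sp n g)) + (sp n h - rw n (sp n h))"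
   using add by (simp add: rw)
  then show ?case using add wideal_add[OF I(1)] by metis
 qed (simp add: rw wideal_zero[OF I(1)])
 moreover have "rw n (sp n f) : Weq n"
  using sp_Wle[OF f, of n] rwFS[OF FS_sp[OF f]] by (auto simp: Weq_def Wle_def rw_def)
 moreover have "hc k (rw n (sp n f)) = rw n (sp n f)" if "hc k f = f"
  using sp_hc[OF f, of k n] that by (simp add: rw_def hc_def fun_eq_iff)
 ultimately show ?thesis by blast
qed

end

section \<open>The enveloping algebra as a quotient of the free algebra by one ideal\<close>

section \<open>Quotients of the free algebra\<close>

lemma ring_eqI:
 assumes "ring R" "carrier S = carrier R" "add S = add R" "mult S = mult R" "zero S = zero R" "one S = one R"
 shows "ring S"
proof -
 interpret ring R by fact
 show ?thesis
 proof (rule ringI)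
  show "abelian_group S"
   by (rule abelian_groupI) (use assms a_assoc a_comm l_neg in \<open>auto intro: a_inv_closed\<close>)
  show "Group.monoid S"
   by (rule monoidI) (use assms m_assoc in auto)
 qed (use assms l_distr r_distr in auto)
qed

lemma ring_minusI:
 assumes "ring R" "d : carrier R" "y : carrier R" "d \<oplus>\<^sub>R y = x"
 shows "x \<ominus>\<^sub>R y = d"
proof -
 interpret ring R by fact
 show ?thesis using assms(2-) by (auto simp: a_minus_def a_assoc r_neg)
qed

text \<open>Instantiated with the ideal of the enveloping algebra of the semidirect product and with
  that of \<open>Sym\<close>.\<close>

locale wquot =
 fixes V :: "(complex, 'v, 'z) dgmod_scheme" and I :: "'v wfun set"
 assumes wI: "wideal V I"
begin

abbreviation "Q \<equiv> dg_quot (words V) I"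
definition q where "q f = I +>\<^bsub>words V\<^esub> f"

sublocale W: ring "words V" by (rule words_ring)
sublocale I: ideal I "words V" using wI by (simp add: wideal_iff)

lemma q_eq: "f : word_carrier V ==> g : word_carrier V ==> q f = q g \<longleftrightarrow> f - g : I"
 using W.quotient_eq_iff_same_a_r_cos[OF I.is_ideal, of f g] by (simp add: q_def words_sel words_minus)

lemma q_self: "f : word_carrier V ==> f : q f"
 using I.a_rcos_self[of f] by (simp add: q_def words_sel)

lemma q_mem: "f : word_carrier V ==> g : q f \<longleftrightarrow> g : word_carrier V & f - g : I"
proof -
 assume f: "f : word_carrier V"
 show ?thesis
 proof
  assume g: "g : q f"
  then have gc: "g : word_carrier V"
   using W.a_r_coset_subset_G[OF I.a_subset, of f] f by (auto simp: q_def words_sel)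
  moreover have "q f = q g" using W.a_repr_independence[OF _ _ I.a_subgroup, of g f] g f by (simp add: q_def words_sel)
  ultimately show "g : word_carrier V & f - g : I" using q_eq f by simp
 next
  assume "g : word_carrier V & f - g : I"
  then show "g : q f" using q_eq[OF f, of g] q_self by blast
 qed
qed

lemma Q_carrier: "car Q = q ` word_carrier V"
 by (auto simp: dg_quot_def A_RCOSETS_def' q_def words_sel)

lemma Q_zero: "zero Q = q 0"
proof -
 have "q 0 = I" using W.a_coset_add_zero[OF I.a_subset] by (simp add: q_def words_sel)
 then show ?thesis by (simp add: dg_quot_def)
qed

lemma Q_one: "one Q = q (word [])"
 by (simp add: dg_quot_def q_def words_sel)

lemma Q_add: "f : word_carrier V ==> g : word_carrier V ==> q f \<oplus>\<^sub>Q q g = q (f + g)"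
 using I.a_rcos_sum[of f g] by (simp add: dg_quot_def q_def words_sel)

lemma Q_mult: "f : word_carrier V ==> g : word_carrier V ==> q f \<otimes>\<^sub>Q q g = q (f ** g)"
 using I.rcoset_mult_add[of f g] by (simp add: dg_quot_def q_def words_sel)

lemma Q_ring: "ring Q"
 by (rule ring_eqI[OF I.quotient_is_ring]) (simp_all add: dg_quot_def FactRing_def)

lemma Q_minus: "f : word_carrier V ==> g : word_carrier V ==> q f \<ominus>\<^sub>Q q g = q (f - g)"
 by (rule ring_minusI[OF Q_ring]) (auto simp: Q_carrier Q_add)

lemma Q_hpart: "hp Q n = q ` {f : word_carrier V. hc n f = f}"
 by (auto simp: dg_quot_def q_def words_hpart image_iff)

text \<open>The operations of \<open>dg_quot\<close> are unions over all representatives; such a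
  union collapses when its members agree.\<close>

lemma Un_q: "f : word_carrier V ==> (!!g h. g : word_carrier V ==> h : word_carrier V ==> g - h : I ==> X g = X h) ==>
 (\<Union>g\<in>q f. X g) = X f"
 using q_self q_mem by (metis (no_types, lifting) SUP_eq_const empty_iff)

lemma Q_dif:
 assumes f: "f : word_carrier V" and d: "!!f. f : word_carrier V ==> der 1 (dif V) f : word_carrier V"
  "!!f. f : I ==> der 1 (dif V) f : I"
 shows "dif Q (q f) = q (der 1 (dif V) f)"
proof -
 have "dif Q (q f) = (\<Union>g\<in>q f. q (der 1 (dif V) g))"
  by (simp add: dg_quot_def q_def words_dif)
 also have "\<dots> = q (der 1 (dif V) f)"
 proof (rule Un_q[OF f])
  fix g h assume g: "g : word_carrier V" "h : word_carrier V" "g - h : I"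
  then have "der 1 (dif V) g - der 1 (dif V) h : I"
   using d(2)[of "g - h"] by (simp add: der_diff[of _ V])
  then show "q (der 1 (dif V) g) = q (der 1 (dif V) h)"
   using q_eq[OF d(1) d(1)] g by simp
 qed
 finally show ?thesis .
qed

end

section \<open>The enveloping algebra of an algebroid\<close>

context algebroid_loc
begin

lemma G_smult_zero: "a : car A ==> a \<odot>\<^sub>G \<zero>\<^sub>G = \<zero>\<^sub>G"
 using G_mod(5)[of a "\<zero>\<^sub>G" "\<zero>\<^sub>G"] G_mod(3)[of a "\<zero>\<^sub>G"]
 by (metis G.add.l_cancel_one' G.zero_closed G.l_zero)

sublocale wmod A G
 by unfold_locales (auto simp: G_hpart G_mod(8) G_smult_zero)

lemma sm_csm: "sm = csm"
 by (simp add: fun_eq_iff sm_def csm_def)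

lemma G_ksign: "x : car G ==> ksign G k x = sm (sg k) x"
proof -
 assume x: "x : car G"
 have "csm 0 x \<oplus>\<^sub>G csm 0 x = csm 0 x" using GC_mod(4)[of x 0 0] x by simp
 then have z: "csm 0 x = \<zero>\<^sub>G" using x by (metis G.add.l_cancel_one' csm_closed)
 have "csm (- 1) x \<oplus>\<^sub>G x = \<zero>\<^sub>G"
  using GC_mod(4)[of x "-1" 1] GC_mod(7)[of x] x z by simp
 then have "csm (- 1) x = \<ominus>\<^sub>G x" using x by (metis G.minus_equality csm_closed)
 then show ?thesis using GC_mod(7)[of x] x by (auto simp: ksign_def sg_def sm_csm)
qed

lemma sm_smult: "a : car A ==> x : car G ==> sm c (a \<odot>\<^sub>G x) = (c \<odot> a) \<odot>\<^sub>G x"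
 unfolding sm_def by (subst G_mod(6)[symmetric]) (auto simp: A_sc1[symmetric])

abbreviation "L \<equiv> semidirect A G"

lemma semi_sel [simp]: "carrier L = car A \<times> car G" "zero L = (\<zero>, \<zero>\<^sub>G)" "add L = add V" "smult L = smult V"
 "hpart L = hp V" "dif L = dif V"
 by (simp_all add: semidirect_def dgmod.extend_def dgla.fields_def)

lemma words_L [simp]: "words L = words V" "word_carrier L = FS" "linear_rels L = linear_rels V"
proof -
 show 1: "word_carrier L = FS" by (simp add: word_carrier_def)
 have 2: "word_dif L = word_dif V" by (simp add: word_dif_def fun_eq_iff)
 show 3: "words L = words V" by (simp add: words_def 1 2)
 show "linear_rels L = linear_rels V" unfolding linear_rels_def 3 by simp
qed

abbreviation "sbr \<equiv> bracket L"

lemma anchor_hpart: "x : hp G n ==> a : hp A k ==> anchor G x a : hp A (n + k)"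
 using derD(1)[OF anchor_der] .

lemma semi_bracket:
 assumes "a : hp A n" "x : hp G n" "b : hp A m" "y : hp G m"
 shows "sbr (a, x) (b, y) = (anchor G x b \<ominus> ksign A (n * m) (anchor G y a), bracket G x y)"
proof -
 have "(\<Oplus>\<^bsub>A\<^esub>ij\<in>hsupp A a \<times> hsupp G y. ksign A (fst ij * snd ij) (anchor G (hcomp G y (snd ij)) (hcomp A a (fst ij))))
   = ksign A (n * m) (anchor G y a)"
 proof (cases "a = \<zero> | y = \<zero>\<^sub>G")
  case True
  have "anchor G \<zero>\<^sub>G a = \<zero>"
   using anchor_add[of "\<zero>\<^sub>G" "\<zero>\<^sub>G" a] assms(1) anchor_closed[of "\<zero>\<^sub>G" a] by (metis A.add.l_cancel_one' A_hcarr G.zero_closed G.l_zero)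
  then show ?thesis using True assms der_zero_A[OF anchor_der[OF assms(4)]]
   by (auto simp: hcomp_hom[OF grA assms(1)] hcomp_hom[OF grG assms(4)] A_ksign)
 next
  case False
  then show ?thesis using assms anchor_closed[of y a]
   by (simp add: hcomp_hom[OF grA assms(1)] hcomp_hom[OF grG assms(4)])
 qed
 then show ?thesis by (simp add: semidirect_def dgmod.extend_def dgla.fields_def)
qed

lemma semi_bracket_hpart: "u : hp V n ==> v : hp V m ==> sbr u v : hp V (n + m)"
proof -
 assume "u : hp V n" "v : hp V m"
 then obtain a x b y where u: "u = (a, x)" "v = (b, y)" and h: "a : hp A n" "x : hp G n" "b : hp A m" "y : hp G m"
  by auto
 have "anchor G y a : hp A (n + m)" using anchor_hpart[OF h(4,1)] by (simp add: add.commute)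
 then show ?thesis using h by (simp add: u semi_bracket[OF h] A_hpart anchor_hpart bracket_hpart)
qed

definition env_gens where
 "env_gens = linear_rels V \<union>
  {word [(n, u)] ** word [(m, v)] - (sc (sg (n * m)) (word [(m, v)] ** word [(n, u)]) + word [(n + m, sbr u v)]) | n m u v.
    u : hp V n & v : hp V m}"

definition alg_gens where
 "alg_gens = {word [(n, (a, \<zero>\<^sub>G))] ** word [(m, (b, y))] - word [(n + m, (a \<otimes> b, a \<odot>\<^sub>G y))] | n m a b y.
    a : hp A n & b : hp A m & y : hp G m}"

text \<open>\<open>U\<close> is a quotient of a quotient, with cosets of cosets as elements.
  \<open>K\<close> is the preimage in the free algebra of the second ideal (\<open>q_J\<close>), and
  computations in \<open>U\<close> become congruences modulo \<open>K\<close>.\<close>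

definition K where "K = Idl\<^bsub>words V\<^esub> (env_gens \<union> alg_gens)"

abbreviation "Ie \<equiv> env_ideal L"

lemma env_ideal_eq: "Ie = Idl\<^bsub>words V\<^esub> env_gens"
proof -
 have "letter n u \<otimes>\<^bsub>words V\<^esub> letter m v \<ominus>\<^bsub>words V\<^esub> (ksign (words V) (n * m) (letter m v \<otimes>\<^bsub>words V\<^esub> letter n u) \<oplus>\<^bsub>words V\<^esub> letter (n + m) (sbr u v)) =
  word [(n, u)] ** word [(m, v)] - (sc (sg (n * m)) (word [(m, v)] ** word [(n, u)]) + word [(n + m, sbr u v)])"
  if "u : hp V n" "v : hp V m" for n m u v
  using that semi_bracket_hpart[OF that] by (subst words_ksign; (subst words_minus)?; simp add: words_sel letter_def)+
 then have "{letter n u \<otimes>\<^bsub>words V\<^esub> letter m v \<ominus>\<^bsub>words V\<^esub> (ksign (words V) (n * m) (letter m v \<otimes>\<^bsub>words V\<^esub> letter n u) \<oplus>\<^bsub>words V\<^esub> letter (n + m) (sbr u v)) | n m u v.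
    u : hp V n & v : hp V m} =
   {word [(n, u)] ** word [(m, v)] - (sc (sg (n * m)) (word [(m, v)] ** word [(n, u)]) + word [(n + m, sbr u v)]) | n m u v.
    u : hp V n & v : hp V m}"
  by (intro Collect_cong ex_cong1) (metis (no_types, lifting))
 then show ?thesis unfolding env_ideal_def env_gens_def by simp
qed

lemma env_gens_FS: "env_gens <= FS"
proof -
 have "{word [(n, u)] ** word [(m, v)] - (sc (sg (n * m)) (word [(m, v)] ** word [(n, u)]) + word [(n + m, sbr u v)]) | n m u v.
    u : hp V n & v : hp V m} <= FS"
  using semi_bracket_hpart by (auto intro!: FS_diff FS_add FS_sc FS_cm)
 then show ?thesis using linear_rels_FS by (simp add: env_gens_def)
qed

lemma alg_gens_FS: "alg_gens <= FS"
 unfolding alg_gens_def by (auto simp: A_mult M_smult)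

lemma gens_FS: "env_gens \<union> alg_gens <= FS"
 using env_gens_FS alg_gens_FS by simp

lemma K_ideal: "wideal V K" and gens_K: "env_gens \<union> alg_gens <= K" and Ie_ideal: "wideal V Ie"
 and gens_Ie: "env_gens <= Ie"
 unfolding K_def env_ideal_eq by (rule Idl_wideal[OF gens_FS] Idl_self[OF gens_FS] Idl_wideal[OF env_gens_FS] Idl_self[OF env_gens_FS])+

lemma lin_K: "linear_rels V <= K"
 using gens_K by (simp add: env_gens_def)

lemmas K_add = wideal_add[OF K_ideal] and K_diff = wideal_diff[OF K_ideal] and K_minus = wideal_minus[OF K_ideal]
 and K_sc = wideal_sc[OF K_ideal] and K_left = wideal_left[OF K_ideal] and K_right = wideal_right[OF K_ideal]
 and K_zero = wideal_zero[OF K_ideal] and K_FS = wideal_FS[OF K_ideal] and K_sum = wideal_sum[OF K_ideal]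

lemma K_env: "u : hp V n ==> v : hp V m ==>
  word [(n, u)] ** word [(m, v)] - (sc (sg (n * m)) (word [(m, v)] ** word [(n, u)]) + word [(n + m, sbr u v)]) : K"
 and K_alg: "a : hp A n ==> b : hp A m ==> y : hp G m ==>
  word [(n, (a, \<zero>\<^sub>G))] ** word [(m, (b, y))] - word [(n + m, (a \<otimes> b, a \<odot>\<^sub>G y))] : K"
 apply (rule subsetD[OF gens_K], unfold env_gens_def)
 apply (rule UnI1, rule UnI2, rule CollectI, intro exI conjI, rule refl, assumption+)
 apply (rule subsetD[OF gens_K], unfold alg_gens_def)
 apply (rule UnI2, rule CollectI, intro exI conjI, rule refl, assumption+)
 done

lemma Ie_K: "Ie <= K"
 unfolding env_ideal_eq using K_ideal gens_K by (intro Idl_minimal) auto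

sublocale E: wquot V Ie
 by unfold_locales (rule Ie_ideal)

lemma env_eq: "env L = E.Q"
 by (simp add: env_def)

abbreviation "J \<equiv> algebroid_ideal A G"

definition J_gens where "J_gens = E.q ` alg_gens"

lemma J_eq: "J = Idl\<^bsub>E.Q\<^esub> J_gens"
proof -
 have "env_letter L n (a, \<zero>\<^sub>G) \<otimes>\<^sub>E.Q env_letter L m (b, y) \<ominus>\<^sub>E.Q env_letter L (n + m) (a \<otimes> b, a \<odot>\<^sub>G y) =
   E.q (word [(n, (a, \<zero>\<^sub>G))] ** word [(m, (b, y))] - word [(n + m, (a \<otimes> b, a \<odot>\<^sub>G y))])"
  if "a : hp A n" "b : hp A m" "y : hp G m" for n m a b y
  using that by (simp add: env_letter_def letter_def E.q_def[symmetric] E.Q_mult E.Q_minus A_mult M_smult)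
 then have "{env_letter L n (a, \<zero>\<^sub>G) \<otimes>\<^sub>E.Q env_letter L m (b, y) \<ominus>\<^sub>E.Q env_letter L (n + m) (a \<otimes> b, a \<odot>\<^sub>G y) | n m a b y.
         a : hp A n & b : hp A m & y : hp G m} =
  {E.q (word [(n, (a, \<zero>\<^sub>G))] ** word [(m, (b, y))] - word [(n + m, (a \<otimes> b, a \<odot>\<^sub>G y))]) | n m a b y.
         a : hp A n & b : hp A m & y : hp G m}"
  by (intro Collect_cong ex_cong1) (metis (no_types, lifting))
 also have "\<dots> = J_gens"
  unfolding J_gens_def alg_gens_def
  apply (intro equalityI subsetI)
   apply (elim CollectE exE conjE, hypsubst, rule imageI, rule CollectI, intro exI conjI, rule refl, assumption+)
  apply (elim imageE CollectE exE conjE, hypsubst, rule CollectI, intro exI conjI, rule refl, assumption+)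
  done
 finally show ?thesis unfolding algebroid_ideal_def Let_def env_eq by simp
qed

sublocale EQ: ring E.Q by (rule E.Q_ring)

lemma J_ideal: "ideal J E.Q" and J_gens: "J_gens <= J"
proof -
 have "J_gens <= carrier E.Q" using alg_gens_FS by (auto simp: J_gens_def E.Q_carrier)
 then show "ideal J E.Q" "J_gens <= J"
  using EQ.genideal_ideal EQ.genideal_self by (auto simp: J_eq)
qed

sublocale J: ideal J E.Q by (rule J_ideal)

text \<open>The correspondence of ideals under a quotient map: the preimage of \<open>J\<close> is
  an ideal containing the generators of \<open>K\<close>, and the image of \<open>K\<close> is an
  ideal containing those of \<open>J\<close>. The last step uses that \<open>Ie\<close> is contained
  in \<open>K\<close>.\<close>

lemma q_J: "f : FS ==> E.q f : J \<longleftrightarrow> f : K"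
proof
 have c: "E.q f : carrier E.Q" if "f : FS" for f using that by (simp add: E.Q_carrier)
 assume f: "f : FS"
 have "wideal V {f : FS. E.q f : J}"
  unfolding wideal_def
 proof (intro conjI ballI)
  show "0 : {f : FS. E.q f : J}"
   using additive_subgroup.zero_closed[OF J.additive_subgroup_axioms] by (simp add: E.Q_zero)
 next
  fix f g assume "f : {f : FS. E.q f : J}" "g : {f : FS. E.q f : J}"
  then show "f + g : {f : FS. E.q f : J}"
   using additive_subgroup.a_closed[OF J.additive_subgroup_axioms, of "E.q f" "E.q g"] by (simp add: E.Q_add)
 next
  fix f h assume "f : {f : FS. E.q f : J}" "h : FS"
  then show "h ** f : {f : FS. E.q f : J}" "f ** h : {f : FS. E.q f : J}"
   using J.I_l_closed[of "E.q f" "E.q h"] J.I_r_closed[of "E.q f" "E.q h"] c by (simp_all add: E.Q_mult)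
 qed auto
 moreover have "env_gens \<union> alg_gens <= {f : FS. E.q f : J}"
 proof -
  have "E.q f : J" if "f : env_gens" for f
  proof -
   have "f : FS" "f - 0 : Ie" using that env_gens_FS gens_Ie by auto
   then have "E.q f = E.q 0" by (subst E.q_eq) auto
   then show ?thesis using additive_subgroup.zero_closed[OF J.additive_subgroup_axioms] by (simp add: E.Q_zero)
  qed
  moreover have "E.q f : J" if "f : alg_gens" for f
   using that J_gens by (auto simp: J_gens_def)
  ultimately show ?thesis using gens_FS by auto
 qed
 ultimately have "K <= {f : FS. E.q f : J}" unfolding K_def by (rule Idl_minimal)
 then show "f : K ==> E.q f : J" by auto
 have "ideal (E.q ` K) E.Q"
 proof (rule idealI[OF E.Q_ring])
  show "subgroup (E.q ` K) (add_monoid E.Q)"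
  proof (rule EQ.add.subgroupI)
   show "E.q ` K <= carrier E.Q" using K_FS by (auto simp: E.Q_carrier)
   show "E.q ` K ~= {}" using K_zero by auto
   fix a assume "a : E.q ` K"
   then obtain f where f: "a = E.q f" "f : K" by auto
   have "\<ominus>\<^sub>E.Q E.q f = E.q (- f)"
    using f K_FS K_minus by (intro EQ.minus_equality) (auto simp: E.Q_carrier E.Q_add E.Q_zero)
   then show "\<ominus>\<^sub>E.Q a : E.q ` K" using f K_minus by auto
  next
   fix a b assume "a : E.q ` K" "b : E.q ` K"
   then show "a \<oplus>\<^sub>E.Q b : E.q ` K" using K_FS K_add by (auto simp: E.Q_add)
  qed
 qed (use K_FS K_left K_right in \<open>auto simp: E.Q_carrier E.Q_mult\<close>)
 moreover have "J_gens <= E.q ` K" using gens_K by (auto simp: J_gens_def)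
 ultimately have "J <= E.q ` K" unfolding J_eq by (rule EQ.genideal_minimal)
 then show "E.q f : J ==> f : K"
 proof -
  assume "E.q f : J"
  with \<open>J <= E.q ` K\<close> obtain k where "k : K" "E.q f = E.q k" by auto
  then have "f - k : K" "k : K" using E.q_eq f K_FS Ie_K by blast+
  from K_add[OF this] show ?thesis by simp
 qed
qed

subsection \<open>Operations on classes of words\<close>

definition pr where "pr f = UEA_proj A G f"

lemma pr_def': "pr f = J +>\<^bsub>E.Q\<^esub> E.q f"
 by (simp add: pr_def UEA_proj_def Let_def env_eq E.q_def)

lemma pr_eq: "f : FS ==> g : FS ==> pr f = pr g \<longleftrightarrow> f - g : K"
proof -
 assume f: "f : FS" "g : FS"
 then have "E.q f \<ominus>\<^sub>E.Q E.q g : J \<longleftrightarrow> pr f = pr g"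
  unfolding pr_def' by (intro EQ.quotient_eq_iff_same_a_r_cos[OF J_ideal]) (auto simp: E.Q_carrier)
 then show ?thesis using f q_J[of "f - g"] by (simp add: E.Q_minus)
qed

abbreviation "U \<equiv> UEA A G"

text \<open>The lift of the augmentation ideal \<open>env_plus\<close> to the free algebra.\<close>

definition FS1 where "FS1 = {f : FS. f [] = 0}"

lemma FS1_wideal: "wideal V FS1"
 unfolding wideal_def FS1_def by (auto simp: fapp cm_Nil)

lemma gens_FS1: "env_gens \<union> alg_gens <= FS1"
proof -
 have "f [] = 0" if "f : env_gens \<union> alg_gens" for f
  using that unfolding env_gens_def alg_gens_def linear_rels_V
  by (auto simp: fapp word_apply cm_Nil)
 then show ?thesis using gens_FS by (auto simp: FS1_def)
qed

lemma K_FS1: "K <= FS1"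
 unfolding K_def using FS1_wideal gens_FS1 by (rule Idl_minimal)

lemma FS1_FS: "f : FS1 ==> f : FS" by (simp add: FS1_def)

lemma word_Nil0: "w ~= [] ==> word w [] = 0"
 by (simp add: word_def)

lemma env_plus_eq: "env_plus L = E.q ` FS1"
proof -
 let ?X = "{env_letter L n x | n x. x : hpart L n}"
 have X: "?X = {E.q (word [(n, u)]) | n u. u : hp V n}"
  by (simp add: env_letter_def letter_def E.q_def)
 have Xc: "?X <= carrier E.Q" unfolding X by (auto simp: E.Q_carrier)
 have id: "ideal (E.q ` FS1) E.Q"
 proof (rule idealI[OF E.Q_ring])
  show "subgroup (E.q ` FS1) (add_monoid E.Q)"
  proof (rule EQ.add.subgroupI)
   show "E.q ` FS1 <= carrier E.Q" using FS1_FS by (auto simp: E.Q_carrier)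
   show "E.q ` FS1 ~= {}" using wideal_zero[OF FS1_wideal] by auto
   fix a assume "a : E.q ` FS1"
   then obtain f where f: "a = E.q f" "f : FS1" by auto
   have "\<ominus>\<^sub>E.Q E.q f = E.q (- f)"
    using f FS1_FS by (intro EQ.minus_equality) (auto simp: E.Q_carrier E.Q_add E.Q_zero)
   then show "\<ominus>\<^sub>E.Q a : E.q ` FS1" using f wideal_minus[OF FS1_wideal] by auto
  next
   fix a b assume "a : E.q ` FS1" "b : E.q ` FS1"
   then show "a \<oplus>\<^sub>E.Q b : E.q ` FS1" using FS1_FS wideal_add[OF FS1_wideal] by (auto simp: E.Q_add)
  qed
 qed (use FS1_FS wideal_left[OF FS1_wideal] wideal_right[OF FS1_wideal] in \<open>auto simp: E.Q_carrier E.Q_mult\<close>)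
 have "env_plus L <= E.q ` FS1"
  unfolding env_plus_def env_eq
 proof (rule EQ.genideal_minimal[OF id])
  have "word [(n, u)] : FS1" if "u : hp V n" for n u
   using that word_Nil0[of "[(n, u)]"] by (auto simp: FS1_def)
  then show "?X <= E.q ` FS1" unfolding X by blast
 qed
 moreover have "E.q f : env_plus L" if "f : FS1" for f
 proof -
  have pI: "ideal (env_plus L) E.Q" and Xp: "?X <= env_plus L"
   unfolding env_plus_def env_eq by (rule EQ.genideal_ideal[OF Xc], rule EQ.genideal_self[OF Xc])
  interpret p: ideal "env_plus L" E.Q by (rule pI)
  have z: "E.q 0 : env_plus L"
   using additive_subgroup.zero_closed[OF p.additive_subgroup_axioms] by (simp add: E.Q_zero)
  have w: "E.q (sc c (word w)) : env_plus L" if "valid V w" "w ~= []" for c w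
  proof -
   obtain l u where w: "w = l # u" using \<open>w ~= []\<close> by (cases w) auto
   have "E.q (word [l]) : env_plus L" using Xp that unfolding X w by (cases l) auto
   then have "E.q (word [l]) \<otimes>\<^sub>E.Q E.q (sc c (word u)) : env_plus L"
    using that w by (intro p.I_r_closed) (auto simp: E.Q_carrier)
   then show ?thesis using that by (simp add: w E.Q_mult cm_distrib word_cm_word)
  qed
  \<comment> \<open>Subtracting the constant term makes the claim additive in g, so that it can be
    proved by induction over all of \<open>FS\<close>.\<close>
  have "g : FS ==> E.q (g - sc (g []) (word [])) : env_plus L" for g
  proof (induction g rule: FS_induct)
   case (word c v)
   show ?case
   proof (cases "v = []")
    case False
    then have "sc c (word v) [] = 0" by (simp add: sc_apply word_Nil0)
    then show ?thesis using w[OF word False, of c] by simp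
   next
    case True
    then have "sc c (word v) [] = c" by (simp add: sc_apply word_def)
    then show ?thesis using z True by simp
   qed
  next
   case (add g h)
   have e: "g + h - sc ((g + h) []) (word []) = (g - sc (g []) (word [])) + (h - sc (h []) (word []))"
    by (simp add: plus_fun_apply sc_add_left)
   show ?case
    unfolding e using additive_subgroup.a_closed[OF p.additive_subgroup_axioms add(3,4)]
    by (subst (asm) E.Q_add) (use add in auto)
  next
   case zero
   have "(0 :: ('a \<times> 'g) wfun) [] = 0" by (simp add: zero_fun_def)
   then show ?case using z by simp
  qed
  from this[of f] that show ?thesis by (simp add: FS1_def)
 qed
 ultimately show ?thesis by auto
qed

lemma U_carrier: "car U = pr ` FS1"
 by (simp add: UEA_def Let_def env_eq env_plus_eq pr_def' image_image)

lemma U_zero: "zero U = pr 0"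
proof -
 have "pr 0 = J" unfolding pr_def' using EQ.a_coset_add_zero[OF J.a_subset] by (simp add: E.Q_zero)
 then show ?thesis by (simp add: UEA_def Let_def)
qed

lemma U_add: "f : FS ==> g : FS ==> pr f \<oplus>\<^sub>U pr g = pr (f + g)"
 using J.a_rcos_sum[of "E.q f" "E.q g"] by (simp add: UEA_def Let_def pr_def' env_eq E.Q_add E.Q_carrier)

lemma U_mult: "f : FS ==> g : FS ==> pr f \<otimes>\<^sub>U pr g = pr (f ** g)"
 using J.rcoset_mult_add[of "E.q f" "E.q g"] by (simp add: UEA_def Let_def pr_def' env_eq E.Q_mult E.Q_carrier)

abbreviation "one1 \<equiv> word [(0, (\<one>, \<zero>\<^sub>G))]"

lemma U_one: "one U = pr one1"
 by (simp add: UEA_def Let_def pr_def' env_eq env_letter_def E.q_def letter_def)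

lemma U_group: "abelian_group U"
proof (rule abelian_groupI)
 fix x assume "x : car U"
 then obtain f where f: "x = pr f" "f : FS1" by (auto simp: U_carrier)
 then show "\<exists>y\<in>car U. y \<oplus>\<^sub>U x = \<zero>\<^sub>U"
  using FS1_FS wideal_minus[OF FS1_wideal] by (intro bexI[of _ "pr (- f)"]) (auto simp: U_add U_zero U_carrier)
qed (use FS1_FS wideal_zero[OF FS1_wideal] wideal_add[OF FS1_wideal] in \<open>auto simp: U_carrier U_zero U_add algebra_simps\<close>)

sublocale U: abelian_group U by (rule U_group)

lemma U_finsum: "finite T ==> (!!i. i : T ==> f i : FS1) ==> (\<Oplus>\<^bsub>U\<^esub>i\<in>T. pr (f i)) = pr (\<Sum>i\<in>T. f i)"
proof (induction T rule: finite_induct)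
 case (insert x F)
 have "(\<Sum>i\<in>F. f i) : FS1" by (rule wideal_sum[OF FS1_wideal]) (use insert in auto)
 with insert show ?case
  using FS1_FS by (subst U.finsum_insert) (auto simp: U_carrier U_add)
qed (simp add: U_zero)

text \<open>The representative of a in the free algebra through which A acts on \<open>UEA\<close>
  and on \<open>Sym\<close>. As a sum over the support of a, it is additive in a only modulo the
  linear relations (\<open>al_add\<close>).\<close>

definition al where "al a = (\<Sum>n\<in>hsupp A a. word [(n, (hcomp A a n, \<zero>\<^sub>G))])"

lemma al_FS: "a : car A ==> al a : FS"
 unfolding al_def by (rule FS_sum) (auto intro: hcomp_hpart[OF grA])

lemma al_FS1: "a : car A ==> al a : FS1"
 using al_FS unfolding al_def by (auto simp: FS1_def fun_sum_apply word_apply)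

lemma al_hom: "a : hp A n ==> wideal V I ==> linear_rels V <= I ==> al a - word [(n, (a, \<zero>\<^sub>G))] : I"
 using lr_zero[of I n] by (auto simp: al_def hcomp_hom[OF grA] wideal_zero wideal_minus)

lemma al_add:
 assumes "a : car A" "b : car A" and I: "wideal V I" "linear_rels V <= I"
 shows "al (a \<oplus> b) - (al a + al b) : I"
proof -
 define w where "w a n = word [(n, (hcomp A a n, \<zero>\<^sub>G))]" for a n
 let ?T = "hsupp A (a \<oplus> b) \<union> hsupp A a \<union> hsupp A b"
 have f: "finite ?T" using assms finite_hsupp[OF grA] by auto
 have s: "(\<Sum>n\<in>?T. w c n) - al c : I" if "c : car A" "hsupp A c <= ?T" for c
 proof -
  have "(\<Sum>n\<in>?T. w c n) - al c = (\<Sum>n\<in>?T - hsupp A c. w c n)"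
   using sum.subset_diff[OF that(2) f, of "w c"] by (simp add: al_def w_def)
  moreover have "w c n : I" if "n : ?T - hsupp A c" for n
   using that lr_zero[OF I, of n] by (auto simp: hsupp_def w_def)
  ultimately show ?thesis using wideal_sum[OF I(1)] by (metis (no_types, lifting))
 qed
 have "w (a \<oplus> b) n - (w a n + w b n) : I" for n
  using lr_add[OF I, of "hcomp A a n" n "hcomp A b n" "\<zero>\<^sub>G" "\<zero>\<^sub>G"] assms hcomp_hpart[OF grA]
  by (simp add: w_def hcomp_add[OF grA])
 then have t: "(\<Sum>n\<in>?T. w (a \<oplus> b) n - (w a n + w b n)) : I" by (intro wideal_sum[OF I(1)])
 have e: "(\<Sum>n\<in>?T. w (a \<oplus> b) n - (w a n + w b n)) = (\<Sum>n\<in>?T. w (a \<oplus> b) n) - ((\<Sum>n\<in>?T. w a n) + (\<Sum>n\<in>?T. w b n))"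
  by (simp add: sum_subtractf sum.distrib)
 have s': "(\<Sum>n\<in>?T. w (a \<oplus> b) n) - al (a \<oplus> b) : I" "(\<Sum>n\<in>?T. w a n) - al a : I"
   "(\<Sum>n\<in>?T. w b n) - al b : I"
  by (rule s; use assms in auto)+
 from wideal_add[OF I(1) wideal_add[OF I(1) wideal_diff[OF I(1) t[unfolded e] s'(1)] s'(2)] s'(3)]
 show ?thesis by (simp add: algebra_simps)
qed

lemma U_smult:
 assumes a: "a : car A" and f: "f : FS"
 shows "a \<odot>\<^sub>U pr f = pr (al a ** f)"
proof -
 have T: "(\<Oplus>\<^bsub>E.Q\<^esub>n\<in>T. env_letter L n (hcomp A a n, \<zero>\<^sub>G)) = E.q (\<Sum>n\<in>T. word [(n, (hcomp A a n, \<zero>\<^sub>G))])" if "finite T" for T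
  using that
 proof (induction T rule: finite_induct)
  case (insert n T)
  have w: "word [(k, (hcomp A a k, \<zero>\<^sub>G))] : FS" for k using hcomp_hpart[OF grA a] by simp
  have "env_letter L n (hcomp A a n, \<zero>\<^sub>G) = E.q (word [(n, (hcomp A a n, \<zero>\<^sub>G))])" for n
   by (simp add: env_letter_def letter_def E.q_def)
  with insert w show ?case by (subst EQ.finsum_insert) (auto simp: E.Q_carrier E.Q_add)
 qed (simp add: E.Q_zero)
 have "a \<odot>\<^sub>U pr f = (\<Union>u\<in>pr f. J +>\<^bsub>E.Q\<^esub> (E.q (al a) \<otimes>\<^sub>E.Q u))"
  using T[OF finite_hsupp[OF grA a]] by (simp add: UEA_def Let_def env_eq al_def)
 also have "\<dots> = (\<Union>u\<in>pr f. pr (al a ** f))"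
 proof (rule SUP_cong[OF refl])
  fix u assume u: "u : pr f"
  then have "u : carrier E.Q"
   using EQ.a_r_coset_subset_G[OF J.a_subset, of "E.q f"] f by (auto simp: pr_def' E.Q_carrier)
  then obtain g where g: "u = E.q g" "g : FS" by (auto simp: E.Q_carrier)
  have "pr f = pr g"
   using EQ.a_repr_independence[OF _ _ J.a_subgroup, of u "E.q f"] u f g by (simp add: pr_def' E.Q_carrier)
  then have "f - g : K" using f g by (simp add: pr_eq)
  then have "al a ** (f - g) : K" using al_FS[OF a] by (rule K_left)
  then show "J +>\<^bsub>E.Q\<^esub> (E.q (al a) \<otimes>\<^sub>E.Q u) = pr (al a ** f)"
   using f g al_FS[OF a] K_minus[of "al a ** (f - g)"] by (auto simp: pr_def'[symmetric] E.Q_mult pr_eq cm_distrib)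
 qed
 also have "\<dots> = pr (al a ** f)"
  using J.a_rcos_self[of "E.q f"] f by (auto simp: pr_def' E.Q_carrier)
 finally show ?thesis .
qed

text \<open>A homogeneous representative of a class in \<open>env_plus\<close> differs from a
  representative in \<open>FS1\<close> by an element of \<open>Ie\<close>. The relations have no
  constant term, so the homogeneous representative lies in \<open>FS1\<close> as well.\<close>

lemma U_hpart: "hp U n = pr ` {f : FS1. hc n f = f}"
proof -
 have "env_plus L \<inter> hpart E.Q n = E.q ` {f : FS1. hc n f = f}"
 proof safe
  fix u assume "u : env_plus L" "u : hpart E.Q n"
  then obtain f g where f: "u = E.q f" "f : FS" "hc n f = f" and g: "u = E.q g" "g : FS1"
   by (auto simp: env_plus_eq E.Q_hpart)
  then have "f - g : Ie" using E.q_eq FS1_FS by metis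
  then have "f - g : FS1" using Ie_K K_FS1 by auto
  from wideal_add[OF FS1_wideal this g(2)] have "f : FS1" by simp
  with f show "u : E.q ` {f : FS1. hc n f = f}" by auto
 qed (auto simp: env_plus_eq E.Q_hpart FS1_FS)
 then show ?thesis by (simp add: UEA_def Let_def env_eq pr_def' image_image)
qed

end

context wmod
begin

text \<open>\<open>map_prod dA dM\<close> respects the splitting of a letter into its two parts, so
  the derivation preserves the weight.\<close>

lemma sp_der:
 assumes d: "!!n a. a : hp A n ==> dA a : hp A (n + e)" "!!n x. x : hp M n ==> dM x : hp M (n + e)"
  and z: "dA \<zero> = \<zero>" "dM \<zero>\<^sub>M = \<zero>\<^sub>M" and f: "f : FS"
 shows "sp n (der e (map_prod dA dM) f) = der e (map_prod dA dM) (sp n f)"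
proof -
 let ?d = "map_prod dA dM"
 have dV: "x : hp V k ==> ?d x : hp V (k + e)" for k x using d by auto
 have F: "valid V w ==> wder e ?d w : FS" for w by (rule FS_wder[OF dV])
 have w: "sp n (wder e ?d w) = der e ?d (spw n w)" if "valid V w" for w
  using that
 proof (induction w arbitrary: n)
  case (Cons l w)
  obtain k a x where l: "l = (k, (a, x))" by (cases l) auto
  have v: "valid V w" "valid V [l]" "a : hp A k" "x : hp M k" "valid V [(k + e, (dA a, dM x))]"
   using Cons(2) d by (auto simp: l)
  note IH = Cons.IH[OF v(1)]
  have f0: "word (l # w) = word [l] ** word w" for l :: "int \<times> 'a \<times> 'm" by (simp add: word_cm_word)
  show ?case
   using v F[OF v(1)] FS_spw[OF v(1)]
   by (auto simp: l sp_add sp_left[OF F[OF v(1)]] IH z der_letter_left[of _ V] der_add[of _ V] cm_distrib sc_add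
     algebra_simps split: nat.split)
 qed simp
 show ?thesis using f
 proof (induction f rule: FS_induct)
  case (add g h)
  then show ?case using FS_der[OF _ dV] by (simp add: der_add[of _ V])
 qed (auto simp: w)
qed

end

context algebroid_loc
begin

subsection \<open>The differential on the quotients\<close>

lemma dif_V: "dif V = map_prod (dif A) (dif G)"
 by (auto simp: fun_eq_iff)

abbreviation "D \<equiv> der 1 (dif V)"

lemma A_sc0: "a : car A ==> (0::complex) \<odot> a = \<zero>"
 using A_mod(4)[of 0 0 a] by (metis A.add.l_cancel_one' A_smult_closed CC_sel(1) CC_sel(5) UNIV_I add_0)

lemma G_sc0: "x : car G ==> csm 0 x = \<zero>\<^sub>G"
 using GC_mod(4)[of x 0 0] by (metis G.add.l_cancel_one' csm_closed add_0)

lemma dif_A_sc: "a : car A ==> dif A (c \<odot> a) = c \<odot> dif A a"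
 using A_mod(12)[of c 0 a] by (simp add: A_sc0 ksign_def)

lemma dif_G_sc: "x : car G ==> dif G (csm c x) = csm c (dif G x)"
 using GC_mod(12)[of c 0 x] by (simp add: G_sc0 ksign_def)

lemma dif_A_zero [simp]: "dif A \<zero> = \<zero>" and dif_G_zero [simp]: "dif G \<zero>\<^sub>G = \<zero>\<^sub>G"
 using dif_A_sc[of "\<zero>" 0] dif_G_sc[of "\<zero>\<^sub>G" 0] by (simp_all add: A_sc0 G_sc0)

lemma dif_A_mult: "a : hp A n ==> b : hp A m ==>
 dif A (a \<otimes> b) = dif A a \<otimes> b \<oplus> (sg (1 * n) \<odot> a) \<otimes> dif A b"
 by (simp add: A_dif_mult A_ksign A_sc1)

lemma dif_G_smult: "a : hp A n ==> x : hp G m ==>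
 dif G (a \<odot>\<^sub>G x) = dif A a \<odot>\<^sub>G x \<oplus>\<^sub>G (sg (1 * n) \<odot> a) \<odot>\<^sub>G dif G x"
 by (simp add: G_mod(12) G_ksign G_mod(3) sm_smult)

lemmas d_hyps = A_mod(9) A_mod(10)[OF A_hcarr A_hcarr] dif_A_sc[OF A_hcarr] dif_A_mult
 G_mod(9) G_mod(10)[OF G_hcarr G_hcarr] dif_G_sc[OF G_hcarr, folded sm_csm] dif_G_smult dif_G_zero

lemma D_hpart: "u : hp V n ==> dif V u : hp V (n + 1)"
 using A_mod(9) G_mod(9) by auto

lemma D_FS [simp]: "f : FS ==> D f : FS"
 by (rule FS_der[OF _ D_hpart])

lemma D_S: "f : S ==> D f : S"
 unfolding dif_V by (rule der_S) (simp_all add: d_hyps)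

lemma sp_D: "f : FS ==> sp n (D f) = D (sp n f)"
 unfolding dif_V by (rule sp_der) (simp_all add: d_hyps)

text \<open>Besides the Leibniz rule for the bracket of \<gg> this uses that the anchor commutes
  with the differentials; that accounts for the terms with values in A.\<close>

lemma dif_sbr:
 assumes u: "u : hp V n" and v: "v : hp V m"
 shows "dif V (sbr u v) = sbr (dif V u) v \<oplus>\<^sub>V sg n \<odot>\<^sub>V sbr u (dif V v)"
proof -
 obtain a x b y where uv: "u = (a, x)" "v = (b, y)" and h: "a : hp A n" "x : hp G n" "b : hp A m" "y : hp G m"
  using u v by auto
 note d = A_mod(9)[OF h(1)] G_mod(9)[OF h(2)] A_mod(9)[OF h(3)] G_mod(9)[OF h(4)]
 have 1: "dif A (anchor G x b) = anchor G (dif G x) b \<oplus> ksign A n (anchor G x (dif A b))"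
  using anchor_dif[OF h(2), of b] h anchor_closed[of x] anchor_closed[of "dif G x" b]
  by (simp add: A.minus_eq A.a_assoc A.l_neg)
 have 2: "dif A (anchor G y a) = anchor G (dif G y) a \<oplus> ksign A m (anchor G y (dif A a))"
  using anchor_dif[OF h(4), of a] h anchor_closed[of y] anchor_closed[of "dif G y" a]
  by (simp add: A.minus_eq A.a_assoc A.l_neg)
 have dk: "dif A (ksign A k z) = ksign A k (dif A z)" if "z : car A" for k z
  using that by (simp add: A_ksign dif_A_sc)
 have dm: "dif A (z \<ominus> z') = dif A z \<ominus> dif A z'" if "z : car A" "z' : car A" for z z'
  using that dk[of z' 1] by (simp add: A.minus_eq A_mod(10) ksign_def)
 have "dif A (anchor G x b \<ominus> ksign A (n * m) (anchor G y a)) =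
   (anchor G (dif G x) b \<ominus> ksign A ((n + 1) * m) (anchor G y (dif A a))) \<oplus>
   ksign A n (anchor G x (dif A b) \<ominus> ksign A (n * (m + 1)) (anchor G (dif G y) a))"
  using h by (simp add: dm dk 1 2)
   (cases "even n"; cases "even m"; simp add: ksign_def A.minus_eq A.minus_add A.a_ac)
 moreover have "dif G (bracket G x y) = bracket G (dif G x) y \<oplus>\<^sub>G ksign G n (bracket G x (dif G y))"
  using h by (simp add: bracket_dif)
 ultimately show ?thesis
  using h d by (simp add: uv semi_bracket[OF h] semi_bracket[OF d(1,2) h(3,4)] semi_bracket[OF h(1,2) d(3,4)] A_ksign[symmetric]
    G_ksign[folded sm_def, symmetric] sm_def[symmetric] G_ksign[symmetric])
qed

declare dsum_sel(6) [simp del]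

text \<open>The ideal is arbitrary so that the result applies both to \<open>Ie\<close> and to
  \<open>K\<close>.\<close>

lemma der_env_gens:
 assumes I: "wideal V I" "env_gens <= I" and g: "g : env_gens"
 shows "D g : I"
proof -
 have lI: "linear_rels V <= I" using I by (simp add: env_gens_def)
 consider "g : linear_rels V" | n m u v where "g = word [(n, u)] ** word [(m, v)] - (sc (sg (n * m)) (word [(m, v)] ** word [(n, u)]) + word [(n + m, sbr u v)])"
    "u : hp V n" "v : hp V m"
  using g unfolding env_gens_def by blast
 then show ?thesis
 proof cases
  case 1
  then consider n a b x y where "g = word [(n, (a \<oplus> b, x \<oplus>\<^sub>G y))] - (word [(n, (a, x))] + word [(n, (b, y))])"
    "a : hp A n" "b : hp A n" "x : hp G n" "y : hp G n"
  | n c a x where "g = word [(n, (c \<odot> a, sm c x))] - sc c (word [(n, (a, x))])" "a : hp A n" "x : hp G n"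
   unfolding linear_rels_V by blast
  then show ?thesis
  proof cases
   case (1 n a b x y)
   then have "D g = word [(n + 1, (dif A a \<oplus> dif A b, dif G x \<oplus>\<^sub>G dif G y))] -
     (word [(n + 1, (dif A a, dif G x))] + word [(n + 1, (dif A b, dif G y))])"
    using A_hpart(3)[OF 1(2,3)] M_add[OF 1(4,5)]
    by (simp add: der_diff[of _ V] der_add[of _ V] d_hyps dsum_sel(6))
   then show ?thesis using lr_add[OF I(1) lI] 1 d_hyps by simp
  next
   case (2 n c a x)
   then have "D g = word [(n + 1, (c \<odot> dif A a, sm c (dif G x)))] - sc c (word [(n + 1, (dif A a, dif G x))])"
    by (simp add: der_diff[of _ V] A_smult_hpart d_hyps dsum_sel(6))
   then show ?thesis using lr_sc[OF I(1) lI] 2 d_hyps by simp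
  qed
 next
  case (2 n m u v)
  let ?e = "%n u m v. word [(n, u)] ** word [(m, v)] - (sc (sg (n * m)) (word [(m, v)] ** word [(n, u)]) + word [(n + m, sbr u v)])"
  have e: "?e n u m v : I" if "u : hp V n" "v : hp V m" for n u m v
   apply (rule subsetD[OF I(2)], unfold env_gens_def)
   apply (rule UnI2, rule CollectI, intro exI conjI, rule refl)
   using that by auto
  have uv: "dif V u : hp V (n + 1)" "dif V v : hp V (m + 1)" using 2 D_hpart by blast+
  have d: "D (word [(n, u)] ** word [(m, v)]) = word [(n + 1, dif V u)] ** word [(m, v)] +
    sc (sg n) (word [(n, u)] ** word [(m + 1, dif V v)])"
   if "u : hp V n" "v : hp V m" for n m u v
   using that by (simp add: der_letter_left[of _ V])
  obtain p1 z1 p2 z2 where s: "sbr (dif V u) v = (p1, z1)" "sbr u (dif V v) = (p2, z2)" by fastforce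
  have "sbr (dif V u) v : hp V (n + m + 1)" "sbr u (dif V v) : hp V (n + m + 1)" "sbr u v : hp V (n + m)"
   using semi_bracket_hpart[OF uv(1) 2(3)] semi_bracket_hpart[OF 2(2) uv(2)] semi_bracket_hpart[OF 2(2,3)]
   by (simp_all add: algebra_simps del: dsum_sel)
  from this[unfolded s] have h: "p1 : hp A (n + m + 1)" "z1 : hp G (n + m + 1)" "p2 : hp A (n + m + 1)" "z2 : hp G (n + m + 1)"
   and sf: "word [(n + m, sbr u v)] : FS"
   by auto
  have r: "word [(n + m + 1, dif V (sbr u v))] - (word [(n + m + 1, (p1, z1))] + sc (sg n) (word [(n + m + 1, (p2, z2))])) : I"
  proof -
   have "dif V (sbr u v) = (p1 \<oplus> sg n \<odot> p2, z1 \<oplus>\<^sub>G sm (sg n) z2)"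
    unfolding dif_sbr[OF 2(2,3)] s by (simp add: sm_def)
   then have "word [(n + m + 1, dif V (sbr u v))] - (word [(n + m + 1, (p1, z1))] + word [(n + m + 1, (sg n \<odot> p2, sm (sg n) z2))]) : I"
    using lr_add[OF I(1) lI h(1) _ h(2), of "sg n \<odot> p2" "sm (sg n) z2"] h by (simp add: A_smult_hpart)
   from wideal_add[OF I(1) this lr_sc[OF I(1) lI h(3,4), of "sg n"]] show ?thesis by (simp add: algebra_simps)
  qed
  have "D g = (?e (n + 1) (dif V u) m v + sc (sg n) (?e n u (m + 1) (dif V v))) -
   (word [(n + m + 1, dif V (sbr u v))] - (word [(n + m + 1, (p1, z1))] + sc (sg n) (word [(n + m + 1, (p2, z2))])))"
   unfolding 2(1) using 2(2,3) sf
   by (simp add: der_diff[of _ V] der_add[of _ V] d s sc_add sc_diff sg_add ring_distribs mult_ac algebra_simps)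
  then show ?thesis
   using e[OF uv(1) 2(3)] e[OF 2(2) uv(2)] r by (auto intro!: wideal_diff[OF I(1)] wideal_add[OF I(1)] wideal_sc[OF I(1)])
 qed
qed

lemma hc_gens_K: "g : env_gens \<union> alg_gens ==> \<exists>m. hc m g = g"
proof -
 assume "g : env_gens \<union> alg_gens"
 then consider "g : linear_rels V"
  | n m u v where "g = word [(n, u)] ** word [(m, v)] - (sc (sg (n * m)) (word [(m, v)] ** word [(n, u)]) + word [(n + m, sbr u v)])"
  | n m a b y where "g = word [(n, (a, \<zero>\<^sub>G))] ** word [(m, (b, y))] - word [(n + m, (a \<otimes> b, a \<odot>\<^sub>G y))]"
  unfolding env_gens_def alg_gens_def by blast
 then show ?thesis
 proof cases
  case 1
  then show ?thesis by (intro hc_gens) (simp add: sym_gens_def)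
 next
  case (2 n m u v) then show ?thesis by (intro exI[of _ "n + m"]) (simp add: hc_word word_cm_word)
 next
  case (3 n m a b y) then show ?thesis by (intro exI[of _ "n + m"]) (simp add: hc_word word_cm_word)
 qed
qed

lemma hc_K: "f : K ==> hc n f : K"
 unfolding K_def by (rule hc_Idl[OF gens_FS hc_gens_K])

lemma der_alg_gens: "g : alg_gens ==> D g : K"
proof -
 assume "g : alg_gens"
 then obtain n m a b y where g: "g = word [(n, (a, \<zero>\<^sub>G))] ** word [(m, (b, y))] - word [(n + m, (a \<otimes> b, a \<odot>\<^sub>G y))]"
  and h0: "a : hp A n" "b : hp A m" "y : hp G m"
  unfolding alg_gens_def by blast
 let ?a = "sg n \<odot> a" and ?k = "n + m + 1"
 have h: "dif A a : hp A (n + 1)" "dif A b : hp A (m + 1)" "dif G y : hp G (m + 1)" "?a : hp A n"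
  using h0 d_hyps A_smult_hpart by auto
 have h2: "dif A a \<otimes> b : hp A ?k" "?a \<otimes> dif A b : hp A ?k" "dif A a \<odot>\<^sub>G y : hp G ?k" "?a \<odot>\<^sub>G dif G y : hp G ?k"
  using A_mult[OF h(1) h0(2)] A_mult[OF h(4,2)] M_smult[OF h(1) h0(3)] M_smult[OF h(4,3)] by (simp_all add: algebra_simps)
 have 1: "D g = word [(n + 1, (dif A a, \<zero>\<^sub>G))] ** word [(m, (b, y))] +
   sc (sg n) (word [(n, (a, \<zero>\<^sub>G))] ** word [(m + 1, (dif A b, dif G y))]) -
   word [(?k, (dif A a \<otimes> b \<oplus> ?a \<otimes> dif A b, dif A a \<odot>\<^sub>G y \<oplus>\<^sub>G ?a \<odot>\<^sub>G dif G y))]"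
  unfolding g using h0
  by (simp add: der_diff[of _ V] der_letter_left[of _ V] A_mult M_smult dif_A_mult[OF h0(1,2)] dif_G_smult[OF h0(1,3)] dsum_sel(6))
 have r1: "word [(n + 1, (dif A a, \<zero>\<^sub>G))] ** word [(m, (b, y))] - word [(?k, (dif A a \<otimes> b, dif A a \<odot>\<^sub>G y))] : K"
  using K_alg[OF h(1) h0(2,3)] by (simp add: algebra_simps)
 have r2: "word [(n, (?a, \<zero>\<^sub>G))] ** word [(m + 1, (dif A b, dif G y))] - word [(?k, (?a \<otimes> dif A b, ?a \<odot>\<^sub>G dif G y))] : K"
  using K_alg[OF h(4,2,3)] by (simp add: algebra_simps)
 have r3: "(word [(n, (?a, \<zero>\<^sub>G))] - sc (sg n) (word [(n, (a, \<zero>\<^sub>G))])) ** word [(m + 1, (dif A b, dif G y))] : K"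
  using lr_sc[OF K_ideal lin_K h0(1) M_zero, of "sg n"] h by (intro K_right) auto
 have r4: "word [(?k, (dif A a \<otimes> b \<oplus> ?a \<otimes> dif A b, dif A a \<odot>\<^sub>G y \<oplus>\<^sub>G ?a \<odot>\<^sub>G dif G y))] -
   (word [(?k, (dif A a \<otimes> b, dif A a \<odot>\<^sub>G y))] + word [(?k, (?a \<otimes> dif A b, ?a \<odot>\<^sub>G dif G y))]) : K"
  by (rule lr_add[OF K_ideal lin_K h2])
 from K_diff[OF K_add[OF r1 K_diff[OF r2 r3]] r4] show ?thesis
  unfolding 1 by (simp add: cm_distrib algebra_simps)
qed

lemma D_K: "f : K ==> D f : K"
 unfolding K_def
proof (rule der_Idl[OF gens_FS D_hpart])
 fix g assume g: "g : env_gens \<union> alg_gens"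
 then show "D g : Idl\<^bsub>words V\<^esub> (env_gens \<union> alg_gens)"
  using der_env_gens[OF K_ideal] der_alg_gens gens_K by (auto simp: K_def)
 obtain m where "hc m g = g" using hc_gens_K[OF g] by blast
 then show "tw 1 g : Idl\<^bsub>words V\<^esub> (env_gens \<union> alg_gens)"
  using gens_K g K_sc by (auto simp: tw_hc K_def)
qed

lemma D_Ie: "f : Ie ==> D f : Ie"
 unfolding env_ideal_eq
proof (rule der_Idl[OF env_gens_FS D_hpart])
 fix g assume g: "g : env_gens"
 then show "D g : Idl\<^bsub>words V\<^esub> env_gens"
  using der_env_gens[OF Ie_ideal] gens_Ie by (auto simp: env_ideal_eq)
 obtain m where "hc m g = g" using hc_gens_K[of g] g by blast
 then show "tw 1 g : Idl\<^bsub>words V\<^esub> env_gens"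
  using gens_Ie g wideal_sc[OF Ie_ideal] by (auto simp: tw_hc env_ideal_eq)
qed

lemma pr_Un:
 assumes f: "f : FS" and X: "!!g. g : FS ==> f - g : K ==> X (E.q g) = Y"
 shows "(\<Union>u\<in>pr f. X u) = Y"
proof -
 have "X u = Y" if u: "u : pr f" for u
 proof -
  have "u : carrier E.Q"
   using u EQ.a_r_coset_subset_G[OF J.a_subset, of "E.q f"] f by (auto simp: pr_def' E.Q_carrier)
  then obtain g where g: "u = E.q g" "g : FS" by (auto simp: E.Q_carrier)
  have "pr f = pr g"
   using EQ.a_repr_independence[OF _ _ J.a_subgroup, of u "E.q f"] u f g by (simp add: pr_def' E.Q_carrier)
  then show ?thesis using X[OF g(2)] f g by (simp add: pr_eq)
 qed
 moreover have "E.q f : pr f" using J.a_rcos_self[of "E.q f"] f by (simp add: pr_def' E.Q_carrier)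
 ultimately show ?thesis by blast
qed

lemma U_dif: "f : FS ==> dif U (pr f) = pr (D f)"
proof -
 assume f: "f : FS"
 have "dif U (pr f) = (\<Union>u\<in>pr f. J +>\<^bsub>E.Q\<^esub> dif E.Q u)"
  by (simp add: UEA_def Let_def env_eq)
 also have "\<dots> = pr (D f)"
 proof (rule pr_Un[OF f])
  fix g assume g: "g : FS" "f - g : K"
  then have "D f - D g : K" using D_K[of "f - g"] f by (simp add: der_diff[of _ V])
  then have "D g - D f : K" using K_minus[of "D f - D g"] by simp
  then have "pr (D g) = pr (D f)" by (rule pr_eq[THEN iffD2, OF D_FS[OF g(1)] D_FS[OF f]])
  then show "J +>\<^bsub>E.Q\<^esub> dif E.Q (E.q g) = pr (D f)"
   by (simp only: E.Q_dif[OF g(1) D_FS D_Ie] pr_def')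
 qed
 finally show ?thesis .
qed

subsection \<open>The unit of the enveloping algebra\<close>

lemma anchor_zero [simp]: "a : car A ==> anchor G \<zero>\<^sub>G a = \<zero>"
 using anchor_add[of "\<zero>\<^sub>G" "\<zero>\<^sub>G" a] anchor_closed[of "\<zero>\<^sub>G" a] by (metis A.add.l_cancel_one' G.zero_closed G.l_zero)

lemma anchor_at_zero [simp]: "x : hp G n ==> anchor G x \<zero> = \<zero>"
 using der_zero_A[OF anchor_der] .

lemma anchor_one [simp]: "x : hp G n ==> anchor G x \<one> = \<zero>"
proof -
 assume x: "x : hp G n"
 have "anchor G x \<one> = anchor G x \<one> \<oplus> anchor G x \<one>"
  using derD(4)[OF anchor_der[OF x] A_one A.one_closed] x by (simp add: ksign_def)
 then show ?thesis using x by (metis A.add.l_cancel_one' A.one_closed G_hcarr anchor_closed)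
qed

lemma bracket_zero [simp]: "x : car G ==> bracket G x \<zero>\<^sub>G = \<zero>\<^sub>G" "x : car G ==> bracket G \<zero>\<^sub>G x = \<zero>\<^sub>G"
 using bracket_add(2)[of x "\<zero>\<^sub>G" "\<zero>\<^sub>G"] bracket_add(1)[of "\<zero>\<^sub>G" "\<zero>\<^sub>G" x] bracket_closed
 by (metis G.add.l_cancel_one' G.zero_closed G.l_zero)+

lemma one1_l: "valid V [l] ==> one1 ** word [l] - word [l] : K"
 using K_alg[of "\<one>" 0 "fst (snd l)" "fst l" "snd (snd l)"] G_mod(7) by (cases l) auto

text \<open>The relation for products by elements of A makes the unit of A a left unit. The
  commutator relation carries it to the right, because the bracket of y with it is the anchor of y
  applied to 1, which is 0.\<close>

lemma l_one1: "valid V [l] ==> word [l] ** one1 - word [l] : K"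
proof -
 assume v: "valid V [l]"
 obtain n b y where l: "l = (n, (b, y))" by (cases l) auto
 have h: "b : hp A n" "y : hp G n" using v by (auto simp: l)
 have s: "sbr (b, y) (\<one>, \<zero>\<^sub>G) = (\<zero>, \<zero>\<^sub>G)"
  using h by (simp add: semi_bracket[OF h A_one M_zero] ksign_def A.minus_eq)
 have "word [(n, (b, y))] ** one1 - (one1 ** word [(n, (b, y))] + word [(n, (\<zero>, \<zero>\<^sub>G))]) : K"
  using K_env[of "(b, y)" n "(\<one>, \<zero>\<^sub>G)" 0] h by (simp add: s)
 from K_add[OF K_add[OF this lr_zero[OF K_ideal lin_K, of n]] one1_l[OF v]] show ?thesis by (simp add: l)
qed

lemma FS1_induct [consumes 1, case_names zero word add]:
 assumes "f : FS1" "P 0" "!!c w. valid V w ==> w ~= [] ==> P (sc c (word w))"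
  "!!g h. g : FS1 ==> h : FS1 ==> P g ==> P h ==> P (g + h)"
 shows "P f"
proof -
 have "fs f" using assms(1) FS_fs[of f V] by (simp add: FS1_def)
 then have "f : FS1 --> P f"
 proof (induction rule: fun_fs_induct)
  case (word w)
  have e: "(%v. if v = w then f w else 0) = sc (f w) (word w)"
   by (auto simp: word_apply fapp)
  have "w ~= []" using word assms(1) by (auto simp: FS1_def)
  moreover have "valid V w" using word assms(1) by (auto simp: FS1_def word_carrier_iff valid_def)
  ultimately show ?case unfolding e by (auto intro: assms(3))
 next
  case (add g h)
  then have "g : FS1" "h : FS1"
   using assms(1) by (auto simp: FS1_def word_carrier_iff)
  with add show ?case by (auto intro: assms(4))
 qed (use assms in auto)
 with assms(1) show ?thesis by simp
qed

text \<open>The domain is \<open>FS1\<close> since the empty word is the unit of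
  \<open>env L\<close>, and \<open>K\<close> does not identify that unit with the unit of A.\<close>

lemma one1_left: "f : FS1 ==> one1 ** f - f : K"
proof (induction f rule: FS1_induct)
 case (word c w)
 then obtain l u where w: "w = l # u" by (cases w) auto
 then have v: "valid V [l]" "valid V u" using word by auto
 have "(one1 ** word [l] - word [l]) ** word u : K" using one1_l[OF v(1)] v by (intro K_right) auto
 from K_sc[OF this, of c] show ?case by (simp add: w cm_distrib cm_assoc word_cm_word sc_diff)
next
 case (add g h)
 then show ?case using K_add[OF add(3,4)] by (simp add: cm_distrib algebra_simps)
qed (simp add: K_zero)

lemma one1_right: "f : FS1 ==> f ** one1 - f : K"
proof (induction f rule: FS1_induct)
 case (word c w)
 then obtain u l where w: "w = u @ [l]" by (cases w rule: rev_cases) auto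
 then have v: "valid V [l]" "valid V u" using word by auto
 have "word u ** (word [l] ** one1 - word [l]) : K" using l_one1[OF v(1)] v by (intro K_left) auto
 from K_sc[OF this, of c] show ?case by (simp add: w cm_distrib word_cm_word sc_diff)
next
 case (add g h)
 then show ?case using K_add[OF add(3,4)] by (simp add: cm_distrib algebra_simps)
qed (simp add: K_zero)

lemma one1_FS1: "f : FS ==> one1 ** f : FS1"
 using word_Nil0[of "[(0, (\<one>, \<zero>\<^sub>G))]"] by (auto simp: FS1_def cm_Nil)

end

lemma (in wmod) spw_append: "spw n (u @ w) = (\<Sum>i\<le>n. spw i u ** spw (n - i) w)"
proof (induction u arbitrary: n)
 case Nil
 have "(\<Sum>i\<le>n. spw i [] ** spw (n - i) w) = (\<Sum>i\<in>{0}. spw i [] ** spw (n - i) w)"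
  by (rule sum.mono_neutral_right) auto
 then show ?case by simp
next
 case (Cons l u)
 have d: "(\<Sum>n\<in>T. g ** f n) = g ** (\<Sum>n\<in>T. f n)" for g f and T :: "nat set"
  by (induction T rule: infinite_finite_induct) (auto simp: cm_distrib)
 show ?case
 proof (cases n)
  case 0
  then show ?thesis using Cons[of 0] by (simp add: cm_assoc)
 next
  case (Suc m)
  have "(\<Sum>i\<le>n. spw i (l # u) ** spw (n - i) w) =
    (\<Sum>i\<le>n. lA l ** (spw i u ** spw (n - i) w)) + (\<Sum>i\<le>n. (case i of 0 => 0 | Suc j => lM l ** spw j u) ** spw (n - i) w)"
   by (simp add: cm_distrib cm_assoc sum.distrib)
  also have "(\<Sum>i\<le>n. (case i of 0 => 0 | Suc j => lM l ** spw j u) ** spw (n - i) w) = (\<Sum>j\<le>m. lM l ** (spw j u ** spw (m - j) w))"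
   unfolding Suc by (subst sum.atMost_Suc_shift) (simp add: cm_assoc)
  finally show ?thesis using Cons[of n] Cons[of m] by (simp add: Suc d)
 qed
qed

lemma (in wmod) sp_cm: "f : FS ==> g : FS ==> sp n (f ** g) = (\<Sum>i\<le>n. sp i f ** sp (n - i) g)"
proof (induction f rule: FS_induct)
 case (word c w)
 from word(2,1) show ?case
 proof (induction g rule: FS_induct)
  case (word d u)
  then show ?case by (simp add: cm_distrib word_cm_word spw_append sc_sum)
 qed (simp_all add: cm_distrib sum.distrib)
qed (simp_all add: cm_distrib sum.distrib)

section \<open>The PBW filtration, its associated graded algebra and the canonical map\<close>

context algebroid_loc
begin

declare dsum_sel(6) [simp del]

subsection \<open>The filtration modulo lower terms\<close>

text \<open>The preimage in \<open>FS\<close> of the filtration step below n: combinations of words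
  of weight at most \<open>n - 1\<close>, plus \<open>K\<close>, and \<open>K\<close> alone for
  \<open>n = 0\<close>. Classes in weight n of the associated graded algebra are elements modulo
  \<open>Qb n\<close>.\<close>

definition Qb :: "nat => ('a \<times> 'g) wfun set" where
 "Qb n = (case n of 0 => K | Suc m => {f : FS. \<exists>g\<in>Wle m \<inter> FS1. f - g : K})"

lemma Qb_0 [simp]: "Qb 0 = K"
 by (simp add: Qb_def)

lemma Qb_Suc: "f : Qb (Suc m) \<longleftrightarrow> (\<exists>g k. g : Wle m & g : FS1 & k : K & f = g + k)"
proof
 assume "f : Qb (Suc m)"
 then obtain g where "g : Wle m" "g : FS1" "f - g : K" by (auto simp: Qb_def)
 then show "\<exists>g k. g : Wle m & g : FS1 & k : K & f = g + k"
  by (intro exI[of _ g] exI[of _ "f - g"]) auto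
next
 assume "\<exists>g k. g : Wle m & g : FS1 & k : K & f = g + k"
 then show "f : Qb (Suc m)" using K_FS by (auto simp: Qb_def Wle_FS intro!: bexI)
qed

lemmas FS1_add = wideal_add[OF FS1_wideal] and FS1_sc = wideal_sc[OF FS1_wideal] and FS1_zero = wideal_zero[OF FS1_wideal]
 and FS1_left = wideal_left[OF FS1_wideal] and FS1_right = wideal_right[OF FS1_wideal] and FS1_sum = wideal_sum[OF FS1_wideal]
 and FS1_diff = wideal_diff[OF FS1_wideal]

lemma Qb_FS1: "f : Qb n ==> f : FS1"
 using K_FS1 by (cases n) (auto simp: Qb_Suc intro: FS1_add)

lemma Qb_FS: "f : Qb n ==> f : FS"
 using Qb_FS1 FS1_FS by blast

lemma K_Qb: "f : K ==> f : Qb n"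
proof (cases n)
 case (Suc m)
 assume "f : K"
 then show ?thesis unfolding Suc Qb_Suc by (intro exI[of _ 0] exI[of _ f]) (simp add: FS1_zero)
qed simp

lemma FS1_hc: "f : FS1 ==> hc k f : FS1"
proof -
 assume f: "f : FS1"
 then have "hc k f [] = 0" by (simp add: hc_def FS1_def)
 with f show ?thesis unfolding FS1_def by simp
qed

lemma Qb_add: "f : Qb n ==> g : Qb n ==> f + g : Qb n"
proof (cases n)
 case (Suc m)
 assume "f : Qb n" "g : Qb n"
 then obtain f' k g' k' where "f' : Wle m" "f' : FS1" "k : K" "f = f' + k" "g' : Wle m" "g' : FS1" "k' : K" "g = g' + k'"
  unfolding Suc Qb_Suc by blast
 then show ?thesis unfolding Suc Qb_Suc
  by (intro exI[of _ "f' + g'"] exI[of _ "k + k'"]) (auto intro: FS1_add K_add)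
qed (auto intro: K_add)

lemma Qb_sc: "f : Qb n ==> sc c f : Qb n"
proof (cases n)
 case (Suc m)
 assume "f : Qb n"
 then obtain f' k where "f' : Wle m" "f' : FS1" "k : K" "f = f' + k"
  unfolding Suc Qb_Suc by blast
 then show ?thesis unfolding Suc Qb_Suc
  by (intro exI[of _ "sc c f'"] exI[of _ "sc c k"]) (auto intro: FS1_sc K_sc simp: sc_add)
qed (auto intro: K_sc)

lemma Qb_zero [simp]: "0 : Qb n"
 using K_Qb K_zero by blast

lemma Qb_minus: "f : Qb n ==> - f : Qb n"
 using Qb_sc[of f n "-1"] by simp

lemma Qb_diff: "f : Qb n ==> g : Qb n ==> f - g : Qb n"
 using Qb_add[of f n "- g"] Qb_minus by simp

lemma Qb_sum: "(!!x. x : T ==> f x : Qb n) ==> sum f T : Qb n"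
 by (induction T rule: infinite_finite_induct) (auto intro: Qb_add)

lemma Wle_Qb: "f : Wle m ==> f : FS1 ==> m < n ==> f : Qb n"
proof -
 assume f: "f : Wle m" "f : FS1" "m < n"
 then obtain k where k: "n = Suc k" "m \<le> k" by (cases n) auto
 show ?thesis unfolding k Qb_Suc using f k K_zero by (intro exI[of _ f] exI[of _ 0]) (auto intro: Wle_mono)
qed

lemma Qb_mono: "f : Qb n ==> n \<le> m ==> f : Qb m"
proof (cases n)
 case (Suc k)
 assume "f : Qb n" "n \<le> m"
 then obtain f' k' where "f' : Wle k" "f' : FS1" "k' : K" "f = f' + k'"
  unfolding Suc Qb_Suc by blast
 then have "f' : Qb m" "k' : Qb m" using \<open>n \<le> m\<close> Suc by (auto intro: Wle_Qb[of f' k] K_Qb)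
 then show ?thesis unfolding \<open>f = f' + k'\<close> by (rule Qb_add)
qed (auto intro: K_Qb)

lemma Qb_Wle: "f : Qb i ==> g : Wle j ==> f ** g : Qb (i + j) & g ** f : Qb (j + i)"
proof (cases i)
 case 0
 assume "f : Qb i" "g : Wle j"
 then show ?thesis using 0 by (auto intro: K_Qb K_left K_right Wle_FS)
next
 case (Suc m)
 assume "f : Qb i" and g: "g : Wle j"
 then obtain f' k where f: "f' : Wle m" "f' : FS1" "k : K" "f = f' + k"
  unfolding Suc Qb_Suc by blast
 have "f' ** g : Qb (i + j)" "g ** f' : Qb (j + i)"
  using Wle_Qb[OF Wle_cm[OF f(1) g] FS1_right[OF f(2) Wle_FS[OF g]], of "i + j"]
   Wle_Qb[OF Wle_cm[OF g f(1)] FS1_left[OF f(2) Wle_FS[OF g]], of "j + i"] by (simp_all add: Suc)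
 moreover have "k ** g : Qb (i + j)" "g ** k : Qb (j + i)"
  using f g by (auto intro: K_Qb K_left K_right Wle_FS)
 ultimately show ?thesis by (auto simp: f(4) cm_distrib intro: Qb_add)
qed

lemma Qb_Qb: "f : Qb i ==> g : Qb j ==> f ** g : Qb (i + j)"
proof (cases j)
 case 0
 assume "f : Qb i" "g : Qb j"
 then show ?thesis using 0 by (auto intro: K_Qb K_left Qb_FS)
next
 case (Suc m)
 assume f: "f : Qb i" and "g : Qb j"
 then obtain g' k where g: "g' : Wle m" "g' : FS1" "k : K" "g = g' + k"
  unfolding Suc Qb_Suc by blast
 have "f ** g' : Qb (i + j)" using Qb_Wle[OF f g(1)] Suc by (auto intro: Qb_mono)
 moreover have "f ** k : Qb (i + j)" using f g by (auto intro: K_Qb K_left Qb_FS)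
 ultimately show ?thesis by (auto simp: g(4) cm_distrib intro: Qb_add)
qed

lemma wA_Wle: "a : hp A k ==> word [(k, (a, \<zero>\<^sub>G))] : Wle 0"
 and wM_Wle: "x : hp G k ==> word [(k, (\<zero>, x))] : Wle 1"
 by (auto simp: Wle_word)

lemma al_Wle: "a : car A ==> al a : Wle 0"
 unfolding al_def by (rule Wle_sum) (auto intro: wA_Wle hcomp_hpart[OF grA])

text \<open>The differential of a zero component is zero, so pure letters stay pure; the weight
  drops when the differential of a letter from \<gg> vanishes.\<close>

lemma wder_Wle: "valid V w ==> pure_word A G w ==> wder 1 (dif V) w : Wle (weight G w)"
proof (induction w)
 case (Cons l w)
 obtain k a x where l: "l = (k, (a, x))" by (cases l) auto
 have h: "a : hp A k" "x : hp G k" "a = \<zero> | x = \<zero>\<^sub>G" using Cons(2,3) by (auto simp: l)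
 have d: "dif A a : hp A (k + 1)" "dif G x : hp G (k + 1)" using h d_hyps by auto
 have v: "valid V w" "pure_word A G w" using Cons(2,3) by auto
 have "word [l] : Wle (if x = \<zero>\<^sub>G then 0 else 1)" using h by (auto simp: Wle_word l)
 from Wle_cm[OF this Cons.IH[OF v]] have 1: "word [l] ** wder 1 (dif V) w : Wle (weight G (l # w))" by (simp add: l)
 have 2: "word ((k + 1, dif V (a, x)) # w) : Wle (weight G (l # w))"
  using h d v by (auto simp: Wle_word l dsum_sel(6))
 show ?case using 1 2 by (auto simp: l)
qed simp

lemma Wle_D: "f : Wle m ==> D f : Wle m"
proof (induction f rule: Wle_induct)
 case (word c w)
 then show ?case using Wle_mono[OF wder_Wle[of w], of m] by simp
next
 case (add g h)
 then show ?case using Wle_FS by (simp add: der_add[of _ V])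
qed simp

lemma FS1_D: "f : FS1 ==> D f : FS1"
proof (induction f rule: FS1_induct)
 case (word c w)
 have "valid V w ==> w ~= [] ==> wder 1 (dif V) w : FS1" for w
 proof (cases w)
  case (Cons l u)
  assume v: "valid V w"
  have u: "wder 1 (dif V) u : FS" using v by (intro FS_wder D_hpart) (auto simp: Cons)
  have l: "word [l] : FS1" "word ((fst l + 1, dif V (snd l)) # u) : FS1"
   using v D_hpart[of "snd l" "fst l"] word_Nil0 by (auto simp: FS1_def Cons)
  show ?thesis using FS1_right[OF l(1) u] l(2) by (auto simp: Cons intro!: FS1_add FS1_sc)
 qed simp
 then show ?case using word by (simp add: FS1_sc)
next
 case (add g h)
 then show ?case using FS1_FS by (simp add: der_add[of _ V] FS1_add)
qed (simp add: FS1_zero)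

lemma Qb_D: "f : Qb n ==> D f : Qb n"
proof (cases n)
 case (Suc m)
 assume "f : Qb n"
 then obtain f' k' where f: "f' : Wle m" "f' : FS1" "k' : K" "f = f' + k'"
  unfolding Suc Qb_Suc by blast
 then show ?thesis unfolding Suc Qb_Suc using FS1_FS K_FS
  by (intro exI[of _ "D f'"] exI[of _ "D k'"]) (auto intro: Wle_D D_K FS1_D simp: der_add[of _ V])
qed (auto intro: D_K)

subsection \<open>The associated graded algebra\<close>

lemma PBW_eq: "PBW A G n = pr ` (Wle n \<inter> FS1)"
proof -
 have "{f : carrier (words (dsum A G)). \<forall>w. f w ~= 0 --> w ~= [] & pure_word A G w & weight G w \<le> n} = Wle n \<inter> FS1"
  by (auto simp: Wle_def FS1_def words_sel)
 then show ?thesis by (simp add: PBW_def pr_def)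
qed

lemma PBW_below_eq: "PBW_below A G n = pr ` Qb n"
proof (cases n)
 case 0
 have "pr f = pr 0" if "f : K" for f
  using pr_eq[OF K_FS[OF that] FS_zero] that by simp
 then have "pr ` K = {pr 0}" using K_zero by blast
 then show ?thesis by (simp add: PBW_below_def 0 U_zero)
next
 case (Suc m)
 have "pr (g + k) = pr g" if "g : FS1" "k : K" for g k
  using pr_eq[OF FS_add[OF FS1_FS[OF that(1)] K_FS[OF that(2)]] FS1_FS[OF that(1)]] that by simp
 note e = this
 have "pr ` Qb (Suc m) = pr ` (Wle m \<inter> FS1)"
 proof (intro equalityI subsetI)
  fix z assume "z : pr ` Qb (Suc m)"
  then obtain f where "f : Qb (Suc m)" and z: "z = pr f" by blast
  then obtain g k where g: "g : Wle m" "g : FS1" "k : K" "f = g + k" unfolding Qb_Suc by blast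
  have "z = pr g" unfolding z g(4) by (rule e[OF g(2,3)])
  then show "z : pr ` (Wle m \<inter> FS1)" using g(1,2) by blast
 next
  fix z assume "z : pr ` (Wle m \<inter> FS1)"
  then obtain g where g: "g : Wle m" "g : FS1" and z: "z = pr g" by blast
  have "g : Qb (Suc m)" by (rule Wle_Qb[OF g]) simp
  then show "z : pr ` Qb (Suc m)" unfolding z by (rule imageI)
 qed
 then show ?thesis by (simp add: PBW_below_def Suc PBW_eq)
qed

definition cl where "cl n f = PBW_below A G n +>\<^bsub>U\<^esub> pr f"

text \<open>Elements of the associated graded algebra are sets of classes in \<open>U\<close>; this
  describes them by representatives in the free algebra.\<close>

lemma cl_set: "f : FS ==> cl n f = pr ` {h : FS. h - f : Qb n}"
proof -
 assume f: "f : FS"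
 have "cl n f = (%g. pr (g + f)) ` Qb n"
  using f Qb_FS by (auto simp: cl_def PBW_below_eq a_r_coset_def' U_add image_iff)
 also have "\<dots> = pr ` {h : FS. h - f : Qb n}"
 proof (safe)
  fix g assume "g : Qb n"
  then show "pr (g + f) : pr ` {h : FS. h - f : Qb n}" using f Qb_FS by (intro imageI) auto
 next
  fix h assume "h : FS" "h - f : Qb n"
  then show "pr h : (%g. pr (g + f)) ` Qb n" by (intro image_eqI[of _ _ "h - f"]) auto
 qed
 finally show ?thesis .
qed

lemma cl_mem: "f : FS ==> h : FS ==> pr h : cl n f \<longleftrightarrow> h - f : Qb n"
proof -
 assume f: "f : FS" "h : FS"
 have "h - f : Qb n" if "pr h = pr g" "g : FS" "g - f : Qb n" for g
 proof -
  have "h - g : K" using that f by (simp add: pr_eq)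
  from Qb_add[OF K_Qb[OF this] that(3)] show ?thesis by simp
 qed
 with f show ?thesis by (auto simp: cl_set)
qed

lemma cl_eq: "f : FS ==> g : FS ==> cl n f = cl n g \<longleftrightarrow> f - g : Qb n"
proof
 assume f: "f : FS" "g : FS"
 show "cl n f = cl n g ==> f - g : Qb n"
  using f cl_mem[of g f n] cl_mem[of f f n] by simp
 assume "f - g : Qb n"
 then have "h - f : Qb n \<longleftrightarrow> h - g : Qb n" for h
  using Qb_add[of "h - f" n "f - g"] Qb_diff[of "h - g" n "f - g"] by auto
 then show "cl n f = cl n g" using f by (simp add: cl_set)
qed

lemma cl_eqI: "f : FS ==> g : FS ==> f - g : K ==> cl n f = cl n g"
 by (simp add: cl_eq K_Qb)

lemma cl_zero: "PBW_below A G n = cl n 0"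
proof -
 have "{h : FS. h : Qb n} = Qb n" using Qb_FS by blast
 then show ?thesis by (simp add: cl_set PBW_below_eq)
qed

lemma cl_add: "f : FS ==> g : FS ==> cl n f <+>\<^bsub>U\<^esub> cl n g = cl n (f + g)"
proof -
 assume f: "f : FS" "g : FS"
 have 1: "pr h \<oplus>\<^sub>U pr h' : cl n (f + g)" if "h : FS" "h - f : Qb n" "h' : FS" "h' - g : Qb n" for h h'
  using Qb_add[OF that(2,4)] that f by (simp add: U_add cl_mem algebra_simps)
 have 2: "\<exists>h h'. h : FS & h - f : Qb n & h' : FS & h' - g : Qb n & pr k = pr h \<oplus>\<^sub>U pr h'"
  if "k : FS" "k - (f + g) : Qb n" for k
  using that f by (intro exI[of _ "k - g"] exI[of _ g]) (auto simp: U_add algebra_simps)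
 show ?thesis
 proof (intro equalityI subsetI)
  fix z assume "z : cl n f <+>\<^bsub>U\<^esub> cl n g"
  then obtain x y where "x : cl n f" "y : cl n g" "z = x \<oplus>\<^sub>U y" by (auto simp: set_add_def')
  then show "z : cl n (f + g)" using 1 f by (auto simp: cl_set[of f] cl_set[of g])
 next
  fix z assume "z : cl n (f + g)"
  then obtain k where k: "z = pr k" "k : FS" "k - (f + g) : Qb n" using cl_set[of "f + g"] f by auto
  obtain h h' where h: "h : FS" "h - f : Qb n" "h' : FS" "h' - g : Qb n" "pr k = pr h \<oplus>\<^sub>U pr h'"
   using 2[OF k(2,3)] by blast
  then have "pr h : cl n f" "pr h' : cl n g" using f by (simp_all add: cl_mem)
  then show "z : cl n f <+>\<^bsub>U\<^esub> cl n g" using h(5) k(1) by (auto simp: set_add_def')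
 qed
qed

lemma cl_Un:
 assumes f: "f : FS" and X: "!!h. h : FS ==> h - f : Qb n ==> X (pr h) = Y"
 shows "(\<Union>u\<in>cl n f. X u) = Y"
proof -
 have "X u = Y" if "u : cl n f" for u using that X f by (auto simp: cl_set)
 moreover have "pr f : cl n f" using f by (simp add: cl_mem)
 ultimately show ?thesis by blast
qed

abbreviation "gU \<equiv> grU A G"

text \<open>Elements of the associated graded algebra are handled through families F of
  representatives with \<open>F n\<close> of weight at most n (\<open>gr_carrier\<close>).\<close>

definition gl where "gl F = (%n::nat. cl n (F n))"

lemma gr_carrier: "\<gamma> : carrier gU \<longleftrightarrow> (\<exists>F. (\<forall>n. F n : Wle n \<inter> FS1) & finite {n. F n \<notin> Qb n} & \<gamma> = gl F)"
proof -
 have "\<gamma> : carrier gU \<longleftrightarrow> (\<forall>n. \<exists>f\<in>Wle n \<inter> FS1. \<gamma> n = cl n f) & finite {n. \<gamma> n ~= PBW_below A G n}"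
  by (simp add: grU_def Let_def PBW_eq cl_def)
 also have "\<dots> \<longleftrightarrow> (\<exists>F. (\<forall>n. F n : Wle n \<inter> FS1) & \<gamma> = gl F) & finite {n. \<gamma> n ~= PBW_below A G n}"
  by (auto simp: gl_def fun_eq_iff Bex_def choice_iff)
 also have "\<dots> \<longleftrightarrow> (\<exists>F. (\<forall>n. F n : Wle n \<inter> FS1) & finite {n. F n \<notin> Qb n} & \<gamma> = gl F)"
 proof -
  have "gl F n ~= PBW_below A G n \<longleftrightarrow> F n \<notin> Qb n" if "\<forall>n. F n : Wle n \<inter> FS1" for F n
   using that FS1_FS by (simp add: gl_def cl_zero cl_eq)
  then show ?thesis by auto
 qed
 finally show ?thesis .
qed

lemma gr_add: "(!!n. F n : FS) ==> (!!n. F' n : FS) ==> gl F \<oplus>\<^sub>gU gl F' = gl (%n. F n + F' n)"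
 by (simp add: grU_def Let_def gl_def cl_add)

lemma gr_one: "one gU = gl (%n. if n = 0 then one1 else 0)"
proof -
 have "one gU = (PBW_below A G)(0 := PBW_below A G 0 +>\<^bsub>U\<^esub> \<one>\<^sub>U)" by (simp add: grU_def Let_def)
 then show ?thesis by (auto simp: gl_def fun_eq_iff U_one cl_def[symmetric] cl_zero[symmetric])
qed

lemma gr_smult: "a : car A ==> (!!n. F n : FS) ==> a \<odot>\<^sub>gU gl F = gl (%n. al a ** F n)"
proof
 fix n assume a: "a : car A" and F: "!!n. F n : FS"
 have "(a \<odot>\<^sub>gU gl F) n = (\<Union>u\<in>cl n (F n). PBW_below A G n +>\<^bsub>U\<^esub> (a \<odot>\<^sub>U u))"
  by (simp add: grU_def Let_def gl_def)
 also have "\<dots> = cl n (al a ** F n)"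
 proof (rule cl_Un[OF F])
  fix h assume h: "h : FS" "h - F n : Qb n"
  have "al a ** (h - F n) : Qb n" using Qb_Wle[OF h(2) al_Wle[OF a]] by simp
  then show "PBW_below A G n +>\<^bsub>U\<^esub> (a \<odot>\<^sub>U pr h) = cl n (al a ** F n)"
   using h a F al_FS[OF a] by (simp add: U_smult cl_def[symmetric] cl_eq cm_distrib)
 qed
 finally show "(a \<odot>\<^sub>gU gl F) n = gl (%n. al a ** F n) n" by (simp add: gl_def)
qed

lemma gr_dif: "(!!n. F n : FS) ==> dif gU (gl F) = gl (%n. D (F n))"
proof
 fix n assume F: "!!n. F n : FS"
 have "dif gU (gl F) n = (\<Union>u\<in>cl n (F n). PBW_below A G n +>\<^bsub>U\<^esub> dif U u)"
  by (simp add: grU_def Let_def gl_def)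
 also have "\<dots> = cl n (D (F n))"
 proof (rule cl_Un[OF F])
  fix h assume h: "h : FS" "h - F n : Qb n"
  have "D (h - F n) : Qb n" using Qb_D[OF h(2)] .
  then show "PBW_below A G n +>\<^bsub>U\<^esub> dif U (pr h) = cl n (D (F n))"
   using h F by (simp add: U_dif cl_def[symmetric] cl_eq der_diff[of _ V])
 qed
 finally show "dif gU (gl F) n = gl (%n. D (F n)) n" by (simp add: gl_def)
qed

text \<open>The product is a union over all families of representatives. Replacing \<open>F\<close>
  and \<open>F'\<close> by \<open>h\<close> and \<open>h'\<close> changes a product by
  \<open>(h - F) F' + F (h' - F') + (h - F) (h' - F')\<close>, and each of these terms lies in
  \<open>Qb n\<close>.\<close>

lemma gr_mult:
 assumes F: "!!n. F n : Wle n" "!!n. F n : FS1" and F': "!!n. F' n : Wle n" "!!n. F' n : FS1"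
 shows "gl F \<otimes>\<^sub>gU gl F' = gl (%n. \<Sum>i\<le>n. F i ** F' (n - i))"
proof
 fix n
 let ?X = "%u v. PBW_below A G n +>\<^bsub>U\<^esub> (\<Oplus>\<^bsub>U\<^esub>i\<in>{..n}. u i \<otimes>\<^sub>U v (n - i))"
 let ?R = "cl n (\<Sum>i\<le>n. F i ** F' (n - i))"
 have FS: "F n : FS" "F' n : FS" for n using F F' FS1_FS by auto
 have X: "?X u v = ?R" if u: "u : Pi UNIV (gl F)" and v: "v : Pi UNIV (gl F')" for u v
 proof -
  have "\<exists>h. h : FS & h - F i : Qb i & u i = pr h" for i
  proof -
   have "u i : cl i (F i)" using u by (simp add: gl_def Pi_def)
   then show ?thesis using cl_set[OF FS(1)] by auto
  qed
  then obtain h where h: "!!i. h i : FS" "!!i. h i - F i : Qb i" "!!i. u i = pr (h i)" by metis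
  have "\<exists>h. h : FS & h - F' i : Qb i & v i = pr h" for i
  proof -
   have "v i : cl i (F' i)" using v by (simp add: gl_def Pi_def)
   then show ?thesis using cl_set[OF FS(2)] by auto
  qed
  then obtain h' where h': "!!i. h' i : FS" "!!i. h' i - F' i : Qb i" "!!i. v i = pr (h' i)" by metis
  have h1: "h i : FS1" for i using FS1_add[OF Qb_FS1[OF h(2)[of i]] F(2)[of i]] by simp
  have "(\<Oplus>\<^bsub>U\<^esub>i\<in>{..n}. u i \<otimes>\<^sub>U v (n - i)) = (\<Oplus>\<^bsub>U\<^esub>i\<in>{..n}. pr (h i ** h' (n - i)))"
   using h h' by (simp add: U_mult)
  also have "\<dots> = pr (\<Sum>i\<le>n. h i ** h' (n - i))"
   by (rule U_finsum) (use h1 h'(1) FS1_right in auto)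
  finally have e: "?X u v = cl n (\<Sum>i\<le>n. h i ** h' (n - i))" by (simp add: cl_def)
  have "h i ** h' (n - i) - F i ** F' (n - i) : Qb n" if "i \<le> n" for i
  proof -
   have "(h i - F i) ** F' (n - i) : Qb n" "F i ** (h' (n - i) - F' (n - i)) : Qb n"
    "(h i - F i) ** (h' (n - i) - F' (n - i)) : Qb n"
    using Qb_Wle[OF h(2)[of i] F'(1)[of "n - i"]] Qb_Wle[OF h'(2)[of "n - i"] F(1)[of i]]
     Qb_Qb[OF h(2)[of i] h'(2)[of "n - i"]] that by auto
   from Qb_add[OF Qb_add[OF this(1,2)] this(3)] show ?thesis by (simp add: cm_distrib algebra_simps)
  qed
  then have "(\<Sum>i\<le>n. h i ** h' (n - i) - F i ** F' (n - i)) : Qb n" by (intro Qb_sum) auto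
  then show ?thesis unfolding e using h h' FS by (subst cl_eq) (auto simp: sum_subtractf)
 qed
 have "(%i. pr (F i)) : Pi UNIV (gl F)" "(%i. pr (F' i)) : Pi UNIV (gl F')"
  using FS by (auto simp: gl_def cl_mem)
 then have "(\<Union>u\<in>Pi UNIV (gl F). \<Union>v\<in>Pi UNIV (gl F'). ?X u v) = ?R" using X by blast
 then show "(gl F \<otimes>\<^sub>gU gl F') n = gl (%n. \<Sum>i\<le>n. F i ** F' (n - i)) n"
  by (simp add: grU_def Let_def gl_def)
qed

text \<open>A class that is both of filtration n and homogeneous of degree k has one representative
  with both properties: the component of degree k of a representative of weight at most n. This
  works because \<open>K\<close> is homogeneous.\<close>

lemma gr_hpart: "\<gamma> : hpart gU k \<longleftrightarrow> \<gamma> : carrier gU & (\<forall>n. \<exists>f\<in>Wle n \<inter> FS1. hc k f = f & \<gamma> n = cl n f)"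
proof -
 have "(\<exists>u\<in>PBW A G n \<inter> hp U k. \<gamma> n = PBW_below A G n +>\<^bsub>U\<^esub> u) \<longleftrightarrow> (\<exists>f\<in>Wle n \<inter> FS1. hc k f = f & \<gamma> n = cl n f)" for n
 proof
  assume "\<exists>u\<in>PBW A G n \<inter> hp U k. \<gamma> n = PBW_below A G n +>\<^bsub>U\<^esub> u"
  then obtain u where u: "u : PBW A G n" "u : hp U k" "\<gamma> n = PBW_below A G n +>\<^bsub>U\<^esub> u" by blast
  then obtain f g where f: "f : Wle n" "f : FS1" "u = pr f" and g: "g : FS1" "hc k g = g" "u = pr g"
   by (auto simp: PBW_eq U_hpart)
  have "f - g : K" using f g pr_eq FS1_FS by metis
  then have "hc k f - g : K" using hc_K[of "f - g" k] g(2) by simp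
  then have "pr (hc k f) = u" unfolding g(3) using f g FS1_FS by (subst pr_eq) auto
  moreover have "hc k f : Wle n \<inter> FS1" using f hc_Wle FS1_hc by blast
  ultimately show "\<exists>f\<in>Wle n \<inter> FS1. hc k f = f & \<gamma> n = cl n f"
   using u by (intro bexI[of _ "hc k f"]) (auto simp: cl_def hc_hc)
 next
  assume "\<exists>f\<in>Wle n \<inter> FS1. hc k f = f & \<gamma> n = cl n f"
  then show "\<exists>u\<in>PBW A G n \<inter> hp U k. \<gamma> n = PBW_below A G n +>\<^bsub>U\<^esub> u"
   by (auto simp: PBW_eq U_hpart cl_def)
 qed
 then show ?thesis by (simp add: grU_def Let_def)
qed

lemma gr_wpart: "\<gamma> : wpart gU n \<longleftrightarrow> \<gamma> : carrier gU & (\<forall>m. m ~= n --> \<gamma> m = cl m 0)"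
 by (simp add: grU_def Let_def cl_zero)

end

context algebroid_loc
begin

subsection \<open>The canonical map\<close>

sublocale SQ: wquot V S
 by unfold_locales (rule S_ideal)

abbreviation "sq \<equiv> SQ.q"
abbreviation "Sy \<equiv> Sym A G"

lemma Sy_sel: "carrier Sy = sq ` FS" "zero Sy = sq 0" "one Sy = sq (word [])"
 "f : FS ==> g : FS ==> sq f \<oplus>\<^sub>Sy sq g = sq (f + g)"
 "f : FS ==> g : FS ==> sq f \<otimes>\<^sub>Sy sq g = sq (f ** g)"
 "hpart Sy k = sq ` {f : FS. hc k f = f}"
 "f : FS ==> dif Sy (sq f) = sq (D f)"
 "wpart Sy n = sq ` Weq n"
 using SQ.Q_carrier SQ.Q_zero SQ.Q_one SQ.Q_add SQ.Q_mult SQ.Q_hpart SQ.Q_dif[OF _ D_FS D_S]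
 by (simp_all add: Sym_def Let_def Weq_def SQ.q_def[abs_def] words_sel)

lemma Sy_smult:
 assumes a: "a : car A" and f: "f : FS"
 shows "a \<odot>\<^sub>Sy sq f = sq (al a ** f)"
proof -
 have T: "finite T ==> (\<Oplus>\<^bsub>words V\<^esub>n\<in>T. letter n (hcomp A a n, \<zero>\<^sub>G)) = (\<Sum>n\<in>T. word [(n, (hcomp A a n, \<zero>\<^sub>G))])" for T
 proof (induction T rule: finite_induct)
  case (insert n T)
  have w: "word [(k, (hcomp A a k, \<zero>\<^sub>G))] : FS" for k using hcomp_hpart[OF grA a] by simp
  with insert show ?case by (subst E.W.finsum_insert) (auto simp: words_sel letter_def)
 qed (simp add: words_sel(4))
 have "a \<odot>\<^sub>Sy sq f = (\<Union>g\<in>sq f. sq (al a ** g))"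
  using T[OF finite_hsupp[OF grA a]] by (simp add: Sym_def Let_def SQ.q_def al_def words_sel)
 also have "\<dots> = sq (al a ** f)"
 proof (rule SQ.Un_q[OF f])
  fix g h assume gh: "g : FS" "h : FS" "g - h : S"
  have "al a ** (g - h) : S" by (rule S_left[OF gh(3) al_FS[OF a]])
  then show "sq (al a ** g) = sq (al a ** h)"
   using gh al_FS[OF a] by (subst SQ.q_eq) (auto simp: cm_distrib)
 qed
 finally show ?thesis .
qed

text \<open>The factor \<open>one1\<close> represents the unit of \<open>U\<close> and moves every
  component into \<open>FS1\<close>. In particular it takes care of the empty word, which is the
  unit of \<open>Sym\<close> but does not belong to \<open>FS1\<close>.\<close>

definition psi where "psi f = gl (%n. one1 ** sp n f)"

lemma one1_FS [simp]: "one1 : FS"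
 by simp

lemma one1_cm: "f : FS1 ==> h : FS ==> (f ** one1) ** h - f ** h : K" "f : FS1 ==> h : FS ==> (one1 ** f) ** h - f ** h : K"
 using K_right[OF one1_right, of f h] K_right[OF one1_left, of f h] by (simp_all add: cm_distrib)

lemma one1_Qb: "f : Qb n ==> one1 ** f : Qb n"
 using Qb_Wle[of f n one1 0] wA_Wle[OF A_one] by simp

lemma FS1_letter: "valid V [l] ==> word [l] : FS1"
 using word_Nil0[of "[l]"] by (simp add: FS1_def)

lemma K_comm:
 assumes u: "(a, x) : hp V k" and v: "(b, y) : hp V m"
 shows "\<exists>p z. (p, z) : hp V (k + m) & sbr (a, x) (b, y) = (p, z) & z = bracket G x y \<and>
  p = anchor G x b \<ominus> ksign A (k * m) (anchor G y a) \<and>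
  (word [(k, (a, x))] ** word [(m, (b, y))] - sc (sg (k * m)) (word [(m, (b, y))] ** word [(k, (a, x))])) - word [(k + m, (p, z))] : K"
proof -
 have h: "a : hp A k" "x : hp G k" "b : hp A m" "y : hp G m" using u v by auto
 show ?thesis
  using K_env[OF u v] semi_bracket[OF h] semi_bracket_hpart[OF u v]
  by (intro exI conjI) (auto simp: algebra_simps)
qed

text \<open>The relations of \<open>Sym\<close> hold in \<open>U\<close> up to lower terms: a
  commutator equals a bracket, whose weight is one less than that of the product, and the two units
  are identified after multiplication by \<open>one1\<close>.\<close>

lemma psi_S: "f : S ==> one1 ** sp n f : Qb n"
proof -
 assume "f : S"
 have cA: "valid V [l] ==> f : FS ==> one1 ** (word [l] ** f) - word [l] ** (one1 ** f) : K" for l f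
  using K_diff[OF one1_cm(2)[of "word [l]" f] one1_cm(1)[of "word [l]" f]] FS1_letter[of l] by (simp add: cm_assoc)
 \<comment> \<open>With \<open>one1\<close> built into the target family, multiplication by a letter
   on the right is immediate; on the left, \<open>cA\<close> moves the letter past
   \<open>one1\<close>.\<close>
 have "sp n f : {f : FS. one1 ** f : Qb n}"
 proof (rule sp_Idl[OF sym_gens_FS, where Q = "%n. {f : FS. one1 ** f : Qb n}"])
  show "f : Idl\<^bsub>words V\<^esub> sym_gens" using \<open>f : S\<close> by (simp add: sym_ideal_eq)
 next
  fix g n assume "g : sym_gens"
  then have gFS: "g : FS" using sym_gens_FS by blast
  consider "g : linear_rels V"
  | k m a x b y where "g = word [(k, (a, x))] ** word [(m, (b, y))] - sc (sg (k * m)) (word [(m, (b, y))] ** word [(k, (a, x))])"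
    "(a, x) : hp V k" "(b, y) : hp V m"
  | "g = one1 - word []"
  | k m a b y where "g = word [(k, (a, \<zero>\<^sub>G))] ** word [(m, (b, y))] - word [(k + m, (a \<otimes> b, a \<odot>\<^sub>G y))]"
    "a : hp A k" "b : hp A m" "y : hp G m"
   using \<open>g : sym_gens\<close> unfolding sym_gens_def by auto
  then have "one1 ** sp n g : Qb n"
  proof cases
   case 1
   then show ?thesis using sp_gens_lin[OF 1 K_ideal lin_K, of n] by (intro one1_Qb K_Qb)
  next
   case (2 k m a x b y)
   have h: "a : hp A k" "x : hp G k" "b : hp A m" "y : hp G m" using 2 by auto
   let ?c = "%u v. word [(k, u)] ** word [(m, v)] - sc (sg (k * m)) (word [(m, v)] ** word [(k, u)])"
   have e: "sp n g = (if n = 0 then ?c (a, \<zero>\<^sub>G) (b, \<zero>\<^sub>G) else if n = 1 then ?c (a, \<zero>\<^sub>G) (\<zero>, y) + ?c (\<zero>, x) (b, \<zero>\<^sub>G)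
     else if n = 2 then ?c (\<zero>, x) (\<zero>, y) else 0)"
    using 2(2,3) by (auto simp: 2(1) sp_left cm_distrib sc_add algebra_simps numeral_2_eq_2 split: nat.split)
   have 0: "?c (a, \<zero>\<^sub>G) (b, \<zero>\<^sub>G) : K"
   proof -
    have "?c (a, \<zero>\<^sub>G) (b, \<zero>\<^sub>G) - word [(k + m, (\<zero>, \<zero>\<^sub>G))] : K"
     using K_comm[of a "\<zero>\<^sub>G" k b "\<zero>\<^sub>G" m] h by (auto simp: ksign_def A.minus_eq split: if_splits)
    from K_add[OF this lr_zero[OF K_ideal lin_K, of "k + m"]] show ?thesis by simp
   qed
   have w1: "word [(k + m, (p, \<zero>\<^sub>G))] : Qb 1" if "p : hp A (k + m)" for p
    using that by (intro Wle_Qb[of _ 0] wA_Wle FS1_letter) auto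
   have 1: "?c (a, \<zero>\<^sub>G) (\<zero>, y) : Qb 1"
   proof -
    obtain p where "p : hp A (k + m)" "?c (a, \<zero>\<^sub>G) (\<zero>, y) - word [(k + m, (p, \<zero>\<^sub>G))] : K"
     using K_comm[of a "\<zero>\<^sub>G" k "\<zero>" y m] h by auto
    from Qb_add[OF K_Qb[OF this(2)] w1[OF this(1)]] show ?thesis by simp
   qed
   have 2: "?c (\<zero>, x) (b, \<zero>\<^sub>G) : Qb 1"
   proof -
    obtain p where "p : hp A (k + m)" "?c (\<zero>, x) (b, \<zero>\<^sub>G) - word [(k + m, (p, \<zero>\<^sub>G))] : K"
     using K_comm[of "\<zero>" x k b "\<zero>\<^sub>G" m] h by auto
    from Qb_add[OF K_Qb[OF this(2)] w1[OF this(1)]] show ?thesis by simp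
   qed
   have 3: "?c (\<zero>, x) (\<zero>, y) : Qb 2"
   proof -
    obtain z where z: "z : hp G (k + m)" "?c (\<zero>, x) (\<zero>, y) - word [(k + m, (\<zero>, z))] : K"
     using K_comm[of "\<zero>" x k "\<zero>" y m] h by (auto simp: ksign_def A.minus_eq split: if_splits)
    have "word [(k + m, (\<zero>, z))] : Qb 2"
     using z(1) by (intro Wle_Qb[of _ 1] wM_Wle FS1_letter) auto
    from Qb_add[OF K_Qb[OF z(2)] this] show ?thesis by simp
   qed
   have "sp n g : Qb n" unfolding e using 0 3 Qb_add[OF 1 2] by (auto simp: numeral_2_eq_2)
   then show ?thesis by (rule one1_Qb)
  next
   case 3
   have "sp n g = (if n = 0 then one1 - word [] else if n = 1 then word [(0, (\<zero>, \<zero>\<^sub>G))] else 0)"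
    by (auto simp: 3 split: nat.split)
   moreover have "one1 ** (one1 - word []) : K"
    using one1_left[of one1] FS1_letter[of "(0, (\<one>, \<zero>\<^sub>G))"] by (simp add: cm_distrib)
   ultimately show ?thesis using lr_zero[OF K_ideal lin_K, of 0]
    by (auto intro: K_Qb one1_Qb)
  next
   case (4 k m a b y)
   have e: "sp n g = (if n = 0 then word [(k, (a, \<zero>\<^sub>G))] ** word [(m, (b, \<zero>\<^sub>G))] - word [(k + m, (a \<otimes> b, a \<odot>\<^sub>G \<zero>\<^sub>G))]
     else if n = 1 then word [(k, (a, \<zero>\<^sub>G))] ** word [(m, (\<zero>, y))] - word [(k + m, (a \<otimes> \<zero>, a \<odot>\<^sub>G y))]
      + word [(k, (\<zero>, \<zero>\<^sub>G))] ** word [(m, (b, \<zero>\<^sub>G))]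
     else if n = 2 then word [(k, (\<zero>, \<zero>\<^sub>G))] ** word [(m, (\<zero>, y))] else 0)"
    using 4(2-) by (auto simp: 4(1) sp_left cm_distrib A_mult M_smult M_smult_zero[OF 4(2)] numeral_2_eq_2 split: nat.split)
   have "sp n g : K" unfolding e using 4(2-) K_alg[OF 4(2,3) M_zero] K_alg[OF 4(2) A_zero 4(4)]
     lr_zero[OF K_ideal lin_K, of k] K_zero by (auto intro!: K_add K_right)
   then show ?thesis by (intro one1_Qb K_Qb)
  qed
  then show "sp n g : {f : FS. one1 ** f : Qb n}" using gFS by simp
 next
  fix n f k a assume f: "f : {f : FS. one1 ** f : Qb n}" and a: "a : hp A k"
  let ?l = "(k, (a, \<zero>\<^sub>G))"
  have "word [?l] ** (one1 ** f) : Qb n" using Qb_Wle[of "one1 ** f" n _ 0] wA_Wle[OF a] f by auto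
  from Qb_add[OF K_Qb[OF cA[of ?l f]] this] show "word [?l] ** f : {f : FS. one1 ** f : Qb n}"
   using f a by simp
  have "one1 ** f ** word [?l] : Qb n" using Qb_Wle[of "one1 ** f" n _ 0] wA_Wle[OF a] f by auto
  then show "f ** word [?l] : {f : FS. one1 ** f : Qb n}"
   using f a by (simp add: cm_assoc)
 next
  fix n f k x assume f: "f : {f : FS. one1 ** f : Qb n}" and x: "x : hp G k"
  let ?l = "(k, (\<zero>, x))"
  have "word [?l] ** (one1 ** f) : Qb (Suc n)" using Qb_Wle[of "one1 ** f" n _ 1] wM_Wle[OF x] f by auto
  from Qb_add[OF K_Qb[OF cA[of ?l f]] this] show "word [?l] ** f : {f : FS. one1 ** f : Qb (Suc n)}"
   using f x by simp
  have "one1 ** f ** word [?l] : Qb (Suc n)" using Qb_Wle[of "one1 ** f" n _ 1] wM_Wle[OF x] f by auto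
  then show "f ** word [?l] : {f : FS. one1 ** f : Qb (Suc n)}"
   using f x by (simp add: cm_assoc)
 qed (auto simp: cm_distrib intro: Qb_add Qb_sc)
 then show ?thesis by simp
qed

lemma psi_F: "f : FS ==> one1 ** sp n f : Wle n" "f : FS ==> one1 ** sp n f : FS1" "f : FS ==> one1 ** sp n f : FS"
 using Wle_cm[OF wA_Wle[OF A_one] sp_Wle, of f n] one1_FS1[of "sp n f"] by auto

lemma gl_eqI: "(!!n. F n : FS) ==> (!!n. F' n : FS) ==> (!!n. F n - F' n : Qb n) ==> gl F = gl F'"
 unfolding gl_def by (rule ext) (simp add: cl_eq)

lemma gl_eqK: "(!!n. F n : FS) ==> (!!n. F' n : FS) ==> (!!n. F n - F' n : K) ==> gl F = gl F'"
 by (intro gl_eqI K_Qb)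

lemma psi_eq: "f : FS ==> g : FS ==> f - g : S ==> psi f = psi g"
 unfolding psi_def using psi_S[of "f - g"] by (intro gl_eqI psi_F) (auto simp: cm_distrib)

definition phi where "phi = (\<lambda>C\<in>carrier Sy. psi (SOME f. f : FS & C = sq f))"

lemma phi_sq: "f : FS ==> phi (sq f) = psi f"
proof -
 assume f: "f : FS"
 let ?g = "SOME g. g : FS & sq f = sq g"
 have "?g : FS & sq f = sq ?g" by (rule someI[of _ f]) (use f in simp)
 then have "f - ?g : S" "?g : FS" using SQ.q_eq f by auto
 then show ?thesis using psi_eq[OF f] f by (simp add: phi_def Sy_sel(1))
qed

lemma psi_carrier: "f : FS ==> psi f : carrier gU"
proof -
 assume f: "f : FS"
 obtain N0 where N: "\<forall>n\<ge>N0. sp n f = 0" using sum_sp[OF f K_ideal lin_K] by blast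
 have "finite {n. one1 ** sp n f \<notin> Qb n}"
  by (rule finite_subset[of _ "{..<N0}"]) (use N in \<open>auto simp: not_le[symmetric]\<close>)
 then show ?thesis unfolding gr_carrier psi_def
  by (intro exI[of _ "%n. one1 ** sp n f"] conjI) (use psi_F[OF f] in auto)
qed

lemma psi_add: "f : FS ==> g : FS ==> psi (f + g) = psi f \<oplus>\<^sub>gU psi g"
 by (simp add: psi_def gr_add psi_F(3) cm_distrib)

lemma psi_one: "psi (word []) = \<one>\<^sub>gU"
proof -
 have "(%n. one1 ** sp n (word [])) = (%n. if n = 0 then one1 else 0)" by auto
 then show ?thesis by (simp only: psi_def gr_one)
qed

text \<open>Weight components of a product are Cauchy sums, and so are products in the associated
  graded algebra. The two factors \<open>one1\<close> are merged into one modulo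
  \<open>K\<close>.\<close>

lemma psi_mult: "f : FS ==> g : FS ==> psi (f ** g) = psi f \<otimes>\<^sub>gU psi g"
proof -
 assume f: "f : FS" and g: "g : FS"
 have d: "(\<Sum>n\<in>T. h ** F n) = h ** (\<Sum>n\<in>T. F n)" for h F and T :: "nat set"
  by (induction T rule: infinite_finite_induct) (auto simp: cm_distrib)
 have "psi f \<otimes>\<^sub>gU psi g = gl (%n. \<Sum>i\<le>n. (one1 ** sp i f) ** (one1 ** sp (n - i) g))"
  unfolding psi_def by (rule gr_mult) (use f g psi_F in auto)
 also have "\<dots> = gl (%n. one1 ** sp n (f ** g))"
 proof (rule gl_eqK)
  fix n
  have "(one1 ** sp i f) ** (one1 ** sp (n - i) g) - one1 ** (sp i f ** sp (n - i) g) : K" for i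
   using one1_cm(1)[OF psi_F(2)[OF f, of i] FS_sp[OF g, of "n - i"]] by (simp add: cm_assoc)
  then have "(\<Sum>i\<le>n. (one1 ** sp i f) ** (one1 ** sp (n - i) g) - one1 ** (sp i f ** sp (n - i) g)) : K"
   by (intro K_sum)
  then show "(\<Sum>i\<le>n. (one1 ** sp i f) ** (one1 ** sp (n - i) g)) - one1 ** sp n (f ** g) : K"
   by (simp add: sp_cm[OF f g] sum_subtractf d)
 qed (use f g psi_F in auto)
 finally show ?thesis by (simp add: psi_def)
qed

text \<open>The letters of \<open>al a\<close> have second part zero, so the extra term in the
  expansion of the product contains a zero letter.\<close>

lemma sp_al: "a : car A ==> f : FS ==> sp n (al a ** f) - al a ** sp n f : K"
proof -
 assume a: "a : car A" and f: "f : FS"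
 define w where "w k = word [(k, (hcomp A a k, \<zero>\<^sub>G))]" for k
 have v: "valid V [(k, (hcomp A a k, \<zero>\<^sub>G))]" for k using hcomp_hpart[OF grA a] by simp
 then have wF: "w k : FS" for k by (simp add: w_def)
 have 1: "sp n (w k ** f) - w k ** sp n f : K" for k
  using v[of k] K_right[OF lr_zero[OF K_ideal lin_K, of k] FS_sp[OF f]] K_zero
  by (auto simp: w_def sp_left[OF f] split: nat.split)
 have "sp n ((\<Sum>k\<in>T. w k) ** f) - (\<Sum>k\<in>T. w k) ** sp n f : K" for T
 proof (induction T rule: infinite_finite_induct)
  case (insert k T)
  have "sp n ((\<Sum>k\<in>insert k T. w k) ** f) - (\<Sum>k\<in>insert k T. w k) ** sp n f =
   (sp n (w k ** f) - w k ** sp n f) + (sp n ((\<Sum>k\<in>T. w k) ** f) - (\<Sum>k\<in>T. w k) ** sp n f)"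
   using insert(1,2) wF f by (simp add: cm_distrib)
  then show ?case using K_add[OF 1 insert(3)] by simp
 qed (simp_all add: K_zero)
 then show ?thesis by (simp add: al_def w_def)
qed

lemma psi_smult: "a : car A ==> f : FS ==> psi (al a ** f) = a \<odot>\<^sub>gU psi f"
proof -
 assume a: "a : car A" and f: "f : FS"
 have "a \<odot>\<^sub>gU psi f = gl (%n. al a ** (one1 ** sp n f))"
  unfolding psi_def by (rule gr_smult) (use a psi_F(3)[OF f] in auto)
 also have "\<dots> = gl (%n. one1 ** sp n (al a ** f))"
 proof (rule gl_eqK)
  fix n
  have 1: "(al a ** one1) ** sp n f - al a ** sp n f : K" "(one1 ** al a) ** sp n f - al a ** sp n f : K"
   by (rule one1_cm; use al_FS1[OF a] f in simp)+
  have 2: "one1 ** (sp n (al a ** f) - al a ** sp n f) : K" by (rule K_left[OF sp_al[OF a f] one1_FS])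
  from K_diff[OF K_diff[OF 1] 2] show "al a ** (one1 ** sp n f) - one1 ** sp n (al a ** f) : K"
   by (simp add: cm_distrib cm_assoc)
 qed (use al_FS[OF a] f psi_F in auto)
 finally show ?thesis by (simp add: psi_def)
qed

lemma psi_dif: "f : FS ==> psi (D f) = dif gU (psi f)"
proof -
 assume f: "f : FS"
 have d1: "dif A \<one> = \<zero>"
  by (rule dA_one[of "dif A" 1 "dif G"]) (simp_all add: d_hyps)
 have dv: "dif V (\<one>, \<zero>\<^sub>G) = (\<zero>, \<zero>\<^sub>G)" by (simp add: dsum_sel(6) d1)
 have "dif gU (psi f) = gl (%n. D (one1 ** sp n f))"
  unfolding psi_def by (rule gr_dif) (use psi_F(3)[OF f] in auto)
 also have "\<dots> = gl (%n. one1 ** sp n (D f))"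
 proof (rule gl_eqK)
  fix n
  have "word [(1, (\<zero>, \<zero>\<^sub>G))] ** sp n f : K" using K_right[OF lr_zero[OF K_ideal lin_K]] f by simp
  then show "D (one1 ** sp n f) - one1 ** sp n (D f) : K"
   using f by (simp add: der_letter_left[of _ V] sp_D dv)
 qed (use f in \<open>auto simp del: der_add\<close>)
 finally show ?thesis by (simp add: psi_def)
qed

lemma psi_hpart: "f : FS ==> hc k f = f ==> psi f : hpart gU k"
proof -
 assume f: "f : FS" "hc k f = f"
 have "hc k (one1 ** sp n f) = one1 ** sp n f" for n
  using f sp_hc[OF f(1), of k n] by (simp add: hc_letter_left[of _ V])
 then show ?thesis unfolding gr_hpart using psi_carrier[OF f(1)] psi_F[OF f(1)]
  by (auto simp: psi_def gl_def)
qed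

lemma psi_wpart: "f : Weq n ==> psi f : wpart gU n"
proof -
 assume f: "f : Weq n"
 then have fF: "f : FS" by (simp add: Weq_def)
 have "one1 ** sp m f : K" if "m ~= n" for m
  using sp_Weq[OF K_ideal lin_K f, of m] that K_left by simp
 then have "cl m (one1 ** sp m f) = cl m 0" if "m ~= n" for m
  using that by (intro cl_eqI psi_F(3)[OF fF]) auto
 then show ?thesis unfolding gr_wpart using psi_carrier[OF fF]
  by (simp add: psi_def gl_def)
qed

lemma psi_letter: "x : hp G k ==> psi (letter k (\<zero>, x)) =
  (PBW_below A G)(1 := PBW A G 0 +>\<^bsub>U\<^esub> UEA_proj A G (letter k (\<zero>, x)))"
proof
 fix n assume x: "x : hp G k"
 let ?w = "word [(k, (\<zero>, x))]"
 have B: "PBW A G 0 = PBW_below A G 1" by (simp add: PBW_below_def)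
 have "one1 ** sp n ?w - (if n = 1 then ?w else 0) : K"
  using one1_l[of "(k, (\<zero>, x))"] K_left[OF lr_zero[OF K_ideal lin_K, of k] one1_FS] x K_zero
  by (auto split: nat.split)
 moreover have "one1 ** sp n ?w : FS" by (rule psi_F(3)) (use x in simp)
 moreover have "(if n = 1 then ?w else 0) : FS" using x by simp
 ultimately have "cl n (one1 ** sp n ?w) = cl n (if n = 1 then ?w else 0)"
  by (intro cl_eqI)
 then show "psi (letter k (\<zero>, x)) n = ((PBW_below A G)(1 := PBW A G 0 +>\<^bsub>U\<^esub> UEA_proj A G (letter k (\<zero>, x)))) n"
  by (auto simp: psi_def gl_def letter_def B pr_def[symmetric] cl_def[symmetric] cl_zero[symmetric])
qed

lemma phi_hom: "graded_dg_algebra_hom A Sy gU phi"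
proof -
 have "phi : ring_hom Sy gU"
  unfolding ring_hom_def by (auto simp: Sy_sel phi_sq psi_carrier psi_mult psi_add psi_one)
 moreover have "phi x : hpart gU n" if x: "x : hpart Sy n" for n x
 proof -
  obtain f where "f : FS" "hc n f = f" "x = sq f" using x unfolding Sy_sel(6) by blast
  then show ?thesis using psi_hpart phi_sq by simp
 qed
 moreover have "phi (a \<odot>\<^sub>Sy x) = a \<odot>\<^sub>gU phi x" if a: "a : car A" and x: "x : carrier Sy" for a x
 proof -
  obtain f where f: "f : FS" "x = sq f" using x unfolding Sy_sel(1) by blast
  have "phi (a \<odot>\<^sub>Sy x) = psi (al a ** f)"
   using f Sy_smult[OF a f(1)] phi_sq[OF FS_cm[OF al_FS[OF a] f(1)]] by simp
  then show ?thesis using psi_smult[OF a f(1)] phi_sq f by simp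
 qed
 moreover have "phi x : wpart gU n" if x: "x : wpart Sy n" for n x
 proof -
  obtain f where f: "f : Weq n" "x = sq f" using x unfolding Sy_sel(8) by blast
  then have "f : FS" by (simp add: Weq_def)
  then show ?thesis using psi_wpart f phi_sq by simp
 qed
 moreover have "\<forall>x\<in>carrier Sy. phi (dif Sy x) = dif gU (phi x)"
  by (auto simp: Sy_sel phi_sq psi_dif)
 moreover have "\<forall>x\<in>carrier Sy. \<forall>y\<in>carrier Sy. phi (x \<oplus>\<^sub>Sy y) = phi x \<oplus>\<^sub>gU phi y"
  by (auto simp: Sy_sel phi_sq psi_add)
 ultimately show ?thesis
  unfolding graded_dg_algebra_hom_def dg_module_hom_def graded_module_hom_def by blast
qed

lemma phi_canonical: "canonical_map A G phi"
 unfolding canonical_map_def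
proof (intro conjI allI ballI phi_hom)
 show "phi : extensional (carrier Sy)" by (simp add: phi_def)
 fix k x assume x: "x : hp G k"
 have "sym_ideal A G +>\<^bsub>words (dsum A G)\<^esub> letter k (\<zero>, x) = sq (letter k (\<zero>, x))" by (simp add: SQ.q_def)
 moreover have "letter k (\<zero>, x) : FS" using x by (simp add: letter_def)
 ultimately show "phi (sym_ideal A G +>\<^bsub>words (dsum A G)\<^esub> letter k (\<zero>, x)) =
    (PBW_below A G)(1 := PBW A G 0 +>\<^bsub>U\<^esub> UEA_proj A G (letter k (\<zero>, x)))"
  using phi_sq psi_letter[OF x] by simp
qed

text \<open>Elements of A give multiples of the unit in \<open>Sym\<close>, so two canonical maps
  agree on all letters and hence on words. For the zero function and for scalars, 0 is represented
  by the zero letter and c by the letter of \<open>c \<odot> \<one>\<close>.\<close>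

lemma canonical_unique:
 assumes 1: "canonical_map A G f1" and 2: "canonical_map A G f2"
 shows "f1 = f2"
proof -
 have h: "f \<one>\<^sub>Sy = \<one>\<^sub>gU" "!!x y. x : carrier Sy ==> y : carrier Sy ==> f (x \<otimes>\<^sub>Sy y) = f x \<otimes>\<^sub>gU f y"
  "!!x y. x : carrier Sy ==> y : carrier Sy ==> f (x \<oplus>\<^sub>Sy y) = f x \<oplus>\<^sub>gU f y"
  "!!a x. a : car A ==> x : carrier Sy ==> f (a \<odot>\<^sub>Sy x) = a \<odot>\<^sub>gU f x"
  "!!k x. x : hp G k ==> f (sq (word [(k, (\<zero>, x))])) =
    (PBW_below A G)(1 := PBW A G 0 +>\<^bsub>U\<^esub> UEA_proj A G (letter k (\<zero>, x)))"
  "f : extensional (carrier Sy)" if "canonical_map A G f" for f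
  using that unfolding canonical_map_def graded_dg_algebra_hom_def dg_module_hom_def graded_module_hom_def ring_hom_def
  by (auto simp: SQ.q_def letter_def)
 have c: "f : FS ==> sq f : carrier Sy" for f by (simp add: Sy_sel)
 have A1: "f1 (sq (word [(k, (a, \<zero>\<^sub>G))])) = f2 (sq (word [(k, (a, \<zero>\<^sub>G))]))" if a: "a : hp A k" for k a
 proof -
  have "sq (word [(k, (a, \<zero>\<^sub>G))]) = a \<odot>\<^sub>Sy \<one>\<^sub>Sy"
   using a al_FS[of a] S_minus[OF al_hom[OF a S_ideal lin_S]] by (simp add: Sy_sel Sy_smult SQ.q_eq)
  then show ?thesis using h(1,4)[OF 1] h(1,4)[OF 2] a c[of "word []"] by (simp add: Sy_sel(3))
 qed
 have l: "f1 (sq (word [l])) = f2 (sq (word [l]))" if v: "valid V [l]" for l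
 proof -
  obtain k a x where l: "l = (k, (a, x))" by (cases l) auto
  have "sq (word [l]) = sq (word [(k, (a, \<zero>\<^sub>G))]) \<oplus>\<^sub>Sy sq (word [(k, (\<zero>, x))])"
   using v lr_split[OF S_ideal lin_S, of a k x] by (simp add: l Sy_sel SQ.q_eq)
  then show ?thesis using v h(3,5)[OF 1] h(3,5)[OF 2] A1[of a k] c by (simp add: l)
 qed
 have m: "f1 (sq (word [l] ** f)) = f2 (sq (word [l] ** f))" if v: "valid V [l]" "f : FS" "f1 (sq f) = f2 (sq f)" for l f
 proof -
  have "sq (word [l] ** f) = sq (word [l]) \<otimes>\<^sub>Sy sq f" using that by (simp add: Sy_sel)
  then show ?thesis using h(2)[OF 1] h(2)[OF 2] that l c by simp
 qed
 have w: "f1 (sq (word w)) = f2 (sq (word w))" if "valid V w" for w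
  using that
 proof (induction w)
  case Nil
  then show ?case using h(1)[OF 1] h(1)[OF 2] by (simp add: Sy_sel)
 next
  case (Cons l w)
  then show ?case using m[of l "word w"] by (simp add: word_cm_word)
 qed
 have all: "f1 (sq f) = f2 (sq f)" if "f : FS" for f
  using that
 proof (induction f rule: FS_induct)
  case zero
  then show ?case using lr_zero[OF S_ideal lin_S, of 0] w[of "[(0, (\<zero>, \<zero>\<^sub>G))]"] SQ.q_eq[of 0 "word [(0, (\<zero>, \<zero>\<^sub>G))]"] S_minus
   by (simp add: dsum_sel(5))
 next
  case (word c w)
  let ?u = "word [(0, (c \<odot> \<one>, \<zero>\<^sub>G))]"
  have "(?u - sc c (word [])) ** word w : S"
   using S_add[OF lr_sc[OF S_ideal lin_S A_one M_zero, of c] S_sc[OF S_one, of c]] word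
   by (intro S_right) (auto simp: sc_diff)
  then have "sc c (word w) - ?u ** word w : S" using S_minus[of "(?u - sc c (word [])) ** word w"] by (simp add: cm_distrib)
  then have "sq (sc c (word w)) = sq (?u ** word w)" using word by (subst SQ.q_eq) auto
  then show ?case using m[of _ "word w"] w[OF word] word by simp
 next
  case (add f g)
  then show ?case using h(3)[OF 1, of "sq f" "sq g"] h(3)[OF 2, of "sq f" "sq g"] c by (simp add: Sy_sel(4))
 qed
 show ?thesis
  by (rule extensionalityI[OF h(6)[OF 1] h(6)[OF 2]]) (use all in \<open>auto simp: Sy_sel\<close>)
qed

text \<open>The words of weight below n make up the lower term. For \<open>n = 0\<close> there are
  none, in accordance with \<open>Qb 0 = K\<close>.\<close>

lemma Wle_top:
 assumes f: "f : Wle n" "f : FS1"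
 shows "\<exists>g\<in>Weq n. g : FS1 & f - g : Qb n & (hc k f = f --> hc k g = g)"
proof -
 define g where "g = (%w. if weight G w = n then f w else 0)"
 have gF: "g : FS" using f by (auto simp: g_def Wle_def word_carrier_iff fs_def intro: finite_subset)
 have g0: "g [] = 0" using f by (simp add: g_def FS1_def)
 have g1: "g : FS1" using gF g0 by (simp add: FS1_def)
 have gW: "g : Weq n" unfolding Weq_def using f gF by (auto simp: g_def Wle_def)
 have e: "(f - g) w = (if weight G w = n then 0 else f w)" for w by (simp add: g_def minus_apply)
 have "f - g : Qb n"
 proof (cases n)
  case 0
  have "f - g = 0"
  proof
   fix w show "(f - g) w = 0 w" using f(1) by (auto simp: e 0 Wle_def zero_fun_def)
  qed
  then show ?thesis by simp
 next
  case (Suc m)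
  have "\<forall>w. (f - g) w ~= 0 --> pure_word A G w & weight G w \<le> m"
   unfolding e using f(1) Suc by (auto simp: Wle_def le_Suc_eq)
  then have "f - g : Wle m" unfolding Wle_def using gF f FS1_FS by simp
  then show ?thesis using FS1_diff[OF f(2) g1] by (rule Wle_Qb) (simp add: Suc)
 qed
 moreover have "hc k g = g" if "hc k f = f"
  using that by (auto simp: g_def hc_def fun_eq_iff)
 ultimately show ?thesis using gW g1 by blast
qed

text \<open>Surjectivity comes from the top parts of representatives. Injectivity is reduced to a
  single weight n and to combinations of pure words of weight exactly n, the form in which leading
  terms can be read off.\<close>

lemma phi_iso:
 assumes inj: "!!n h. h : Weq n ==> one1 ** h : Qb n ==> h : S"
 shows "graded_dg_algebra_iso A Sy gU phi"
proof -
 have psi_inj: "f : S" if f: "f : FS" and p: "!!n. one1 ** sp n f : Qb n" for f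
 proof -
  \<comment> \<open>Working modulo the intersection allows \<open>sp n f\<close> to be replaced by a
    combination of pure words of weight n in \<open>Sym\<close> and in \<open>U\<close> at the same
    time.\<close>
  have SK: "wideal V (S \<inter> K)" "linear_rels V <= S \<inter> K"
   using S_ideal K_ideal lin_S lin_K by (auto simp: wideal_def)
  have spS: "sp n f : S" for n
  proof -
   obtain g where g: "g : Weq n" "sp n f - g : S \<inter> K" using Wle_Weq[OF SK f, of n 0] by blast
   have "one1 ** (sp n f - g) : Qb n" using g(2) K_left[of "sp n f - g" one1] by (intro K_Qb) auto
   from Qb_diff[OF p[of n] this] have "one1 ** g : Qb n" by (simp add: cm_distrib)
   then have "g : S" by (rule inj[OF g(1)])
   from S_add[OF _ this, of "sp n f - g"] g(2) show ?thesis by simp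
  qed
  moreover obtain N where "f - (\<Sum>n<N. sp n f) : S" using sum_sp[OF f S_ideal lin_S] by blast
  moreover have "(\<Sum>n<N. sp n f) : S" by (rule S_sum) (rule spS)
  ultimately show ?thesis using S_add[of "f - (\<Sum>n<N. sp n f)" "\<Sum>n<N. sp n f"] by simp
 qed
 have injon: "inj_on phi (carrier Sy)"
 proof (rule inj_onI)
  fix x y assume "x : carrier Sy" "y : carrier Sy" "phi x = phi y"
  then obtain f g where f: "f : FS" "x = sq f" "g : FS" "y = sq g" "psi f = psi g"
   by (auto simp: Sy_sel phi_sq)
  have "one1 ** sp n (f - g) : Qb n" for n
  proof -
   have "cl n (one1 ** sp n f) = cl n (one1 ** sp n g)"
    using fun_cong[OF f(5), of n] by (simp only: psi_def gl_def)
   then have "one1 ** sp n f - one1 ** sp n g : Qb n"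
    using cl_eq[OF psi_F(3)[OF f(1), of n] psi_F(3)[OF f(3), of n]] by blast
   then show ?thesis using f by (simp add: cm_distrib)
  qed
  then have "f - g : S" using f by (intro psi_inj) auto
  then show "x = y" using f by (simp add: SQ.q_eq)
 qed
 have psiW: "psi g n = cl n g" "m ~= n ==> psi g m = cl m 0" if "g : Weq n" "g : FS1" for g n m
 proof -
  have 1: "one1 ** (sp m g - (if m = n then g else 0)) : K" for m
   by (rule K_left[OF sp_Weq[OF K_ideal lin_K that(1)] one1_FS])
  have 2: "one1 ** sp m g - (if m = n then g else 0) : K" for m
   using 1[of m] K_add[OF 1[of n] one1_left[OF that(2)]] by (cases "m = n") (auto simp: cm_distrib)
  have gF: "g : FS" using that(2) by (rule FS1_FS)
  have "cl m (one1 ** sp m g) = cl m (if m = n then g else 0)" for m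
   by (rule cl_eqI[OF psi_F(3)[OF gF] _ 2]) (use gF in simp)
  then show "psi g n = cl n g" "m ~= n ==> psi g m = cl m 0"
   by (simp_all add: psi_def gl_def)
 qed
 have surj: "phi ` carrier Sy = carrier gU"
 proof
  show "phi ` carrier Sy <= carrier gU" by (auto simp: Sy_sel phi_sq psi_carrier)
  show "carrier gU <= phi ` carrier Sy"
  proof
   fix \<gamma> assume "\<gamma> : carrier gU"
   then obtain F where F: "!!n. F n : Wle n" "!!n. F n : FS1" "finite {n. F n \<notin> Qb n}" "\<gamma> = gl F"
    by (auto simp: gr_carrier)
   have "\<exists>g. g : Weq n & g : FS1 & F n - g : Qb n" for n using Wle_top[OF F(1,2)] by blast
   then obtain g where g: "!!n. g n : Weq n" "!!n. g n : FS1" "!!n. F n - g n : Qb n" by metis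
   let ?T = "{n. F n \<notin> Qb n}"
   have s: "psi (\<Sum>n\<in>T. g n) m = cl m (if m : T then g m else 0)" if "finite T" for T m
    using that
   proof (induction T rule: finite_induct)
    case empty
    show ?case by (simp add: psi_def gl_def)
   next
    case (insert n T)
    have FS: "g k : FS" "sum g T : FS" for k using g(2) FS1_FS by auto
    have "psi (\<Sum>n\<in>insert n T. g n) m = psi (g n) m <+>\<^bsub>U\<^esub> psi (sum g T) m"
     using insert(1,2) FS by (simp add: psi_add) (simp add: grU_def Let_def)
    also have "\<dots> = cl m (if m = n then g n else 0) <+>\<^bsub>U\<^esub> cl m (if m : T then g m else 0)"
     using psiW(1)[OF g(1)[of n] g(2)[of n]] psiW(2)[OF g(1)[of n] g(2)[of n], of m] insert(3) by auto
    also have "\<dots> = cl m (if m : insert n T then g m else 0)"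
     using insert(2) FS by (subst cl_add) auto
    finally show ?case .
   qed
   have "\<gamma> = psi (\<Sum>n\<in>?T. g n)"
   proof
    fix m
    have "cl m (F m) = cl m (if m : ?T then g m else 0)"
     using F(2)[of m] g(2,3)[of m] FS1_FS by (subst cl_eq) auto
    then show "\<gamma> m = psi (\<Sum>n\<in>?T. g n) m" using s[OF F(3)] by (simp add: F(4) gl_def)
   qed
   moreover have "(\<Sum>n\<in>?T. g n) : FS" using g(2) FS1_FS by auto
   ultimately show "\<gamma> : phi ` carrier Sy" by (auto simp: Sy_sel phi_sq intro!: image_eqI[of _ phi "sq (\<Sum>n\<in>?T. g n)"])
  qed
 qed
 have bij: "bij_betw phi (wpart Sy n \<inter> hpart Sy k) (wpart gU n \<inter> hpart gU k)" for n k
 proof (rule bij_betw_imageI)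
  show "inj_on phi (wpart Sy n \<inter> hpart Sy k)"
   by (rule inj_on_subset[OF injon]) (auto simp: Sy_sel)
  show "phi ` (wpart Sy n \<inter> hpart Sy k) = wpart gU n \<inter> hpart gU k"
  proof
   show "phi ` (wpart Sy n \<inter> hpart Sy k) <= wpart gU n \<inter> hpart gU k"
    using phi_hom by (auto simp: graded_dg_algebra_hom_def dg_module_hom_def graded_module_hom_def)
   show "wpart gU n \<inter> hpart gU k <= phi ` (wpart Sy n \<inter> hpart Sy k)"
   proof
    fix \<gamma> assume \<gamma>: "\<gamma> : wpart gU n \<inter> hpart gU k"
    then obtain f where f: "f : Wle n" "f : FS1" "hc k f = f" "\<gamma> n = cl n f"
     by (auto simp: gr_hpart)
    obtain g where g: "g : Weq n" "g : FS1" "f - g : Qb n" "hc k g = g"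
     using Wle_top[OF f(1,2), of k] f(3) by blast
    have "cl n f = cl n g" using f g FS1_FS by (subst cl_eq) auto
    then have "\<gamma> = psi g"
     using \<gamma> psiW[OF g(1,2)] f(4) by (intro ext) (metis IntD1 gr_wpart)
    moreover have "sq g : wpart Sy n \<inter> hpart Sy k" using g FS1_FS by (auto simp: Sy_sel)
    ultimately show "\<gamma> : phi ` (wpart Sy n \<inter> hpart Sy k)"
     using g FS1_FS by (intro image_eqI[of _ phi "sq g"]) (auto simp: phi_sq)
   qed
  qed
 qed
 show ?thesis unfolding graded_dg_algebra_iso_def using phi_hom injon surj bij by (auto simp: bij_betw_def)
qed

end

section \<open>The action of U on a symmetric algebra and its leading terms\<close>

section \<open>Injectivity from a flat torsion-free module\<close>

definition lmap :: "('v => 'u) => 'v wfun => 'u wfun" where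
 "lmap \<theta> f = lin (%w. word (map (%l. (fst l, \<theta> (snd l))) w)) f"

lemma lmap_simps [simp]: "lmap \<theta> 0 = 0" "lmap \<theta> (sc c f) = sc c (lmap \<theta> f)" "lmap \<theta> (word w) = word (map (%l. (fst l, \<theta> (snd l))) w)"
 and lmap_add: "f : word_carrier V ==> g : word_carrier V ==> lmap \<theta> (f + g) = lmap \<theta> f + lmap \<theta> g"
 and lmap_diff: "f : word_carrier V ==> g : word_carrier V ==> lmap \<theta> (f - g) = lmap \<theta> f - lmap \<theta> g"
 by (auto simp: lmap_def lin_add lin_diff FS_fs)

lemma lmap_cm: "f : word_carrier V ==> g : word_carrier V ==> lmap \<theta> (f ** g) = lmap \<theta> f ** lmap \<theta> g"
proof (induction f rule: FS_induct)
 case (word c w)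
 from word(2,1) show ?case
  by (induction g rule: FS_induct) (auto simp: cm_distrib word_cm_word lmap_add[of _ V])
qed (auto simp: cm_distrib lmap_add[of _ V])

lemma FS_lmap: "(!!n x. x : hp V n ==> \<theta> x : hp V' n) ==> f : word_carrier V ==> lmap \<theta> f : word_carrier V'"
 unfolding lmap_def by (erule FS_lin) (auto simp: valid_def)

text \<open>\<open>nab\<close> is the connection, \<open>jj\<close> the torsion-free injection and
  \<open>rr\<close> its retraction. All conditions are imposed on homogeneous elements, which are
  the letters of the free algebras.\<close>

locale flat_data = algebroid_loc A G + N: wmod A N
 for A :: "(complex, 'a) dgmod" (structure) and G :: "('a, 'g) algebroid" and N :: "('a, 'n, 'y) dgmod_scheme" +
 fixes nab :: "'g => 'n => 'n" and jj :: "'g => 'n" and rr :: "'n => 'g"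
 assumes nab_hpart: "x : hp G k ==> v : hp N n ==> nab x v : hp N (n + k)"
  and nab_add: "x : hp G k ==> v : hp N n ==> v' : hp N n ==> nab x (v \<oplus>\<^sub>N v') = nab x v \<oplus>\<^sub>N nab x v'"
  and nab_sm: "x : hp G k ==> v : hp N n ==> nab x (N.sm c v) = N.sm c (nab x v)"
  and nab_smult: "x : hp G k ==> a : hp A n ==> v : hp N m ==>
   nab x (a \<odot>\<^sub>N v) = anchor G x a \<odot>\<^sub>N v \<oplus>\<^sub>N (sg (k * n) \<odot> a) \<odot>\<^sub>N nab x v"
  and nab_zero: "x : hp G k ==> nab x \<zero>\<^sub>N = \<zero>\<^sub>N"
  and nab_zero_left: "v : hp N n ==> nab \<zero>\<^sub>G v = \<zero>\<^sub>N"
  and nab_add_left: "x : hp G k ==> y : hp G k ==> v : hp N n ==> nab (x \<oplus>\<^sub>G y) v = nab x v \<oplus>\<^sub>N nab y v"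
  and nab_smult_left: "a : hp A m ==> x : hp G k ==> v : hp N n ==> nab (a \<odot>\<^sub>G x) v = a \<odot>\<^sub>N nab x v"
  and nab_flat: "x : hp G k ==> y : hp G m ==> v : hp N n ==>
   nab x (nab y v) = nab (bracket G x y) v \<oplus>\<^sub>N N.sm (sg (k * m)) (nab y (nab x v))"
  and jj_hpart: "x : hp G k ==> jj x : hp N k"
  and jj_add: "x : hp G k ==> y : hp G k ==> jj (x \<oplus>\<^sub>G y) = jj x \<oplus>\<^sub>N jj y"
  and jj_smult: "a : hp A m ==> x : hp G k ==> jj (a \<odot>\<^sub>G x) = a \<odot>\<^sub>N jj x"
  and jj_zero: "jj \<zero>\<^sub>G = \<zero>\<^sub>N"
  and torsion_free: "x : hp G k ==> y : hp G m ==>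
   nab x (jj y) = jj (bracket G x y) \<oplus>\<^sub>N N.sm (sg (k * m)) (nab y (jj x))"
  and rr_hpart: "v : hp N n ==> rr v : hp G n"
  and rr_add: "v : hp N n ==> v' : hp N n ==> rr (v \<oplus>\<^sub>N v') = rr v \<oplus>\<^sub>G rr v'"
  and rr_smult: "a : hp A m ==> v : hp N n ==> rr (a \<odot>\<^sub>N v) = a \<odot>\<^sub>G rr v"
  and rr_zero: "rr \<zero>\<^sub>N = \<zero>\<^sub>G"
  and rr_jj: "x : hp G k ==> rr (jj x) = x"
begin

lemma nab_csm_left: "x : hp G k ==> v : hp N n ==> nab (sm c x) v = N.sm c (nab x v)"
 unfolding sm_def N.sm_def by (rule nab_smult_left[OF c_one])

lemma jj_sm: "x : hp G k ==> jj (sm c x) = N.sm c (jj x)"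
 unfolding sm_def N.sm_def by (rule jj_smult[OF c_one])

lemma rr_sm: "v : hp N k ==> rr (N.sm c v) = sm c (rr v)"
 unfolding sm_def N.sm_def by (rule rr_smult[OF c_one])

abbreviation "dl x \<equiv> map_prod (anchor G x) (nab x)"

lemma anchor_mult: "x : hp G e ==> a : hp A n ==> b : car A ==>
  anchor G x (a \<otimes> b) = anchor G x a \<otimes> b \<oplus> (sg (e * n) \<odot> a) \<otimes> anchor G x b"
 using derD(4)[OF anchor_der, of x e a n b] by (simp add: A_ksign A_sc1)

lemma anchor_hpart': "x : hp G e ==> a : hp A n ==> anchor G x a : hp A (n + e)"
 using anchor_hpart[of x e a n] by (simp add: add.commute)

lemma dl_hpart: "x : hp G e ==> u : hp N.V n ==> dl x u : hp N.V (n + e)"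
 using anchor_hpart' nab_hpart by auto

lemma FS_dl [simp]: "x : hp G e ==> f : N.FS ==> der e (dl x) f : N.FS"
 by (rule FS_der[OF _ dl_hpart])

lemma dl_S: "x : hp G e ==> f : N.S ==> der e (dl x) f : N.S"
 by (rule N.der_S)
   (simp_all add: anchor_hpart' anchor_mult derD(2)[OF anchor_der] derD(3)[OF anchor_der] nab_hpart nab_add nab_sm nab_smult nab_zero)

lemma sp_dl: "x : hp G e ==> f : N.FS ==> N.sp n (der e (dl x) f) = der e (dl x) (N.sp n f)"
 by (rule N.sp_der) (simp_all add: anchor_hpart' nab_hpart nab_zero)

text \<open>The operator of a letter of \<open>U\<close> on the free algebra over the letters of A
  and N. Its first part multiplies, its second part is the derivation by x; it preserves the ideal
  of the symmetric algebra and satisfies the relations of \<open>U\<close> modulo that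
  ideal.\<close>

definition T :: "int \<times> 'a \<times> 'g => ('a \<times> 'n) wfun => ('a \<times> 'n) wfun" where
 "T l f = word [(fst l, (fst (snd l), jj (snd (snd l))))] ** f + der (fst l) (dl (snd (snd l))) f"

lemma validD: "valid V [l] ==> fst (snd l) : hp A (fst l)" "valid V [l] ==> snd (snd l) : hp G (fst l)"
 by auto

lemma T_letter [simp]: "valid V [l] ==> word [(fst l, (fst (snd l), jj (snd (snd l))))] : N.FS"
 using validD[of l] jj_hpart by simp

lemma T_FS [simp]: "valid V [l] ==> f : N.FS ==> T l f : N.FS"
 unfolding T_def by (intro FS_add FS_cm T_letter FS_dl validD)

lemma T_S: "valid V [l] ==> f : N.S ==> T l f : N.S"
 unfolding T_def by (intro N.S_add N.S_left T_letter dl_S validD)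

lemma T_lin [simp]: "T l 0 = 0" "T l (sc c f) = sc c (T l f)"
 and T_add: "f : N.FS ==> g : N.FS ==> T l (f + g) = T l f + T l g"
 and T_diff: "f : N.FS ==> g : N.FS ==> T l (f - g) = T l f - T l g"
 by (auto simp: T_def cm_distrib sc_add der_add[of _ N.V] der_diff[of _ N.V] algebra_simps)

text \<open>A map that obeys a Leibniz rule modulo the ideal has values in the ideal as soon as its
  values on letters are there. Applied to differences of derivations, this reduces identities
  between operators to identities in A and N.\<close>

lemma der_vanish:
 assumes z: "\<Delta> 0 : N.S" "\<Delta> (word []) : N.S" and add: "!!f g. f : N.FS ==> g : N.FS ==> \<Delta> (f + g) = \<Delta> f + \<Delta> g"
  and sc: "!!c f. \<Delta> (sc c f) = sc c (\<Delta> f)"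
  and l: "!!l. valid N.V [l] ==> \<Delta> (word [l]) : N.S"
  and d: "!!l f. valid N.V [l] ==> f : N.FS ==> \<Delta> (word [l] ** f) - (\<Delta> (word [l]) ** f + sc (sg (e * fst l)) (word [l] ** \<Delta> f)) : N.S"
  and f: "f : N.FS"
 shows "\<Delta> f : N.S"
proof -
 have w: "\<Delta> (word w) : N.S" if "valid N.V w" for w
  using that
 proof (induction w)
  case (Cons k w)
  then have v: "valid N.V [k]" "valid N.V w" by auto
  have "\<Delta> (word [k]) ** word w + sc (sg (e * fst k)) (word [k] ** \<Delta> (word w)) : N.S"
   using v Cons.IH l by (intro N.S_add N.S_sc N.S_left N.S_right) auto
  from N.S_add[OF d[OF v(1), of "word w"] this] show ?case using v by (simp add: word_cm_word)
 qed (rule z(2))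
 show ?thesis using f
  by (induction f rule: FS_induct) (auto simp: z add sc w intro: N.S_sc N.S_add)
qed

lemma T_add_letter:
 assumes h: "a : hp A n" "b : hp A n" "x : hp G n" "y : hp G n" and f: "f : N.FS"
 shows "T (n, (a \<oplus> b, x \<oplus>\<^sub>G y)) f - (T (n, (a, x)) f + T (n, (b, y)) f) : N.S"
proof -
 let ?xy = "x \<oplus>\<^sub>G y"
 let ?\<Delta> = "%f. der n (dl ?xy) f - (der n (dl x) f + der n (dl y) f)"
 have xy: "?xy : hp G n" using h by (simp add: G_hpart)
 have "?\<Delta> f : N.S"
 proof (rule der_vanish[OF _ _ _ _ _ _ f, where e = n])
  fix l assume v: "valid N.V [l]"
  obtain k c v' where l: "l = (k, (c, v'))" by (cases l) auto
  have c: "c : hp A k" "v' : hp N k" using v by (auto simp: l)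
  show "?\<Delta> (word [l]) : N.S"
   using N.lr_add[OF N.S_ideal N.lin_S anchor_hpart'[OF h(3) c(1)] anchor_hpart'[OF h(4) c(1)] nab_hpart[OF h(3) c(2)] nab_hpart[OF h(4) c(2)]]
    h c by (simp add: l anchor_add nab_add_left)
 qed (use f in \<open>auto simp: der_add[of _ N.V] der_letter_left[of _ N.V] sc_add sc_diff cm_distrib algebra_simps N.S_zero\<close>)
 moreover have "(word [(n, (a \<oplus> b, jj ?xy))] - (word [(n, (a, jj x))] + word [(n, (b, jj y))])) ** f : N.S"
  using N.lr_add[OF N.S_ideal N.lin_S h(1,2) jj_hpart[OF h(3)] jj_hpart[OF h(4)]] h f by (intro N.S_right) (auto simp: jj_add)
 ultimately show ?thesis using N.S_add by (fastforce simp: T_def cm_distrib algebra_simps)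
qed

lemma T_sc_letter:
 assumes h: "a : hp A n" "x : hp G n" and f: "f : N.FS"
 shows "T (n, (c \<odot> a, sm c x)) f - sc c (T (n, (a, x)) f) : N.S"
proof -
 let ?\<Delta> = "%f. der n (dl (sm c x)) f - sc c (der n (dl x) f)"
 have "?\<Delta> f : N.S"
 proof (rule der_vanish[OF _ _ _ _ _ _ f, where e = n])
  fix l assume v: "valid N.V [l]"
  obtain k b v' where l: "l = (k, (b, v'))" by (cases l) auto
  have b: "b : hp A k" "v' : hp N k" using v by (auto simp: l)
  have "anchor G (sm c x) b = c \<odot> anchor G x b"
   using h b by (simp add: sm_def anchor_smult A_sc1[symmetric])
  then show "?\<Delta> (word [l]) : N.S"
   using N.lr_sc[OF N.S_ideal N.lin_S anchor_hpart'[OF h(2) b(1)] nab_hpart[OF h(2) b(2)], of c]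
    h b by (simp add: l nab_csm_left)
 qed (use f in \<open>auto simp: der_add[of _ N.V] der_letter_left[of _ N.V] sc_add sc_diff cm_distrib algebra_simps N.S_zero\<close>)
 moreover have "(word [(n, (c \<odot> a, jj (sm c x)))] - sc c (word [(n, (a, jj x))])) ** f : N.S"
  using N.lr_sc[OF N.S_ideal N.lin_S h(1) jj_hpart[OF h(2)], of c] h f by (intro N.S_right) (auto simp: jj_sm)
 ultimately show ?thesis using N.S_add by (fastforce simp: T_def cm_distrib sc_add algebra_simps)
qed

lemma T_alg:
 assumes h: "a : hp A n" "b : hp A m" "y : hp G m" and f: "f : N.FS"
 shows "T (n, (a, \<zero>\<^sub>G)) (T (m, (b, y)) f) - T (n + m, (a \<otimes> b, a \<odot>\<^sub>G y)) f : N.S"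
proof -
 have z: "der n (dl \<zero>\<^sub>G) g : N.S" if g: "g : N.FS" for g
 proof (rule der_vanish[OF _ _ _ _ _ _ g, where e = n])
  fix l assume v: "valid N.V [l]"
  then show "der n (dl \<zero>\<^sub>G) (word [l]) : N.S"
   using N.lr_zero[OF N.S_ideal N.lin_S] by (cases l) (auto simp: nab_zero_left)
 qed (auto simp: der_add[of _ N.V] der_letter_left[of _ N.V] N.S_zero)
 let ?a = "word [(n, (a, \<zero>\<^sub>N))]"
 have aF: "?a : N.FS" using h by simp
 have ay: "a \<odot>\<^sub>G y : hp G (n + m)" using M_smult[OF h(1,3)] .
 let ?\<Delta> = "%f. ?a ** der m (dl y) f - der (n + m) (dl (a \<odot>\<^sub>G y)) f"
 have "?\<Delta> f : N.S"
 proof (rule der_vanish[OF _ _ _ _ _ _ f, where e = "n + m"])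
  fix l assume v: "valid N.V [l]"
  obtain k c v' where l: "l = (k, (c, v'))" by (cases l) auto
  have c: "c : hp A k" "v' : hp N k" using v by (auto simp: l)
  show "?\<Delta> (word [l]) : N.S"
   using N.S_mult[OF h(1) anchor_hpart'[OF h(3) c(1)] nab_hpart[OF h(3) c(2)]] h c
   by (simp add: l anchor_smult nab_smult_left algebra_simps)
  fix g assume g: "g : N.FS"
  let ?l' = "word [(k + m, (anchor G y c, nab y v'))]" and ?l'' = "word [(k + (n + m), (anchor G (a \<odot>\<^sub>G y) c, nab (a \<odot>\<^sub>G y) v'))]"
  \<comment> \<open>The two operators obey the same Leibniz rule except that a stands in front of
    the letter in one and behind it in the other. Graded commutativity absorbs the
    difference.\<close>
  have "?\<Delta> (word [l] ** g) - (?\<Delta> (word [l]) ** g + sc (sg ((n + m) * fst l)) (word [l] ** ?\<Delta> g)) =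
    sc (sg (m * k)) (?a ** word [l] - sc (sg (n * k)) (word [l] ** ?a)) ** der m (dl y) g"
   using g by (simp add: l der_letter_left[of _ N.V] cm_distrib sc_add sc_diff sg_add ring_distribs cm_assoc algebra_simps)
  moreover have "sc (sg (m * k)) (?a ** word [l] - sc (sg (n * k)) (word [l] ** ?a)) ** der m (dl y) g : N.S"
   using N.S_comm[of "(a, \<zero>\<^sub>N)" n "(c, v')" k] h c g by (intro N.S_right N.S_sc FS_dl[OF h(3)]) (auto simp: l)
  ultimately show "?\<Delta> (word [l] ** g) - (?\<Delta> (word [l]) ** g + sc (sg ((n + m) * fst l)) (word [l] ** ?\<Delta> g)) : N.S"
   by (simp only:)
 qed (use f in \<open>auto simp: der_add[of _ N.V] sc_diff cm_distrib algebra_simps N.S_zero\<close>)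
 moreover have "(?a ** word [(m, (b, jj y))] - word [(n + m, (a \<otimes> b, jj (a \<odot>\<^sub>G y)))]) ** f : N.S"
  using N.S_mult[OF h(1,2) jj_hpart[OF h(3)]] f h by (intro N.S_right) (simp_all add: jj_smult)
 moreover have "der n (dl \<zero>\<^sub>G) (T (m, (b, y)) f) : N.S"
  by (intro z T_FS f) (use h in simp)
 moreover have "T (n, (a, \<zero>\<^sub>G)) (T (m, (b, y)) f) - T (n + m, (a \<otimes> b, a \<odot>\<^sub>G y)) f =
   ?\<Delta> f + (?a ** word [(m, (b, jj y))] - word [(n + m, (a \<otimes> b, jj (a \<odot>\<^sub>G y)))]) ** f + der n (dl \<zero>\<^sub>G) (T (m, (b, y)) f)"
  by (simp add: T_def[of "(n, _)"] T_def[of "(n + m, _)"] jj_zero)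
    (simp add: T_def cm_distrib cm_assoc algebra_simps)
 ultimately show ?thesis using N.S_add by metis
qed

text \<open>The commutator of the two operators has three parts: the commutator of the derivations,
  given by flatness; that of the multiplications, zero by graded commutativity; and the mixed terms,
  where torsion-freeness produces \<open>jj\<close> of the bracket.\<close>

lemma T_env:
 assumes u: "(a, x) : hp V n" and v: "(b, y) : hp V m" and f: "f : N.FS"
 shows "T (n, (a, x)) (T (m, (b, y)) f) -
  (sc (sg (n * m)) (T (m, (b, y)) (T (n, (a, x)) f)) + T (n + m, sbr (a, x) (b, y)) f) : N.S"
proof -
 have h: "a : hp A n" "x : hp G n" "b : hp A m" "y : hp G m" using u v by auto
 let ?s = "sg (n * m)"
 let ?u = "word [(n, (a, jj x))]" and ?v = "word [(m, (b, jj y))]"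
 let ?Dx = "der n (dl x)" and ?Dy = "der m (dl y)"
 define p where "p = anchor G x b \<ominus> ksign A (n * m) (anchor G y a)"
 define z where "z = bracket G x y"
 have s: "sbr (a, x) (b, y) = (p, z)" using semi_bracket[OF h] by (simp add: p_def z_def)
 have pz: "p : hp A (n + m)" "z : hp G (n + m)" using semi_bracket_hpart[OF u v] by (auto simp: s)
 let ?Dz = "der (n + m) (dl z)"
 have uF: "?u : N.FS" "?v : N.FS" using h jj_hpart by auto
 have xb: "anchor G x b : hp A (n + m)" "anchor G y a : hp A (n + m)" "nab x (jj y) : hp N (n + m)" "nab y (jj x) : hp N (n + m)"
  using anchor_hpart'[OF h(2,3)] anchor_hpart'[OF h(4,1)] nab_hpart[OF h(2) jj_hpart[OF h(4)]] nab_hpart[OF h(4) jj_hpart[OF h(2)]]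
  by (simp_all add: add.commute)
 let ?\<Delta> = "%f. ?Dx (?Dy f) - (sc ?s (?Dy (?Dx f)) + ?Dz f)"
 have D: "?\<Delta> f : N.S"
 proof (rule der_vanish[OF _ _ _ _ _ _ f, where e = "n + m"])
  fix l assume vl: "valid N.V [l]"
  obtain k c w where l: "l = (k, (c, w))" by (cases l) auto
  have c: "c : hp A k" "w : hp N k" using vl by (auto simp: l)
  note hy = anchor_hpart'[OF h(4) c(1)] nab_hpart[OF h(4) c(2)]
  note hx = anchor_hpart'[OF h(2) c(1)] nab_hpart[OF h(2) c(2)]
  let ?k = "k + n + m"
  have h2: "anchor G z c : hp A ?k" "nab z w : hp N ?k" "anchor G y (anchor G x c) : hp A ?k" "nab y (nab x w) : hp N ?k"
   using anchor_hpart'[OF pz(2) c(1)] nab_hpart[OF pz(2) c(2)] anchor_hpart'[OF h(4) hx(1)] nab_hpart[OF h(4) hx(2)] by (simp_all add: algebra_simps)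
  have ab: "anchor G x (anchor G y c) = anchor G z c \<oplus> ?s \<odot> anchor G y (anchor G x c)"
  proof -
   have "anchor G x (anchor G y c) : car A" "anchor G y (anchor G x c) : car A" using h c by simp_all
   then show ?thesis using anchor_bracket[OF h(2,4), of c] c
    by (simp add: z_def A_ksign A.minus_eq A.a_assoc A.l_neg)
  qed
  have "?\<Delta> (word [l]) = word [(?k, (anchor G z c \<oplus> ?s \<odot> anchor G y (anchor G x c), nab z w \<oplus>\<^sub>N N.sm ?s (nab y (nab x w))))]
    - (sc ?s (word [(?k, (anchor G y (anchor G x c), nab y (nab x w)))]) + word [(?k, (anchor G z c, nab z w))])"
   by (simp add: l ab nab_flat[OF h(2,4) c(2), folded z_def] algebra_simps)
  also have "\<dots> = (word [(?k, (anchor G z c \<oplus> ?s \<odot> anchor G y (anchor G x c), nab z w \<oplus>\<^sub>N N.sm ?s (nab y (nab x w))))]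
    - (word [(?k, (anchor G z c, nab z w))] + word [(?k, (?s \<odot> anchor G y (anchor G x c), N.sm ?s (nab y (nab x w))))]))
    + (word [(?k, (?s \<odot> anchor G y (anchor G x c), N.sm ?s (nab y (nab x w))))] - sc ?s (word [(?k, (anchor G y (anchor G x c), nab y (nab x w)))]))"
   by simp
  also have "\<dots> : N.S"
   by (intro N.S_add N.lr_add[OF N.S_ideal N.lin_S] N.lr_sc[OF N.S_ideal N.lin_S] h2 A_smult_hpart N.sm_hpart)
  finally show "?\<Delta> (word [l]) : N.S" .
  fix g assume g: "g : N.FS"
  have lF: "word [(k + m, (anchor G y c, nab y w))] : N.FS" "word [(k + n, (anchor G x c, nab x w))] : N.FS"
   using hy hx by auto
  have "?\<Delta> (word [l] ** g) - (?\<Delta> (word [l]) ** g + sc (sg ((n + m) * fst l)) (word [l] ** ?\<Delta> g)) = 0"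
   using g lF c FS_dl[OF h(2) g] FS_dl[OF h(4) g]
   by (simp add: l der_letter_left[of _ N.V] der_add[of _ N.V] cm_distrib sc_add sc_diff sg_add ring_distribs algebra_simps)
  then show "?\<Delta> (word [l] ** g) - (?\<Delta> (word [l]) ** g + sc (sg ((n + m) * fst l)) (word [l] ** ?\<Delta> g)) : N.S"
   by (simp only: N.S_zero)
 qed (use h pz f in \<open>auto simp: der_add[of _ N.V] sc_add sc_diff algebra_simps N.S_zero\<close>)
 have 1: "(?u ** ?v - sc ?s (?v ** ?u)) ** f : N.S"
  using N.S_comm[of "(a, jj x)" n "(b, jj y)" m] h jj_hpart f by (intro N.S_right) auto
 \<comment> \<open>Each derivation is applied to the multiplier of the other letter. The components
   in A combine to p by its definition, those in N to \<open>jj z\<close> by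
   torsion-freeness.\<close>
 have 2: "(word [(n + m, (anchor G x b, nab x (jj y)))] - (sc ?s (word [(n + m, (anchor G y a, nab y (jj x)))]) + word [(n + m, (p, jj z))])) ** f : N.S"
 proof (rule N.S_right[OF _ f])
  have e: "anchor G x b = p \<oplus> ?s \<odot> anchor G y a"
   using h xb by (simp add: p_def A_ksign A.minus_eq A.a_assoc A.l_neg)
  have "word [(n + m, (p \<oplus> ?s \<odot> anchor G y a, jj z \<oplus>\<^sub>N N.sm ?s (nab y (jj x))))]
    - (word [(n + m, (p, jj z))] + word [(n + m, (?s \<odot> anchor G y a, N.sm ?s (nab y (jj x))))]) : N.S"
   by (intro N.lr_add[OF N.S_ideal N.lin_S] pz jj_hpart xb A_smult_hpart N.sm_hpart)
  note r1 = this
  have "word [(n + m, (?s \<odot> anchor G y a, N.sm ?s (nab y (jj x))))] - sc ?s (word [(n + m, (anchor G y a, nab y (jj x)))]) : N.S"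
   by (intro N.lr_sc[OF N.S_ideal N.lin_S] xb)
  from N.S_add[OF r1 this] have "word [(n + m, (p \<oplus> ?s \<odot> anchor G y a, jj z \<oplus>\<^sub>N N.sm ?s (nab y (jj x))))]
    - (word [(n + m, (p, jj z))] + sc ?s (word [(n + m, (anchor G y a, nab y (jj x)))])) : N.S"
   by (simp add: algebra_simps)
  then show "word [(n + m, (anchor G x b, nab x (jj y)))] - (sc ?s (word [(n + m, (anchor G y a, nab y (jj x)))]) + word [(n + m, (p, jj z))]) : N.S"
   unfolding e[symmetric] torsion_free[OF h(2,4), folded z_def, symmetric] by (simp add: algebra_simps)
 qed
 have "T (n, (a, x)) (T (m, (b, y)) f) - (sc ?s (T (m, (b, y)) (T (n, (a, x)) f)) + T (n + m, (p, z)) f) =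
   ?\<Delta> f + (?u ** ?v - sc ?s (?v ** ?u)) ** f +
   (word [(n + m, (anchor G x b, nab x (jj y)))] - (sc ?s (word [(n + m, (anchor G y a, nab y (jj x)))]) + word [(n + m, (p, jj z))])) ** f"
  using f uF FS_dl[OF h(2) f] FS_dl[OF h(4) f]
  by (simp add: T_def der_add[of _ N.V] der_letter_left[of _ N.V] cm_distrib cm_assoc sc_add sc_diff algebra_simps)
 with N.S_add[OF N.S_add[OF D 1] 2] show ?thesis unfolding s by (simp only:)
qed

fun Phiw :: "(int \<times> 'a \<times> 'g) list => ('a \<times> 'n) wfun" where
 "Phiw [] = word []"
| "Phiw (l # w) = T l (Phiw w)"

definition Phi where "Phi f = lin Phiw f"

lemma Phiw_FS: "valid V w ==> Phiw w : N.FS"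
 by (induction w) (auto intro!: T_FS)

lemma Phi_FS [simp]: "f : FS ==> Phi f : N.FS"
 unfolding Phi_def by (erule FS_lin) (rule Phiw_FS)

lemma Phi_simps [simp]: "Phi 0 = 0" "Phi (sc c f) = sc c (Phi f)" "Phi (word w) = Phiw w"
 and Phi_add: "f : FS ==> g : FS ==> Phi (f + g) = Phi f + Phi g"
 and Phi_diff: "f : FS ==> g : FS ==> Phi (f - g) = Phi f - Phi g"
 by (auto simp: Phi_def lin_add lin_diff FS_fs)

lemma Phi_left: "f : FS ==> valid V [l] ==> Phi (word [l] ** f) = T l (Phi f)"
 by (induction f rule: FS_induct) (auto simp: cm_distrib word_cm_word Phi_add T_add)

text \<open>\<open>Phi f\<close> is the value of f on 1, and vanishing there is not a two-sided
  condition. The ideal consists instead of those f that annihilate all vectors \<open>Phi h\<close>;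
  at the end h is taken to be the empty word.\<close>

lemma Phi_K: "f : K ==> Phi f : N.S"
proof -
 assume f: "f : K"
 let ?I = "{f : FS. \<forall>h\<in>FS. Phi (f ** h) : N.S}"
 have "wideal V ?I"
 proof (rule wideal_letters)
  fix l f assume "f : ?I" "valid V [l]"
  then show "word [l] ** f : ?I" "f ** word [l] : ?I"
   by (auto simp: cm_assoc Phi_left intro!: T_S)
 qed (auto simp: cm_distrib Phi_add N.S_zero intro: N.S_add N.S_sc)
 moreover have "env_gens \<union> alg_gens <= ?I"
 proof
  fix g assume g: "g : env_gens \<union> alg_gens"
  have "Phi (g ** h) : N.S" if h: "h : FS" for h
  proof -
   have F: "Phi h : N.FS" using h by simp
   consider n a b x y where "g = word [(n, (a \<oplus> b, x \<oplus>\<^sub>G y))] - (word [(n, (a, x))] + word [(n, (b, y))])"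
     "a : hp A n" "b : hp A n" "x : hp G n" "y : hp G n"
    | n c a x where "g = word [(n, (c \<odot> a, sm c x))] - sc c (word [(n, (a, x))])" "a : hp A n" "x : hp G n"
    | n m a x b y where "g = word [(n, (a, x))] ** word [(m, (b, y))] - (sc (sg (n * m)) (word [(m, (b, y))] ** word [(n, (a, x))]) + word [(n + m, sbr (a, x) (b, y))])"
      "(a, x) : hp V n" "(b, y) : hp V m"
    | n m a b y where "g = word [(n, (a, \<zero>\<^sub>G))] ** word [(m, (b, y))] - word [(n + m, (a \<otimes> b, a \<odot>\<^sub>G y))]"
      "a : hp A n" "b : hp A m" "y : hp G m"
    using g unfolding env_gens_def alg_gens_def linear_rels_V by fast
   then show ?thesis
   proof cases
    case (1 n a b x y)
    then show ?thesis using T_add_letter[OF 1(2-) F] h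
     by (simp add: cm_distrib Phi_diff Phi_add Phi_left A_hpart M_add)
   next
    case (2 n c a x)
    then show ?thesis using T_sc_letter[OF 2(2-) F] h
     by (simp add: cm_distrib Phi_diff Phi_left A_smult_hpart)
   next
    case (3 n m a x b y)
    have vs: "valid V [(n + m, sbr (a, x) (b, y))]" "valid V [(n, (a, x))]" "valid V [(m, (b, y))]"
     using semi_bracket_hpart[OF 3(2,3)] 3(2,3) by simp_all
    have "Phi (g ** h) = T (n, (a, x)) (T (m, (b, y)) (Phi h)) -
      (sc (sg (n * m)) (T (m, (b, y)) (T (n, (a, x)) (Phi h))) + T (n + m, sbr (a, x) (b, y)) (Phi h))"
     using h vs FS_word[of "[(n, (a, x))]" V] FS_word[of "[(m, (b, y))]" V] FS_word[of "[(n + m, sbr (a, x) (b, y))]" V]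
     unfolding 3(1) by (simp add: cm_distrib cm_assoc Phi_diff Phi_add Phi_left del: FS_word dsum_sel)
    then show ?thesis using T_env[OF 3(2,3) F] by simp
   next
    case (4 n m a b y)
    have vs: "valid V [(n + m, (a \<otimes> b, a \<odot>\<^sub>G y))]" "valid V [(n, (a, \<zero>\<^sub>G))]" "valid V [(m, (b, y))]"
     using 4(2-) A_mult M_smult by simp_all
    then show ?thesis using T_alg[OF 4(2-) F] h
     by (simp add: 4(1) cm_distrib cm_assoc Phi_diff Phi_left)
   qed
  qed
  then show "g : ?I" using g gens_FS by blast
 qed
 ultimately have "K <= ?I" unfolding K_def by (rule Idl_minimal)
 with f have *: "\<forall>h\<in>FS. Phi (f ** h) : N.S" by blast
 show ?thesis using bspec[OF *, of "word []"] by simp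
qed

abbreviation "Jm \<equiv> lmap (%u. (fst u, jj (snd u)))"
abbreviation "Rm \<equiv> lmap (%u. (fst u, rr (snd u)))"

text \<open>The derivations preserve the weight and multiplication by \<open>jj x\<close> raises it
  by one. The top term of the action on 1 therefore takes the multiplication for every letter from
  \<gg>.\<close>

lemma Phi_lead:
 assumes "valid V w" "pure_word A G w"
 shows "N.sp (weight G w) (Phiw w) - Jm (word w) : N.S & (\<forall>m>weight G w. N.sp m (Phiw w) : N.S)"
 using assms
proof (induction w)
 case Nil
 then show ?case by (auto simp: N.S_zero)
next
 case (Cons l w)
 obtain k a x where l: "l = (k, (a, x))" by (cases l) auto
 have h: "a : hp A k" "x : hp G k" "valid V w" "pure_word A G w" "a = \<zero> | x = \<zero>\<^sub>G"
  using Cons(2,3) by (auto simp: l)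
 let ?f = "Phiw w" and ?n = "weight G w"
 have f: "?f : N.FS" using Phiw_FS[OF h(3)] .
 have IH: "N.sp ?n ?f - Jm (word w) : N.S" "!!m. m > ?n ==> N.sp m ?f : N.S" using Cons.IH[OF h(3,4)] by auto
 have vl: "valid N.V [(k, (a, jj x))]" using h jj_hpart by simp
 have D: "N.sp m (der k (dl x) ?f) = der k (dl x) (N.sp m ?f)" for m by (rule sp_dl[OF h(2) f])
 have z: "word [(k, (\<zero>, \<zero>\<^sub>N))] ** N.sp m ?f : N.S" for m
  using N.S_right[OF N.lr_zero[OF N.S_ideal N.lin_S, of k] N.FS_sp[OF f]] .
 have T: "N.sp m (Phiw (l # w)) = word [(k, (a, \<zero>\<^sub>N))] ** N.sp m ?f
   + (case m of 0 => 0 | Suc i => word [(k, (\<zero>, jj x))] ** N.sp i ?f) + der k (dl x) (N.sp m ?f)" for m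
  using f vl h FS_dl[OF h(2) f] by (auto simp: l T_def N.sp_left D split: nat.split)
 show ?case
 proof (cases "x = \<zero>\<^sub>G")
  case True
  have d0: "der k (dl \<zero>\<^sub>G) g : N.S" if g: "g : N.FS" for g
  proof (rule der_vanish[OF _ _ _ _ _ _ g, where e = k])
   fix l assume v: "valid N.V [l]"
   then show "der k (dl \<zero>\<^sub>G) (word [l]) : N.S"
    using N.lr_zero[OF N.S_ideal N.lin_S] by (cases l) (auto simp: nab_zero_left)
  qed (auto simp: der_add[of _ N.V] der_letter_left[of _ N.V] N.S_zero)
  have aF: "word [(k, (a, \<zero>\<^sub>N))] : N.FS" using h by simp
  have e: "N.sp m (Phiw (l # w)) - word [(k, (a, \<zero>\<^sub>N))] ** N.sp m ?f : N.S" for m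
  proof -
   have "(case m of 0 => 0 | Suc i => word [(k, (\<zero>, jj x))] ** N.sp i ?f) : N.S"
    using z N.S_zero by (auto simp: True jj_zero split: nat.split)
   from N.S_add[OF this d0[OF N.FS_sp[OF f, of m]]] show ?thesis
    unfolding T by (simp add: True)
  qed
  have "N.sp ?n (Phiw (l # w)) - Jm (word (l # w)) =
    (N.sp ?n (Phiw (l # w)) - word [(k, (a, \<zero>\<^sub>N))] ** N.sp ?n ?f) + word [(k, (a, \<zero>\<^sub>N))] ** (N.sp ?n ?f - Jm (word w))"
   by (simp add: cm_distrib word_cm_word l True jj_zero)
  then have 1: "N.sp ?n (Phiw (l # w)) - Jm (word (l # w)) : N.S"
   using N.S_add[OF e[of ?n] N.S_left[OF IH(1) aF]] by (simp only:)
  have 2: "N.sp m (Phiw (l # w)) : N.S" if "m > ?n" for m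
   using N.S_add[OF e[of m] N.S_left[OF IH(2)[OF that] aF]] by simp
  from 1 2 show ?thesis by (simp add: l True)
 next
  case False
  then have a: "a = \<zero>" using h by simp
  let ?x = "word [(k, (\<zero>, jj x))]"
  have xF: "?x : N.FS" using h jj_hpart by simp
  have e: "N.sp (Suc i) (Phiw (l # w)) - ?x ** N.sp i ?f : N.S" if "i \<ge> ?n" for i
  proof -
   have "der k (dl x) (N.sp (Suc i) ?f) : N.S" using dl_S[OF h(2) IH(2)[of "Suc i"]] that by simp
   from N.S_add[OF z[of "Suc i"] this] show ?thesis unfolding T by (simp add: a)
  qed
  have eq: "N.sp (Suc ?n) (Phiw (l # w)) - Jm (word (l # w)) =
    (N.sp (Suc ?n) (Phiw (l # w)) - ?x ** N.sp ?n ?f) + ?x ** (N.sp ?n ?f - Jm (word w))"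
   by (simp add: cm_distrib word_cm_word l a)
  have "N.sp (Suc ?n) (Phiw (l # w)) - ?x ** N.sp ?n ?f : N.S" by (rule e) simp
  from N.S_add[OF this N.S_left[OF IH(1) xF]] have 1: "N.sp (Suc ?n) (Phiw (l # w)) - Jm (word (l # w)) : N.S"
   unfolding eq .
  have 2: "N.sp m (Phiw (l # w)) : N.S" if m: "m > Suc ?n" for m
  proof -
   obtain i where i: "m = Suc i" "i > ?n" using m by (cases m) auto
   show ?thesis unfolding i(1) using N.S_add[OF e[of i] N.S_left[OF IH(2)[OF i(2)] xF]] i(2) by simp
  qed
  from 1 2 show ?thesis by (simp add: l False)
 qed
qed

lemma Phi_Wle: "f : Wle m ==> m < n ==> N.sp n (Phi f) : N.S"
proof (induction f rule: Wle_induct)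
 case (word c w)
 then show ?case using Phi_lead[of w] by (auto intro!: N.S_sc)
next
 case (add g h)
 then show ?case using Wle_FS by (simp add: Phi_add N.S_add)
qed (simp add: N.S_zero)

lemma jm_hpart: "u : hp V k ==> (%u. (fst u, jj (snd u))) u : hp N.V k"
 using jj_hpart by auto

lemma rm_hpart: "u : hp N.V k ==> (%u. (fst u, rr (snd u))) u : hp V k"
 using rr_hpart by auto

lemma Phi_Weq: "f : Weq n ==> N.sp n (Phi f) - Jm f : N.S"
proof -
 assume f: "f : Weq n"
 have "fs f" using f FS_fs[of f V] by (simp add: Weq_def)
 then have "f : Weq n --> N.sp n (Phi f) - Jm f : N.S"
 proof (induction rule: fun_fs_induct)
  case (word w)
  have e: "(%v. if v = w then f w else 0) = sc (f w) (word w)"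
   by (auto simp: word_apply fapp)
  have w: "valid V w" "pure_word A G w" "weight G w = n"
   using f word by (auto simp: Weq_def word_carrier_iff valid_def)
  have e2: "N.sp n (Phi (sc (f w) (word w))) - Jm (sc (f w) (word w)) = sc (f w) (N.sp n (Phiw w) - Jm (word w))"
   by (simp add: sc_diff)
  have "sc (f w) (N.sp n (Phiw w) - Jm (word w)) : N.S"
   using Phi_lead[OF w(1,2)] w(3) by (intro N.S_sc) auto
  then show ?case unfolding e e2 by simp
 next
  case (add g h)
  then have gh: "g : Weq n" "h : Weq n"
   using f by (auto simp: Weq_def word_carrier_iff)
  then have FS: "g : FS" "h : FS" by (auto simp: Weq_def)
  have e: "N.sp n (Phi (g + h)) - Jm (g + h) = (N.sp n (Phi g) - Jm g) + (N.sp n (Phi h) - Jm h)"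
   using FS by (simp add: Phi_add lmap_add[of _ V])
  have "N.sp n (Phi g) - Jm g : N.S" "N.sp n (Phi h) - Jm h : N.S" using add gh by auto
  then show ?case unfolding e by (blast intro: N.S_add)
 qed (simp add: N.S_zero)
 with f show ?thesis by simp
qed

text \<open>\<open>rr\<close> is a map of A-modules and so induces a map of symmetric
  algebras.\<close>

lemma Rm_S: "f : N.S ==> Rm f : S"
proof -
 assume f: "f : N.S"
 let ?I = "{f : N.FS. Rm f : S}"
 have R: "g : N.FS ==> Rm g : FS" for g by (rule FS_lmap[OF rm_hpart])
 have "wideal N.V ?I"
  unfolding wideal_def using R by (auto simp: lmap_add[of _ N.V] lmap_cm[of _ N.V] S_zero intro: S_add S_left S_right)
 moreover have "N.sym_gens <= ?I"
 proof
  fix g assume g: "g : N.sym_gens"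
  then consider n a b x y where "g = word [(n, (a \<oplus> b, x \<oplus>\<^sub>N y))] - (word [(n, (a, x))] + word [(n, (b, y))])"
    "a : hp A n" "b : hp A n" "x : hp N n" "y : hp N n"
   | n c a x where "g = word [(n, (c \<odot> a, N.sm c x))] - sc c (word [(n, (a, x))])" "a : hp A n" "x : hp N n"
   | n m a x b y where "g = word [(n, (a, x))] ** word [(m, (b, y))] - sc (sg (n * m)) (word [(m, (b, y))] ** word [(n, (a, x))])"
     "a : hp A n" "b : hp A m" "x : hp N n" "y : hp N m"
   | "g = word [(0, (\<one>, \<zero>\<^sub>N))] - word []"
   | n m a b y where "g = word [(n, (a, \<zero>\<^sub>N))] ** word [(m, (b, y))] - word [(n + m, (a \<otimes> b, a \<odot>\<^sub>N y))]"
     "a : hp A n" "b : hp A m" "y : hp N m"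
   unfolding N.sym_gens_def N.linear_rels_V by auto
  then have "Rm g : S"
  proof cases
   case (1 n a b x y)
   then show ?thesis using lr_add[OF S_ideal lin_S 1(2,3) rr_hpart[OF 1(4)] rr_hpart[OF 1(5)]]
    by (simp add: lmap_diff[of _ N.V] lmap_add[of _ N.V] rr_add A_hpart N.M_add)
  next
   case (2 n c a x)
   then show ?thesis using lr_sc[OF S_ideal lin_S 2(2) rr_hpart[OF 2(3)], of c]
    by (simp add: lmap_diff[of _ N.V] rr_sm A_smult_hpart)
  next
   case (3 n m a x b y)
   then show ?thesis using S_comm[of "(a, rr x)" n "(b, rr y)" m] rr_hpart
    by (simp add: lmap_diff[of _ N.V] lmap_cm[of _ N.V])
  next
   case 4
   then show ?thesis using S_one by (simp add: lmap_diff[of _ N.V] rr_zero)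
  next
   case (5 n m a b y)
   then show ?thesis using S_mult[OF 5(2,3) rr_hpart[OF 5(4)]]
    by (simp add: lmap_diff[of _ N.V] lmap_cm[of _ N.V] rr_smult rr_zero A_mult N.M_smult)
  qed
  then show "g : ?I" using g N.sym_gens_FS by auto
 qed
 ultimately have "N.S <= ?I" unfolding N.sym_ideal_eq by (rule Idl_minimal)
 with f show ?thesis by auto
qed

lemma Rm_Jm: "f : FS ==> Rm (Jm f) = f"
proof (induction f rule: FS_induct)
 case (word c w)
 then have "map ((%l. (fst l, (%u. (fst u, rr (snd u))) (snd l))) \<circ> (%l. (fst l, (%u. (fst u, jj (snd u))) (snd l)))) w = w"
  by (intro map_idI) (auto simp: valid_def rr_jj prod_eq_iff mem_Times_iff)
 then show ?case by simp
next
 case (add g h)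
 have "Jm u : N.FS" if "u : FS" for u by (rule FS_lmap[where V = V and V' = N.V, OF jm_hpart that])
 with add show ?case by (simp add: lmap_add[of _ V] lmap_add[of _ N.V])
qed simp

text \<open>Modulo the ideal the part of \<open>Phi h\<close> in weight n is \<open>Jm h\<close>. It
  vanishes if h is a lower term in \<open>U\<close>, and \<open>Rm\<close> recovers h from
  \<open>Jm h\<close>.\<close>

lemma weight_inj:
 assumes h: "h : Weq n" and q: "one1 ** h : Qb n"
 shows "h : S"
proof -
 have hF: "h : FS" using h by (simp add: Weq_def)
 have v1: "valid V [(0, (\<one>, \<zero>\<^sub>G))]" by simp
 \<comment> \<open>The unit of A acts as the identity: its letter is identified with the empty word,
   and the derivation by 0 vanishes on letters, hence everywhere.\<close>
 have "Phi (one1 ** h) - Phi h : N.S"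
 proof -
  have d0: "der 0 (dl \<zero>\<^sub>G) g : N.S" if g: "g : N.FS" for g
  proof (rule der_vanish[OF _ _ _ _ _ _ g, where e = 0])
   fix l assume v: "valid N.V [l]"
   then show "der 0 (dl \<zero>\<^sub>G) (word [l]) : N.S"
    using N.lr_zero[OF N.S_ideal N.lin_S] by (cases l) (auto simp: nab_zero_left)
  qed (auto simp: der_add[of _ N.V] der_letter_left[of _ N.V] N.S_zero)
  have "(word [(0, (\<one>, \<zero>\<^sub>N))] - word []) ** Phi h : N.S" by (rule N.S_right[OF N.S_one]) (use hF in simp)
  from N.S_add[OF this d0[of "Phi h"]] show ?thesis
   using hF by (simp add: Phi_left[OF hF v1] T_def jj_zero cm_distrib algebra_simps)
 qed
 then have s: "N.sp n (Phi (one1 ** h)) - N.sp n (Phi h) : N.S"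
  using N.sp_S[of _ n] hF by fastforce
 have "N.sp n (Phi (one1 ** h)) : N.S"
 proof (cases n)
  case 0
  then show ?thesis using q by (intro N.sp_S Phi_K) simp
 next
  case (Suc m)
  then obtain g k where g: "g : Wle m" "g : FS1" "k : K" "one1 ** h = g + k" using q Qb_Suc by blast
  have "N.sp n (Phi g) : N.S" using Phi_Wle[OF g(1), of n] Suc by simp
  moreover have "N.sp n (Phi k) : N.S" by (intro N.sp_S Phi_K g)
  ultimately show ?thesis unfolding g(4) using FS1_FS[OF g(2)] K_FS[OF g(3)] by (simp add: Phi_add N.S_add)
 qed
 from N.S_diff[OF this s] have "N.sp n (Phi h) : N.S" by simp
 from N.S_diff[OF this Phi_Weq[OF h]] have "Jm h : N.S" by simp
 from Rm_S[OF this] show ?thesis by (simp add: Rm_Jm[OF hF])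
qed

theorem PBW_iso: "graded_dg_algebra_iso A Sy gU phi"
 by (rule phi_iso[OF weight_inj])

end

declare minus_apply [simp del] uminus_apply [simp del]

section \<open>Additive calculus and models of A and \<gg> with operations defined
  everywhere\<close>

section \<open>Additive maps and finitely supported functions\<close>

text \<open>Additivity on a whole type is preserved by composition and can be derived from the shape
  of an operator. It reduces identities in Y to monomials.\<close>

definition ad :: "('x::ab_group_add => 'y::ab_group_add) => bool" where
 "ad T \<longleftrightarrow> (\<forall>x y. T (x + y) = T x + T y)"

lemma ad_add: "ad T ==> T (x + y) = T x + T y"
 by (simp add: ad_def)

lemma ad_zero: "ad T ==> T 0 = 0"
 using ad_add[of T 0 0] by simp

lemma ad_minus: "ad T ==> T (- x) = - T x"
 using ad_add[of T x "- x"] ad_zero[of T] by (simp add: add_eq_0_iff)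

lemma ad_diff: "ad T ==> T (x - y) = T x - T y"
 using ad_add[of T x "- y"] ad_minus[of T y] by simp

lemma ad_sum: "ad T ==> T (sum f S) = (\<Sum>x\<in>S. T (f x))"
 by (induction S rule: infinite_finite_induct) (simp_all add: ad_zero ad_add)

lemma ad_comp: "ad S ==> ad T ==> ad (%x. S (T x))"
 by (simp add: ad_def)

lemma ad_plus: "ad S ==> ad T ==> ad (%x. S x + T x)"
 and ad_subtract: "ad S ==> ad T ==> ad (%x. S x - T x)"
 and ad_uminus: "ad T ==> ad (%x. - T x)"
 by (simp_all add: ad_def algebra_simps)

lemma ad_ident: "ad (%x. x)"
 and ad_const: "ad (%x. 0)"
 by (simp_all add: ad_def algebra_simps)

lemmas ad_rules = ad_comp ad_plus ad_subtract ad_uminus ad_ident ad_const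

definition sgm :: "int => 'x::ab_group_add => 'x" where
 "sgm k x = (if even k then x else - x)"

lemma ad_sgm: "ad (sgm k)" and ad_sgm': "ad T ==> T (sgm k x) = sgm k (T x)"
 by (auto simp: ad_def sgm_def ad_minus)

lemma sgm_sc: "sgm k f = sc (sg k) f"
 by (cases "even k") (simp_all add: sgm_def sg_def)

text \<open>Extension from monomials \<open>single w a\<close> by a map that is additive in the
  coefficient. Linearity over A would be too much to ask, since letters differentiate the
  coefficients.\<close>

definition ext :: "('w => 'c::zero => 'd::comm_monoid_add) => ('w \<Rightarrow>\<^sub>0 'c) => 'd" where
 "ext T f = (\<Sum>w\<in>keys f. T w (lookup f w))"

lemma ext_superset: "(!!w. T w 0 = 0) ==> finite S ==> keys f <= S ==> ext T f = (\<Sum>w\<in>S. T w (lookup f w))"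
 unfolding ext_def by (rule sum.mono_neutral_left) (auto simp: in_keys_iff)

lemma ad_ext: "(!!w. ad (T w)) ==> ad (ext T)"
 unfolding ad_def[of "ext T"]
proof (intro allI)
 fix f g :: "'a \<Rightarrow>\<^sub>0 'b" assume T: "!!w. ad (T w)"
 let ?S = "keys f \<union> keys g"
 have "ext T h = (\<Sum>w\<in>?S. T w (lookup h w))" if "keys h <= ?S" for h :: "'a \<Rightarrow>\<^sub>0 'b"
  using that by (intro ext_superset) (auto simp: ad_zero[OF T])
 then show "ext T (f + g) = ext T f + ext T g"
  using Poly_Mapping.keys_add[of f g] by (simp add: lookup_add ad_add[OF T] sum.distrib)
qed

lemma ext_single: "ad (T w) ==> ext T (single w a) = T w a"
 by (simp add: ext_def ad_zero lookup_single when_def)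

lemma poly_mapping_sum_single: "f = (\<Sum>w\<in>keys f. single w (lookup f w))"
 for f :: "'w \<Rightarrow>\<^sub>0 'c::ab_group_add"
proof (rule poly_mapping_eqI)
 fix k
 have "(\<Sum>w\<in>keys f. lookup (single w (lookup f w)) k) =
   (\<Sum>w\<in>keys f. if w = k then lookup f w else 0)"
  by (intro sum.cong refl) (auto simp: lookup_single when_def)
 also have "\<dots> = lookup f k" by (simp add: in_keys_iff)
 finally show "lookup f k = lookup (\<Sum>w\<in>keys f. single w (lookup f w)) k"
  by (simp add: lookup_sum)
qed

lemma ad_eq: "ad S ==> ad T ==> (!!w a. S (single w a) = T (single w a)) ==> S f = T f"
 by (subst (1 2) poly_mapping_sum_single) (simp add: ad_sum)

lemma ad_single: "ad (single w)" and ad_lookup: "ad (%f. lookup f w)"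
 by (simp_all add: ad_def single_add lookup_add)

lemma lookup_cw: "(!!w. ad (T w)) ==> lookup (ext (%w b. single w (T w b)) f) w = T w (lookup f w)"
 by (rule ad_eq[where S = "%f. lookup (ext (%w b. single w (T w b)) f) w" and T = "%f. T w (lookup f w)"])
   (auto intro!: ad_comp[OF ad_lookup] ad_ext ad_comp[OF ad_single] ad_comp[OF _ ad_lookup] simp: ext_single ad_comp[OF ad_single] lookup_single when_def ad_zero)

section \<open>Total representatives\<close>

text \<open>A vector space whose carrier is a set is a retract of a space of functions, on which all
 operations can be defined everywhere.\<close>

lemma vector_space_sc: "vector_space (sc :: complex => ('i => complex) => _)"
 by unfold_locales (simp_all add: sc_add sc_add_left)

definition is_total :: "(complex, 'm, 'z) dgmod_scheme => ('m => 'm => complex) => (('m => complex) => 'm) => bool" where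
 "is_total M e d \<longleftrightarrow> (\<forall>x. d x : car M) & (\<forall>x y. d (x + y) = d x \<oplus>\<^sub>M d y) & (\<forall>c x. d (sc c x) = c \<odot>\<^sub>M d x) \<and>
   (\<forall>x\<in>car M. d (e x) = x) & (\<forall>x\<in>car M. \<forall>y\<in>car M. e (x \<oplus>\<^sub>M y) = e x + e y) \<and>
   (\<forall>c. \<forall>x\<in>car M. e (c \<odot>\<^sub>M x) = sc c (e x))"

text \<open>\<open>Fs\<close> is the vector space with the carrier as basis, v evaluates formal
  combinations in M, and \<open>Kr\<close> is the kernel. Linear algebra provides projections onto
  \<open>Fs\<close> and onto \<open>Kr\<close>; combined to P, they kill \<open>Kr\<close> without
  changing values under v. Hence v after P is defined on all functions, and P of a basis vector
  depends linearly on the element.\<close>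

lemma ex_total:
 fixes M :: "(complex, 'm, 'z) dgmod_scheme"
 assumes M: "dg_module CC M"
 shows "\<exists>e d. is_total M e d"
proof -
 interpret M: abelian_group M by (rule dg_moduleD(2)[OF M])
 interpret vp: vector_space_pair "sc :: complex => ('m => complex) => _" "sc :: complex => ('m => complex) => _"
  by (intro vector_space_pair.intro vector_space_sc)
 note m = dg_moduleD(3-7)[OF M, simplified]
 have z: "0 \<odot>\<^sub>M x = \<zero>\<^sub>M" if x: "x : car M" for x
  using m(2)[OF x, of 0 0] m(1)[OF x, of 0] by (metis M.add.l_cancel_one' add_0)
 define Fs where "Fs = {f :: 'm => complex. fs f & (\<forall>a. a \<notin> car M --> f a = 0)}"
 define v where "v f = (\<Oplus>\<^bsub>M\<^esub>a\<in>{a. f a ~= 0}. f a \<odot>\<^sub>M a)" for f :: "'m => complex"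
 have v_sup: "v f = (\<Oplus>\<^bsub>M\<^esub>a\<in>S. f a \<odot>\<^sub>M a)" if "finite S" "{a. f a ~= 0} <= S" "S <= car M" for f S
  unfolding v_def by (rule M.add.finprod_mono_neutral_cong_left) (use that z m in auto)
 have v_closed: "v f : car M" if "f : Fs" for f
 proof -
  have "a : car M" if "f a ~= 0" for a using \<open>f : Fs\<close> that by (auto simp: Fs_def)
  then show ?thesis unfolding v_def using m(1) by (intro M.finsum_closed) auto
 qed
 have v_add: "v (f + g) = v f \<oplus>\<^sub>M v g" if fg: "f : Fs" "g : Fs" for f g
 proof -
  let ?S = "{a. f a ~= 0} \<union> {a. g a ~= 0}"
  have S: "finite ?S" "?S <= car M" using fg by (auto simp: Fs_def fs_def)
  have "v (f + g) = (\<Oplus>\<^bsub>M\<^esub>a\<in>?S. f a \<odot>\<^sub>M a \<oplus>\<^sub>M g a \<odot>\<^sub>M a)"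
   by (subst v_sup[OF S(1) _ S(2)]) (use S m in \<open>auto intro!: M.finsum_cong' simp: plus_fun_apply\<close>)
  also have "\<dots> = (\<Oplus>\<^bsub>M\<^esub>a\<in>?S. f a \<odot>\<^sub>M a) \<oplus>\<^sub>M (\<Oplus>\<^bsub>M\<^esub>a\<in>?S. g a \<odot>\<^sub>M a)"
   using S m by (intro M.finsum_addf) auto
  finally show ?thesis using v_sup[OF S(1) _ S(2), of f] v_sup[OF S(1) _ S(2), of g] by simp
 qed
 have v_sc: "v (sc c f) = c \<odot>\<^sub>M v f" if f: "f : Fs" for c f
 proof -
  have S: "finite {a. f a ~= 0}" "{a. f a ~= 0} <= car M" using f by (auto simp: Fs_def fs_def)
  have "v (sc c f) = (\<Oplus>\<^bsub>M\<^esub>a\<in>{a. f a ~= 0}. c \<odot>\<^sub>M (f a \<odot>\<^sub>M a))"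
   by (subst v_sup[OF S(1) _ S(2)]) (use S m in \<open>auto intro!: M.finsum_cong' simp: sc_apply\<close>)
  also have "\<dots> = c \<odot>\<^sub>M v f"
   unfolding v_def
   by (rule additive_finsum(1)[symmetric]) (use S m M.abelian_group_axioms in auto)
  finally show ?thesis .
 qed
 define Kr where "Kr = {f : Fs. v f = \<zero>\<^sub>M}"
 have F0: "0 : Fs" by (simp add: Fs_def zero_fun_apply)
 have Fadd: "f + g : Fs" if "f : Fs" "g : Fs" for f g
  using that fs_add[of f g] by (auto simp: Fs_def plus_fun_apply)
 have Fsc: "sc c f : Fs" if "f : Fs" for c f
  using that by (auto simp: Fs_def sc_apply)
 have subF: "vp.vs1.subspace Fs" using F0 Fadd Fsc by (auto simp: vp.vs1.subspace_def)
 have cz: "c \<odot>\<^sub>M \<zero>\<^sub>M = \<zero>\<^sub>M" for c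
  using m(3)[of "\<zero>\<^sub>M" "\<zero>\<^sub>M" c] m(1)[of "\<zero>\<^sub>M" c] by (metis M.add.l_cancel_one' M.l_zero M.zero_closed)
 have v0: "v 0 = \<zero>\<^sub>M" by (simp add: v_def zero_fun_apply)
 have subK: "vp.vs1.subspace Kr"
  using subF v0 by (auto simp: vp.vs1.subspace_def Kr_def v_add v_sc cz)
 have lid: "Vector_Spaces.linear sc sc (%x :: 'm => complex. x)"
  by (rule vp.vs1.linear_ident)
 obtain pK where pK: "range pK <= Kr" "Vector_Spaces.linear sc sc pK" "!!x. x : Kr ==> pK x = x"
  using vp.linear_exists_left_inverse_on[OF lid subK] by (auto simp: inj_on_def)
 obtain pF where pF: "range pF <= Fs" "Vector_Spaces.linear sc sc pF" "!!x. x : Fs ==> pF x = x"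
  using vp.linear_exists_left_inverse_on[OF lid subF] by (auto simp: inj_on_def)
 interpret pK: Vector_Spaces.linear sc sc pK by (rule pK(2))
 interpret pF: Vector_Spaces.linear sc sc pF by (rule pF(2))
 define P where "P x = pF x - pK (pF x)" for x
 have KF: "x : Kr ==> x : Fs" for x by (simp add: Kr_def)
 have P_F: "P x : Fs" for x
 proof -
  have "pF x : Fs" "sc (- 1) (pK (pF x)) : Fs" using pF(1) pK(1) KF Fsc by blast+
  from Fadd[OF this] show ?thesis by (simp add: P_def)
 qed
 have P_add: "P (x + y) = P x + P y" for x y by (simp add: P_def pF.add pK.add)
 have P_sc: "P (sc c x) = sc c (P x)" for c x by (simp add: P_def pF.scale pK.scale sc_diff)
 have P_K: "P x = 0" if "x : Kr" for x using that by (simp add: P_def pF(3) KF pK(3))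
 have vP: "v (P x) = v x" if x: "x : Fs" for x
 proof -
  have k: "pK x : Kr" using pK(1) by auto
  have "v (P x + pK x) = v (P x) \<oplus>\<^sub>M v (pK x)" using P_F KF[OF k] by (rule v_add)
  moreover have "P x + pK x = x" using x by (simp add: P_def pF(3))
  moreover have "v (P x) : car M" "v (pK x) = \<zero>\<^sub>M" using v_closed[OF P_F] k by (simp_all add: Kr_def)
  ultimately show ?thesis by simp
 qed
 define \<delta> where "\<delta> a = (%b. if b = a then 1 else 0 :: complex)" for a :: 'm
 have dF: "\<delta> a : Fs" and vd: "v (\<delta> a) = a" if "a : car M" for a
 proof -
  have s: "{b. \<delta> a b ~= 0} = {a}" by (auto simp: \<delta>_def)
  then show "\<delta> a : Fs" using that by (auto simp: Fs_def fs_def \<delta>_def)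
  show "v (\<delta> a) = a" unfolding v_def s using that m by (simp add: \<delta>_def)
 qed
 have kr: "x - y : Kr" if "x : Fs" "y : Fs" "v x = v y" for x y
 proof -
  have "sc (- 1) y : Fs" using Fsc that by blast
  then have F: "x - y : Fs" using Fadd[of x "sc (- 1) y"] that by simp
  have "v (x - y + y) = v (x - y) \<oplus>\<^sub>M v y" by (rule v_add[OF F that(2)])
  then have "v (x - y) = \<zero>\<^sub>M" using that v_closed[OF F] v_closed[OF that(2)] M.add.r_cancel_one' by simp
  then show ?thesis using F by (simp add: Kr_def)
 qed
 have eq: "P x = P y" if "x : Fs" "y : Fs" "v x = v y" for x y
  using P_add[of "x - y" y] P_K[OF kr[OF that]] by simp
 have "is_total M (%a. P (\<delta> a)) (%x. v (P x))"
  unfolding is_total_def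
 proof (intro conjI allI ballI)
  fix x y assume x: "x : car M" and y: "y : car M"
  have "P (\<delta> (x \<oplus>\<^sub>M y)) = P (\<delta> x + \<delta> y)"
   by (rule eq) (use x y in \<open>auto simp: dF vd v_add Fadd\<close>)
  then show "P (\<delta> (x \<oplus>\<^sub>M y)) = P (\<delta> x) + P (\<delta> y)" by (simp add: P_add)
 next
  fix c x assume x: "x : car M"
  have "P (\<delta> (c \<odot>\<^sub>M x)) = P (sc c (\<delta> x))"
   by (rule eq) (use x m in \<open>auto simp: dF vd v_sc Fsc\<close>)
  then show "P (\<delta> (c \<odot>\<^sub>M x)) = sc c (P (\<delta> x))" by (simp add: P_sc)
 qed (simp_all add: P_add P_sc v_add v_sc P_F v_closed vP dF vd)
 then show ?thesis by blast
qed

definition "tot_e M = (SOME e. \<exists>d. is_total M e d)"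
definition "tot_d M = (SOME d. is_total M (tot_e M) d)"

lemma is_total: "dg_module CC M ==> is_total M (tot_e M) (tot_d M)"
 using someI_ex[OF ex_total] unfolding tot_e_def[symmetric] unfolding tot_d_def by (rule someI_ex)

section \<open>The odd part of an element\<close>

text \<open>For odd k the sign \<open>(-1)^(k * deg x)\<close> subtracts twice the odd part of x. In
  this form Koszul signs are additive operations on elements that are not homogeneous.\<close>

definition oddp :: "('r, 'm, 'z) gmod_scheme => 'm => 'm" where
 "oddp M x = (\<Oplus>\<^bsub>M\<^esub>n\<in>{n : hsupp M x. odd n}. hcomp M x n)"

lemma oddp_superset:
 assumes M: "graded_group M" "x : car M" "finite S" "hsupp M x <= S"
 shows "oddp M x = (\<Oplus>\<^bsub>M\<^esub>n\<in>S. if odd n then hcomp M x n else \<zero>\<^sub>M)"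
proof -
 interpret abelian_group M using M by (simp add: graded_group_abelian)
 show ?thesis unfolding oddp_def
  by (rule add.finprod_mono_neutral_cong_left) (use M hcomp_carrier[OF M(1,2)] in \<open>auto simp: hsupp_def\<close>)
qed

lemma oddp_add:
 assumes M: "graded_group M" "x : car M" "y : car M"
 shows "oddp M (x \<oplus>\<^sub>M y) = oddp M x \<oplus>\<^sub>M oddp M y"
proof -
 interpret abelian_group M using M by (simp add: graded_group_abelian)
 let ?S = "hsupp M x \<union> hsupp M y \<union> hsupp M (x \<oplus>\<^sub>M y)"
 have S: "finite ?S" using M by (simp add: finite_hsupp)
 note c = hcomp_carrier[OF M(1)]
 have "oddp M (x \<oplus>\<^sub>M y) = (\<Oplus>\<^bsub>M\<^esub>n\<in>?S. (if odd n then hcomp M x n else \<zero>\<^sub>M) \<oplus>\<^sub>M (if odd n then hcomp M y n else \<zero>\<^sub>M))"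
  unfolding oddp_superset[OF M(1) a_closed[OF M(2,3)] S Un_upper2]
  by (rule finsum_cong') (use M c in \<open>auto simp: hcomp_add[OF M]\<close>)
 also have "\<dots> = (\<Oplus>\<^bsub>M\<^esub>n\<in>?S. if odd n then hcomp M x n else \<zero>\<^sub>M) \<oplus>\<^sub>M (\<Oplus>\<^bsub>M\<^esub>n\<in>?S. if odd n then hcomp M y n else \<zero>\<^sub>M)"
  using M c by (intro finsum_addf) auto
 also have "\<dots> = oddp M x \<oplus>\<^sub>M oddp M y"
  using oddp_superset[OF M(1,2) S le_supI1[OF Un_upper1]] oddp_superset[OF M(1,3) S le_supI1[OF Un_upper2]] by (simp only:)
 finally show ?thesis .
qed

lemma oddp_hom: "graded_group M ==> x : hp M n ==> oddp M x = (if odd n then x else \<zero>\<^sub>M)"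
proof -
 assume M: "graded_group M" "x : hp M n"
 interpret abelian_group M using M by (simp add: graded_group_abelian)
 have "x : car M" using M by (simp add: hpart_carrier)
 then show ?thesis
  using oddp_superset[OF M(1), of x "{n}"] hcomp_hom[OF M] by (auto split: if_splits)
qed

lemma oddp_closed: "graded_group M ==> x : car M ==> oddp M x : car M"
proof -
 assume M: "graded_group M" "x : car M"
 interpret abelian_group M using M by (simp add: graded_group_abelian)
 show ?thesis unfolding oddp_def using hcomp_carrier[OF M] by (intro finsum_closed) auto
qed

type_synonym ('x, 'y) wmd = "(int \<times> 'y) list \<Rightarrow>\<^sub>0 ('x => complex)"

section \<open>Total operations\<close>

context algebroid_loc
begin

abbreviation "eA \<equiv> tot_e A"
abbreviation "dA \<equiv> tot_d A"
abbreviation "eG \<equiv> tot_e (over_CC A G)"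
abbreviation "dG \<equiv> tot_d (over_CC A G)"

lemma totA: "dA x : car A" "dA (x + y) = dA x \<oplus> dA y" "dA (sc c x) = c \<odot> dA x"
 "a : car A ==> dA (eA a) = a" "a : car A ==> b : car A ==> eA (a \<oplus> b) = eA a + eA b"
 "a : car A ==> eA (c \<odot> a) = sc c (eA a)"
 using is_total[OF modA] by (simp_all add: is_total_def)

lemma totG: "dG u : car G" "dG (u + v) = dG u \<oplus>\<^sub>G dG v" "dG (sc c u) = csm c (dG u)"
 "x : car G ==> dG (eG x) = x" "x : car G ==> y : car G ==> eG (x \<oplus>\<^sub>G y) = eG x + eG y"
 "x : car G ==> eG (csm c x) = sc c (eG x)"
 using is_total[OF over_CC_mod] by (simp_all add: is_total_def)

lemmas tot [simp] = totA(1,4) totG(1,4)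

lemma eA_zero [simp]: "eA \<zero> = 0" and eG_zero [simp]: "eG \<zero>\<^sub>G = 0"
 using totA(5)[of "\<zero>" "\<zero>"] totG(5)[of "\<zero>\<^sub>G" "\<zero>\<^sub>G"] by simp_all

lemma dA_zero [simp]: "dA 0 = \<zero>" and dG_zero [simp]: "dG 0 = \<zero>\<^sub>G"
 using totA(4)[of "\<zero>"] totG(4)[of "\<zero>\<^sub>G"] by simp_all

lemma eA_minus: "a : car A ==> eA (\<ominus> a) = - eA a" and eG_minus: "x : car G ==> eG (\<ominus>\<^sub>G x) = - eG x"
 using totA(5)[of a "\<ominus> a"] totG(5)[of x "\<ominus>\<^sub>G x"] by (simp_all add: A.r_neg G.r_neg add_eq_0_iff)

lemma eA_ksign: "a : car A ==> eA (ksign A k a) = sgm k (eA a)"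
 and eG_ksign: "x : car G ==> eG (ksign G k x) = sgm k (eG x)"
 by (auto simp: ksign_def sgm_def eA_minus eG_minus)

text \<open>A is only a retract of the function space, and \<open>pj\<close> is the projection onto
  its copy. The operations on coefficients read their arguments through \<open>dA\<close> or
  \<open>dG\<close> and return values in the copies of A and \<gg>, so they factor through the
  projections.\<close>

definition "pj a = eA (dA a)"
definition "pjG u = eG (dG u)"
definition "am a b = eA (dA a \<otimes> dA b)"
definition "oA a = eA (oddp A (dA a))"
definition "hA n a = eA (hcomp A (dA a) n)"
definition "dAT a = eA (dif A (dA a))"
definition "ga a u = eG (dA a \<odot>\<^sub>G dG u)"
definition "gb u v = eG (bracket G (dG u) (dG v))"
definition "dT u = eG (dif G (dG u))"
definition "rh u a = eA (anchor G (dG u) (dA a))"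
text \<open>The twist of a by \<open>(-1)^(k * deg a)\<close>, as \<open>sA_HA\<close> confirms for
  homogeneous elements.\<close>

definition "sA k a = (if even k then pj a else pj a - oA a - oA a)" for k :: int
definition "HA n a \<longleftrightarrow> (\<exists>x\<in>hp A n. a = eA x)"
definition "HG n u \<longleftrightarrow> (\<exists>x\<in>hp G n. u = eG x)"

lemmas total_defs = pj_def pjG_def am_def oA_def hA_def dAT_def ga_def gb_def dT_def rh_def

lemma closures [simp]: "a : car A ==> x : car G ==> a \<odot>\<^sub>G x : car G"
 "x : car G ==> y : car G ==> bracket G x y : car G"
 "x : car G ==> a : car A ==> anchor G x a : car A"
 "a : car A ==> oddp A a : car A" "a : car A ==> hcomp A a n : car A"
 using G_mod(3) bracket_closed anchor_closed oddp_closed[OF grA] hcomp_carrier[OF grA] by auto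

lemma anchor_add_right: "x : car G ==> a : car A ==> b : car A ==> anchor G x (a \<oplus> b) = anchor G x a \<oplus> anchor G x b"
proof -
 assume x: "x : car G" and ab: "a : car A" "b : car A"
 show ?thesis using grG x
proof (induction x rule: graded_induct)
 case (hom n y)
 then show ?case using derD(2)[OF anchor_der] ab by simp
next
 case (add y z)
 then show ?case using ab by (simp add: anchor_add A.a_ac)
qed (simp_all add: ab)
qed

lemma ad_total: "ad pj" "ad pjG" "ad (am a)" "ad (%a. am a b)" "ad oA" "ad (hA n)" "ad dAT" "ad (ga a)" "ad (%a. ga a u)"
 "ad (gb u)" "ad (%u. gb u v)" "ad dT" "ad (rh u)" "ad (%u. rh u a)" "ad (sA k)"
proof -
 show 1: "ad pj" "ad oA" by (simp_all add: ad_def total_defs totA oddp_add[OF grA])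
 then show "ad (sA k)" unfolding ad_def sA_def by (simp add: algebra_simps)
qed (simp_all add: ad_def total_defs totA totG A.l_distr A.r_distr hcomp_add[OF grA] A_mod(10) G_mod(4,5,10) bracket_add anchor_add anchor_add_right)

lemma pj_simps [simp]: "pj (pj a) = pj a" "am (pj a) b = am a b" "am a (pj b) = am a b" "pj (am a b) = am a b"
 "oA (pj a) = oA a" "pj (oA a) = oA a" "pj (hA n a) = hA n a" "hA n (pj a) = hA n a" "rh u (pj a) = rh u a" "pj (rh u a) = rh u a"
 "ga (pj a) u = ga a u" "ga a (pjG u) = ga a u" "pjG (ga a u) = ga a u" "pjG (gb u v) = gb u v" "dAT (pj a) = dAT a"
 "pj (dAT a) = dAT a"
 by (simp_all add: total_defs)

lemma sA_pj [simp]: "sA k (pj a) = sA k a" "pj (sA k a) = sA k a"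
 by (simp_all only: sA_def ad_diff[OF ad_total(1)] pj_simps simp_thms split: if_split)

lemma eA_pj [simp]: "a : car A ==> pj (eA a) = eA a" and eG_pj [simp]: "x : car G ==> pjG (eG x) = eG x"
 by (simp_all add: total_defs)

lemma HA_I: "a : hp A n ==> HA n (eA a)" and HG_I: "x : hp G n ==> HG n (eG x)"
 by (auto simp: HA_def HG_def)

lemma HA_pj: "HA n a ==> pj a = a" and HG_pj: "HG n u ==> pjG u = u"
 by (auto simp: HA_def HG_def)

lemma HA_rules: "HA n 0" "HA n a ==> HA n b ==> HA n (a + b)" "HA n a ==> HA n (- a)" "HA n a ==> HA n (sc c a)"
 "HA n a ==> HA m b ==> HA (n + m) (am a b)" "HG n u ==> HA m b ==> HA (n + m) (rh u b)" "HA n (hA n x)"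
 "HA n a ==> HA (n + 1) (dAT a)"
proof -
 show "HA n 0" by (rule HA_I[OF A_hpart(2), simplified])
 show "HA n a ==> HA n b ==> HA n (a + b)"
  by (clarsimp simp: HA_def) (metis A_hcarr A_hpart(3) totA(5))
 show "HA n a ==> HA n (- a)" by (clarsimp simp: HA_def) (metis A_hcarr A_hpart(4) eA_minus)
 show "HA n a ==> HA n (sc c a)" by (clarsimp simp: HA_def) (metis A_hcarr A_smult_hpart totA(6))
 show "HA n (hA n x)" unfolding hA_def by (rule HA_I[OF hcomp_hpart[OF grA]]) simp
qed (auto simp: HA_def HG_def total_defs intro: A_mult anchor_hpart A_mod(9))

lemma HG_rules: "HG n 0" "HG n u ==> HG n v ==> HG n (u + v)" "HA n a ==> HG m v ==> HG (n + m) (ga a v)"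
 "HG n u ==> HG m v ==> HG (n + m) (gb u v)" "HG n u ==> HG (n + 1) (dT u)"
proof -
 show "HG n 0" by (rule HG_I[OF G_hpart(2), simplified])
 show "HG n u ==> HG n v ==> HG n (u + v)"
  by (clarsimp simp: HG_def) (metis G_hcarr G_hpart(3) totG(5))
qed (auto simp: HA_def HG_def total_defs intro: G_mod(8,9) bracket_hpart)

lemma HA_sgm: "HA n a ==> HA n (sgm k a)"
 by (simp add: sgm_def HA_rules)

lemma oA_HA: "HA n a ==> oA a = (if odd n then a else 0)"
 by (auto simp: HA_def oA_def oddp_hom[OF grA])

lemma sA_HA: "HA n a ==> sA k a = sgm (k * n) a"
 by (auto simp: sA_def oA_HA HA_pj sgm_def)

lemma hA_HA: "HA n a ==> hA m a = (if m = n then a else 0)"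
 by (auto simp: HA_def hA_def hcomp_hom[OF grA])

text \<open>A map that factors through \<open>pj\<close> is determined on the copy of A, whose
  elements are sums of homogeneous ones. Graded identities thus become available for arbitrary
  functions as variables.\<close>

lemma adA_eq:
 assumes "ad X" "ad Z" "!!x. X (pj x) = X x" "!!x. Z (pj x) = Z x" "!!n a. HA n a ==> X a = Z a"
 shows "X x = Z x"
proof -
 have "X (eA y) = Z (eA y)" if "y : car A" for y
  using grA that
 proof (induction y rule: graded_induct)
  case (hom n y)
  then show ?case using assms(5) HA_I by blast
 qed (simp_all add: ad_zero ad_add totA assms)
 from this[of "dA x"] show ?thesis using assms(3,4)[of x] by (simp add: pj_def)
qed

lemma am_assoc: "am (am a b) c = am a (am b c)" and ga_am: "ga (am a b) u = ga a (ga b u)"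
 and rh_ga: "rh (ga a u) b = am a (rh u b)"
 by (simp_all add: total_defs A.m_assoc G_mod(6) anchor_smult)

abbreviation "A1 \<equiv> eA \<one>"

lemma am_one: "am A1 a = pj a" "am a A1 = pj a" "ga A1 u = pjG u"
 by (simp_all add: total_defs G_mod(7))

lemma HA_one: "HA 0 A1"
 by (rule HA_I) simp

lemma am_comm: "HA n a ==> HA m b ==> am a b = sgm (n * m) (am b a)"
 by (auto simp: HA_def am_def A_comm[of _ n _ m] eA_ksign)

lemma rh_am: "HG k u ==> rh u (am a b) = am (rh u a) b + am (sA k a) (rh u b)"
proof (rule adA_eq[where X = "%a. rh u (am a b)" and Z = "%a. am (rh u a) b + am (sA k a) (rh u b)"])
 fix n a assume u: "HG k u" and a: "HA n a"
 then obtain x y where "x : hp A n" "y : hp G k" "a = eA x" "u = eG y" by (auto simp: HA_def HG_def)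
 then show "rh u (am a b) = am (rh u a) b + am (sA k a) (rh u b)"
  unfolding sA_HA[OF a] ad_sgm'[OF ad_total(4)] by (simp add: total_defs derD(4)[OF anchor_der] totA eA_ksign)
qed (simp_all, (intro ad_rules ad_comp[OF ad_total(13)] ad_comp[OF ad_total(4)] ad_total)+)

lemma sA_am: "sA k (am a b) = am (sA k a) (sA k b)"
proof (rule adA_eq[where X = "%a. sA k (am a b)" and Z = "%a. am (sA k a) (sA k b)"])
 fix n a assume a: "HA n a"
 show "sA k (am a b) = am (sA k a) (sA k b)"
 proof (rule adA_eq[where X = "%b. sA k (am a b)" and Z = "%b. am (sA k a) (sA k b)"])
  fix m b assume b: "HA m b"
  show "sA k (am a b) = am (sA k a) (sA k b)"
   using sA_HA[OF HA_rules(5)[OF a b], of k]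
   by (simp add: sA_HA[OF a] sA_HA[OF b]) (simp add: sgm_def ad_minus[OF ad_total(4)] ad_minus[OF ad_total(3)])
 qed (simp_all, (intro ad_comp[OF ad_total(15)] ad_comp[OF ad_total(3)] ad_total)+)
qed (simp_all, (intro ad_comp[OF ad_total(15)] ad_comp[OF ad_total(4)] ad_total)+)

lemma rh_gb: "HG n u ==> HG m v ==> rh (gb u v) b = rh u (rh v b) - sgm (n * m) (rh v (rh u b))"
 by (auto simp: HG_def total_defs anchor_bracket a_minus_def totA eA_minus eA_ksign)

lemma gb_ga: "HG n u ==> gb u (ga a v) = ga (rh u a) v + ga (sA n a) (gb u v)"
proof (rule adA_eq[where X = "%a. gb u (ga a v)" and Z = "%a. ga (rh u a) v + ga (sA n a) (gb u v)"])
 fix m a assume u: "HG n u" and a: "HA m a"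
 then obtain x y where "x : hp A m" "y : hp G n" "a = eA x" "u = eG y" by (auto simp: HA_def HG_def)
 then show "gb u (ga a v) = ga (rh u a) v + ga (sA n a) (gb u v)"
  unfolding sA_HA[OF a] ad_sgm'[OF ad_total(9)] by (simp add: total_defs bracket_smult totG eG_ksign add.commute)
qed (simp_all, (intro ad_rules ad_comp[OF ad_total(10)] ad_comp[OF ad_total(9)] ad_total)+)

lemma gb_antisym: "HG n u ==> HG m v ==> gb u v = - sgm (n * m) (gb v u)"
 by (auto simp: HG_def gb_def bracket_antisym[of _ n _ m] eG_minus eG_ksign)

lemma gb_jacobi: "HG n u ==> HG m v ==> gb u (gb v w) = gb (gb u v) w + sgm (n * m) (gb v (gb u w))"
 by (auto simp: HG_def gb_def bracket_jacobi[of _ n _ m] totG eG_ksign)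

lemma gb_sc: "gb u (sc c v) = sc c (gb u v)" and ga_sc: "ga (sc c a) u = sc c (ga a u)"
 and am_sc: "am (sc c a) b = sc c (am a b)"
proof -
 have "(c \<odot> dA a) \<odot>\<^sub>G dG u = csm c (dA a \<odot>\<^sub>G dG u)"
  by (simp add: sm_csm[symmetric] sm_smult)
 then show "gb u (sc c v) = sc c (gb u v)" "ga (sc c a) u = sc c (ga a u)" "am (sc c a) b = sc c (am a b)"
  by (simp_all add: total_defs totG totA bracket_csm A_sc1[symmetric])
qed

section \<open>The twisted free algebra Y and its Lie monomials\<close>

section \<open>The free module on words of letters\<close>

text \<open>Letters that are not homogeneous of the recorded degree stand for zero.\<close>

definition "bar v = (if snd v : hp G (fst v) then eG (snd v) else 0)"

lemma HG_bar: "HG (fst v) (bar v)"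
 by (simp add: bar_def HG_I HG_rules)

definition smY :: "('a => complex) => ('a, 'g) wmd => ('a, 'g) wmd" where
 "smY a = ext (%w b. single w (am a b))"

text \<open>A letter acts on \<open>b w\<close> by the rule \<open>v \<cdot> b w = \<rho>\<^sub>v(b) w + (-1)\<^bsup>|v||b|\<^esup> b v w\<close>.\<close>

definition Lv :: "int \<times> 'g => ('a, 'g) wmd => ('a, 'g) wmd" where
 "Lv v = ext (%w b. single w (rh (bar v) b) + single (v # w) (sA (fst v) b))"

primrec wact :: "(int \<times> 'g) list => ('a, 'g) wmd => ('a, 'g) wmd" where
 "wact [] g = g"
| "wact (v # w) g = Lv v (wact w g)"

text \<open>A monomial acts on Y by the operators of its letters followed by its coefficient, and
  the product is this action. Normal forms with coefficients in front are produced by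
  \<open>Lv\<close> and need no separate rewriting.\<close>

definition star :: "('a, 'g) wmd => ('a, 'g) wmd => ('a, 'g) wmd" where
 "star f g = ext (%w a. smY a (wact w g)) f"

lemma ad_smY [simp]: "ad (smY a)"
 unfolding smY_def by (intro ad_ext ad_comp[OF ad_single] ad_total)

lemma smY_single [simp]: "smY a (single w b) = single w (am a b)"
 unfolding smY_def by (intro ext_single ad_comp[OF ad_single] ad_total)

lemma lookup_smY: "lookup (smY a f) w = am a (lookup f w)"
 unfolding smY_def by (intro lookup_cw ad_total)

lemma smY_add_left: "smY (a + b) y = smY a y + smY b y"
 by (rule poly_mapping_eqI) (simp add: lookup_smY lookup_add ad_add[OF ad_total(4)])

lemma ad_smY_left [simp]: "ad (%a. smY a y)"
 by (simp add: ad_def smY_add_left)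

lemma ad_Lv [simp]: "ad (Lv v)"
 unfolding Lv_def by (intro ad_ext ad_plus ad_comp[OF ad_single] ad_total)

lemma Lv_single [simp]: "Lv v (single w b) = single w (rh (bar v) b) + single (v # w) (sA (fst v) b)"
 unfolding Lv_def by (intro ext_single ad_plus ad_comp[OF ad_single] ad_total)

lemma ad_wact [simp]: "ad (wact w)"
 by (induction w) (simp_all add: ad_ident ad_comp[OF ad_Lv])

lemma ad_star_right [simp]: "ad (star f)"
 by (simp add: ad_def star_def ext_def ad_add[OF ad_wact] ad_add[OF ad_smY] sum.distrib)

lemma ad_star_left [simp]: "ad (%f. star f g)"
 unfolding star_def by (intro ad_ext ad_smY_left)

lemma star_single: "star (single w a) g = smY a (wact w g)"
 unfolding star_def by (intro ext_single ad_smY_left)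

lemma smY_smY: "smY a (smY b y) = smY (am a b) y"
 by (rule poly_mapping_eqI) (simp add: lookup_smY am_assoc)

lemma smY_pj [simp]: "smY (pj a) y = smY a y"
 by (rule poly_mapping_eqI) (simp add: lookup_smY)

lemma Lv_smY: "Lv v (smY b y) = smY (rh (bar v) b) y + smY (sA (fst v) b) (Lv v y)"
proof (rule ad_eq[where S = "%y. Lv v (smY b y)" and T = "%y. smY (rh (bar v) b) y + smY (sA (fst v) b) (Lv v y)"])
 show "Lv v (smY b (single w a)) = smY (rh (bar v) b) (single w a) + smY (sA (fst v) b) (Lv v (single w a))" for w a
  by (simp add: rh_am[OF HG_bar] sA_am ad_add[OF ad_smY] single_add add.assoc)
qed (intro ad_plus ad_comp[OF ad_Lv] ad_comp[OF ad_smY] ad_smY ad_Lv)+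

lemma star_smY: "star (smY a f) g = smY a (star f g)"
 by (rule ad_eq[where S = "%f. star (smY a f) g" and T = "%f. smY a (star f g)"])
   (simp_all add: ad_comp[OF ad_star_left] ad_comp[OF ad_smY] star_single smY_smY)

text \<open>\<open>A1\<close> projects the coefficients to the copy of A, so it acts as the identity
  only on elements whose coefficients lie there; values of \<open>Lv\<close> and \<open>smY\<close>
  are of this kind.\<close>

lemma smY_one: "smY A1 (Lv v y) = Lv v y" "smY A1 (smY a y) = smY a y"
proof -
 show "smY A1 (Lv v y) = Lv v y"
  by (rule ad_eq[where S = "%y. smY A1 (Lv v y)"]) (simp_all add: ad_comp[OF ad_smY] ad_add[OF ad_smY] am_one)
 show "smY A1 (smY a y) = smY a y" by (simp add: smY_smY am_one)
qed

lemma star_Lv: "star (Lv v f) g = Lv v (star f g)"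
proof (rule ad_eq[where S = "%f. star (Lv v f) g" and T = "%f. Lv v (star f g)"])
 show "star (Lv v (single w a)) g = Lv v (star (single w a) g)" for w a
  by (simp add: ad_add[OF ad_star_left] star_single Lv_smY)
qed (intro ad_comp[OF ad_star_left] ad_comp[OF ad_Lv] ad_Lv ad_star_left)+

lemma star_wact: "star (wact w g) h = wact w (star g h)"
 by (induction w) (simp_all add: star_Lv)

text \<open>Right multiplication by h commutes with the operators \<open>smY a\<close> and
  \<open>Lv v\<close>, from which left multiplication by a monomial is composed.\<close>

lemma star_assoc: "star (star f g) h = star f (star g h)"
proof (rule ad_eq[where S = "%f. star (star f g) h" and T = "%f. star f (star g h)"])
 show "star (star (single w a) g) h = star (single w a) (star g h)" for w a
  by (simp add: star_single star_smY star_wact)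
qed (intro ad_comp[OF ad_star_left] ad_star_left)+

definition HY :: "int => ('a, 'g) wmd => bool" where "HY n f \<longleftrightarrow> (\<forall>w. HA (n - wdeg w) (lookup f w))"

lemma HY_rules: "HY n 0" "HY n f ==> HY n g ==> HY n (f + g)" "HY n f ==> HY n (- f)"
 by (simp_all add: HY_def HA_rules lookup_add)

lemma HY_diff: "HY n f ==> HY n g ==> HY n (f - g)"
 using HY_rules(2)[of n f "- g"] HY_rules(3)[of n g] by simp

lemma HY_sgm: "HY n f ==> HY n (sgm k f)"
 by (simp add: sgm_def HY_rules)

lemma HY_single: "HA m b ==> n = m + wdeg w ==> HY n (single w b)"
 by (auto simp: HY_def lookup_single when_def HA_rules)

lemma HY_induct [consumes 1, case_names zero single add]:
 assumes f: "HY n f" and "P 0" "!!w b. HA (n - wdeg w) b ==> P (single w b)" "!!f g. P f ==> P g ==> P (f + g)"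
 shows "P f"
proof -
 have "finite S ==> P (\<Sum>w\<in>S. single w (lookup f w))" for S
  by (induction S rule: finite_induct) (use assms in \<open>auto simp: HY_def\<close>)
 from this[of "keys f"] poly_mapping_sum_single[of f] show ?thesis by simp
qed

lemma HY_smY: "HA m a ==> HY n f ==> HY (m + n) (smY a f)"
 unfolding HY_def lookup_smY using HA_rules(5)[of m a] by (metis add_diff_eq)

lemma HY_Lv: "HY n f ==> HY (fst v + n) (Lv v f)"
proof (induction f rule: HY_induct)
 case (single w b)
 then show ?case
  by (auto simp: sA_HA[OF single] intro!: HY_rules HY_single HA_sgm HA_rules(6)[OF HG_bar])
qed (simp_all add: ad_add[OF ad_Lv] ad_zero[OF ad_Lv] HY_rules)

lemma HY_wact: "HY n f ==> HY (wdeg w + n) (wact w f)"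
 by (induction w) (use HY_Lv in \<open>fastforce simp: add.assoc\<close>)+

lemma HY_star: "HY n f ==> HY m g ==> HY (n + m) (star f g)"
proof (induction f rule: HY_induct)
 case (single w b)
 show ?case using HY_smY[OF single(1) HY_wact[OF single(2), of w]] by (simp add: star_single)
qed (simp_all add: ad_add[OF ad_star_left] ad_zero[OF ad_star_left] HY_rules)

lemma HY_smY_one: "HY n f ==> smY A1 f = f"
 by (rule poly_mapping_eqI) (metis HA_pj HY_def am_one(1) lookup_smY)

definition hY :: "int => ('a, 'g) wmd => ('a, 'g) wmd" where "hY n = ext (%w b. single w (hA (n - wdeg w) b))"
text \<open>A term is odd when exactly one of its coefficient and its word is odd. For a word of odd
  degree this selects the even part of the coefficient.\<close>

definition od :: "('a, 'g) wmd => ('a, 'g) wmd" where "od = ext (%w b. single w (if even (wdeg w) then oA b else pj b - oA b))"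

lemma ad_hY [simp]: "ad (hY n)" and ad_od [simp]: "ad od"
 and lookup_hY: "lookup (hY n f) w = hA (n - wdeg w) (lookup f w)"
 and lookup_od: "lookup (od f) w = (if even (wdeg w) then oA (lookup f w) else pj (lookup f w) - oA (lookup f w))"
proof -
 have o: "ad (%b. if even (wdeg w) then oA b else pj b - oA b)" for w :: "(int \<times> 'g) list"
  by (cases "even (wdeg w)") (simp_all add: ad_total ad_subtract)
 show "ad (hY n)" "ad od" unfolding hY_def od_def by (intro ad_ext ad_comp[OF ad_single] ad_total o)+
 show "lookup (hY n f) w = hA (n - wdeg w) (lookup f w)" unfolding hY_def by (intro lookup_cw ad_total)
 show "lookup (od f) w = (if even (wdeg w) then oA (lookup f w) else pj (lookup f w) - oA (lookup f w))"
  unfolding od_def by (intro lookup_cw[of "%w b. if even (wdeg w) then oA b else pj b - oA b"] o)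
qed

lemma hY_HY: "HY n f ==> hY m f = (if m = n then f else 0)"
proof (rule poly_mapping_eqI)
 fix w assume "HY n f"
 then have "HA (n - wdeg w) (lookup f w)" by (simp add: HY_def)
 from hA_HA[OF this, of "m - wdeg w"] show "lookup (hY m f) w = lookup (if m = n then f else 0) w"
  by (simp add: lookup_hY)
qed

lemma od_HY: "HY n f ==> od f = (if odd n then f else 0)"
proof (rule poly_mapping_eqI)
 fix w assume "HY n f"
 then have "HA (n - wdeg w) (lookup f w)" by (simp add: HY_def)
 then show "lookup (od f) w = lookup (if odd n then f else 0) w"
  by (auto simp: lookup_od oA_HA HA_pj)
qed

end

section \<open>Lie monomials\<close>

text \<open>Lie monomials are kept as syntax because they are read in two places, in \<gg> by
  \<open>vl\<close> and in Y by \<open>ev\<close>. That the reading in \<gg> depends only on the one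
  in Y is the content of \<open>rY_ev\<close>.\<close>

datatype 'y ltree = Leaf "int \<times> 'y" | Node "'y ltree" "'y ltree"

primrec tdeg :: "'y ltree => int" where
 "tdeg (Leaf v) = fst v"
| "tdeg (Node s t) = tdeg s + tdeg t"

primrec tlen :: "'y ltree => nat" where
 "tlen (Leaf v) = 1"
| "tlen (Node s t) = tlen s + tlen t"

lemma tlen_pos: "tlen t > 0"
 by (induction t) auto

context algebroid_loc
begin

primrec vl :: "'g ltree => 'g => complex" where
 "vl (Leaf v) = bar v"
| "vl (Node s t) = gb (vl s) (vl t)"

primrec ev :: "'g ltree => ('a, 'g) wmd" where
 "ev (Leaf v) = single [v] A1"
| "ev (Node s t) = star (ev s) (ev t) - sgm (tdeg s * tdeg t) (star (ev t) (ev s))"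

lemmas smY_lin = ad_add[OF ad_smY] ad_diff[OF ad_smY] ad_minus[OF ad_smY] ad_zero[OF ad_smY]
 ad_add[OF ad_smY_left] ad_diff[OF ad_smY_left] ad_minus[OF ad_smY_left] ad_zero[OF ad_smY_left]
lemmas star_lin = ad_add[OF ad_star_right] ad_diff[OF ad_star_right] ad_minus[OF ad_star_right] ad_zero[OF ad_star_right]
 ad_add[OF ad_star_left] ad_diff[OF ad_star_left] ad_minus[OF ad_star_left] ad_zero[OF ad_star_left]
lemmas Ylin = smY_lin star_lin
lemmas rh_lin = ad_add[OF ad_total(13)] ad_minus[OF ad_total(13)] ad_diff[OF ad_total(13)] ad_zero[OF ad_total(13)]
 ad_add[OF ad_total(14)] ad_minus[OF ad_total(14)] ad_diff[OF ad_total(14)] ad_zero[OF ad_total(14)]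
lemmas gb_lin = ad_add[OF ad_total(10)] ad_minus[OF ad_total(10)] ad_diff[OF ad_total(10)] ad_zero[OF ad_total(10)]
 ad_add[OF ad_total(11)] ad_minus[OF ad_total(11)] ad_diff[OF ad_total(11)] ad_zero[OF ad_total(11)]
lemmas ga_lin = ad_add[OF ad_total(8)] ad_minus[OF ad_total(8)] ad_diff[OF ad_total(8)] ad_zero[OF ad_total(8)]
 ad_add[OF ad_total(9)] ad_minus[OF ad_total(9)] ad_diff[OF ad_total(9)] ad_zero[OF ad_total(9)]
lemmas am_lin = ad_add[OF ad_total(3)] ad_minus[OF ad_total(3)] ad_diff[OF ad_total(3)] ad_zero[OF ad_total(3)]
 ad_add[OF ad_total(4)] ad_minus[OF ad_total(4)] ad_diff[OF ad_total(4)] ad_zero[OF ad_total(4)]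
lemmas sA_zero = ad_zero[OF ad_total(15)]

lemma HG_vl: "HG (tdeg t) (vl t)"
 by (induction t) (auto intro: HG_bar HG_rules)

lemma HY_ev: "HY (tdeg t) (ev t)"
proof (induction t)
 case (Node s t)
 show ?case using HY_star[OF Node] HY_star[OF Node(2,1)]
  by (auto simp: add.commute[of "tdeg t"] intro!: HY_diff HY_sgm)
qed (auto intro: HY_single[OF HA_one])

lemma star_Leaf: "star (single [v] A1) g = Lv v g"
 by (simp add: star_single smY_one)

lemma star_Node: "star (ev (Node s t)) g = star (ev s) (star (ev t) g) - sgm (tdeg s * tdeg t) (star (ev t) (star (ev s) g))"
 by (simp add: star_lin ad_sgm'[OF ad_star_left] star_assoc)

text \<open>For a letter this is the rule defining Y. It passes to commutators because the anchor
  preserves brackets, so what differentiates the coefficient is the anchor of the value of the tree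
  in \<gg>.\<close>

lemma star_ev_smY:
 "star (ev t) (smY b g) = smY (rh (vl t) b) g + smY (sA (tdeg t) b) (star (ev t) g)"
proof -
 have *: "star (ev t) (smY b g) = smY (rh (vl t) b) g + sgm (tdeg t * m) (smY b (star (ev t) g))" if "HA m b" for m b g
  using that
 proof (induction t arbitrary: b m g)
  case (Leaf v)
  then show ?case by (simp add: star_Leaf Lv_smY sA_HA ad_sgm'[OF ad_smY_left])
 next
  case (Node s t)
  note b = HA_rules(6)[OF HG_vl Node(3)]
  show ?case
   unfolding star_Node Node(1)[OF Node(3)] Node(2)[OF Node(3)] ad_add[OF ad_star_right] ad_sgm'[OF ad_star_right]
    Node(1)[OF b] Node(2)[OF b] tdeg.simps vl.simps rh_gb[OF HG_vl HG_vl]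
   by (cases "even (tdeg s)"; cases "even (tdeg t)"; cases "even m"; simp add: sgm_def Ylin)
 qed
 show ?thesis
 proof (rule adA_eq[where X = "%b. star (ev t) (smY b g)" and Z = "%b. smY (rh (vl t) b) g + smY (sA (tdeg t) b) (star (ev t) g)"])
  show "star (ev t) (smY a g) = smY (rh (vl t) a) g + smY (sA (tdeg t) a) (star (ev t) g)" if "HA n a" for n a
   using *[OF that] by (simp add: sA_HA[OF that] ad_sgm'[OF ad_smY_left])
 qed (simp_all, (intro ad_plus ad_comp[OF ad_star_right] ad_comp[OF ad_smY_left] ad_smY_left ad_total)+)
qed

section \<open>Dynkin's operator and the Lie map from F to \<gg>\<close>

section \<open>The Dynkin operator\<close>

text \<open>The bracket nested to the right. The last letter is treated apart, since bracketing it
  with \<open>Dw [] = 0\<close> would give zero.\<close>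

primrec Dw :: "(int \<times> 'g) list => 'g => complex" where
 "Dw [] = 0"
| "Dw (v # w) = (if w = [] then bar v else gb (bar v) (Dw w))"

lemma HG_Dw: "HG (wdeg w) (Dw w)"
 by (induction w) (auto intro: HG_rules HG_bar)

definition Dt :: "('a, 'g) wmd => 'g => complex" where "Dt = ext (%w b. ga b (Dw w))"
text \<open>The division by the length normalises the operator so that a Lie monomial is sent to its
  value. For the empty word the factor is \<open>1 / 0 = 0\<close>, and \<open>Dw []\<close> is zero
  as well.\<close>

definition rY :: "('a, 'g) wmd => 'g => complex" where "rY = ext (%w b. ga (sc (1 / of_nat (length w)) b) (Dw w))"

lemma ad_sc: "ad (sc c)" by (simp add: ad_def sc_add)

lemma ad_Dt [simp]: "ad Dt" and ad_rY [simp]: "ad rY"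
 and Dt_single [simp]: "Dt (single w b) = ga b (Dw w)"
 and rY_single [simp]: "rY (single w b) = ga (sc (1 / of_nat (length w)) b) (Dw w)"
proof -
 have r: "ad (%b. ga (sc c b) u)" for c u by (rule ad_comp[OF ad_total(9) ad_sc])
 show "ad Dt" "ad rY" unfolding Dt_def rY_def by (intro ad_ext ad_total r)+
 show "Dt (single w b) = ga b (Dw w)" unfolding Dt_def by (intro ext_single ad_total)
 show "rY (single w b) = ga (sc (1 / of_nat (length w)) b) (Dw w)" unfolding rY_def by (intro ext_single r)
qed

lemmas rY_lin = ad_add[OF ad_rY] ad_minus[OF ad_rY] ad_diff[OF ad_rY] ad_zero[OF ad_rY]

lemma am_sc_right: "am a (sc c b) = sc c (am a b)"
 by (simp add: total_defs totA A_sc2[symmetric])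

lemma rY_smY: "rY (smY a y) = ga a (rY y)"
 by (rule ad_eq[where S = "%y. rY (smY a y)" and T = "%y. ga a (rY y)"])
   (simp_all add: ad_comp[OF ad_rY] ad_comp[OF ad_total(8)] am_sc_right[symmetric] ga_am)

lemma lookup_Lv_Nil: "lookup (Lv v g) [] = rh (bar v) (lookup g [])"
 by (rule ad_eq[where S = "%g. lookup (Lv v g) []" and T = "%g. rh (bar v) (lookup g [])"])
   (auto intro!: ad_comp[OF ad_lookup ad_Lv] ad_comp[OF ad_total(13) ad_lookup] simp: lookup_add lookup_single when_def rh_lin)

lemma lookup_star_Nil: "lookup (star (ev t) g) [] = rh (vl t) (lookup g [])"
 by (induction t arbitrary: g)
   (simp_all add: star_Leaf lookup_Lv_Nil star_Node lookup_minus rh_gb[OF HG_vl HG_vl] ad_sgm'[OF ad_lookup] del: ev.simps(2))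

lemma lookup_ev_Nil: "lookup (ev t) [] = 0"
 by (induction t) (simp_all add: lookup_single lookup_minus lookup_star_Nil ad_sgm'[OF ad_lookup] rh_lin sgm_def)

text \<open>On both sides the coefficient is differentiated by the anchor: on the left by the rule
  of Y, on the right by the Leibniz rule for the bracket of \<gg>. The last term corrects for the
  empty word, where \<open>Dw [v]\<close> is the letter itself and not a bracket.\<close>

lemma Dt_Lv: "Dt (Lv v g) = gb (bar v) (Dt g) + ga (sA (fst v) (lookup g [])) (bar v)"
 by (rule ad_eq[where S = "%g. Dt (Lv v g)" and T = "%g. gb (bar v) (Dt g) + ga (sA (fst v) (lookup g [])) (bar v)"])
   (auto intro!: ad_plus ad_comp[OF ad_Dt ad_Lv] ad_comp[OF ad_total(10) ad_Dt] ad_comp[OF ad_total(9) ad_comp[OF ad_total(15) ad_lookup]]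
    simp: ad_add[OF ad_Dt] gb_ga[OF HG_bar] lookup_single when_def sA_zero ga_lin gb_lin)

text \<open>Without a constant term, \<open>Dt\<close> turns left multiplication by a letter into
  its adjoint action on \<gg>. The Jacobi identity extends this to trees.\<close>

lemma Dt_star: "lookup g [] = 0 ==> Dt (star (ev t) g) = gb (vl t) (Dt g)"
proof (induction t arbitrary: g)
 case (Node s t)
 have z: "lookup (star (ev r) g) [] = 0" for r by (simp add: lookup_star_Nil Node(3) rh_lin)
 show ?case
  unfolding star_Node ad_diff[OF ad_Dt] ad_sgm'[OF ad_Dt] Node(1)[OF z] Node(2)[OF z] Node(1)[OF Node(3)] Node(2)[OF Node(3)]
  by (simp add: gb_jacobi[OF HG_vl[of s] HG_vl[of t]])
qed (simp add: star_Leaf Dt_Lv sA_zero ga_lin)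

text \<open>The Dynkin-Specht-Wever identity. On the node of s and t, the product in the order s, t
  contributes the bracket \<open>tlen t\<close> times, and the product in the other order
  contributes it \<open>tlen s\<close> times by antisymmetry.\<close>

lemma Dt_ev: "Dt (ev t) = sc (of_nat (tlen t)) (vl t)"
proof (induction t)
 case (Leaf v)
 then show ?case by (simp add: am_one HG_pj[OF HG_bar])
next
 case (Node s t)
 have e: "gb (vl s) (vl t) = - sgm (tdeg s * tdeg t) (gb (vl t) (vl s))" by (rule gb_antisym[OF HG_vl HG_vl])
 show ?case
  by (simp add: ad_diff[OF ad_Dt] ad_sgm'[OF ad_Dt] Dt_star lookup_ev_Nil Node gb_sc sc_add_left e)
    (simp add: sgm_def sc_minus algebra_simps)
qed

text \<open>\<open>rY\<close> divides by the length word by word, so it is a multiple of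
  \<open>Dt\<close> only on elements of one length. Lie monomials have scalar coefficients, which
  the anchor kills; hence no shorter words arise when letters are moved past them.\<close>

inductive_set pu :: "nat => ('a, 'g) wmd set" for p where
 pu_zero: "0 : pu p"
| pu_single: "length w = p ==> f : pu p ==> single w (sc c A1) + f : pu p"

lemma pu_add: "f : pu p ==> g : pu p ==> f + g : pu p"
 by (induction f rule: pu.induct) (auto simp: add.assoc intro: pu.intros)

lemma pj_sc_one: "pj (sc c A1) = sc c A1"
 by (rule HA_pj[OF HA_rules(4)[OF HA_one]])

lemma pu_smY: "f : pu p ==> smY (sc c A1) f : pu p"
 by (induction f rule: pu.induct)
   (auto simp: smY_lin am_sc am_one pj_sc_one sc_simps(4) intro: pu.intros)

lemma rh_sc_one: "HG n u ==> rh u (sc c A1) = 0"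
 by (auto simp: HG_def rh_def totA derD(3)[OF anchor_der])

lemma pu_Lv: "f : pu p ==> Lv v f : pu (Suc p)"
 by (induction f rule: pu.induct)
   (auto simp: ad_zero[OF ad_Lv] ad_add[OF ad_Lv] rh_sc_one[OF HG_bar] sA_HA[OF HA_rules(4)[OF HA_one]] sgm_def intro: pu.intros)

lemma pu_star: "f : pu p ==> g : pu q ==> star f g : pu (p + q)"
proof (induction f rule: pu.induct)
 case (pu_single w f c)
 have "wact u g : pu (length u + q)" for u
  using \<open>g : pu q\<close> by (induction u) (auto intro: pu_Lv)
 then have "smY (sc c A1) (wact w g) : pu (p + q)" using pu_single(1) pu_smY by blast
 then show ?case using pu_single by (simp add: star_lin star_single pu_add)
qed (auto simp: star_lin intro: pu.intros)

lemma pu_sgm: "f : pu p ==> sgm k f : pu p" and pu_minus: "f : pu p ==> - f : pu p"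
proof -
 show m: "- f : pu p" if "f : pu p" for f using that
 proof (induction f rule: pu.induct)
  case (pu_single w f c)
  then show ?case using pu.pu_single[of w p "- f" "- c"] by (simp add: single_uminus sc_minus_left)
 qed (simp add: pu.intros)
 then show "f : pu p ==> sgm k f : pu p" by (simp add: sgm_def)
qed

lemma pu_ev: "ev t : pu (tlen t)"
proof (induction t)
 case (Leaf v)
 show ?case using pu_single[of "[v]" 1 0 1] pu_zero[of 1] by simp
next
 case (Node s t)
 have "star (ev s) (ev t) + - sgm (tdeg s * tdeg t) (star (ev t) (ev s)) : pu (tlen s + tlen t)"
  using pu_star[OF Node] pu_star[OF Node(2,1)] by (intro pu_add pu_minus pu_sgm) (simp_all add: add.commute)
 then show ?case by simp
qed

lemma rY_pu: "f : pu p ==> rY f = sc (1 / of_nat p) (Dt f)"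
 by (induction f rule: pu.induct)
   (auto simp: rY_lin ad_zero[OF ad_Dt] ad_add[OF ad_Dt] sc_add ga_sc)

lemma rY_ev: "rY (ev t) = vl t"
 using tlen_pos[of t] by (simp add: rY_pu[OF pu_ev] Dt_ev)

lemma HG_rY: "HY n f ==> HG n (rY f)"
proof (induction f rule: HY_induct)
 case (single w b)
 show ?case using HG_rules(3)[OF HA_rules(4)[OF single] HG_Dw[of w]] by simp
qed (auto simp: rY_lin intro: HG_rules)

section \<open>The free Lie algebroid inside the free module\<close>

text \<open>The graded commutator; \<open>od\<close> is the odd part, so the last two terms correct the sign for two odd
  elements.\<close>

definition br :: "('a, 'g) wmd => ('a, 'g) wmd => ('a, 'g) wmd" where
 "br f g = star f g - star g f + star (od g) (od f) + star (od g) (od f)"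

lemma ad_br [simp]: "ad (br f)" "ad (%f. br f g)"
 unfolding br_def by (intro ad_plus ad_subtract ad_comp[OF ad_star_left] ad_comp[OF ad_star_right] ad_star_left ad_star_right ad_od)+

lemmas br_lin = ad_add[OF ad_br(1)] ad_minus[OF ad_br(1)] ad_diff[OF ad_br(1)] ad_zero[OF ad_br(1)]
 ad_add[OF ad_br(2)] ad_minus[OF ad_br(2)] ad_diff[OF ad_br(2)] ad_zero[OF ad_br(2)]

lemma br_HY: "HY n f ==> HY m g ==> br f g = star f g - sgm (n * m) (star g f)"
 by (auto simp: br_def od_HY sgm_def star_lin)

inductive_set Fs :: "('a, 'g) wmd set" where
 Fs_zero: "0 : Fs"
| Fs_gen: "HA i a ==> f : Fs ==> smY a (ev t) + f : Fs"

lemma Fs_add: "f : Fs ==> g : Fs ==> f + g : Fs"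
 by (induction f rule: Fs.induct) (auto simp: add.assoc intro: Fs.intros)

lemma Fs_smY_ev: "smY c (ev t) : Fs"
proof -
 have "smY (eA y) (ev t) : Fs" if "y : car A" for y
  using grA that
 proof (induction y rule: graded_induct)
  case (hom n y)
  then show ?case using Fs_gen[OF HA_I Fs_zero] by simp
 qed (auto simp: totA smY_lin Fs_zero Fs_add)
 from this[of "dA c"] show ?thesis by (simp add: pj_def[symmetric])
qed

lemma Fs_smY: "f : Fs ==> smY b f : Fs"
 by (induction f rule: Fs.induct) (auto simp: smY_lin smY_smY Fs_zero intro: Fs_add Fs_smY_ev)

lemma Fs_smY_one: "f : Fs ==> smY A1 f = f"
 by (induction f rule: Fs.induct) (auto simp: smY_lin smY_one)

lemma Fs_minus: "f : Fs ==> - f : Fs"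
 using Fs_smY[of f "- A1"] by (simp add: smY_lin Fs_smY_one)

lemma Fs_diff: "f : Fs ==> g : Fs ==> f - g : Fs"
 using Fs_add[of f "- g"] Fs_minus[of g] by simp

lemma Fs_sgm: "f : Fs ==> sgm k f : Fs"
 by (simp add: sgm_def Fs_minus)

lemma lookup_Fs_Nil: "f : Fs ==> lookup f [] = 0"
 by (induction f rule: Fs.induct) (simp_all add: lookup_add lookup_smY lookup_ev_Nil am_lin)

lemma gb_ga_ga:
 assumes h: "HA i a" "HG j u" "HA k b" "HG l v"
 shows "gb (ga a u) (ga b v) = ga (am a (rh u b)) v - sgm ((i + j) * (k + l)) (ga (am b (rh v a)) u) + sgm (j * k) (ga (am a b) (gb u v))"
proof -
 have 1: "gb (ga a u) (ga b v) = ga (am a (rh u b)) v + sgm ((i + j) * k) (ga b (gb (ga a u) v))"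
  using gb_ga[OF HG_rules(3)[OF h(1,2)], of b v] by (simp add: rh_ga sA_HA[OF h(3)] ad_sgm'[OF ad_total(9)])
 have 2: "gb (ga a u) v = - sgm ((i + j) * l) (ga (rh v a) u + sgm (l * i) (ga a (gb v u)))"
  using gb_antisym[OF HG_rules(3)[OF h(1,2)] h(4)] gb_ga[OF h(4), of a u] by (simp add: sA_HA[OF h(1)] ad_sgm'[OF ad_total(9)])
 have 3: "gb v u = - sgm (l * j) (gb u v)" by (rule gb_antisym[OF h(4,2)])
 have 4: "am b a = sgm (k * i) (am a b)" by (rule am_comm[OF h(3,1)])
 show ?thesis
  unfolding 1 2 3 ga_lin ad_sgm'[OF ad_total(8)] ga_am[symmetric] 4 ad_sgm'[OF ad_total(9)]
  by (cases "even i"; cases "even j"; cases "even k"; cases "even l"; simp add: sgm_def ga_lin)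
qed

text \<open>The right-hand side is that of \<open>gb_ga_ga\<close> with Lie monomials in place of
  their values. This gives at once that F is closed under the commutator and that \<open>rY\<close>
  preserves brackets.\<close>

lemma br_gens:
 assumes h: "HA i a" "HA k b"
 shows "br (smY a (ev s)) (smY b (ev t)) = smY (am a (rh (vl s) b)) (ev t) - sgm ((i + tdeg s) * (k + tdeg t)) (smY (am b (rh (vl t) a)) (ev s))
  + sgm (tdeg s * k) (smY (am a b) (ev (Node s t)))"
proof -
 have 1: "star (smY a (ev s)) (smY b (ev t)) = smY (am a (rh (vl s) b)) (ev t) + sgm (tdeg s * k) (smY (am a b) (star (ev s) (ev t)))"
  by (simp add: star_smY star_ev_smY sA_HA[OF h(2)] smY_lin smY_smY ad_sgm'[OF ad_smY] ad_sgm'[OF ad_smY_left])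
 have 2: "star (smY b (ev t)) (smY a (ev s)) = smY (am b (rh (vl t) a)) (ev s) + sgm (tdeg t * i) (smY (am b a) (star (ev t) (ev s)))"
  by (simp add: star_smY star_ev_smY sA_HA[OF h(1)] smY_lin smY_smY ad_sgm'[OF ad_smY] ad_sgm'[OF ad_smY_left])
 show ?thesis
  unfolding br_HY[OF HY_smY[OF h(1) HY_ev] HY_smY[OF h(2) HY_ev]] 1 2 am_comm[OF h(2,1)] ev.simps
  by (cases "even i"; cases "even k"; cases "even (tdeg s)"; cases "even (tdeg t)"; simp add: sgm_def Ylin)
qed

lemma Fs_br_gens:
 assumes h: "HA i a" "HA k b"
 shows "br (smY a (ev s)) (smY b (ev t)) : Fs"
  and "rY (br (smY a (ev s)) (smY b (ev t))) = gb (rY (smY a (ev s))) (rY (smY b (ev t)))"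
proof -
 show "br (smY a (ev s)) (smY b (ev t)) : Fs"
  unfolding br_gens[OF h] by (intro Fs_add Fs_diff Fs_sgm Fs_smY_ev)
 show "rY (br (smY a (ev s)) (smY b (ev t))) = gb (rY (smY a (ev s))) (rY (smY b (ev t)))"
  unfolding br_gens[OF h] rY_smY rY_ev gb_ga_ga[OF h(1) HG_vl h(2) HG_vl] rY_lin ad_sgm'[OF ad_rY] vl.simps ..
qed

lemma Fs_br: assumes "f : Fs" "g : Fs" shows "br f g : Fs & rY (br f g) = gb (rY f) (rY g)"
 using assms(1)
proof (induction f rule: Fs.induct)
 case (Fs_gen i a f s)
 have "br (smY a (ev s)) g : Fs & rY (br (smY a (ev s)) g) = gb (rY (smY a (ev s))) (rY g)"
  using assms(2)
 proof (induction g rule: Fs.induct)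
  case (Fs_gen k b g t)
  then show ?case using Fs_br_gens[OF \<open>HA i a\<close> Fs_gen(1), of s t] by (simp add: br_lin rY_lin gb_lin Fs_add)
 qed (simp add: br_lin rY_lin gb_lin Fs_zero)
 then show ?case using Fs_gen by (simp add: br_lin rY_lin gb_lin Fs_add)
qed (simp add: br_lin rY_lin gb_lin Fs_zero)

lemma star_Fs_smY:
 assumes f: "f : Fs" "HY n f"
 shows "star f (smY b g) = smY (rh (rY f) b) g + smY (sA n b) (star f g)"
proof -
 \<comment> \<open>The sign for f and b is written as 1 minus twice the term with both odd parts.
   This form is additive in f and b, as the induction requires: it does not keep f
   homogeneous.\<close>
 have *: "star f (smY b g) = smY (rh (rY f) b) g + smY b (star f g) - smY (oA b) (star (od f) g) - smY (oA b) (star (od f) g)"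
  using f(1)
 proof (induction f rule: Fs.induct)
  case (Fs_gen i a f t)
  have "star (smY a (ev t)) (smY b g) = smY (rh (rY (smY a (ev t))) b) g + smY b (star (smY a (ev t)) g)
    - smY (oA b) (star (od (smY a (ev t))) g) - smY (oA b) (star (od (smY a (ev t))) g)"
  proof (rule adA_eq[where X = "%b. star (smY a (ev t)) (smY b g)" and Z = "%b. smY (rh (rY (smY a (ev t))) b) g
    + smY b (star (smY a (ev t)) g) - smY (oA b) (star (od (smY a (ev t))) g) - smY (oA b) (star (od (smY a (ev t))) g)"])
   fix m b assume b: "HA m b"
   show "star (smY a (ev t)) (smY b g) = smY (rh (rY (smY a (ev t))) b) g + smY b (star (smY a (ev t)) g)
     - smY (oA b) (star (od (smY a (ev t))) g) - smY (oA b) (star (od (smY a (ev t))) g)"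
    unfolding od_HY[OF HY_smY[OF Fs_gen(1) HY_ev]] oA_HA[OF b] rY_smY rY_ev rh_ga star_smY star_ev_smY sA_HA[OF b]
    using am_comm[OF b Fs_gen(1)]
    by (cases "even i"; cases "even m"; cases "even (tdeg t)"; simp add: sgm_def Ylin am_lin smY_smY star_smY)
  qed (simp_all, (intro ad_plus ad_subtract ad_comp[OF ad_star_right] ad_comp[OF ad_smY_left] ad_smY_left ad_total)+)
  with Fs_gen show ?case by (simp add: Ylin rY_lin rh_lin ad_add[OF ad_od])
 qed (simp add: Ylin rY_lin rh_lin ad_zero[OF ad_od])
 show ?thesis
 proof (cases "even n")
  case True
  then show ?thesis using * by (simp add: od_HY[OF f(2)] sA_def Ylin)
 next
  case False
  then have "sA n b = pj b - oA b - oA b" by (simp only: sA_def if_False)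
  then show ?thesis using * False by (simp only: od_HY[OF f(2)] smY_lin smY_pj if_True add_diff_eq not_False_eq_True)
 qed
qed

end

section \<open>The trivial fibration onto \<gg> and the lifting argument\<close>

section \<open>Graded groups spanned by their parts\<close>

inductive_set hspan :: "(int => 'e::ab_group_add set) => 'e set" for H where
 hspan_zero: "0 : hspan H"
| hspan_step: "x : H n ==> y : hspan H ==> x + y : hspan H"

lemma hspan_add: "x : hspan H ==> y : hspan H ==> x + y : hspan H"
 by (induction x rule: hspan.induct) (auto simp: add.assoc intro: hspan.intros)

lemma hspan_hom: "x : H n ==> x : hspan H"
 using hspan_step[OF _ hspan_zero] by fastforce

lemma hspan_minus: "(!!n x. x : H n ==> - x : H n) ==> x : hspan H ==> - x : hspan H"
proof -
 assume H: "!!n x. x : H n ==> - x : H n" and "x : hspan H"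
 from this(2) show ?thesis
 proof (induction x rule: hspan.induct)
  case (hspan_step x n y)
  have "- x + - y : hspan H" using H hspan_step by (blast intro: hspan.hspan_step)
  then show ?case by simp
 qed (simp add: hspan_zero)
qed

text \<open>The additive maps \<open>pr\<close> are given on the whole type and separate the parts;
  applied to a finite sum of homogeneous elements they yield both its decomposition and the
  uniqueness.\<close>

lemma span_graded:
 fixes M :: "('r, 'e::ab_group_add, 'z) gmod_scheme"
 assumes H: "!!n. 0 : H n" "!!n x y. x : H n ==> y : H n ==> x + y : H n" "!!n x. x : H n ==> - x : H n"
  and pr: "!!n. ad (pr n)" "!!n m x. x : H m ==> pr n x = (if m = n then x else 0)"
  and M: "car M = hspan H" "add M = (+)" "zero M = 0" "hp M = H"
 shows "graded_group M"
proof -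
 have minus: "- x : hspan H" if "x : hspan H" for x
  by (rule hspan_minus[of H x, OF H(3) that])
 have ab: "abelian_group M"
 proof (rule abelian_groupI)
  fix x assume "x : car M"
  then show "\<exists>y\<in>car M. y \<oplus>\<^sub>M x = \<zero>\<^sub>M" using minus by (intro bexI[of _ "- x"]) (auto simp: M)
 qed (auto simp: M hspan_add hspan_zero add.assoc add.commute)
 interpret abelian_group M by (rule ab)
 have inv: "\<ominus>\<^sub>M x = - x" if "x : hspan H" for x
  using that minus by (intro minus_equality) (auto simp: M)
 have fin: "(\<Oplus>\<^bsub>M\<^esub>n\<in>T. f n) = (\<Sum>n\<in>T. f n)" if "finite T" "!!n. f n : H n" for T f
  using that(1)
 proof (induction T rule: finite_induct)
  case (insert n T)
  have "f : T \<rightarrow> car M" "f n : car M" using hspan_hom[OF that(2)] by (auto simp: M)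
  with insert show ?case by (subst finsum_insert) (simp_all add: M)
 qed (simp add: M)
 have dec: "\<exists>S. finite S & (\<forall>n. pr n x : H n) & (\<forall>T. finite T --> S <= T --> x = (\<Sum>n\<in>T. pr n x))" if "x : hspan H" for x
  using that
 proof (induction x rule: hspan.induct)
  case hspan_zero
  then show ?case using ad_zero[OF pr(1)] H(1) by (intro exI[of _ "{}"]) simp
 next
  case (hspan_step x n y)
  then obtain S where S: "finite S" "!!n. pr n y : H n" "!!T. finite T ==> S <= T ==> y = (\<Sum>n\<in>T. pr n y)" by blast
  have "x + y = (\<Sum>k\<in>T. pr k (x + y))" if "finite T" "insert n S <= T" for T
  proof -
   have "(\<Sum>k\<in>T. pr k x) = (\<Sum>k\<in>T. if n = k then x else 0)" by (rule sum.cong) (simp_all add: pr(2)[OF hspan_step(1)])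
   also have "\<dots> = x" using that by simp
   finally show ?thesis using S(3)[of T] that by (simp add: ad_add[OF pr(1)] sum.distrib)
  qed
  moreover have "pr k (x + y) : H k" for k
   using hspan_step(1) S(2) H(2)[of x k "pr k y"] by (auto simp: ad_add[OF pr(1)] pr(2)[OF hspan_step(1)])
  ultimately show ?case using S(1) by (intro exI[of _ "insert n S"]) blast
 qed
 show ?thesis
 proof (rule graded_groupI(1)[OF ab, where pr = pr])
  show "subgroup (hp M n) (add_monoid M)" for n
  proof (rule add.subgroupI)
   fix x assume "x : hp M n"
   then show "\<ominus>\<^sub>M x : hp M n" using inv[OF hspan_hom] H(3) by (simp add: M)
  next
   show "hp M n ~= {}" using H(1)[of n] by (auto simp: M)
  qed (use H hspan_hom in \<open>auto simp: M\<close>)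
  show "pr n x : car M" if "x : car M" for n x
   using dec[of x] that hspan_hom by (fastforce simp: M)
  show "pr n x = (if m = n then x else \<zero>\<^sub>M)" if "x : hp M m" for n m x
   using pr(2) that by (simp add: M)
  show "\<exists>S f. finite S & (\<forall>n\<in>S. f n : hp M n) & x = (\<Oplus>\<^bsub>M\<^esub>n\<in>S. f n)" if x: "x : car M" for x
  proof -
   obtain S where S: "finite S" "!!n. pr n x : H n" "x = (\<Sum>n\<in>S. pr n x)" using dec[of x] x by (auto simp: M)
   have "x = (\<Oplus>\<^bsub>M\<^esub>n\<in>S. pr n x)" using fin[OF S(1,2)] S(3) by simp
   then show ?thesis using S(1,2) by (intro exI[of _ S] exI[of _ "%n. pr n x"]) (simp add: M)
  qed
 qed (simp_all add: M ad_add[OF pr(1)])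
qed

context cdga_loc
begin

text \<open>A scalar c acts through \<open>c \<odot> \<one>\<close>, a cocycle of degree 0 in A. In
  the other degrees \<open>CC\<close> has only the scalar 0, so zero scalars are treated
  separately.\<close>

lemma over_CC_dg_module:
 fixes M :: "('a, 'm, 'z) dgla_scheme"
 assumes M: "dg_module A M"
 shows "dg_module CC (over_CC A M)"
proof -
 let ?C = "over_CC A M"
 note m = dg_moduleD[OF M]
 have sel: "carrier ?C = car M" "add ?C = add M" "zero ?C = zero M" "hp ?C = hp M" "dif ?C = dif M"
  "smult ?C = (%c x. (c \<odot> \<one>) \<odot>\<^sub>M x)" by (simp_all add: over_CC_def)
 have hd: "hdecomp ?C = hdecomp M"
  unfolding hdecomp_def fun_eq_iff sel by (simp add: finsum_eqI[of ?C M, OF sel(1,2,3)])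
 have ab: "abelian_group ?C"
 proof -
  interpret abelian_group M by (rule m(2))
  show ?thesis by (rule abelian_groupI) (use a_assoc a_comm l_neg in \<open>auto simp: sel intro: a_inv_closed\<close>)
 qed
 have sg: "subgroup (hp M n) (add_monoid ?C)" for n
  using m(1) unfolding graded_group_def subgroup_def m_inv_def by (simp add: sel)
 have gr: "graded_group ?C"
  using m(1) ab sg unfolding graded_group_def hd sel by simp
 have c1: "c \<odot> \<one> : hp A 0" for c by (simp add: A_smult_hpart)
 have cc: "c \<odot> \<one> : car A" for c using A_hcarr[OF c1] .
 have inv: "a_inv ?C = a_inv M" by (simp add: a_inv_def m_inv_def fun_eq_iff sel)
 have z: "(0 \<odot> \<one>) = \<zero>"
  using A_mod(4)[of 0 0 "\<one>"] cc[of 0] by (metis A.add.l_cancel_one' A.one_closed CC_sel(1,5) UNIV_I add_0)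
 have z2: "\<zero> \<odot>\<^sub>M x = \<zero>\<^sub>M" if "x : car M" for x
 proof -
  interpret abelian_group M by (rule m(2))
  show ?thesis using m(4)[of "\<zero>" "\<zero>" x] m(3)[of "\<zero>" x] that by (metis A.l_zero A.zero_closed add.l_cancel_one')
 qed
 have kz: "\<ominus>\<^sub>M \<zero>\<^sub>M = \<zero>\<^sub>M"
 proof -
  interpret abelian_group M by (rule m(2))
  show ?thesis by (rule minus_equality) simp_all
 qed
 have d1: "dif A (c \<odot> \<one>) = \<zero>" for c
 proof -
  have "dif A \<one> = dif A \<one> \<oplus> dif A \<one>"
   using A_dif_mult[OF A_one, of "\<one>"] by (simp add: ksign_def)
  then have "dif A \<one> = \<zero>" by (metis A.add.l_cancel_one' A.one_closed A_dif)
  then show ?thesis using A_mod(12)[of c 0 "\<one>"] by (simp add: ksign_def z)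
 qed
 show ?thesis
  unfolding dg_module_def graded_module_def
 proof (intro conjI ballI allI)
  fix n :: int and a :: complex and x assume a: "a : hpart CC n" and x: "x : carrier ?C"
  have "dif M ((a \<odot> \<one>) \<odot>\<^sub>M x) = \<zero> \<odot>\<^sub>M x \<oplus>\<^sub>M (a \<odot> \<one>) \<odot>\<^sub>M dif M x"
   using m(12)[OF c1, of x a] x by (simp add: d1 sel ksign_def)
  then show "dif ?C (a \<odot>\<^sub>?C x) = dif CC a \<odot>\<^sub>?C x \<oplus>\<^sub>?C ksign ?C n (a \<odot>\<^sub>?C dif ?C x)"
   using a dg_moduleD(3)[OF M cc dif_carrier[OF M]] x z2 z
   by (cases "n = 0") (auto simp: sel ksign_def inv dif_carrier[OF M] kz)
 next
  fix n k :: int and a :: complex and x assume "a : hpart CC n" "x : hp ?C k"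
  then show "a \<odot>\<^sub>?C x : hp ?C (n + k)"
   using m(8)[OF c1, of x k a] z z2 hpart_zero[OF m(1)] hpart_carrier[OF m(1)] by (cases "n = 0") (auto simp: sel)
 next
  fix a b :: complex and x assume x: "x : carrier ?C"
  show "(a \<oplus>\<^sub>CC b) \<odot>\<^sub>?C x = a \<odot>\<^sub>?C x \<oplus>\<^sub>?C b \<odot>\<^sub>?C x"
   using m(4)[OF cc cc, of x a b] A_mod(4)[of a b "\<one>"] x by (simp add: sel)
  show "(a \<otimes>\<^sub>CC b) \<odot>\<^sub>?C x = a \<odot>\<^sub>?C (b \<odot>\<^sub>?C x)"
   using m(6)[OF cc cc, of x a b] x by (simp add: sel A_sc1[symmetric] A_sc_assoc)
 next
  fix x assume x: "x : carrier ?C"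
  show "\<one>\<^sub>CC \<odot>\<^sub>?C x = x" using m(7)[of x] A_mod(7)[of "\<one>"] x by (simp add: sel)
 qed (use m cc gr in \<open>simp_all add: sel dif_carrier[OF M]\<close>)
qed

end

section \<open>The cofree dg-Lie algebroid on the free one\<close>

lemma dg_module_hom_comp: "dg_module_hom R M N f ==> graded_group M ==> dg_module_hom R N P g ==>
  (!!x. x : car M ==> f x : car N) ==> (!!x. x : car M ==> h x = g (f x)) ==>
  (!!x y. x : car M ==> y : car M ==> x \<oplus>\<^sub>M y : car M) ==> (!!a x. a : carrier R ==> x : car M ==> a \<odot>\<^sub>M x : car M) ==>
  (!!x. x : car M ==> dif M x : car M) ==> dg_module_hom R M P h"
 unfolding dg_module_hom_def graded_module_hom_def by (simp add: hpart_carrier)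

context algebroid_loc
begin

lemma dAT_am: "dAT (am a b) = am (dAT a) b + am (sA 1 a) (dAT b)"
proof (rule adA_eq[where X = "%a. dAT (am a b)" and Z = "%a. am (dAT a) b + am (sA 1 a) (dAT b)"])
 fix n a assume a: "HA n a"
 then obtain x where "x : hp A n" "a = eA x" by (auto simp: HA_def)
 then show "dAT (am a b) = am (dAT a) b + am (sA 1 a) (dAT b)"
  unfolding sA_HA[OF a] ad_sgm'[OF ad_total(4)] by (simp add: total_defs A_dif_mult totA eA_ksign)
qed (simp_all, (intro ad_rules ad_comp[OF ad_total(7)] ad_comp[OF ad_total(4)] ad_total)+)

lemma dAT_dAT: "dAT (dAT a) = 0" and dT_dT: "dT (dT u) = 0"
 by (simp_all add: total_defs A_mod(11) G_mod(11))

lemma dT_ga: "HA n a ==> dT (ga a u) = ga (dAT a) u + sgm n (ga a (dT u))"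
 by (auto simp: HA_def total_defs G_mod(12) totG eG_ksign)

lemma dT_gb: "HG n u ==> dT (gb u v) = gb (dT u) v + sgm n (gb u (dT v))"
 by (auto simp: HG_def total_defs bracket_dif totG eG_ksign)

lemma dAT_rh: "HG n u ==> dAT (rh u a) = rh (dT u) a + sgm n (rh u (dAT a))"
proof -
 assume "HG n u"
 then obtain x where x: "x : hp G n" "u = eG x" by (auto simp: HG_def)
 have "dif A (anchor G x (dA a)) = anchor G (dif G x) (dA a) \<oplus> ksign A n (anchor G x (dif A (dA a)))"
  using anchor_dif[OF x(1), of "dA a"] x(1) by (simp add: a_minus_def A.a_assoc A.l_neg)
 then show ?thesis using x by (simp add: total_defs totA eA_ksign)
qed

lemma dAT_eA: "a : car A ==> dAT (eA a) = eA (dif A a)"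
 by (simp add: dAT_def)

lemma dAT_one: "dAT (sc c A1) = 0"
proof -
 have "dAT A1 = dAT A1 + dAT A1"
  using dAT_am[of A1 A1] by (simp add: am_one sA_HA[OF HA_one] sgm_def)
 moreover have "dAT (sc c a) = sc c (dAT a)" for a
  by (simp add: total_defs totA dif_A_sc)
 ultimately show ?thesis by simp
qed

definition "sY f = f - od f - od f"

lemma ad_sY [simp]: "ad sY"
 unfolding sY_def by (intro ad_subtract ad_ident ad_od)

lemma sY_HY: "HY n f ==> sY f = sgm n f"
 by (auto simp: sY_def od_HY sgm_def)

lemma Fs_sY: "HY n f ==> f : Fs ==> sY f : Fs"
 by (simp add: sY_HY Fs_sgm)

lemma HY_br: "HY n f ==> HY m g ==> HY (n + m) (br f g)"
 using HY_star[of n f m g] HY_star[of m g n f] by (auto simp: br_HY add.commute intro!: HY_diff HY_sgm)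

lemma br_antisym: "HY n f ==> HY m g ==> br f g = - sgm (n * m) (br g f)"
 by (auto simp: br_HY sgm_def)

lemma br_jacobi:
 assumes h: "HY n f" "HY m g" "HY l h"
 shows "br f (br g h) = br (br f g) h + sgm (n * m) (br g (br f h))"
 unfolding br_HY[OF h(1) HY_br[OF h(2,3)]] br_HY[OF HY_br[OF h(1,2)] h(3)] br_HY[OF h(2) HY_br[OF h(1,3)]]
 unfolding br_HY[OF h(1,2)] br_HY[OF h(1,3)] br_HY[OF h(2,3)]
 by (cases "even n"; cases "even m"; cases "even l"; simp add: sgm_def star_lin star_assoc)

lemma br_smY:
 assumes f: "f : Fs" "HY n f" and a: "HA m a" and g: "HY l g"
 shows "br f (smY a g) = smY (rh (rY f) a) g + sgm (n * m) (smY a (br f g))"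
 unfolding br_HY[OF f(2) HY_smY[OF a g]] br_HY[OF f(2) g] star_Fs_smY[OF f] star_smY sA_HA[OF a]
 by (cases "even n"; cases "even m"; cases "even l"; simp add: sgm_def smY_lin)

lemma smY_const: "star (smY (sc c A1) f) g = smY (sc c A1) (star f g)" "star f (smY (sc c A1) g) = smY (sc c A1) (star f g)"
 "od (smY (sc c A1) f) = smY (sc c A1) (od f)"
proof -
 have L: "Lv v (smY (sc c A1) y) = smY (sc c A1) (Lv v y)" for v y
  by (simp add: Lv_smY rh_sc_one[OF HG_bar] sA_HA[OF HA_rules(4)[OF HA_one]] sgm_def smY_lin)
 have w: "wact w (smY (sc c A1) g) = smY (sc c A1) (wact w g)" for w g by (induction w) (simp_all add: L)
 show "star (smY (sc c A1) f) g = smY (sc c A1) (star f g)" by (rule star_smY)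
 show "star f (smY (sc c A1) g) = smY (sc c A1) (star f g)"
  by (rule ad_eq[where S = "%f. star f (smY (sc c A1) g)" and T = "%f. smY (sc c A1) (star f g)"])
    (auto intro!: ad_comp[OF ad_smY ad_star_left] simp: star_single w smY_smY am_sc am_sc_right am_one)
 have o: "oA (am (sc c A1) b) = am (sc c A1) (oA b)" for b
 proof (rule adA_eq[where X = "%b. oA (am (sc c A1) b)" and Z = "%b. am (sc c A1) (oA b)"])
  show "oA (am (sc c A1) b) = am (sc c A1) (oA b)" if "HA n b" for n b
   using oA_HA[OF that] oA_HA[OF HA_rules(5)[OF HA_rules(4)[OF HA_one] that], of c] by (simp add: am_lin)
 qed (simp_all, (intro ad_comp[OF ad_total(3)] ad_comp[OF ad_total(5)] ad_total)+)
 show "od (smY (sc c A1) f) = smY (sc c A1) (od f)"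
  by (rule poly_mapping_eqI) (simp add: lookup_od lookup_smY o am_lin)
qed

definition "EH n = {x. fst x : Fs & HY n (fst x) & snd x : Fs & HY (n + 1) (snd x) & rY (snd x) = dT (rY (fst x))}"

text \<open>The fibre product of \<open>\<gg>\<close> and \<open>F[\<epsilon>]\<close> over \<open>\<gg>[\<epsilon>]\<close>, where \<open>|\<epsilon>| = -1\<close>, \<open>d = \<partial>/\<partial>\<epsilon>\<close> and \<open>\<gg>\<close> maps to
  \<open>\<gg>[\<epsilon>]\<close> by \<open>x \<mapsto> x + dx \<epsilon>\<close>; the algebra \<open>A\<close> acts through \<open>a \<mapsto> a + da \<epsilon>\<close>.\<close>

definition Ea :: "('a, ('a, 'g) wmd \<times> ('a, 'g) wmd) algebroid" where
 "Ea = \<lparr>carrier = hspan EH, mult = undefined, one = undefined, zero = 0, add = (+),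
   smult = (%a x. (smY (eA a) (fst x), smY (dAT (eA a)) (fst x) + smY (sA 1 (eA a)) (snd x))),
   hpart = EH, dif = (%x. (snd x, 0)),
   bracket = (%x y. (br (fst x) (fst y), br (snd x) (fst y) + br (sY (fst x)) (snd y))),
   anchor = (%x. anchor G (dG (rY (fst x))))\<rparr>"

lemma Ea_sel [simp]: "carrier Ea = hspan EH" "zero Ea = 0" "add Ea = (+)" "hpart Ea = EH" "dif Ea = (%x. (snd x, 0))"
 "smult Ea = (%a x. (smY (eA a) (fst x), smY (dAT (eA a)) (fst x) + smY (sA 1 (eA a)) (snd x)))"
 "bracket Ea = (%x y. (br (fst x) (fst y), br (snd x) (fst y) + br (sY (fst x)) (snd y)))"
 "anchor Ea = (%x. anchor G (dG (rY (fst x))))"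
 by (simp_all add: Ea_def)

lemmas EH_span = hspan_hom[where H = EH]

lemma EH_D: "x : EH n ==> fst x : Fs" "x : EH n ==> HY n (fst x)" "x : EH n ==> snd x : Fs" "x : EH n ==> HY (n + 1) (snd x)"
 "x : EH n ==> rY (snd x) = dT (rY (fst x))"
 by (auto simp: EH_def)

lemma EH_rules: "0 : EH n" "x : EH n ==> y : EH n ==> x + y : EH n" "x : EH n ==> - x : EH n"
 by (auto simp: EH_def Fs_zero HY_rules Fs_add Fs_minus rY_lin ad_zero[OF ad_total(12)] ad_add[OF ad_total(12)] ad_minus[OF ad_total(12)])

lemma Ea_D: "x : hspan EH ==> fst x : Fs & snd x : Fs & rY (snd x) = dT (rY (fst x))"
 by (induction x rule: hspan.induct)
   (auto simp: EH_def Fs_zero Fs_add rY_lin ad_zero[OF ad_total(12)] ad_add[OF ad_total(12)])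

lemma Ea_graded: "graded_group Ea"
proof (rule span_graded[where pr = "%n x. (hY n (fst x), hY (n + 1) (snd x))"])
 show "(hY n (fst x), hY (n + 1) (snd x)) = (if m = n then x else 0)" if "x : EH m" for n m x
  using hY_HY[OF EH_D(2)[OF that], of n] hY_HY[OF EH_D(4)[OF that], of "n + 1"] by (auto simp: zero_prod_def)
qed (auto simp: EH_rules ad_def ad_add[OF ad_hY])

lemma Ea_minus: "x : hspan EH ==> - x : hspan EH"
 by (rule hspan_minus[OF EH_rules(3)])

lemma Ea_ksign: "x : hspan EH ==> ksign Ea k x = sgm k x" and Ea_a_inv: "x : hspan EH ==> \<ominus>\<^sub>Ea x = - x"
proof -
 interpret abelian_group Ea by (rule graded_group_abelian[OF Ea_graded])
 show 1: "x : hspan EH ==> \<ominus>\<^sub>Ea x = - x" using Ea_minus by (intro minus_equality) auto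
 then show "x : hspan EH ==> ksign Ea k x = sgm k x" by (simp add: ksign_def sgm_def)
qed

lemma Ea_smult_hpart: "a : hp A n ==> x : EH m ==> a \<odot>\<^sub>Ea x : EH (n + m)"
proof -
 assume a: "a : hp A n" and x: "x : EH m"
 note e = EH_D[OF x] and h = HA_I[OF a]
 have "HY (n + 1 + m) (smY (dAT (eA a)) (fst x))" by (rule HY_smY[OF HA_rules(8)[OF h] e(2)])
 moreover have "HY (n + (m + 1)) (smY (sA 1 (eA a)) (snd x))"
  using HY_smY[OF HA_sgm[OF h] e(4)] by (simp add: sA_HA[OF h])
 ultimately show ?thesis
  using e HY_smY[OF h e(2)]
  by (auto simp: EH_def Fs_smY Fs_add Fs_sgm rY_lin rY_smY dT_ga[OF h] sA_HA[OF h] ad_sgm'[OF ad_total(9)] ad_sgm'[OF ad_smY_left] ad_sgm'[OF ad_rY] algebra_simps intro!: HY_rules(2))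
qed

lemma Ea_smult_closed: "a : car A ==> x : hspan EH ==> a \<odot>\<^sub>Ea x : hspan EH"
proof -
 have *: "a \<odot>\<^sub>Ea x : hspan EH" if a: "a : hp A n" and x: "x : hspan EH" for a x n
  using x
 proof (induction x rule: hspan.induct)
  case hspan_zero
  then show ?case using hspan.hspan_zero[of EH] by (simp add: smY_lin zero_prod_def)
 next
  case (hspan_step x m y)
  have "a \<odot>\<^sub>Ea (x + y) = a \<odot>\<^sub>Ea x + a \<odot>\<^sub>Ea y" by (simp add: smY_lin prod_eq_iff)
  then show ?case using EH_span[OF Ea_smult_hpart[OF a hspan_step(1)]] hspan_step by (simp add: hspan_add del: Ea_sel(6))
 qed
 assume a: "a : car A" and x: "x : hspan EH"
 show ?thesis using grA a
 proof (induction a rule: graded_induct)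
  case zero
  then show ?case using hspan_zero[of EH] by (simp add: smY_lin zero_prod_def ad_zero[OF ad_total(7)] sA_zero)
 next
  case (add y z)
  have "(y \<oplus> z) \<odot>\<^sub>Ea x = y \<odot>\<^sub>Ea x + z \<odot>\<^sub>Ea x"
   using add by (simp add: totA smY_lin prod_eq_iff ad_add[OF ad_total(7)] ad_add[OF ad_total(15)])
  then show ?case using add by (simp add: hspan_add del: Ea_sel(6))
 qed (use * x in auto)
qed

lemma Ea_dif: "x : EH n ==> (snd x, 0) : EH (n + 1)"
 by (auto simp: EH_def Fs_zero HY_rules rY_lin dT_dT)

lemma Ea_dif_closed: "x : hspan EH ==> (snd x, 0) : hspan EH"
proof (induction x rule: hspan.induct)
 case (hspan_step x n y)
 have "(snd (x + y), 0) = (snd x, 0) + (snd y, 0 :: ('a, 'g) wmd)" by simp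
 then show ?case using hspan_add[OF EH_span[OF Ea_dif[OF hspan_step(1)]] hspan_step(3)] by (simp only:)
qed (use hspan_zero[of EH] in \<open>simp add: zero_prod_def\<close>)

text \<open>The differential extracts the coefficient of \<epsilon>. The term with
  \<open>dif A a\<close> in the Leibniz rule comes from the scalar multiplication, whose second
  component contains \<open>dAT\<close>.\<close>

lemma Ea_module: "dg_module A Ea"
 unfolding dg_module_def graded_module_def
proof (intro conjI ballI allI)
 show "graded_group Ea" by (rule Ea_graded)
 fix a b x assume a: "a : car A" and x: "x : carrier Ea"
 show "a \<odot>\<^sub>Ea x : carrier Ea" using Ea_smult_closed a x by simp
 assume b: "b : car A"
 show "(a \<oplus> b) \<odot>\<^sub>Ea x = a \<odot>\<^sub>Ea x \<oplus>\<^sub>Ea b \<odot>\<^sub>Ea x"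
  using a b by (simp add: totA smY_lin prod_eq_iff ad_add[OF ad_total(7)] ad_add[OF ad_total(15)])
 have "eA (a \<otimes> b) = am (eA a) (eA b)" using a b by (simp add: am_def)
 then show "(a \<otimes> b) \<odot>\<^sub>Ea x = a \<odot>\<^sub>Ea (b \<odot>\<^sub>Ea x)"
  by (simp add: smY_smY dAT_am sA_am smY_lin)
next
 fix a x y show "a \<odot>\<^sub>Ea (x \<oplus>\<^sub>Ea y) = a \<odot>\<^sub>Ea x \<oplus>\<^sub>Ea a \<odot>\<^sub>Ea y"
  by (simp add: smY_lin prod_eq_iff)
next
 fix x assume "x : carrier Ea"
 then show "\<one> \<odot>\<^sub>Ea x = x"
  using Ea_D[of x] dAT_one[of 1] by (simp add: smY_lin prod_eq_iff Fs_smY_one sA_HA[OF HA_one] sgm_def)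
next
 fix n m a x assume "a : hp A n" "x : hpart Ea m"
 then show "a \<odot>\<^sub>Ea x : hpart Ea (n + m)" using Ea_smult_hpart by simp
next
 fix n x assume "x : hpart Ea n"
 then show "dif Ea x : hpart Ea (n + 1)" using Ea_dif by simp
next
 fix x y show "dif Ea (x \<oplus>\<^sub>Ea y) = dif Ea x \<oplus>\<^sub>Ea dif Ea y" by simp
 show "dif Ea (dif Ea x) = \<zero>\<^sub>Ea" by (simp add: zero_prod_def)
next
 fix n a x assume a: "a : hp A n" and x: "x : carrier Ea"
 note h = HA_I[OF a]
 have c: "a \<odot>\<^sub>Ea (dif Ea x) : hspan EH" using Ea_smult_closed[OF A_hcarr[OF a] Ea_dif_closed[of x]] x by simp
 show "dif Ea (a \<odot>\<^sub>Ea x) = dif A a \<odot>\<^sub>Ea x \<oplus>\<^sub>Ea ksign Ea n (a \<odot>\<^sub>Ea dif Ea x)"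
  unfolding Ea_ksign[OF c] using A_hcarr[OF a]
  by (simp add: dAT_eA[symmetric] dAT_dAT sA_HA[OF HA_rules(8)[OF h]] sA_HA[OF h] smY_lin) (auto simp: sgm_def smY_lin)
qed

lemma Ea_add_induct:
 assumes "x : hspan EH" "ad X" "ad Z" "!!n x. x : EH n ==> X x = Z x"
 shows "X x = Z x"
 using assms(1) by (induction x rule: hspan.induct) (simp_all add: assms ad_zero ad_add)

lemma ad_pair: "ad X ==> ad Z ==> ad (%x. (X x, Z x))" and ad_fst: "ad fst" and ad_snd: "ad snd"
 by (simp_all add: ad_def)

text \<open>The condition on \<open>rY\<close> survives because \<open>rY\<close> preserves brackets
  and the differential of \<gg> is a derivation of its bracket.\<close>

lemma Ea_bracket_hpart: assumes x: "x : EH n" and y: "y : EH m" shows "bracket Ea x y : EH (n + m)"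
proof -
 note e = EH_D[OF x] EH_D[OF y]
 have s: "sY (fst x) = sgm n (fst x)" by (rule sY_HY[OF e(2)])
 have F: "sY (fst x) : Fs" using Fs_sY e by blast
 have "HY (n + 1 + m) (br (snd x) (fst y))" "HY (n + (m + 1)) (br (sY (fst x)) (snd y))"
  unfolding s by (intro HY_br HY_sgm e)+
 then have "HY (n + m + 1) (br (snd x) (fst y) + br (sY (fst x)) (snd y))" by (intro HY_rules) (simp_all add: algebra_simps)
 then show ?thesis
  using Fs_br[OF e(1,6)] Fs_br[OF e(3,6)] Fs_br[OF F e(8)] HY_br[OF e(2,7)]
  by (simp add: EH_def Fs_add rY_lin e dT_gb[OF HG_rY[OF e(2)]] s ad_sgm'[OF ad_rY] ad_sgm'[OF ad_total(11)])
qed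

lemma Ea_bracket_closed: "x : hspan EH ==> y : hspan EH ==> bracket Ea x y : hspan EH"
proof (induction x rule: hspan.induct)
 case (hspan_step x n z)
 have "bracket Ea x y : hspan EH" using hspan_step(4)
 proof (induction y rule: hspan.induct)
  case (hspan_step y' m z')
  have "bracket Ea x (y' + z') = bracket Ea x y' + bracket Ea x z'" by (simp add: br_lin)
  then show ?case using EH_span[OF Ea_bracket_hpart[OF \<open>x : EH n\<close> hspan_step(1)]] hspan_step by (simp add: hspan_add del: Ea_sel(7))
 qed (use hspan_zero[of EH] in \<open>simp add: br_lin zero_prod_def\<close>)
 moreover have "bracket Ea (x + z) y = bracket Ea x y + bracket Ea z y" by (simp add: br_lin ad_add[OF ad_sY])
 ultimately show ?case using hspan_step by (simp add: hspan_add del: Ea_sel(7))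
qed (use hspan_zero[of EH] in \<open>simp add: br_lin ad_zero[OF ad_sY] zero_prod_def\<close>)

lemma Ea_antisym: assumes x: "x : EH n" and y: "y : EH m" shows "bracket Ea x y = - sgm (n * m) (bracket Ea y x)"
proof -
 note e = EH_D[OF x] EH_D[OF y]
 have "br (snd x) (fst y) = - sgm ((n + 1) * m) (br (fst y) (snd x))" "br (fst x) (snd y) = - sgm (n * (m + 1)) (br (snd y) (fst x))"
  "br (fst x) (fst y) = - sgm (n * m) (br (fst y) (fst x))"
  by (rule br_antisym; rule e)+
 then show ?thesis
  by (simp add: sY_HY[OF e(2)] sY_HY[OF e(7)] prod_eq_iff ad_sgm'[OF ad_fst] ad_sgm'[OF ad_snd] ad_sgm'[OF ad_br(2)])
    (auto simp: sgm_def)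
qed

text \<open>The component at \<epsilon> is a sum of three Jacobi identities of F, in each of which
  one argument is replaced by its coefficient of \<epsilon>.\<close>

lemma Ea_jacobi: assumes x: "x : EH n" and y: "y : EH m" and z: "z : hspan EH"
 shows "bracket Ea x (bracket Ea y z) = bracket Ea (bracket Ea x y) z + sgm (n * m) (bracket Ea y (bracket Ea x z))"
proof (rule Ea_add_induct[OF z, where X = "%z. bracket Ea x (bracket Ea y z)" and
  Z = "%z. bracket Ea (bracket Ea x y) z + sgm (n * m) (bracket Ea y (bracket Ea x z))"])
 have b: "ad (bracket Ea u)" for u by (simp add: ad_def br_lin)
 show "ad (%z. bracket Ea x (bracket Ea y z))" "ad (%z. bracket Ea (bracket Ea x y) z + sgm (n * m) (bracket Ea y (bracket Ea x z)))"
  by (intro ad_plus ad_comp[OF ad_sgm] ad_comp[OF b b] b)+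
 fix l z assume z: "z : EH l"
 note e = EH_D[OF x] EH_D[OF y] EH_D[OF z]
 note s = sY_HY[OF e(2)] sY_HY[OF e(7)] sY_HY[OF HY_br[OF e(2,7)]]
 note j = br_jacobi[OF e(2,7,12)] br_jacobi[OF e(4,7,12)] br_jacobi[OF e(2,9,12)] br_jacobi[OF e(2,7,14)]
 show "bracket Ea x (bracket Ea y z) = bracket Ea (bracket Ea x y) z + sgm (n * m) (bracket Ea y (bracket Ea x z))"
  by (simp add: s prod_eq_iff ad_sgm'[OF ad_fst] ad_sgm'[OF ad_snd] br_lin j)
    (cases "even n"; cases "even m"; simp add: sgm_def br_lin j)
qed

lemma Ea_proj: "dg_module_hom A Ea G (%x. dG (rY (fst x)))"
 unfolding dg_module_hom_def graded_module_hom_def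
proof (intro conjI ballI allI)
 fix n x assume "x : hpart Ea n"
 then have "HG n (rY (fst x))" using HG_rY[OF EH_D(2)] by simp
 then show "dG (rY (fst x)) : hp G n" by (auto simp: HG_def)
next
 fix x assume "x : carrier Ea"
 then show "dG (rY (fst (dif Ea x))) = dif G (dG (rY (fst x)))" using Ea_D[of x] by (simp add: dT_def)
qed (auto simp: rY_lin totG rY_smY ga_def)

lemma Ea_algebroid: "dg_lie_algebroid A Ea"
 unfolding dg_lie_algebroid_def
proof (intro conjI)
 show M: "dg_module A Ea" by (rule Ea_module)
 let ?C = "over_CC A Ea"
 have sel: "carrier ?C = hspan EH" "add ?C = (+)" "hp ?C = EH" "dif ?C = dif Ea" "bracket ?C = bracket Ea"
  "smult ?C = (%c x. (c \<odot> \<one>) \<odot>\<^sub>Ea x)"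
  by (simp_all add: over_CC_def)
 have inv: "a_inv ?C = a_inv Ea" by (simp add: a_inv_def m_inv_def fun_eq_iff over_CC_def)
 have ks: "ksign ?C k x = sgm k x" if "x : hspan EH" for k x
  using Ea_a_inv[OF that] by (simp add: ksign_def sgm_def inv)
 have c1: "eA (c \<odot> \<one>) = sc c A1" for c by (simp add: totA)
 have s1: "sA 1 (sc c A1) = sc c A1" for c by (simp add: sA_HA[OF HA_rules(4)[OF HA_one]] sgm_def)
 have brc: "br (smY (sc c A1) f) g = smY (sc c A1) (br f g)" "br f (smY (sc c A1) g) = smY (sc c A1) (br f g)"
  "sY (smY (sc c A1) f) = smY (sc c A1) (sY f)" for c f g
  by (simp_all add: br_def sY_def smY_const smY_lin)
 show "dg_lie ?C"
  unfolding dg_lie_def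
 proof (intro conjI ballI allI)
  show "dg_module CC ?C" by (rule over_CC_dg_module[OF M])
  fix x y z assume "x : carrier ?C" "y : carrier ?C" "z : carrier ?C"
  show "bracket ?C (x \<oplus>\<^sub>?C y) z = bracket ?C x z \<oplus>\<^sub>?C bracket ?C y z"
   "bracket ?C x (y \<oplus>\<^sub>?C z) = bracket ?C x y \<oplus>\<^sub>?C bracket ?C x z"
   by (simp_all add: sel br_lin ad_add[OF ad_sY])
 next
  fix c x y assume "x : carrier ?C" "y : carrier ?C"
  show "bracket ?C (c \<odot>\<^sub>?C x) y = c \<odot>\<^sub>?C bracket ?C x y" "bracket ?C x (c \<odot>\<^sub>?C y) = c \<odot>\<^sub>?C bracket ?C x y"
   by (simp_all add: sel c1 s1 dAT_one brc smY_lin)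
 next
  fix n m x y assume "x : hp ?C n" "y : hp ?C m"
  then have x: "x : EH n" "y : EH m" by (simp_all add: sel)
  note xc = EH_span[OF x(1)] EH_span[OF x(2)]
  show "bracket ?C x y : hp ?C (n + m)" unfolding sel by (rule Ea_bracket_hpart[OF x])
  have "sgm (n * m) (bracket Ea y x) : hspan EH" unfolding sgm_def using Ea_bracket_closed[OF xc(2,1)] Ea_minus[OF Ea_bracket_closed[OF xc(2,1)]] by (simp del: Ea_sel(7))
  then show "bracket ?C x y = \<ominus>\<^sub>?C ksign ?C (n * m) (bracket ?C y x)"
   unfolding sel inv ks[OF Ea_bracket_closed[OF xc(2,1)]] using Ea_antisym[OF x] Ea_a_inv by (metis (no_types))
  fix z assume "z : carrier ?C"
  then have z: "z : hspan EH" by (simp add: sel)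
  show "bracket ?C x (bracket ?C y z) = bracket ?C (bracket ?C x y) z \<oplus>\<^sub>?C ksign ?C (n * m) (bracket ?C y (bracket ?C x z))"
   unfolding sel ks[OF Ea_bracket_closed[OF xc(2) Ea_bracket_closed[OF xc(1) z]]] by (rule Ea_jacobi[OF x z])
 next
  fix n x y assume "x : hp ?C n" "y : carrier ?C"
  then have x: "x : EH n" and y: "y : hspan EH" by (simp_all add: sel)
  have d: "bracket Ea x (dif Ea y) : hspan EH" using Ea_bracket_closed[OF EH_span[OF x] Ea_dif_closed[OF y]] by simp
  show "dif ?C (bracket ?C x y) = bracket ?C (dif ?C x) y \<oplus>\<^sub>?C ksign ?C n (bracket ?C x (dif ?C y))"
   unfolding sel ks[OF d]
   by (simp add: sY_HY[OF EH_D(2)[OF x]] sY_HY[OF EH_D(4)[OF x]] prod_eq_iff ad_sgm'[OF ad_fst] ad_sgm'[OF ad_snd] br_lin)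
     (auto simp: sgm_def br_lin)
 qed
 have anch: "dg_module_hom A G (tangent A) (anchor G)" using algG by (simp add: dg_lie_algebroid_def)
 show "dg_module_hom A Ea (tangent A) (anchor Ea)"
  by (rule dg_module_hom_comp[OF Ea_proj Ea_graded anch])
    (use Ea_smult_closed Ea_dif_closed in \<open>auto simp: hspan_add\<close>)
 show "\<forall>x\<in>carrier Ea. \<forall>y\<in>carrier Ea. anchor Ea (bracket Ea x y) = bracket (tangent A) (anchor Ea x) (anchor Ea y)"
 proof (intro ballI)
  fix x y assume "x : carrier Ea" "y : carrier Ea"
  then have "fst x : Fs" "fst y : Fs" using Ea_D by auto
  from Fs_br[OF this] have "dG (rY (fst (bracket Ea x y))) = bracket G (dG (rY (fst x))) (dG (rY (fst y)))"
   by (simp add: gb_def)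
  then show "anchor Ea (bracket Ea x y) = bracket (tangent A) (anchor Ea x) (anchor Ea y)"
   using algG by (simp add: dg_lie_algebroid_def del: Ea_sel(7))
 qed
 show "\<forall>n m. \<forall>x\<in>hpart Ea n. \<forall>a\<in>hp A m. \<forall>y\<in>carrier Ea. bracket Ea x (a \<odot>\<^sub>Ea y) =
   ksign Ea (n * m) (a \<odot>\<^sub>Ea bracket Ea x y) \<oplus>\<^sub>Ea anchor Ea x a \<odot>\<^sub>Ea y"
 proof (intro allI ballI)
  fix n m x a y assume "x : hpart Ea n" and a: "a : hp A m" and "y : carrier Ea"
  then have x: "x : EH n" and y: "y : hspan EH" by simp_all
  have c: "a \<odot>\<^sub>Ea bracket Ea x y : hspan EH"
   by (rule Ea_smult_closed[OF A_hcarr[OF a] Ea_bracket_closed[OF EH_span[OF x] y]])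
  note h = HA_I[OF a]
  note e = EH_D[OF x]
  have an: "eA (anchor G (dG (rY (fst x))) a) = rh (rY (fst x)) (eA a)" using a by (simp add: rh_def)
  have sm: "ad (%y. b \<odot>\<^sub>Ea y)" and bk: "ad (bracket Ea x)" for b
   by (simp_all add: ad_def smY_lin br_lin)
  have "bracket Ea x (a \<odot>\<^sub>Ea y) = sgm (n * m) (a \<odot>\<^sub>Ea bracket Ea x y) + anchor Ea x a \<odot>\<^sub>Ea y"
  proof (rule Ea_add_induct[OF y, where X = "%y. bracket Ea x (a \<odot>\<^sub>Ea y)" and
    Z = "%y. sgm (n * m) (a \<odot>\<^sub>Ea bracket Ea x y) + anchor Ea x a \<odot>\<^sub>Ea y"])
   show "ad (%y. bracket Ea x (a \<odot>\<^sub>Ea y))" "ad (%y. sgm (n * m) (a \<odot>\<^sub>Ea bracket Ea x y) + anchor Ea x a \<odot>\<^sub>Ea y)"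
    by (intro ad_plus ad_comp[OF ad_sgm] ad_comp[OF bk sm] ad_comp[OF sm bk] sm)+
   fix l y assume y: "y : EH l"
   note e' = EH_D[OF y]
   \<comment> \<open>The Leibniz rule of F for the first components, and then with one of x, a, y
     replaced by its coefficient of \<epsilon>; for a this coefficient is
     \<open>dAT (eA a)\<close>.\<close>
   note b = br_smY[OF e(1,2) h e'(2)] br_smY[OF e(3,4) h e'(2)] br_smY[OF e(1,2) HA_rules(8)[OF h] e'(2)] br_smY[OF e(1,2) h e'(4)]
   have d: "dAT (rh (rY (fst x)) (eA a)) = rh (rY (snd x)) (eA a) + sgm n (rh (rY (fst x)) (dAT (eA a)))"
    using dAT_rh[OF HG_rY[OF e(2)]] e(5) by simp
   have r: "sA 1 (rh (rY (fst x)) (eA a)) = sgm (n + m) (rh (rY (fst x)) (eA a))"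
    using sA_HA[OF HA_rules(6)[OF HG_rY[OF e(2)] h], of 1] by simp
   show "bracket Ea x (a \<odot>\<^sub>Ea y) = sgm (n * m) (a \<odot>\<^sub>Ea bracket Ea x y) + anchor Ea x a \<odot>\<^sub>Ea y"
    by (simp add: sY_HY[OF e(2)] prod_eq_iff ad_sgm'[OF ad_fst] ad_sgm'[OF ad_snd] an d r sA_HA[OF h]
       ad_sgm'[OF ad_smY_left] ad_sgm'[OF ad_br(1)] ad_sgm'[OF ad_br(2)] smY_lin br_lin b)
      (cases "even n"; cases "even m"; simp add: sgm_def smY_lin)
  qed
  then show "bracket Ea x (a \<odot>\<^sub>Ea y) = ksign Ea (n * m) (a \<odot>\<^sub>Ea bracket Ea x y) \<oplus>\<^sub>Ea anchor Ea x a \<odot>\<^sub>Ea y"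
   unfolding Ea_ksign[OF c] by simp
 qed
qed

end

section \<open>Quasi-isomorphisms with acyclic kernel\<close>

lemma mem_a_coset: "y : H +>\<^bsub>M\<^esub> x \<longleftrightarrow> (\<exists>h\<in>H. y = h \<oplus>\<^sub>M x)"
 by (auto simp: a_r_coset_def')

text \<open>A surjection with acyclic kernel. Lifts of cochains exist by surjectivity, and their
  failure to be cocycles, or to be equal up to boundaries, lies in the kernel, where
  \<open>acyc\<close> removes it.\<close>

lemma quasi_isoI:
 assumes M: "dg_module R M" and N: "dg_module R' N"
  and f: "!!n x. x : hp M n ==> f x : hp N n"
   "!!x y. x : car M ==> y : car M ==> f (x \<oplus>\<^sub>M y) = f x \<oplus>\<^sub>N f y"
   "!!x. x : car M ==> f (dif M x) = dif N (f x)"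
  and surj: "degreewise_surj M N f"
  and acyc: "!!n x. x : hp M n ==> dif M x = \<zero>\<^sub>M ==> f x = \<zero>\<^sub>N ==> \<exists>y\<in>hp M (n - 1). dif M y = x & f y = \<zero>\<^sub>N"
 shows "quasi_iso M N f"
 unfolding quasi_iso_def
proof (intro allI)
 fix n
 interpret M: abelian_group M by (rule dg_moduleD(2)[OF M])
 interpret N: abelian_group N by (rule dg_moduleD(2)[OF N])
 note gM = dg_moduleD(1)[OF M] and gN = dg_moduleD(1)[OF N]
 note hM = hpart_carrier[OF gM] and hN = hpart_carrier[OF gN]
 have f0: "f \<zero>\<^sub>M = \<zero>\<^sub>N"
  using f(2)[of "\<zero>\<^sub>M" "\<zero>\<^sub>M"] hN[OF f(1)[OF hpart_zero[OF gM]]] by (metis M.l_zero M.zero_closed N.add.l_cancel_one')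
 have fm: "f (\<ominus>\<^sub>M x) = \<ominus>\<^sub>N f x" if "x : hp M k" for x k
  using f(2)[of "\<ominus>\<^sub>M x" x] hM[OF that] hN[OF f(1)[OF that]] hN[OF f(1)[OF hpart_a_inv[OF gM that]]]
  by (intro N.minus_equality[symmetric]) (simp_all add: M.l_neg f0)
 have dM: "dif M (\<ominus>\<^sub>M x) = \<ominus>\<^sub>M dif M x" if "x : car M" for x
 proof -
  have z: "dif M \<zero>\<^sub>M = \<zero>\<^sub>M"
   using dg_moduleD(10)[OF M, of "\<zero>\<^sub>M" "\<zero>\<^sub>M"] dif_carrier[OF M, of "\<zero>\<^sub>M"] by (metis M.l_zero M.zero_closed M.add.l_cancel_one')
  show ?thesis using dg_moduleD(10)[OF M, of "\<ominus>\<^sub>M x" x] that dif_carrier[OF M]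
   by (intro M.minus_equality[symmetric]) (simp_all add: M.l_neg z)
 qed
 let ?BM = "coboundaries M n" and ?BN = "coboundaries N n"
 have BM: "x : car M" if "x : ?BM" for x using that dif_carrier[OF M] hM by (auto simp: coboundaries_def)
 have BN: "x : car N" if "x : ?BN" for x using that dif_carrier[OF N] hN by (auto simp: coboundaries_def)
 have BNadd: "x \<oplus>\<^sub>N y : ?BN" if xy: "x : ?BN" "y : ?BN" for x y
 proof -
  obtain u v where "u : hp N (n - 1)" "v : hp N (n - 1)" "x = dif N u" "y = dif N v" using xy by (auto simp: coboundaries_def)
  then have "x \<oplus>\<^sub>N y = dif N (u \<oplus>\<^sub>N v)" "u \<oplus>\<^sub>N v : hp N (n - 1)"
   using dg_moduleD(10)[OF N] hN hpart_add[OF gN] by auto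
  then show ?thesis by (auto simp: coboundaries_def)
 qed
 have BMadd: "x \<oplus>\<^sub>M y : ?BM" if xy: "x : ?BM" "y : ?BM" for x y
 proof -
  obtain u v where "u : hp M (n - 1)" "v : hp M (n - 1)" "x = dif M u" "y = dif M v" using xy by (auto simp: coboundaries_def)
  then have "x \<oplus>\<^sub>M y = dif M (u \<oplus>\<^sub>M v)" "u \<oplus>\<^sub>M v : hp M (n - 1)"
   using dg_moduleD(10)[OF M] hM hpart_add[OF gM] by auto
  then show ?thesis by (auto simp: coboundaries_def)
 qed
 have BMinv: "\<ominus>\<^sub>M x : ?BM" if x: "x : ?BM" for x
 proof -
  obtain u where u: "u : hp M (n - 1)" "x = dif M u" using x by (auto simp: coboundaries_def)
  show ?thesis unfolding coboundaries_def
   by (rule image_eqI[of _ _ "\<ominus>\<^sub>M u"]) (use u dM hM hpart_a_inv[OF gM] in auto)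
 qed
 have BM0: "\<zero>\<^sub>M : ?BM"
 proof -
  have b: "dif M \<zero>\<^sub>M : ?BM" unfolding coboundaries_def by (rule imageI[OF hpart_zero[OF gM]])
  from BMadd[OF BMinv[OF b] b] show ?thesis using M.l_neg[OF BM[OF b]] by simp
 qed
 have fB: "f b : ?BN" if "b : ?BM" for b
  using that f(1,3) hM by (auto simp: coboundaries_def)
 have B0: "\<zero>\<^sub>N : ?BN" using fB[OF BM0] by (simp add: f0)
 have im: "?BN <+>\<^bsub>N\<^esub> (f ` (?BM +>\<^bsub>M\<^esub> z)) = ?BN +>\<^bsub>N\<^esub> f z" if z: "z : cocycles M n" for z
 proof (intro equalityI subsetI)
  have zc: "z : car M" "f z : car N" using z hM hN[OF f(1)] by (auto simp: cocycles_def)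
  {
   fix y assume "y : ?BN <+>\<^bsub>N\<^esub> (f ` (?BM +>\<^bsub>M\<^esub> z))"
   then obtain b b' where b: "b : ?BN" "b' : ?BM" "y = b \<oplus>\<^sub>N f (b' \<oplus>\<^sub>M z)"
    by (auto simp: set_add_def' mem_a_coset)
   then have "y = (b \<oplus>\<^sub>N f b') \<oplus>\<^sub>N f z" using zc BM BN fB f(2) by (simp add: N.a_assoc)
   then show "y : ?BN +>\<^bsub>N\<^esub> f z" using b fB BNadd by (auto simp: mem_a_coset)
  next
   fix y assume "y : ?BN +>\<^bsub>N\<^esub> f z"
   then obtain b where b: "b : ?BN" "y = b \<oplus>\<^sub>N f z" by (auto simp: mem_a_coset)
   have "z : ?BM +>\<^bsub>M\<^esub> z" using BM0 zc by (auto simp: mem_a_coset intro!: bexI[of _ "\<zero>\<^sub>M"])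
   then show "y : ?BN <+>\<^bsub>N\<^esub> (f ` (?BM +>\<^bsub>M\<^esub> z))" using b by (auto simp: set_add_def')
  }
 qed
 have inj: "?BM +>\<^bsub>M\<^esub> z = ?BM +>\<^bsub>M\<^esub> z'"
  if z: "z : cocycles M n" and z': "z' : cocycles M n" and e: "?BN +>\<^bsub>N\<^esub> f z = ?BN +>\<^bsub>N\<^esub> f z'" for z z'
 proof -
  have h: "z : hp M n" "z' : hp M n" "dif M z = \<zero>\<^sub>M" "dif M z' = \<zero>\<^sub>M" using z z' by (auto simp: cocycles_def)
  note c = hM[OF h(1)] hM[OF h(2)] hN[OF f(1)[OF h(1)]] hN[OF f(1)[OF h(2)]]
  have "f z : ?BN +>\<^bsub>N\<^esub> f z'" unfolding e[symmetric] using B0 c by (auto simp: mem_a_coset intro!: bexI[of _ "\<zero>\<^sub>N"])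
  then obtain u where u: "u : hp N (n - 1)" "f z = dif N u \<oplus>\<^sub>N f z'" by (auto simp: mem_a_coset coboundaries_def)
  obtain v where v: "v : hp M (n - 1)" "u = f v" using surj u(1) by (auto simp: degreewise_surj_def)
  have vc: "dif M v : hp M n" using dg_moduleD(9)[OF M v(1)] by simp
  have dvB: "dif M v : ?BM" using v(1) by (auto simp: coboundaries_def)
  \<comment> \<open>v lifts the cochain whose boundary separates \<open>f z\<close> from
    \<open>f z'\<close>, so subtracting its boundary and z' from z leaves a cocycle in the kernel of
    f.\<close>
  let ?x = "z \<oplus>\<^sub>M \<ominus>\<^sub>M (dif M v \<oplus>\<^sub>M z')"
  have xh: "?x : hp M n" by (intro hpart_add[OF gM] hpart_a_inv[OF gM] h vc)
  have dx: "dif M ?x = \<zero>\<^sub>M"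
   using c hM[OF vc] dif_carrier[OF M] hM[OF v(1)]
   by (simp add: dg_moduleD(10)[OF M] dM h dg_moduleD(11)[OF M])
  have fd: "f (dif M v) = dif N u" using f(3) hM[OF v(1)] v(2) by simp
  have "f ?x = \<zero>\<^sub>N"
  proof -
   have "f ?x = f z \<oplus>\<^sub>N \<ominus>\<^sub>N f (dif M v \<oplus>\<^sub>M z')"
    using f(2)[OF c(1), of "\<ominus>\<^sub>M (dif M v \<oplus>\<^sub>M z')"] fm[OF hpart_add[OF gM vc h(2)]] hM[OF hpart_add[OF gM vc h(2)]] by simp
   also have "f (dif M v \<oplus>\<^sub>M z') = f z" using f(2) hM[OF vc] c u(2) fd by simp
   finally show ?thesis using c by (simp add: N.r_neg)
  qed
  from acyc[OF xh dx this] obtain y where y: "y : hp M (n - 1)" "dif M y = ?x" by blast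
  have yB: "?x : ?BM" unfolding coboundaries_def y(2)[symmetric] by (rule imageI[OF y(1)])
  have zz: "z = (?x \<oplus>\<^sub>M dif M v) \<oplus>\<^sub>M z'"
  proof -
   have w: "dif M v \<oplus>\<^sub>M z' : car M" using c hM[OF vc] by simp
   have "(?x \<oplus>\<^sub>M dif M v) \<oplus>\<^sub>M z' = ?x \<oplus>\<^sub>M (dif M v \<oplus>\<^sub>M z')"
    using c hM[OF vc] hM[OF xh] by (intro M.a_assoc)
   also have "\<dots> = z \<oplus>\<^sub>M (\<ominus>\<^sub>M (dif M v \<oplus>\<^sub>M z') \<oplus>\<^sub>M (dif M v \<oplus>\<^sub>M z'))"
    using c w by (intro M.a_assoc M.a_inv_closed)
   finally show ?thesis using c w by (simp only: M.l_neg M.r_zero)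
  qed
  have B1: "?x \<oplus>\<^sub>M dif M v : ?BM" (is "?b : _") by (rule BMadd[OF yB dvB])
  show ?thesis
  proof (intro equalityI subsetI)
   fix w assume "w : ?BM +>\<^bsub>M\<^esub> z"
   then obtain h where h: "h : ?BM" "w = h \<oplus>\<^sub>M z" by (auto simp: mem_a_coset)
   then have "w = (h \<oplus>\<^sub>M ?b) \<oplus>\<^sub>M z'" using zz BM[OF h(1)] BM[OF B1] c by (metis M.a_assoc)
   then show "w : ?BM +>\<^bsub>M\<^esub> z'" using BMadd[OF h(1) B1] by (auto simp: mem_a_coset)
  next
   fix w assume "w : ?BM +>\<^bsub>M\<^esub> z'"
   then obtain h where h: "h : ?BM" "w = h \<oplus>\<^sub>M z'" by (auto simp: mem_a_coset)
   have "z' = \<ominus>\<^sub>M ?b \<oplus>\<^sub>M z" using zz BM[OF B1] c by (metis M.a_assoc M.l_neg M.a_inv_closed M.l_zero)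
   then have "w = (h \<oplus>\<^sub>M \<ominus>\<^sub>M ?b) \<oplus>\<^sub>M z" using h BM[OF h(1)] BM[OF B1] c by (metis M.a_assoc M.a_inv_closed)
   then show "w : ?BM +>\<^bsub>M\<^esub> z" using BMadd[OF h(1) BMinv[OF B1]] by (auto simp: mem_a_coset)
  qed
 qed
 have sur: "\<exists>z\<in>cocycles M n. f z = w" if w: "w : cocycles N n" for w
 proof -
  have wh: "w : hp N n" "dif N w = \<zero>\<^sub>N" using w by (auto simp: cocycles_def)
  obtain x where x: "x : hp M n" "w = f x" using surj wh(1) by (auto simp: degreewise_surj_def)
  have "dif M x : hp M (n + 1)" "dif M (dif M x) = \<zero>\<^sub>M" "f (dif M x) = \<zero>\<^sub>N"
   using x wh f(3)[OF hM[OF x(1)]] dg_moduleD(9)[OF M x(1)] dg_moduleD(11)[OF M hM[OF x(1)]] by auto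
  \<comment> \<open>x lifts w without having to be a cocycle. Its differential lies in the kernel
    and is also the differential of an element y of the kernel, which is then subtracted.\<close>
  from acyc[OF this] obtain y where y: "y : hp M n" "dif M y = dif M x" "f y = \<zero>\<^sub>N" by auto
  note c = hM[OF x(1)] hM[OF y(1)] hN[OF f(1)[OF x(1)]] dif_carrier[OF M hM[OF x(1)]]
  have "dif M (x \<oplus>\<^sub>M \<ominus>\<^sub>M y) = \<zero>\<^sub>M" using c y by (simp add: dg_moduleD(10)[OF M] dM M.r_neg)
  moreover have "f (x \<oplus>\<^sub>M \<ominus>\<^sub>M y) = w" using c y x by (simp add: f(2) fm[OF y(1)])
  ultimately show ?thesis
   using hpart_add[OF gM x(1) hpart_a_inv[OF gM y(1)]] by (intro bexI[of _ "x \<oplus>\<^sub>M \<ominus>\<^sub>M y"]) (auto simp: cocycles_def)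
 qed
 have fc: "f z : cocycles N n" if "z : cocycles M n" for z
  using that f(1) f(3)[OF hM] f0 by (fastforce simp: cocycles_def)
 show "bij_betw (%C. ?BN <+>\<^bsub>N\<^esub> (f ` C)) (cohomology M n) (cohomology N n)"
  unfolding bij_betw_def
 proof (rule conjI, rule inj_onI)
  fix C C' assume C: "C : cohomology M n" "C' : cohomology M n" and e: "?BN <+>\<^bsub>N\<^esub> (f ` C) = ?BN <+>\<^bsub>N\<^esub> (f ` C')"
  obtain z z' where z: "z : cocycles M n" "C = ?BM +>\<^bsub>M\<^esub> z" "z' : cocycles M n" "C' = ?BM +>\<^bsub>M\<^esub> z'"
   using C unfolding cohomology_def by blast
  show "C = C'" unfolding z(2,4) by (rule inj[OF z(1,3)]) (use e in \<open>simp only: z(2,4) im[OF z(1)] im[OF z(3)]\<close>)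
 next
  show "(%C. ?BN <+>\<^bsub>N\<^esub> (f ` C)) ` cohomology M n = cohomology N n"
  proof (rule equalityI; rule subsetI)
  fix X assume "X : (%C. ?BN <+>\<^bsub>N\<^esub> (f ` C)) ` cohomology M n"
  then obtain z where z: "z : cocycles M n" "X = ?BN <+>\<^bsub>N\<^esub> (f ` (?BM +>\<^bsub>M\<^esub> z))" unfolding cohomology_def by blast
  show "X : cohomology N n" unfolding z(2) im[OF z(1)] cohomology_def by (rule imageI[OF fc[OF z(1)]])
 next
  fix X assume "X : cohomology N n"
  then obtain w where w: "w : cocycles N n" "X = ?BN +>\<^bsub>N\<^esub> w" by (auto simp: cohomology_def)
  obtain z where z: "z : cocycles M n" "f z = w" using sur[OF w(1)] by blast
  have "X = ?BN <+>\<^bsub>N\<^esub> (f ` (?BM +>\<^bsub>M\<^esub> z))" unfolding im[OF z(1)] w(2) z(2) ..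
  moreover have "?BM +>\<^bsub>M\<^esub> z : cohomology M n" unfolding cohomology_def by (rule imageI[OF z(1)])
  ultimately show "X : (%C. ?BN <+>\<^bsub>N\<^esub> (f ` C)) ` cohomology M n" by (rule image_eqI)
 qed
 qed
qed

section \<open>Transport of structure\<close>

text \<open>The copy of an algebroid along a map that is injective on its carrier. Cofibrancy speaks
  about objects on the type \<open>universe\<close>, so both ends of the fibration have to be moved
  there.\<close>

definition transport :: "('g => 'h) => ('a, 'g) algebroid => ('a, 'h) algebroid" where
 "transport i G = (let j = inv_into (car G) i in
   \<lparr>carrier = i ` car G, mult = undefined, one = undefined, zero = i (zero G),
   add = (%u v. i (j u \<oplus>\<^sub>G j v)), smult = (%a u. i (a \<odot>\<^sub>G j u)),
   hpart = (%n. i ` hp G n), dif = (%u. i (dif G (j u))),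
   bracket = (%u v. i (bracket G (j u) (j v))), anchor = (%u. anchor G (j u))\<rparr>)"

context algebroid_loc
begin

lemma transport_sel:
 assumes i: "inj_on i (car G)"
 shows "carrier (transport i G) = i ` car G" "zero (transport i G) = i \<zero>\<^sub>G" "hpart (transport i G) = (%n. i ` hp G n)"
  "x : car G ==> y : car G ==> i x \<oplus>\<^bsub>transport i G\<^esub> i y = i (x \<oplus>\<^sub>G y)"
  "x : car G ==> a \<odot>\<^bsub>transport i G\<^esub> i x = i (a \<odot>\<^sub>G x)"
  "x : car G ==> dif (transport i G) (i x) = i (dif G x)"
  "x : car G ==> y : car G ==> bracket (transport i G) (i x) (i y) = i (bracket G x y)"
  "x : car G ==> anchor (transport i G) (i x) = anchor G x"
 using inv_into_f_f[OF i] by (simp_all add: transport_def Let_def)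

lemma transport_algebroid:
 assumes i: "inj_on i (car G)"
 shows "dg_lie_algebroid A (transport i G)"
proof -
 let ?T = "transport i G"
 note s = transport_sel[OF i]
 have ab: "abelian_group ?T"
 proof (rule abelian_groupI)
  fix u assume "u : carrier ?T"
  then obtain x where x: "u = i x" "x : car G" by (auto simp: s)
  then show "\<exists>v\<in>carrier ?T. v \<oplus>\<^sub>?T u = \<zero>\<^sub>?T"
   by (intro bexI[of _ "i (\<ominus>\<^sub>G x)"]) (auto simp: s G.l_neg)
 qed (auto simp: s G.a_ac)
 interpret T: abelian_group ?T by (rule ab)
 have inv: "\<ominus>\<^sub>?T (i x) = i (\<ominus>\<^sub>G x)" if "x : car G" for x
  using that by (intro T.minus_equality) (auto simp: s G.l_neg)
 have ks: "ksign ?T k (i x) = i (ksign G k x)" if "x : car G" for k x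
  using inv[OF that] by (simp add: ksign_def)
 have fin: "i (\<Oplus>\<^bsub>G\<^esub>n\<in>S. f n) = (\<Oplus>\<^bsub>?T\<^esub>n\<in>S. i (f n))" if "finite S" "!!n. n : S ==> f n : car G" for S f
  by (rule additive_finsum(1)) (use that ab G.abelian_group_axioms in \<open>auto simp: s\<close>)
 have gr: "graded_group ?T"
 proof (rule graded_groupI(1)[OF ab, where pr = "%n u. i (hcomp G (inv_into (car G) i u) n)"])
  show "subgroup (hp ?T n) (add_monoid ?T)" for n
  proof (rule T.add.subgroupI)
   show "hp ?T n ~= {}" using M_zero[of n] unfolding s(3) by blast
   show "hp ?T n <= carrier ?T" by (auto simp: s)
  next
   fix u assume "u : hp ?T n"
   then show "\<ominus>\<^sub>?T u : hp ?T n" using hpart_a_inv[OF grG] by (auto simp: s inv)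
  next
   fix u v assume "u : hp ?T n" "v : hp ?T n"
   then show "u \<oplus>\<^sub>?T v : hp ?T n" using G_hpart(3) by (auto simp: s)
  qed
 next
  fix n m u assume "u : hp ?T m"
  then show "i (hcomp G (inv_into (car G) i u) n) = (if m = n then u else \<zero>\<^sub>?T)"
   by (auto simp: s inv_into_f_f[OF i] hcomp_hom[OF grG])
 next
  fix u assume "u : carrier ?T"
  then obtain x where x: "u = i x" "x : car G" by (auto simp: s)
  have "u = (\<Oplus>\<^bsub>?T\<^esub>n\<in>hsupp G x. i (hcomp G x n))"
   unfolding x(1) using hcomp_sum[OF grG x(2)] fin[OF finite_hsupp[OF grG x(2)], of "hcomp G x"] hcomp_carrier[OF grG x(2)] by simp
  then show "\<exists>S f. finite S & (\<forall>n\<in>S. f n : hp ?T n) & u = (\<Oplus>\<^bsub>?T\<^esub>n\<in>S. f n)"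
   using finite_hsupp[OF grG x(2)] hcomp_hpart[OF grG x(2)] by (intro exI[of _ "hsupp G x"] exI[of _ "%n. i (hcomp G x n)"]) (auto simp: s)
 qed (auto simp: s inv_into_f_f[OF i] hcomp_carrier[OF grG] hcomp_add[OF grG])
 have M: "dg_module A ?T"
  unfolding dg_module_def graded_module_def
 proof (intro conjI ballI allI)
  fix n a u assume "a : hp A n" "u : carrier ?T"
  then show "dif ?T (a \<odot>\<^sub>?T u) = dif A a \<odot>\<^sub>?T u \<oplus>\<^sub>?T ksign ?T n (a \<odot>\<^sub>?T dif ?T u)"
   by (auto simp: s ks G_mod(12))
 qed (auto simp: s gr G_mod(3-7,10,11) intro!: imageI G_mod(8,9))
 have csm1: "(c \<odot> \<one>) \<odot>\<^sub>G x = csm c x" for c x by (simp add: csm_def)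
 have L: "dg_lie (over_CC A ?T)"
 proof -
  let ?C = "over_CC A ?T"
  have sel: "carrier ?C = i ` car G" "add ?C = add ?T" "hp ?C = hp ?T" "dif ?C = dif ?T" "bracket ?C = bracket ?T"
   "smult ?C = (%c x. (c \<odot> \<one>) \<odot>\<^sub>?T x)"
   by (simp_all add: over_CC_def s)
  have inv': "a_inv ?C = a_inv ?T" by (simp add: a_inv_def m_inv_def fun_eq_iff over_CC_def)
  have ks': "ksign ?C = ksign ?T" by (simp add: ksign_def fun_eq_iff inv')
  have ksG: "ksign G k x : car G" if "x : car G" for k x using that by simp
  show ?thesis
   unfolding dg_lie_def
  proof (intro conjI ballI allI)
   show "dg_module CC ?C" by (rule over_CC_dg_module[OF M])
   fix n m u v assume u: "u : hp ?C n" "v : hp ?C m"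
   then obtain x y where x: "u = i x" "v = i y" "x : hp G n" "y : hp G m" by (auto simp: sel s)
   show "bracket ?C u v : hp ?C (n + m)" using x by (auto simp: sel s intro!: imageI bracket_hpart)
   show "bracket ?C u v = \<ominus>\<^sub>?C ksign ?C (n * m) (bracket ?C v u)"
    using x bracket_antisym[OF x(3,4)] by (simp add: sel s inv' ks' ks inv)
   fix w assume "w : carrier ?C"
   then obtain z where z: "w = i z" "z : car G" by (auto simp: sel)
   show "bracket ?C u (bracket ?C v w) = bracket ?C (bracket ?C u v) w \<oplus>\<^sub>?C ksign ?C (n * m) (bracket ?C v (bracket ?C u w))"
    using x z bracket_jacobi[OF x(3,4) z(2)] by (simp add: sel s ks' ks)
  next
   fix n u v assume "u : hp ?C n" "v : carrier ?C"
   then obtain x y where x: "u = i x" "v = i y" "x : hp G n" "y : car G" by (auto simp: sel s)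
   show "dif ?C (bracket ?C u v) = bracket ?C (dif ?C u) v \<oplus>\<^sub>?C ksign ?C n (bracket ?C u (dif ?C v))"
    using x bracket_dif[OF x(3,4)] by (simp add: sel s ks' ks)
  qed (auto simp: sel s bracket_add bracket_csm csm1)
 qed
 have anch: "dg_module_hom A G (tangent A) (anchor G)" "\<forall>x\<in>car G. \<forall>y\<in>car G. anchor G (bracket G x y) = bracket (tangent A) (anchor G x) (anchor G y)"
  using algG by (simp_all add: dg_lie_algebroid_def)
 have H: "dg_module_hom A ?T (tangent A) (anchor ?T)"
  using anch(1) unfolding dg_module_hom_def graded_module_hom_def by (auto simp: s)
 show ?thesis
  unfolding dg_lie_algebroid_def
 proof (intro conjI M L H allI ballI)
  fix u v assume "u : carrier ?T" "v : carrier ?T"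
  then show "anchor ?T (bracket ?T u v) = bracket (tangent A) (anchor ?T u) (anchor ?T v)" using anch(2) by (auto simp: s)
 next
  fix n m u a v assume "u : hp ?T n" "a : hp A m" "v : carrier ?T"
  then obtain x y where x: "u = i x" "v = i y" "x : hp G n" "y : car G" "a : hp A m" by (auto simp: s)
  show "bracket ?T u (a \<odot>\<^sub>?T v) = ksign ?T (n * m) (a \<odot>\<^sub>?T bracket ?T u v) \<oplus>\<^sub>?T anchor ?T u a \<odot>\<^sub>?T v"
   using x bracket_smult[OF x(3,5,4)] by (simp add: s ks)
 qed
qed

end

section \<open>The section given by cofibrancy\<close>

text \<open>A letter becomes two symbols, its degree as a complex number and its element of \<gg>,
  so the word can be read back.\<close>

definition cw :: "(int \<times> 'g) list => (complex + ('a + 'g)) list" where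
 "cw w = concat (map (%l. [Inl (of_int (fst l)), Inr (Inr (snd l))]) w)"

lemma cw_inj: "cw w = (cw w' :: (complex + ('a + 'g)) list) ==> w = w'"
proof (induction w arbitrary: w')
 case Nil
 then show ?case by (cases w') (auto simp: cw_def)
next
 case (Cons l w)
 obtain l' u where u: "w' = l' # u" using Cons(2) by (cases w') (auto simp: cw_def)
 have "fst l = fst l'" "snd l = snd l'" "cw w = (cw u :: (complex + ('a + 'g)) list)"
  using Cons(2) by (auto simp: cw_def u)
 then show ?case using Cons(1) by (simp add: u prod_eq_iff)
qed

text \<open>A coefficient function is encoded by its graph; each entry is a word ending in the argument
 and the value.\<close>

definition encY :: "complex => ('a, 'g) wmd => ('a + 'g) universe" where
 "encY t f = {Inl t # cw w @ [Inr (Inl a), Inl (lookup f w a)] | w a. True}"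

text \<open>The leading symbols 0 and 1 keep the two components of the pair apart in one
  set.\<close>

definition encE :: "('a, 'g) wmd \<times> ('a, 'g) wmd => ('a + 'g) universe" where
 "encE x = encY 0 (fst x) \<union> encY 1 (snd x)"

definition encG :: "'g => ('a + 'g) universe" where
 "encG x = {[Inr (Inr x)]}"

lemma encY_mem: "Inl t # cw w @ [Inr (Inl a), Inl c] : encY t' f \<longleftrightarrow> t = t' & c = lookup f w a"
proof -
 have "u = w" if "cw w = (cw u :: (complex + ('a + 'b)) list)" for u w :: "(int \<times> 'b) list" using cw_inj[OF that] by simp
 then show ?thesis by (auto simp: encY_def)
qed

lemma inj_encE: "inj (encE :: ('a, 'g) wmd \<times> ('a, 'g) wmd => ('a + 'g) universe)"
proof (rule injI)
 fix x y :: "('a, 'g) wmd \<times> ('a, 'g) wmd" assume e: "encE x = encE y"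
 have m: "Inl t # cw w @ [Inr (Inl a), Inl c] : encE z \<longleftrightarrow>
   t = 0 & c = lookup (fst z) w a | t = 1 & c = lookup (snd z) w a"
  for t w a c and z :: "('a, 'g) wmd \<times> ('a, 'g) wmd"
  by (simp add: encE_def encY_mem)
 have "lookup (fst x) w a = lookup (fst y) w a" for w a
  using m[of 0 w a "lookup (fst x) w a" x] m[of 0 w a "lookup (fst x) w a" y] e by simp
 moreover have "lookup (snd x) w a = lookup (snd y) w a" for w a
  using m[of 1 w a "lookup (snd x) w a" x] m[of 1 w a "lookup (snd x) w a" y] e by simp
 ultimately show "x = y" by (intro prod_eqI poly_mapping_eqI) (simp_all add: fun_eq_iff)
qed

lemma inj_encG: "inj encG"
 by (auto simp: inj_def encG_def)

context algebroid_loc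
begin

lemma Fs_ev: "ev t : Fs"
 using Fs_smY_ev[of A1 t] by (simp add: HY_smY_one[OF HY_ev])

lemma pjG_rY: "pjG (rY f) = rY f"
 by (rule ad_eq[where S = "%f. pjG (rY f)" and T = rY]) (simp_all add: ad_comp[OF ad_total(2)])

text \<open>The coefficient of \<epsilon> has to lie over the differential of x, and the letter of
  \<open>dif G x\<close> does. These pairs make the projection to \<gg> surjective in each
  degree.\<close>

lemma EH_lift: "x : hp G n ==> (ev (Leaf (n, x)), ev (Leaf (n + 1, dif G x))) : EH n"
 using HY_ev[of "Leaf (n, x)"] HY_ev[of "Leaf (n + 1, dif G x)"] G_mod(9)[of x n]
 by (simp add: EH_def Fs_ev rY_ev bar_def dT_def del: ev.simps)

lemma G_section:
 assumes cof: "cofibrant_lie_algebroid A G"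
 obtains s where "!!n x. x : hp G n ==> s x : Fs & HY n (s x) & rY (s x) = eG x"
  "!!x y. x : car G ==> y : car G ==> s (x \<oplus>\<^sub>G y) = s x + s y"
  "!!a x. a : car A ==> x : car G ==> s (a \<odot>\<^sub>G x) = smY (eA a) (s x)"
  "!!x y. x : car G ==> y : car G ==> s (bracket G x y) = br (s x) (s y)"
proof -
 have EL: "algebroid_loc A Ea"
  by (intro algebroid_loc.intro algebroid_loc_axioms.intro cdga_loc_axioms Ea_algebroid)
 have iE: "inj_on encE (carrier Ea)" and iG: "inj_on (encG :: 'g => ('a + 'g) universe) (car G)"
  using inj_encE inj_encG by (auto intro: inj_on_subset)
 define E' :: "('a, ('a + 'g) universe) algebroid" where "E' = transport encE Ea"
 define B :: "('a, ('a + 'g) universe) algebroid" where "B = transport encG G"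
 note sE = algebroid_loc.transport_sel[OF EL iE, folded E'_def]
 note sG = transport_sel[OF iG, folded B_def]
 have aE: "dg_lie_algebroid A E'" and aB: "dg_lie_algebroid A B"
  unfolding E'_def B_def by (rule algebroid_loc.transport_algebroid[OF EL iE], rule transport_algebroid[OF iG])
 define q where "q x = dG (rY (fst x))" for x :: "('a, 'g) wmd \<times> ('a, 'g) wmd"
 have q: "dg_module_hom A Ea G q" using Ea_proj unfolding q_def .
 have qc: "q x : car G" for x by (simp add: q_def)
 have qbr: "q (bracket Ea x y) = bracket G (q x) (q y)" if "x : hspan EH" "y : hspan EH" for x y
  using Fs_br[of "fst x" "fst y"] Ea_D[OF that(1)] Ea_D[OF that(2)] by (simp add: q_def gb_def)
 define jE where "jE = inv_into (carrier Ea) encE"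
 have jE: "jE (encE x) = x" if "x : hspan EH" for x unfolding jE_def by (rule inv_into_f_f[OF iE]) (use that in simp)
 define p :: "('a + 'g) universe => ('a + 'g) universe" where "p u = encG (q (jE u))" for u
 have qh: "q x : hp G n" if "x : EH n" for x n
  using q that by (auto simp: dg_module_hom_def graded_module_hom_def)
 have closed: "a : car A ==> x : hspan EH ==> a \<odot>\<^sub>Ea x : hspan EH" "x : hspan EH ==> dif Ea x : hspan EH"
  "x : hspan EH ==> y : hspan EH ==> x \<oplus>\<^sub>Ea y : hspan EH" "x : hspan EH ==> y : hspan EH ==> bracket Ea x y : hspan EH" for a x y
  using Ea_smult_closed Ea_dif_closed hspan_add Ea_bracket_closed by auto
 have qs: "q (x \<oplus>\<^sub>Ea y) = q x \<oplus>\<^sub>G q y" "a : car A ==> q (a \<odot>\<^sub>Ea x) = a \<odot>\<^sub>G q x" "q (dif Ea x) = dif G (q x)"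
  if "x : hspan EH" "y : hspan EH" for a x y
  using q that unfolding dg_module_hom_def graded_module_hom_def by (simp_all del: Ea_sel(3,5,6))
 note nosel = Ea_sel(3,5,6,7,8)
 have ph: "algebroid_hom A E' B p"
  unfolding algebroid_hom_def dg_module_hom_def graded_module_hom_def
 proof (intro conjI allI ballI)
  fix n u assume "u : hpart E' n"
  then show "p u : hpart B n" using EH_span qh by (auto simp: sE sG p_def jE)
 next
  fix u v assume "u : carrier E'" "v : carrier E'"
  then obtain x y where x: "u = encE x" "v = encE y" "x : hspan EH" "y : hspan EH" by (auto simp: sE)
  show "p (u \<oplus>\<^sub>E' v) = p u \<oplus>\<^sub>B p v"
   using x closed(3) by (simp add: sE sG p_def jE qs qc del: nosel)
  show "p (bracket E' u v) = bracket B (p u) (p v)"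
   using x closed(4) by (simp add: sE sG p_def jE qbr qc del: nosel)
 next
  fix a u assume a: "a : car A" and "u : carrier E'"
  then obtain x where x: "u = encE x" "x : hspan EH" by (auto simp: sE)
  show "p (a \<odot>\<^sub>E' u) = a \<odot>\<^sub>B p u"
   using x a closed(1)[OF a x(2)] qs(2)[OF x(2) x(2) a] by (simp add: sE sG p_def jE qc del: nosel)
 next
  fix u assume "u : carrier E'"
  then obtain x where x: "u = encE x" "x : hspan EH" by (auto simp: sE)
  show "p (dif E' u) = dif B (p u)"
   using x closed(2)[OF x(2)] qs(3)[OF x(2) x(2)] by (simp add: sE sG p_def jE qc del: nosel)
  have "anchor Ea x = anchor G (q x)" by (simp add: q_def)
  then show "anchor B (p u) = anchor E' u"
   using x by (simp add: sE sG p_def jE qc del: nosel)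
 qed
 have surj: "degreewise_surj E' B p"
  unfolding degreewise_surj_def
 proof (intro allI equalityI subsetI)
  fix n u assume "u : p ` hpart E' n"
  then show "u : hpart B n" using ph by (auto simp: algebroid_hom_def dg_module_hom_def graded_module_hom_def)
 next
  fix n u assume "u : hpart B n"
  then obtain x where x: "u = encG x" "x : hp G n" by (auto simp: sG)
  let ?y = "(ev (Leaf (n, x)), ev (Leaf (n + 1, dif G x)))"
  have y: "?y : EH n" by (rule EH_lift[OF x(2)])
  have "q ?y = x" using x(2) unfolding q_def fst_conv rY_ev by (simp add: bar_def)
  then have "u = p (encE ?y)" using x jE[OF EH_span[OF y]] by (simp add: p_def del: ev.simps)
  then show "u : p ` hpart E' n" using y by (auto simp: sE)
 qed
 have ME: "dg_module A E'" and MB: "dg_module A B" using aE aB by (simp_all add: dg_lie_algebroid_def)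
 have qi: "quasi_iso E' B p"
 proof (rule quasi_isoI[OF ME MB _ _ _ surj])
  fix n u assume u: "u : hpart E' n" "dif E' u = \<zero>\<^sub>E'" "p u = \<zero>\<^sub>B"
  then obtain x where x: "u = encE x" "x : EH n" by (auto simp: sE)
  note xs = EH_span[OF x(2)]
  have "encE (dif Ea x) = encE 0" using u(2) xs by (simp add: x sE del: Ea_sel(5))
  then have "dif Ea x = 0" by (rule injD[OF inj_encE])
  then have sx: "snd x = 0" by (simp add: zero_prod_def)
  have "(encG (q x) :: ('a + 'g) universe) = encG \<zero>\<^sub>G" using u(3) xs by (simp add: x p_def jE sG)
  then have "q x = \<zero>\<^sub>G" by (rule injD[OF inj_encG])
  then have rx: "rY (fst x) = 0" using pjG_rY[of "fst x"] by (simp add: q_def pjG_def)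
  \<comment> \<open>A cocycle in the kernel has no term at \<epsilon>, and \<open>rY\<close>
    vanishes on its first component. That component can therefore be placed at \<epsilon>, one
    degree lower, and the differential takes it back to x.\<close>
  have y: "(0, fst x) : EH (n - 1)"
   using EH_D(1,2)[OF x(2)] by (simp add: EH_def Fs_zero HY_rules rx rY_lin ad_zero[OF ad_total(12)])
  have "dif E' (encE (0, fst x)) = u"
   using EH_span[OF y] sx by (simp add: sE x prod_eq_iff) (metis prod.collapse)
  moreover have "p (encE (0, fst x)) = \<zero>\<^sub>B"
   using jE[OF EH_span[OF y]] by (simp add: p_def q_def rY_lin sG)
  ultimately show "\<exists>y\<in>hpart E' (n - 1). dif E' y = u & p y = \<zero>\<^sub>B"
   using y by (intro bexI[of _ "encE (0, fst x)"]) (auto simp: sE)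
 qed (use ph in \<open>auto simp: algebroid_hom_def dg_module_hom_def graded_module_hom_def\<close>)
 \<comment> \<open>The identity of \<gg>, with target replaced by the copy B: this is the map to be
   lifted.\<close>
 have fh: "algebroid_hom A G B encG"
  unfolding algebroid_hom_def dg_module_hom_def graded_module_hom_def by (auto simp: sG)
 obtain h where h: "algebroid_hom A G E' h" "!!x. x : car G ==> p (h x) = encG x"
  using cof aE aB ph surj qi fh unfolding cofibrant_lie_algebroid_def by blast
 have hh: "x : hp G n ==> h x : hpart E' n" "x : car G ==> y : car G ==> h (x \<oplus>\<^sub>G y) = h x \<oplus>\<^sub>E' h y"
  "a : car A ==> x : car G ==> h (a \<odot>\<^sub>G x) = a \<odot>\<^sub>E' h x"
  "x : car G ==> y : car G ==> h (bracket G x y) = bracket E' (h x) (h y)" for n a x y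
  using h(1) by (simp_all add: algebroid_hom_def dg_module_hom_def graded_module_hom_def)
 interpret E': abelian_group E' by (rule dg_moduleD(2)[OF ME])
 have hE: "\<exists>y\<in>hspan EH. h x = encE y" if "x : car G" for x
 proof -
  have "h x : carrier E'" using grG that
  proof (induction x rule: graded_induct)
   case zero
   then show ?case using hpart_carrier[OF dg_moduleD(1)[OF ME] hh(1)[OF G_hpart(2)]] by simp
  next
   case (hom n y)
   then show ?case using hpart_carrier[OF dg_moduleD(1)[OF ME] hh(1)] by blast
  qed (simp add: hh)
  then show ?thesis by (auto simp: sE)
 qed
 define t where "t x = jE (h x)" for x
 have t: "t x : hspan EH & h x = encE (t x)" if "x : car G" for x
  using hE[OF that] jE by (auto simp: t_def)
 have tI: "t x = y" if "h x = encE y" "y : hspan EH" for x y using that jE by (simp add: t_def)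
 show ?thesis
 proof (rule that[of "%x. fst (t x)"])
  fix n x assume x: "x : hp G n"
  have "h x : encE ` EH n" using hh(1)[OF x] by (simp add: sE(3))
  then obtain y where y: "h x = encE y" "y : EH n" by (rule imageE)
  have ty: "t x = y" by (rule tI[OF y(1) EH_span[OF y(2)]])
  have "(encG (q y) :: ('a + 'g) universe) = encG x" using h(2)[of x] x EH_span[OF y(2)] by (simp add: p_def y jE)
  then have "q y = x" by (rule injD[OF inj_encG])
  then have "rY (fst y) = eG x" using pjG_rY[of "fst y"] by (simp add: q_def pjG_def)
  then show "fst (t x) : Fs & HY n (fst (t x)) & rY (fst (t x)) = eG x"
   using EH_D[OF y(2)] by (simp add: ty)
 next
  fix x y assume x: "x : car G" "y : car G"
  note tx = t[OF x(1)] t[OF x(2)]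
  have "t (x \<oplus>\<^sub>G y) = t x \<oplus>\<^sub>Ea t y"
   by (rule tI) (use x tx closed(3) in \<open>auto simp: hh sE simp del: nosel\<close>)
  then show "fst (t (x \<oplus>\<^sub>G y)) = fst (t x) + fst (t y)" by simp
  have "t (bracket G x y) = bracket Ea (t x) (t y)"
   by (rule tI) (use x tx closed(4) in \<open>auto simp: hh sE simp del: nosel\<close>)
  then show "fst (t (bracket G x y)) = br (fst (t x)) (fst (t y))" by simp
 next
  fix a x assume a: "a : car A" and x: "x : car G"
  have "t (a \<odot>\<^sub>G x) = a \<odot>\<^sub>Ea t x"
   by (rule tI) (use x a t[OF x] closed(1)[OF a] in \<open>auto simp: hh sE simp del: nosel\<close>)
  then show "fst (t (a \<odot>\<^sub>G x)) = smY (eA a) (fst (t x))" by simp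
 qed
qed

section \<open>The flat torsion-free module\<close>

text \<open>The field \<open>dif\<close> is a placeholder, as the flat connection lives on a graded
  module without differential.\<close>

definition Nm :: "('a, ('a, 'g) wmd) dgmod" where
 "Nm = \<lparr>carrier = {f. lookup f [] = 0}, mult = undefined, one = undefined, zero = 0, add = (+),
   smult = (%a. smY (eA a)), hpart = (%n. {f. HY n f & lookup f [] = 0}), dif = (%_. 0)\<rparr>"

lemma Nm_sel [simp]: "zero Nm = 0" "add Nm = (+)" "smult Nm = (%a. smY (eA a))"
 "hpart Nm = (%n. {f. HY n f & lookup f [] = 0})"
 by (simp_all add: Nm_def)

text \<open>Left multiplication by an element of F only differentiates the constant term, so
  elements without constant term stay so and N is stable.\<close>

lemma lookup_star_Fs_Nil: "f : Fs ==> lookup (star f g) [] = rh (rY f) (lookup g [])"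
 by (induction f rule: Fs.induct)
   (simp_all add: star_lin rY_lin rh_lin lookup_add star_smY lookup_smY lookup_star_Nil rY_smY rY_ev rh_ga)

lemma smY_sg: "HY n f ==> smY (sc (sg k) A1) f = sgm k f"
 by (simp add: sgm_sc[symmetric] ad_sgm'[OF ad_smY_left] HY_smY_one)

lemma Nm_wmod: "wmod A Nm"
proof unfold_locales
 fix n m a f assume "a : hp A n" "f : hpart Nm m"
 then show "a \<odot>\<^sub>Nm f : hpart Nm (n + m)" using HY_smY[OF HA_I] by (simp add: lookup_smY am_lin)
qed (auto simp: HY_rules lookup_add smY_lin)

text \<open>Flatness and torsion-freeness are one identity here, namely that s sends brackets to
  commutators in Y: multiplied by an element of N in the first case, taken by itself in the second.
  The retraction is \<open>rY\<close> followed by \<open>dG\<close>.\<close>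

lemma section_flat_data:
 assumes s: "!!n x. x : hp G n ==> s x : Fs & HY n (s x) & rY (s x) = eG x"
  "!!x y. x : car G ==> y : car G ==> s (x \<oplus>\<^sub>G y) = s x + s y"
  "!!a x. a : car A ==> x : car G ==> s (a \<odot>\<^sub>G x) = smY (eA a) (s x)"
  "!!x y. x : car G ==> y : car G ==> s (bracket G x y) = br (s x) (s y)"
 shows "flat_data A G Nm (%x. star (s x)) s (%f. dG (rY f))"
proof -
 interpret N: wmod A Nm by (rule Nm_wmod)
 have sm: "N.sm c f = smY (sc c A1) f" for c f by (simp add: N.sm_def totA)
 have h: "s x : Fs" "HY n (s x)" "rY (s x) = eG x" if "x : hp G n" for x n using s(1)[OF that] by auto
 have z: "s \<zero>\<^sub>G = 0" using s(2)[of "\<zero>\<^sub>G" "\<zero>\<^sub>G"] by simp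
 have comm: "star (s x) (star (s y) f) = star (br (s x) (s y)) f + sgm (k * m) (star (s y) (star (s x) f))"
  "star (s x) (s y) = br (s x) (s y) + sgm (k * m) (star (s y) (s x))"
  if "x : hp G k" "y : hp G m" for x y k m f
  by (simp_all add: br_HY[OF h(2)[OF that(1)] h(2)[OF that(2)]] star_lin star_assoc ad_sgm'[OF ad_star_left])
 show ?thesis
 proof (intro flat_data.intro flat_data_axioms.intro algebroid_loc_axioms Nm_wmod)
  fix x k f n assume x: "x : hp G k" and f: "f : hpart Nm n"
  note f' = f[simplified]
  show "star (s x) f : hpart Nm (n + k)"
   using HY_star[OF h(2)[OF x], of n f] f lookup_star_Fs_Nil[OF h(1)[OF x]] by (simp add: add.commute rh_lin)
  show "star (s x) (N.sm c f) = N.sm c (star (s x) f)" for c by (simp add: sm smY_const)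
 next
  fix x k a n f m assume x: "x : hp G k" and a: "a : hp A n" and f: "f : hpart Nm m"
  show "star (s x) (a \<odot>\<^sub>Nm f) = anchor G x a \<odot>\<^sub>Nm f \<oplus>\<^sub>Nm (sg (k * n) \<odot> a) \<odot>\<^sub>Nm star (s x) f"
   using x a by (simp add: star_Fs_smY[OF h(1,2)[OF x]] h(3)[OF x] sA_HA[OF HA_I[OF a]] totA sgm_sc rh_def)
 next
  fix x k y m f n assume x: "x : hp G k" "y : hp G m" and f: "f : hpart Nm n"
  have "HY (m + (k + n)) (star (s y) (star (s x) f))" using f by (intro HY_star h x) simp
  then show "star (s x) (star (s y) f) = star (s (bracket G x y)) f \<oplus>\<^sub>Nm N.sm (sg (k * m)) (star (s y) (star (s x) f))"
   using x comm(1)[OF x, of f] by (simp add: s sm smY_sg)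
 next
  fix x k y m assume x: "x : hp G k" "y : hp G m"
  have "HY (m + k) (star (s y) (s x))" by (intro HY_star h x)
  then show "star (s x) (s y) = s (bracket G x y) \<oplus>\<^sub>Nm N.sm (sg (k * m)) (star (s y) (s x))"
   using x comm(2)[OF x] by (simp add: s sm smY_sg)
 next
  fix x k assume x: "x : hp G k"
  show "s x : hpart Nm k" using h(1,2)[OF x] lookup_Fs_Nil by simp
  show "dG (rY (s x)) = x" using h(3)[OF x] x by simp
 next
  fix f n assume "f : hpart Nm n"
  then have "HG n (rY f)" using HG_rY by simp
  then show "dG (rY f) : hp G n" by (auto simp: HG_def)
 qed (auto simp: star_lin s z rY_lin totG rY_smY ga_def star_smY)
qed

end

section \<open>U as a retract of Y, and projectivity\<close>

section \<open>Projectivity from a dual basis\<close>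

locale section_loc = algebroid_loc A G for A :: "(complex, 'a) dgmod" (structure) and G :: "('a, 'g) algebroid" +
 fixes s :: "'g => ('a, 'g) wmd"
 assumes s_hom: "!!n x. x : hp G n ==> s x : Fs & HY n (s x) & rY (s x) = eG x"
  and s_add: "!!x y. x : car G ==> y : car G ==> s (x \<oplus>\<^sub>G y) = s x + s y"
  and s_smult: "!!a x. a : car A ==> x : car G ==> s (a \<odot>\<^sub>G x) = smY (eA a) (s x)"
  and s_bracket: "!!x y. x : car G ==> y : car G ==> s (bracket G x y) = br (s x) (s y)"

lemma sgm_plus_one: "sgm (k + 1) x = - sgm k x"
 by (simp add: sgm_def)

context algebroid_loc
begin

lemma A_minus_zero [simp]: "\<ominus> \<zero> = \<zero>"
 by (rule A.minus_equality) simp_all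

lemma ksign_zero: "ksign A k \<zero> = \<zero>"
 by (simp add: ksign_def)

text \<open>The rules that follow treat \<open>f - g : K\<close> as a congruence. Equalities in
  \<open>U\<close> are proved as chains of such congruences, because \<open>al\<close> and
  \<open>kap\<close> are additive only modulo \<open>K\<close>.\<close>

lemma K_trans: "f - g : K ==> g - h : K ==> f - h : K"
 using K_add[of "f - g" "g - h"] by simp

lemma K_sym: "f - g : K ==> g - f : K"
 using K_minus[of "f - g"] by simp

lemma K_add_cong: "f - g : K ==> f' - g' : K ==> (f + f') - (g + g') : K"
 using K_add[of "f - g" "f' - g'"] by (simp add: algebra_simps)

lemma K_left_cong: "f - g : K ==> h : FS ==> h ** f - h ** g : K"
 using K_left[of "f - g" h] by (simp add: cm_distrib)

lemma K_right_cong: "f - g : K ==> h : FS ==> f ** h - g ** h : K"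
 using K_right[of "f - g" h] by (simp add: cm_distrib)

lemma K_sc_cong: "f - g : K ==> sc c f - sc c g : K"
 using K_sc[of "f - g" c] by (simp add: sc_diff)

lemma K_sgm_cong: "f - g : K ==> sgm k f - sgm k g : K"
 unfolding sgm_sc by (rule K_sc_cong)

lemma al_K: "a : hp A n ==> al a - word [(n, (a, \<zero>\<^sub>G))] : K"
 by (rule al_hom[OF _ K_ideal lin_K])

lemma al_add_K: "a : car A ==> b : car A ==> al (a \<oplus> b) - (al a + al b) : K"
 by (rule al_add[OF _ _ K_ideal lin_K])

lemma al_zero [simp]: "al \<zero> = 0"
 using hcomp_hom(2)[OF grA A_hpart(2)] by (simp add: al_def)

abbreviation "wA n a \<equiv> word [(n, (a, \<zero>\<^sub>G))]"
abbreviation "wG n x \<equiv> word [(n, (\<zero>, x))]"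

lemma wA_mult: "a : hp A n ==> b : hp A m ==> wA n a ** wA m b - wA (n + m) (a \<otimes> b) : K"
 using K_alg[of a n b m "\<zero>\<^sub>G"] by (simp add: G_smult_zero)

lemma wA_wG: "a : hp A n ==> x : hp G m ==> wA n a ** wG m x - wG (n + m) (a \<odot>\<^sub>G x) : K"
 using K_alg[of a n "\<zero>" m x] by simp

lemma wG_wA: "x : hp G n ==> a : hp A m ==>
 wG n x ** wA m a - (sgm (n * m) (wA m a ** wG n x) + wA (n + m) (anchor G x a)) : K"
 using K_env[of "(\<zero>, x)" n "(a, \<zero>\<^sub>G)" m] semi_bracket[of "\<zero>" n x a m "\<zero>\<^sub>G"]
 by (simp add: sgm_sc ksign_zero A.minus_eq)

lemma wG_wG: "x : hp G n ==> y : hp G m ==>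
 wG n x ** wG m y - (sgm (n * m) (wG m y ** wG n x) + wG (n + m) (bracket G x y)) : K"
 using K_env[of "(\<zero>, x)" n "(\<zero>, y)" m] semi_bracket[of "\<zero>" n x "\<zero>" m y]
 by (simp add: sgm_sc ksign_zero A.minus_eq)

lemma al_mult:
 assumes a: "a : car A" and b: "b : car A"
 shows "al a ** al b - al (a \<otimes> b) : K"
proof -
 have h: "al a ** al b - al (a \<otimes> b) : K" if a: "a : hp A n" for a n
  using grA b
 proof (induction b rule: graded_induct)
  case (hom m b)
  have "al a ** al b - wA n a ** al b : K" by (rule K_right_cong[OF al_K[OF a]]) (use hom in \<open>simp add: al_FS\<close>)
  moreover have "wA n a ** al b - wA n a ** wA m b : K" by (rule K_left_cong[OF al_K[OF hom]]) (use a in simp)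
  ultimately have "al a ** al b - wA n a ** wA m b : K" by (rule K_trans)
  from K_trans[OF this wA_mult[OF a hom]] K_sym[OF al_K[OF A_mult[OF a hom]]] show ?case by (rule K_trans)
 next
  case (add y z)
  have "al a ** al (y \<oplus> z) - (al a ** al y + al a ** al z) : K"
   using K_left_cong[OF al_add_K[OF add(1,2)] al_FS[OF A_hcarr[OF a]]] by (simp add: cm_distrib)
  from K_trans[OF this K_add_cong[OF add(3,4)]]
  have 1: "al a ** al (y \<oplus> z) - (al (a \<otimes> y) + al (a \<otimes> z)) : K" .
  have 2: "(al (a \<otimes> y) + al (a \<otimes> z)) - al (a \<otimes> y \<oplus> a \<otimes> z) : K"
   by (rule K_sym[OF al_add_K]) (use a add in auto)
  have "a \<otimes> (y \<oplus> z) = a \<otimes> y \<oplus> a \<otimes> z"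
   using a add by (simp add: A.r_distr)
  with K_trans[OF 1 2] show ?case by (simp only:)
 qed (use a in \<open>simp add: K_zero\<close>)
 show ?thesis using grA a
 proof (induction a rule: graded_induct)
  case (add y z)
  have "al (y \<oplus> z) ** al b - (al y ** al b + al z ** al b) : K"
   using K_right_cong[OF al_add_K[OF add(1,2)] al_FS[OF b]] by (simp add: cm_distrib)
  from K_trans[OF this K_add_cong[OF add(3,4)]]
  have 1: "al (y \<oplus> z) ** al b - (al (y \<otimes> b) + al (z \<otimes> b)) : K" .
  have 2: "(al (y \<otimes> b) + al (z \<otimes> b)) - al (y \<otimes> b \<oplus> z \<otimes> b) : K"
   by (rule K_sym[OF al_add_K]) (use b add in auto)
  have "(y \<oplus> z) \<otimes> b = y \<otimes> b \<oplus> z \<otimes> b"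
   using b add by (simp add: A.l_distr)
  with K_trans[OF 1 2] show ?case by (simp only:)
 qed (use b h in \<open>simp_all add: K_zero\<close>)
qed

lemma al_one: "f : FS1 ==> al \<one> ** f - f : K"
 using K_trans[OF K_right_cong[OF al_K[OF A_one] FS1_FS] one1_left] .

definition "barg v = (if snd v : hp G (fst v) then snd v else \<zero>\<^sub>G)"

lemma barg_hpart [simp]: "barg v : hp G (fst v)"
 by (simp add: barg_def)

lemma dG_bar: "dG (bar v) = barg v"
 by (simp add: bar_def barg_def)

text \<open>The word w seen in the free algebra. The final factor \<open>one1\<close> puts it into
  \<open>FS1\<close> even when w is empty, so that the empty word yields the unit of
  \<open>U\<close>.\<close>

definition kw :: "(int \<times> 'g) list => ('a \<times> 'g) wfun" where
 "kw w = word (map (%v. (fst v, (\<zero>, barg v))) w) ** one1"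

lemma kw_Cons: "kw (v # w) = wG (fst v) (barg v) ** kw w"
 by (simp add: kw_def word_cm_word flip: cm_assoc)

lemma kw_FS [simp]: "kw w : FS"
 unfolding kw_def by (intro FS_cm) (auto simp: valid_def)

lemma kw_FS1: "kw w : FS1"
 using kw_FS[of w] word_Nil0[of "[(0, (\<one>, \<zero>\<^sub>G))]"] by (auto simp: FS1_def kw_def cm_Nil)

lemma hc_kw: "hc (wdeg w) (kw w) = kw w"
proof -
 have "wdeg (map (%v. (fst v, (\<zero>, barg v))) w @ [(0, (\<one>, \<zero>\<^sub>G))]) = wdeg w" by (induction w) auto
 then show ?thesis by (simp add: kw_def word_cm_word hc_word)
qed

text \<open>A lift to the free algebra of the A-linear map from Y to \<open>U\<close> that is given
  on the basis of words. It splits the map from \<open>U\<close> to Y given by the action on 1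
  (\<open>kap_Act_Y1\<close>).\<close>

definition kap :: "('a, 'g) wmd => ('a \<times> 'g) wfun" where
 "kap y = (\<Sum>w\<in>keys y. al (dA (lookup y w)) ** kw w)"

lemma kap_superset: "finite T ==> keys y <= T ==> kap y = (\<Sum>w\<in>T. al (dA (lookup y w)) ** kw w)"
 unfolding kap_def by (rule sum.mono_neutral_left) (auto simp: in_keys_iff)

lemma kap_term_FS1: "al (dA b) ** kw w : FS1"
 by (rule wideal_left[OF FS1_wideal kw_FS1 al_FS]) simp

lemma kap_FS1: "kap y : FS1"
 unfolding kap_def by (rule wideal_sum[OF FS1_wideal kap_term_FS1])

lemma kap_FS [simp]: "kap y : FS"
 by (rule FS1_FS[OF kap_FS1])

lemma kap_zero [simp]: "kap 0 = 0" by (simp add: kap_def)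

lemma kap_single: "kap (single w b) = al (dA b) ** kw w"
 by (simp add: kap_def lookup_single)

lemma kap_add: "kap (f + g) - (kap f + kap g) : K"
proof -
 let ?T = "keys f \<union> keys g"
 have T: "finite ?T" by simp
 have "kap (f + g) - (kap f + kap g) = (\<Sum>w\<in>?T. (al (dA (lookup f w) \<oplus> dA (lookup g w))
   - (al (dA (lookup f w)) + al (dA (lookup g w)))) ** kw w)"
  using kap_superset[OF T, of "f + g"] kap_superset[OF T, of f] kap_superset[OF T, of g] Poly_Mapping.keys_add[of f g]
  by (simp add: lookup_add totA cm_distrib sum.distrib sum_subtractf)
 also have "\<dots> : K" by (intro K_sum K_right al_add_K) simp_all
 finally show ?thesis .
qed

lemma kap_minus: "kap (- f) - (- kap f) : K"
 using K_minus[OF kap_add[of f "- f"]] by (simp add: algebra_simps)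

lemma kap_sgm: "kap (sgm k f) - sgm k (kap f) : K"
 using kap_minus[of f] K_zero by (auto simp: sgm_def)

text \<open>Both terms are additive in y modulo \<open>K\<close>, so monomials with homogeneous
  coefficients are enough.\<close>

lemma kap_cong:
 assumes X: "ad X" "!!w b. X (single w (pj b)) = X (single w b)" and h: "h : FS"
  and s: "!!w n c. c : hp A n ==> kap (X (single w (eA c))) - h ** kap (single w (eA c)) : K"
 shows "kap (X y) - h ** kap y : K"
proof -
 let ?P = "%y. kap (X y) - h ** kap y : K"
 have add: "?P (f + g)" if "?P f" "?P g" for f g
 proof -
  have "kap (X (f + g)) - (h ** kap f + h ** kap g) : K"
   using K_trans[OF kap_add[of "X f" "X g"] K_add_cong[OF that]] by (simp add: ad_add[OF X(1)])
  from K_trans[OF this] K_sym[OF K_left_cong[OF kap_add[of f g] h]] show ?thesis by (simp add: cm_distrib)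
 qed
 have zero: "?P 0" by (simp add: ad_zero[OF X(1)] K_zero)
 have single: "?P (single w b)" for w b
 proof -
  have "?P (single w (eA c))" if "c : car A" for c
   using grA that
  proof (induction c rule: graded_induct)
   case (add y z)
   then show ?case using \<open>!!f g. _ f ==> _ g ==> _ (f + g)\<close>[of "single w (eA y)" "single w (eA z)"] by (simp add: totA single_add)
  qed (use zero s in auto)
  from this[of "dA b"] show ?thesis using X(2)[of w b] by (simp add: pj_def kap_single)
 qed
 have "finite T ==> ?P (\<Sum>w\<in>T. single w (lookup y w))" for T
 proof (induction T rule: finite_induct)
  case empty
  show ?case using zero by simp
 next
  case (insert w T)
  show ?case using add[OF single insert(3)] insert(1,2) by (simp only: sum.insert not_False_eq_True)
 qed
 from this[of "keys y"] show ?thesis using poly_mapping_sum_single[of y] by simp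
qed

lemma kap_smY: "a : hp A n ==> kap (smY (eA a) y) - al a ** kap y : K"
proof (rule kap_cong)
 fix w m c assume a: "a : hp A n" and c: "c : hp A m"
 have "al (a \<otimes> c) ** kw w - (al a ** al c) ** kw w : K"
  by (rule K_right_cong[OF K_sym[OF al_mult]]) (use a c in auto)
 then show "kap (smY (eA a) (single w (eA c))) - al a ** kap (single w (eA c)) : K"
  using a c by (simp add: kap_single am_def cm_assoc)
qed (auto simp: al_FS)

text \<open>The rule by which letters pass coefficients in Y is the relation \<open>wG_wA\<close> of
  \<open>U\<close>.\<close>

lemma kap_Lv: "kap (Lv v y) - wG (fst v) (barg v) ** kap y : K"
proof (rule kap_cong)
 fix w m c assume c: "c : hp A m"
 let ?n = "fst v" and ?x = "barg v"
 have x: "wG ?n ?x : FS" by simp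
 have rho: "anchor G ?x c : hp A (?n + m)" using anchor_hpart c by simp
 have 1: "kap (Lv v (single w (eA c))) - (al (anchor G ?x c) ** kw w + al (dA (sgm (?n * m) (eA c))) ** (wG ?n ?x ** kw w)) : K"
  using kap_add[of "single w (rh (bar v) (eA c))" "single (v # w) (sA ?n (eA c))"] c
  by (simp add: kap_single kw_Cons sA_HA[OF HA_I[OF c]]) (simp add: dG_bar rh_def A_hcarr[OF rho])
 have 2: "al (anchor G ?x c) ** kw w - wA (?n + m) (anchor G ?x c) ** kw w : K"
  by (rule K_right_cong[OF al_K[OF rho] kw_FS])
 have sg: "al (dA (sgm k (eA c))) - sgm k (wA m c) : K" for k
 proof -
  have "dA (sgm k (eA c)) = sg k \<odot> c" using c by (simp add: sgm_sc totA)
  moreover have "al (sg k \<odot> c) - wA m (sg k \<odot> c) : K" by (rule al_K[OF A_smult_hpart[OF c]])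
  moreover have "wA m (sg k \<odot> c) - sgm k (wA m c) : K"
   using lr_sc[OF K_ideal lin_K c M_zero[of m], of "sg k"] by (simp add: sgm_sc sm_def G_smult_zero)
  ultimately show ?thesis using K_trans by metis
 qed
 have 3: "al (dA (sgm (?n * m) (eA c))) ** (wG ?n ?x ** kw w) - sgm (?n * m) (wA m c) ** (wG ?n ?x ** kw w) : K"
  by (rule K_right_cong[OF sg]) (intro FS_cm x kw_FS)
 have 4: "(sgm (?n * m) (wA m c ** wG ?n ?x) + wA (?n + m) (anchor G ?x c)) ** kw w - wG ?n ?x ** wA m c ** kw w : K"
  by (rule K_right_cong[OF K_sym[OF wG_wA[OF barg_hpart c]] kw_FS])
 have 5: "(wG ?n ?x ** wA m c) ** kw w - (wG ?n ?x ** al c) ** kw w : K"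
  by (rule K_right_cong[OF K_left_cong[OF K_sym[OF al_K[OF c]] x] kw_FS])
 have "kap (Lv v (single w (eA c))) - (wG ?n ?x ** al c) ** kw w : K"
  using K_trans[OF K_trans[OF K_trans[OF 1 K_add_cong[OF 2 3]]] 5] 4
  by (simp add: cm_distrib sgm_sc cm_assoc add.commute)
 then show "kap (Lv v (single w (eA c))) - wG ?n ?x ** kap (single w (eA c)) : K"
  using c by (simp add: kap_single cm_assoc)
qed simp_all

lemma dG_vl: "dG (vl t) : hp G (tdeg t)"
 using HG_vl[of t] by (auto simp: HG_def)

text \<open>At a node Y has a graded commutator by definition and \<open>U\<close> has one by the
  relation \<open>wG_wG\<close>, so the claim passes from the two subtrees to the node.\<close>

lemma kap_star_ev: "kap (star (ev t) y) - wG (tdeg t) (dG (vl t)) ** kap y : K"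
proof (induction t arbitrary: y)
 case (Leaf v)
 show ?case using kap_Lv[of v y] by (simp add: star_Leaf dG_bar)
next
 case (Node p t)
 let ?x = "wG (tdeg p) (dG (vl p))" and ?y = "wG (tdeg t) (dG (vl t))" and ?k = "tdeg p * tdeg t"
 have F: "?x : FS" "?y : FS" using dG_vl by auto
 have a: "kap (star (ev p) (star (ev t) y)) - ?x ** (?y ** kap y) : K"
  by (rule K_trans[OF Node(1) K_left_cong[OF Node(2) F(1)]])
 have b: "kap (star (ev t) (star (ev p) y)) - ?y ** (?x ** kap y) : K"
  by (rule K_trans[OF Node(2) K_left_cong[OF Node(1) F(2)]])
 have b': "kap (- sgm ?k (star (ev t) (star (ev p) y))) - (- sgm ?k (?y ** (?x ** kap y))) : K"
  using K_trans[OF kap_sgm[of "?k + 1" "star (ev t) (star (ev p) y)"] K_sgm_cong[OF b, of "?k + 1"]] by (simp only: sgm_plus_one)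
 have c: "kap (star (ev (Node p t)) y) - (?x ** (?y ** kap y) + - sgm ?k (?y ** (?x ** kap y))) : K"
  using K_trans[OF kap_add K_add_cong[OF a b']] unfolding star_Node by simp
 have "?x ** ?y ** kap y - (sgm ?k (?y ** ?x) + wG (tdeg (Node p t)) (dG (vl (Node p t)))) ** kap y : K"
  using K_right_cong[OF wG_wG[OF dG_vl dG_vl] kap_FS] by (simp add: gb_def)
 from K_add[OF c this] show ?case by (simp add: cm_distrib sgm_sc cm_assoc algebra_simps del: ev.simps vl.simps tdeg.simps)
qed

lemma wG_zero: "wG n \<zero>\<^sub>G : K"
 by (rule lr_zero[OF K_ideal lin_K])

lemma wG_add: "x : hp G n ==> y : hp G n ==> wG n (x \<oplus>\<^sub>G y) - (wG n x + wG n y) : K"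
 using lr_add[OF K_ideal lin_K A_hpart(2) A_hpart(2), of x n y] by simp

lemma HY_hY: "HY n (hY n f)"
 by (simp add: HY_def lookup_hY HA_rules)

text \<open>The letter \<open>wG n\<close> asks for an element of degree n, whereas elements of
  \<open>Fs\<close> are built from generators of varying degree. Projecting to the component of
  degree n first keeps the induction additive.\<close>

lemma kap_star_Fs_hY:
 assumes "f : Fs"
 shows "kap (star (hY n f) y) - wG n (dG (rY (hY n f))) ** kap y : K"
 using assms
proof (induction f rule: Fs.induct)
 case Fs_zero
 show ?case using K_right[OF wG_zero kap_FS, of n y] by (simp add: ad_zero[OF ad_hY] star_lin rY_lin K_minus)
next
 case (Fs_gen i a f t)
 obtain c where c: "c : hp A i" "a = eA c" using Fs_gen(1) by (auto simp: HA_def)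
 let ?g = "smY a (ev t)"
 have g: "kap (star (hY n ?g) y) - wG n (dG (rY (hY n ?g))) ** kap y : K"
 proof (cases "n = i + tdeg t")
  case True
  have r: "dG (rY ?g) = c \<odot>\<^sub>G dG (vl t)" using c by (simp add: rY_smY rY_ev ga_def)
  have F: "wA i c : FS" "al c : FS" "wG (tdeg t) (dG (vl t)) : FS" using c dG_vl by (auto simp: al_FS)
  have "kap (smY (eA c) (star (ev t) y)) - al c ** (wG (tdeg t) (dG (vl t)) ** kap y) : K"
   by (rule K_trans[OF kap_smY[OF c(1)] K_left_cong[OF kap_star_ev F(2)]])
  moreover have "al c ** (wG (tdeg t) (dG (vl t)) ** kap y) - wA i c ** (wG (tdeg t) (dG (vl t)) ** kap y) : K"
   by (rule K_right_cong[OF al_K[OF c(1)]]) (intro FS_cm F kap_FS)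
  moreover have "wA i c ** (wG (tdeg t) (dG (vl t)) ** kap y) - wG (i + tdeg t) (c \<odot>\<^sub>G dG (vl t)) ** kap y : K"
   using K_right_cong[OF wA_wG[OF c(1) dG_vl] kap_FS] by (simp add: cm_assoc)
  ultimately have "kap (smY (eA c) (star (ev t) y)) - wG (i + tdeg t) (c \<odot>\<^sub>G dG (vl t)) ** kap y : K"
   by (blast intro: K_trans)
  then show ?thesis using True r hY_HY[OF HY_smY[OF Fs_gen(1) HY_ev], of n] by (simp add: star_smY c(2))
 next
  case False
  then show ?thesis using K_right[OF wG_zero kap_FS, of n y] hY_HY[OF HY_smY[OF Fs_gen(1) HY_ev], of n]
   by (simp add: star_lin rY_lin K_minus)
 qed
 have h: "dG (rY (hY n f)) : hp G n" for f
 proof -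
  have "HG n (rY (hY n f))" by (rule HG_rY[OF HY_hY])
  then show ?thesis by (auto simp: HG_def)
 qed
 have "wG n (dG (rY (hY n ?g)) \<oplus>\<^sub>G dG (rY (hY n f))) ** kap y - (wG n (dG (rY (hY n ?g))) + wG n (dG (rY (hY n f)))) ** kap y : K"
  by (rule K_right_cong[OF wG_add[OF h h] kap_FS])
 from K_trans[OF K_trans[OF kap_add K_add_cong[OF g Fs_gen(3)]]] K_sym[OF this]
 show ?case by (simp add: ad_add[OF ad_hY] star_lin rY_lin totG cm_distrib)
qed

lemma kap_star_Fs: "f : Fs ==> HY n f ==> rY f = eG x ==> x : car G ==> kap (star f y) - wG n x ** kap y : K"
 using kap_star_Fs_hY[of f n y] by (simp add: hY_HY)

end

lemma graded_module_hom_closed: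
 assumes M: "graded_group M" and N: "graded_group N" and f: "graded_module_hom R M N f" and x: "x : car M"
 shows "f x : car N"
proof -
 interpret N: abelian_group N by (rule graded_group_abelian[OF N])
 show ?thesis using M x
 proof (induction x rule: graded_induct)
  case zero
  then show ?case using f hpart_zero[OF M] hpart_carrier[OF N] unfolding graded_module_hom_def by blast
 next
  case (hom n y)
  then show ?case using f hpart_carrier[OF N] unfolding graded_module_hom_def by blast
 next
  case (add y z)
  then show ?case using f unfolding graded_module_hom_def by simp
 qed
qed

lemma hpart_finsum:
 assumes M: "graded_group M" and f: "!!i. i : T ==> f i : hp M n" and T: "finite T"
 shows "(\<Oplus>\<^bsub>M\<^esub>i\<in>T. f i) : hp M n"
proof -
 interpret abelian_group M by (rule graded_group_abelian[OF M])
 from T f show ?thesis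
 proof (induction T rule: finite_induct)
  case (insert i T)
  then show ?case using hpart_carrier[OF M] by (subst finsum_insert) (auto intro!: hpart_add[OF M])
 qed (simp add: hpart_zero[OF M])
qed

context section_loc
begin

definition Al :: "int \<times> 'a \<times> 'g => ('a, 'g) wmd => ('a, 'g) wmd" where
 "Al l y = smY (eA (fst (snd l))) y + star (s (snd (snd l))) y"

primrec actw :: "(int \<times> 'a \<times> 'g) list => ('a, 'g) wmd => ('a, 'g) wmd" where
 "actw [] y = y"
| "actw (l # w) y = Al l (actw w y)"

text \<open>Complex scalars act through the coefficient \<open>sc c A1\<close>, because coefficients
  in Y are taken from the function space that contains A.\<close>

definition Act :: "('a \<times> 'g) wfun => ('a, 'g) wmd => ('a, 'g) wmd" where
 "Act f y = (\<Sum>w\<in>{w. f w ~= 0}. smY (sc (f w) A1) (actw w y))"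

lemma s_zero [simp]: "s \<zero>\<^sub>G = 0"
 using s_add[of "\<zero>\<^sub>G" "\<zero>\<^sub>G"] by simp

lemma s_star_smY: "x : hp G n ==> b : car A ==>
  star (s x) (smY (eA b) v) = smY (eA (anchor G x b)) v + smY (sA n (eA b)) (star (s x) v)"
 using s_hom[of x n] star_Fs_smY[of "s x" n "eA b" v] by (simp add: rh_def)

lemma ad_Al [simp]: "ad (Al l)"
 unfolding Al_def by (intro ad_plus ad_smY ad_star_right)

lemma Al_lin: "Al l (f + g) = Al l f + Al l g" "Al l 0 = 0"
 using ad_add[OF ad_Al] ad_zero[OF ad_Al] by auto

lemma Al_const: "Al l (smY (sc c A1) y) = smY (sc c A1) (Al l y)"
 by (simp add: Al_def smY_lin smY_smY am_sc am_sc_right am_one smY_const)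

lemma Al_A1: "Al l (smY A1 y) = smY A1 (Al l y)"
 using Al_const[of l 1 y] by simp

lemma smY_A1_Al: "valid V [l] ==> smY A1 (Al l y) = Al l y"
proof -
 assume "valid V [l]"
 then have "snd (snd l) : hp G (fst l)" by auto
 then have "s (snd (snd l)) : Fs" using s_hom by blast
 then have "smY A1 (s (snd (snd l))) = s (snd (snd l))" by (rule Fs_smY_one)
 then have "smY A1 (star (s (snd (snd l))) y) = star (s (snd (snd l))) y" by (metis star_smY)
 then show ?thesis by (simp add: Al_def smY_lin smY_one)
qed

lemma Act_superset: "finite T ==> {w. f w ~= 0} <= T ==> Act f y = (\<Sum>w\<in>T. smY (sc (f w) A1) (actw w y))"
 unfolding Act_def by (rule sum.mono_neutral_left) (auto simp: smY_lin)

lemma Act_zero [simp]: "Act 0 y = 0"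
 by (simp add: Act_def zero_fun_apply)

lemma Act_add: "f : FS ==> g : FS ==> Act (f + g) y = Act f y + Act g y"
proof -
 assume "f : FS" "g : FS"
 then have T: "finite ({w. f w ~= 0} \<union> {w. g w ~= 0})" (is "finite ?T") using FS_fs unfolding fs_def by blast
 have "{w. (f + g) w ~= 0} <= ?T" by (auto simp: plus_fun_apply)
 then show ?thesis
  using Act_superset[OF T, of f y] Act_superset[OF T, of g y] Act_superset[OF T, of "f + g" y]
  by (simp add: plus_fun_apply sc_add_left smY_lin sum.distrib)
qed

lemma Act_sc [simp]: "f : FS ==> Act (sc c f) y = smY (sc c A1) (Act f y)"
proof -
 assume "f : FS"
 then have T: "finite {w. f w ~= 0}" using FS_fs unfolding fs_def by blast
 have "smY (sc c A1) (smY (sc d A1) z) = smY (sc (c * d) A1) z" for d z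
  by (simp add: smY_smY am_sc am_one pj_sc_one)
 then show ?thesis
  using Act_superset[OF T, of f y] Act_superset[OF T, of "sc c f" y]
  by (simp add: sc_apply ad_sum[OF ad_smY] Collect_mono)
qed

lemma Act_diff: "f : FS ==> g : FS ==> Act (f - g) y = Act f y - Act g y"
 using Act_add[of "f - g" g y] by simp

lemma Act_word: "Act (word w) y = smY A1 (actw w y)"
proof -
 have "{v. word w v ~= 0} = {w}" by (auto simp: word_apply)
 then show ?thesis by (simp add: Act_def word_apply)
qed

lemma Act_letter: "valid V [l] ==> Act (word [l]) y = Al l y"
 by (simp add: Act_word smY_A1_Al)

lemma Act_left: "f : FS ==> valid V [l] ==> Act (word [l] ** f) y = Al l (Act f y)"
 by (induction f rule: FS_induct) (auto simp: cm_distrib word_cm_word Act_add Act_word Al_lin Al_const Al_A1)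

lemma Act_right: "f : FS ==> valid V [l] ==> Act (f ** word [l]) y = Act f (Al l y)"
proof (induction f rule: FS_induct)
 case (word c w)
 have "actw (w @ [l]) y = actw w (Al l y)" by (induction w) auto
 then show ?case using word by (simp add: cm_distrib word_cm_word Act_word)
qed (auto simp: cm_distrib Act_add)

text \<open>Three facts combine: s sends brackets to commutators, the elements \<open>s x\<close>
  differentiate coefficients by the anchor, and A is graded commutative.\<close>

lemma Al_Al:
 assumes h: "a : hp A n" "x : hp G n" "b : hp A m" "y : hp G m"
 shows "Al (n, (a, x)) (Al (m, (b, y)) v) = sgm (n * m) (Al (m, (b, y)) (Al (n, (a, x)) v)) + Al (n + m, sbr (a, x) (b, y)) v"
proof -
 have br: "s (bracket G x y) = star (s x) (s y) - sgm (n * m) (star (s y) (s x))"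
  using s_bracket[of x y] s_hom[OF h(2)] s_hom[OF h(4)] h by (simp add: br_HY)
 have e: "eA (anchor G x b \<ominus> ksign A (n * m) (anchor G y a)) = eA (anchor G x b) - sgm (n * m) (eA (anchor G y a))"
  using h by (simp add: a_minus_def totA eA_minus eA_ksign)
 have c: "am (eA a) (eA b) = sgm (n * m) (am (eA b) (eA a))" using am_comm[OF HA_I HA_I] h by blast
 show ?thesis
  unfolding Al_def fst_conv snd_conv semi_bracket[OF h] br e star_lin smY_lin smY_smY c
   s_star_smY[OF h(2) A_hcarr[OF h(3)]] s_star_smY[OF h(4) A_hcarr[OF h(1)]] sA_HA[OF HA_I[OF h(1)]] sA_HA[OF HA_I[OF h(3)]]
  by (cases "even n"; cases "even m"; simp add: sgm_def smY_lin star_lin star_assoc)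
qed

text \<open>\<open>smY A1 y = y\<close> says that the coefficients of y lie in the copy of A. The
  elements of the free algebra that annihilate all such y form an ideal, since letters preserve this
  condition.\<close>

lemma Act_K: "f : K ==> smY A1 y = y ==> Act f y = 0"
proof -
 assume f: "f : K" and y: "smY A1 y = y"
 let ?I = "{f : FS. \<forall>y. smY A1 y = y --> Act f y = 0}"
 have "wideal V ?I"
 proof (rule wideal_letters)
  fix l f assume "f : ?I" "valid V [l]"
  then show "word [l] ** f : ?I" "f ** word [l] : ?I"
   by (auto simp: Act_left Act_right Al_lin smY_A1_Al simp del: valid_simps)
 qed (auto simp: Act_add smY_lin)
 moreover have "env_gens \<union> alg_gens <= ?I"
 proof
  fix g assume g: "g : env_gens \<union> alg_gens"
  have "Act g v = 0" if v: "smY A1 v = v" for v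
  proof -
   consider n a b x y where "g = word [(n, (a \<oplus> b, x \<oplus>\<^sub>G y))] - (word [(n, (a, x))] + word [(n, (b, y))])"
     "a : hp A n" "b : hp A n" "x : hp G n" "y : hp G n"
    | n c a x where "g = word [(n, (c \<odot> a, sm c x))] - sc c (word [(n, (a, x))])" "a : hp A n" "x : hp G n"
    | n m a x b y where "g = word [(n, (a, x))] ** word [(m, (b, y))] - (sc (sg (n * m)) (word [(m, (b, y))] ** word [(n, (a, x))]) + word [(n + m, sbr (a, x) (b, y))])"
      "(a, x) : hp V n" "(b, y) : hp V m"
    | n m a b y where "g = word [(n, (a, \<zero>\<^sub>G))] ** word [(m, (b, y))] - word [(n + m, (a \<otimes> b, a \<odot>\<^sub>G y))]"
      "a : hp A n" "b : hp A m" "y : hp G m"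
    using g unfolding env_gens_def alg_gens_def linear_rels_V by fast
   then show ?thesis
   proof cases
    case (1 n a b x y)
    then show ?thesis
     by (simp add: Act_diff Act_add Act_letter A_hpart M_add) (simp add: Al_def totA s_add smY_lin star_lin)
   next
    case (2 n c a x)
    have e: "s (sm c x) = smY (sc c A1) (s x)" using 2(3) by (simp add: sm_def s_smult totA)
    have x: "valid V [(n, (c \<odot> a, sm c x))]" using 2 csm_hpart by (simp add: sm_csm A_smult_hpart)
    have "Al (n, (c \<odot> a, sm c x)) v = smY (sc c A1) (Al (n, (a, x)) v)"
     using 2(2) by (simp add: Al_def e totA smY_lin smY_smY am_sc am_one star_smY sc_simps(4) ad_sc)
    moreover have x': "valid V [(n, (a, x))]" using 2 by simp
    have "word [(n, (c \<odot> a, sm c x))] : FS" "word [(n, (a, x))] : FS" using x x' by (simp_all only: FS_word)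
    ultimately show ?thesis unfolding 2(1) using x x' by (simp add: Act_diff Act_letter del: valid_simps FS_word dsum_sel)
   next
    case (3 n m a x b y)
    have vs: "valid V [(n, (a, x))]" "valid V [(m, (b, y))]" "valid V [(n + m, sbr (a, x) (b, y))]"
     using semi_bracket_hpart[OF 3(2,3)] 3(2,3) by simp_all
    have w: "word [(n, (a, x))] : FS" "word [(m, (b, y))] : FS" "word [(n + m, sbr (a, x) (b, y))] : FS" using vs by (simp_all only: FS_word)
    let ?z = "Al (m, (b, y)) (Al (n, (a, x)) v)"
    have "smY (sc (sg (n * m)) A1) ?z = sgm (n * m) ?z"
     using smY_A1_Al[OF vs(2)] by (simp add: sgm_sc[symmetric] ad_sgm'[OF ad_smY_left])
    moreover have "Act g v = Al (n, (a, x)) (Al (m, (b, y)) v) - (smY (sc (sg (n * m)) A1) ?z + Al (n + m, sbr (a, x) (b, y)) v)"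
     unfolding 3(1) using w vs by (simp add: Act_diff Act_add Act_left Act_letter del: valid_simps FS_word dsum_sel)
    ultimately show ?thesis using Al_Al[of a n x b m y v] 3(2,3) by simp
   next
    case (4 n m a b y)
    have vs: "valid V [(n, (a, \<zero>\<^sub>G))]" "valid V [(m, (b, y))]" "valid V [(n + m, (a \<otimes> b, a \<odot>\<^sub>G y))]"
     using 4(2-) A_mult M_smult by simp_all
    have w: "word [(n, (a, \<zero>\<^sub>G))] : FS" "word [(m, (b, y))] : FS" "word [(n + m, (a \<otimes> b, a \<odot>\<^sub>G y))] : FS" using vs by (simp_all only: FS_word)
    have "eA (a \<otimes> b) = am (eA a) (eA b)" using 4 by (simp add: am_def)
    then have "Al (n, (a, \<zero>\<^sub>G)) (Al (m, (b, y)) v) = Al (n + m, (a \<otimes> b, a \<odot>\<^sub>G y)) v"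
     using 4 by (simp add: Al_def smY_lin star_lin smY_smY s_smult star_smY)
    then show ?thesis
     unfolding 4(1) using w vs by (simp add: Act_diff Act_left Act_letter del: valid_simps FS_word dsum_sel)
   qed
  qed
  then show "g : ?I" using g gens_FS by blast
 qed
 ultimately have "K <= ?I" unfolding K_def by (rule Idl_minimal)
 with f y show ?thesis by blast
qed

abbreviation "Y1 \<equiv> single ([] :: (int \<times> 'g) list) A1"

lemma Y1: "smY A1 Y1 = Y1" "HY 0 Y1"
 by (simp_all add: am_one HY_single[OF HA_one])

lemma Act_K_eq: "f - g : K ==> f : FS ==> g : FS ==> Act f Y1 = Act g Y1"
 using Act_K[OF _ Y1(1), of "f - g"] by (simp add: Act_diff)

lemma Act_al: "a : car A ==> f : FS ==> Act (al a ** f) Y1 = smY (eA a) (Act f Y1)"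
proof -
 assume a: "a : car A" and f: "f : FS"
 show ?thesis using grA a
 proof (induction a rule: graded_induct)
  case zero
  then show ?case by (simp add: smY_lin)
 next
  case (hom n b)
  have "Act (al b ** f) Y1 = Act (wA n b ** f) Y1"
   by (rule Act_K_eq[OF K_right_cong[OF al_K[OF hom] f]]) (use hom f in \<open>auto simp: al_FS\<close>)
  also have "\<dots> = smY (eA b) (Act f Y1)" using hom f by (simp add: Act_left Al_def star_lin)
  finally show ?case .
 next
  case (add y z)
  have "Act (al (y \<oplus> z) ** f) Y1 = Act ((al y + al z) ** f) Y1"
   by (rule Act_K_eq[OF K_right_cong[OF al_add_K[OF add(1,2)] f]]) (use add f in \<open>auto simp: al_FS\<close>)
  also have "\<dots> = Act (al y ** f) Y1 + Act (al z ** f) Y1"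
   using add(1,2) f by (simp add: cm_distrib Act_add al_FS)
  finally show ?case using add by (simp add: totA smY_lin)
 qed
qed

lemma HY_Act: "f : FS ==> hc n f = f ==> HY n (Act f Y1)"
proof -
 assume f: "f : FS" and h: "hc n f = f"
 have w: "HY (wdeg w) (actw w Y1)" if "valid V w" for w
  using that
 proof (induction w)
  case (Cons l w)
  have l: "fst (snd l) : hp A (fst l)" "snd (snd l) : hp G (fst l)" using Cons(2) by auto
  have IH: "HY (wdeg w) (actw w Y1)" using Cons by simp
  have "HY (fst l + wdeg w) (star (s (snd (snd l))) (actw w Y1))" using HY_star[OF _ IH] s_hom[OF l(2)] by blast
  with HY_smY[OF HA_I[OF l(1)] IH] show ?case by (simp add: Al_def HY_rules)
 qed (simp add: Y1)
 have t: "HY n (smY (sc (f w) A1) (actw w Y1))" if "f w ~= 0" for w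
 proof -
  have "wdeg w = n" using that h by (metis hc_def)
  moreover have "valid V w" using f that by (auto simp: word_carrier_iff valid_def)
  ultimately show ?thesis using HY_smY[OF HA_rules(4)[OF HA_one] w[of w], of "f w"] by simp
 qed
 have sum: "HY n (\<Sum>w\<in>T. F w)" if "!!w. w : T ==> HY n (F w)" for T and F :: "(int \<times> 'a \<times> 'g) list => ('a, 'g) wmd"
  using that by (induction T rule: infinite_finite_induct) (auto intro: HY_rules)
 show ?thesis unfolding Act_def by (rule sum, rule t) simp
qed

lemma kap_Al: "valid V [l] ==> kap (Al l y) - word [l] ** kap y : K"
proof -
 assume "valid V [l]"
 then obtain n a x where l: "l = (n, (a, x))" and h: "a : hp A n" "x : hp G n" by (cases l) auto
 have 1: "kap (star (s x) y) - wG n x ** kap y : K"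
  using s_hom[OF h(2)] h(2) by (intro kap_star_Fs) auto
 have 2: "kap (smY (eA a) y) - wA n a ** kap y : K"
  by (rule K_trans[OF kap_smY[OF h(1)] K_right_cong[OF al_K[OF h(1)] kap_FS]])
 have 3: "(wA n a + wG n x) ** kap y - word [l] ** kap y : K"
  unfolding l by (rule K_right_cong[OF K_sym[OF lr_split[OF K_ideal lin_K h]] kap_FS])
 from K_trans[OF kap_add K_add_cong[OF 2 1]] 3 show ?thesis
  unfolding Al_def l fst_conv snd_conv cm_distrib by (rule K_trans)
qed

lemma kap_const: "kap (smY (sc c A1) y) - sc c (kap y) : K"
proof -
 have c: "c \<odot> \<one> : hp A 0" by (simp add: A_smult_hpart)
 have 1: "kap (smY (sc c A1) y) - al (c \<odot> \<one>) ** kap y : K"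
  using kap_smY[OF c, of y] by (simp add: totA)
 have "wA 0 (c \<odot> \<one>) - sc c one1 : K"
  using lr_sc[OF K_ideal lin_K A_one M_zero[of 0], of c] by (simp add: sm_def G_smult_zero)
 from K_right_cong[OF K_trans[OF al_K[OF c] this] kap_FS]
 have 2: "al (c \<odot> \<one>) ** kap y - sc c (one1 ** kap y) : K" by (simp add: cm_distrib)
 show ?thesis using K_trans[OF K_trans[OF 1 2] K_sc_cong[OF one1_left[OF kap_FS1]]] .
qed

lemma kap_Act: "f : FS ==> kap (Act f y) - f ** kap y : K"
proof (induction f rule: FS_induct)
 case (word c w)
 have "kap (actw w y) - word w ** kap y : K" using word
 proof (induction w)
  case (Cons l w)
  then have l: "valid V [l]" "valid V w" by auto
  have "word [l] : FS" using l(1) by (simp only: FS_word)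
  from K_trans[OF kap_Al[OF l(1)] K_left_cong[OF Cons(1)[OF l(2)] this]]
  show ?case by (simp add: word_cm_Cons[of l w])
 qed (simp add: K_zero)
 from K_sc_cong[OF this] have 1: "sc c (kap (actw w y)) - sc c (word w ** kap y) : K" .
 have "Act (sc c (word w)) y = smY (sc c A1) (actw w y)"
  using word by (simp add: Act_word smY_smY am_sc am_one sc_simps(4))
 then show ?case using K_trans[OF kap_const 1] by (simp add: cm_distrib)
next
 case (add g h)
 from K_trans[OF kap_add K_add_cong[OF add(3,4)]] show ?case using add(1,2) by (simp add: Act_add cm_distrib)
qed (simp add: K_zero)

text \<open>\<open>kap\<close> intertwines the action on Y with left multiplication in
  \<open>U\<close> and sends 1 to the unit; so acting on 1 and mapping back is the identity of
  \<open>U\<close>.\<close>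

lemma kap_Act_Y1: "f : FS1 ==> kap (Act f Y1) - f : K"
proof -
 assume f: "f : FS1"
 note F = FS1_FS[OF f]
 have o: "one1 : FS1" using word_Nil0[of "[(0, (\<one>, \<zero>\<^sub>G))]"] by (simp add: FS1_def)
 have "kap Y1 = al \<one> ** one1" by (simp add: kap_single kw_def)
 then have "kap Y1 - one1 : K" using al_one[OF o] by simp
 from K_trans[OF K_trans[OF kap_Act[OF F] K_left_cong[OF this F]] one1_right[OF f]] show ?thesis .
qed

definition "rep u = (SOME f. f : FS1 & u = pr f)"

lemma rep: "f : FS1 ==> rep (pr f) : FS1 & rep (pr f) - f : K"
proof -
 assume f: "f : FS1"
 have "rep (pr f) : FS1 & pr f = pr (rep (pr f))" unfolding rep_def by (rule someI[of _ f]) (simp add: f)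
 then show ?thesis using pr_eq[of f "rep (pr f)"] f K_sym FS1_FS by blast
qed

lemma FS1_hc: "f : FS1 ==> hc n f : FS1"
proof -
 assume f: "f : FS1"
 have "hc n f [] = 0" using f by (auto simp: FS1_def hc_def)
 then show ?thesis using f by (simp add: FS1_def)
qed

text \<open>Components are taken on a representative. The result does not depend on the choice
  because \<open>K\<close> is homogeneous.\<close>

lemma U_graded: "graded_group U"
proof (rule graded_groupI(1)[OF U_group, where pr = "%n u. pr (hc n (rep u))"])
 have hp: "pr (hc n (rep (pr f))) = pr (hc n f)" if "f : FS1" for f n
 proof -
  have "hc n (rep (pr f) - f) : K" by (rule hc_K) (use rep[OF that] in blast)
  then show ?thesis using rep[OF that] that FS1_FS by (subst pr_eq) auto
 qed
 show "subgroup (hp U n) (add_monoid U)" for n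
 proof (rule U.add.subgroupI)
  show "hp U n <= car U" by (auto simp: U_hpart U_carrier)
  show "hp U n ~= {}" using wideal_zero[OF FS1_wideal] by (auto simp: U_hpart)
 next
  fix u assume "u : hp U n"
  then obtain f where f: "u = pr f" "f : FS1" "hc n f = f" by (auto simp: U_hpart)
  have m: "- f : FS1" by (rule wideal_minus[OF FS1_wideal f(2)])
  have "\<ominus>\<^sub>U u = pr (- f)"
   using f m FS1_FS by (intro U.minus_equality) (auto simp: U_carrier U_add U_zero)
  then show "\<ominus>\<^sub>U u : hp U n" using f m by (auto simp: U_hpart)
 next
  fix u v assume "u : hp U n" "v : hp U n"
  then obtain f g where f: "u = pr f" "f : FS1" "hc n f = f" "v = pr g" "g : FS1" "hc n g = g" by (auto simp: U_hpart)
  have "f + g : FS1" by (rule wideal_add[OF FS1_wideal f(2,5)])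
  moreover have "hc n (f + g) = f + g" using f by simp
  ultimately show "u \<oplus>\<^sub>U v : hp U n" using f FS1_FS by (auto simp: U_hpart U_add)
 qed
 show "pr (hc n (rep u)) : car U" if "u : car U" for n u
 proof -
  obtain f where f: "u = pr f" "f : FS1" using \<open>u : car U\<close> by (auto simp: U_carrier)
  show ?thesis unfolding f(1) hp[OF f(2)] U_carrier by (rule imageI[OF FS1_hc[OF f(2)]])
 qed
 show "pr (hc n (rep (u \<oplus>\<^sub>U v))) = pr (hc n (rep u)) \<oplus>\<^sub>U pr (hc n (rep v))" if uv: "u : car U" "v : car U" for n u v
 proof -
  obtain f g where f: "u = pr f" "f : FS1" "v = pr g" "g : FS1" using uv by (auto simp: U_carrier)
  have e: "u \<oplus>\<^sub>U v = pr (f + g)" using f FS1_FS by (simp add: U_add)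
  show ?thesis unfolding e unfolding hp[OF wideal_add[OF FS1_wideal f(2,4)]] f(1,3) hp[OF f(2)] hp[OF f(4)]
   using f FS1_FS by (simp add: U_add)
 qed
 show "pr (hc n (rep u)) = (if m = n then u else \<zero>\<^sub>U)" if u: "u : hp U m" for n m u
 proof -
  obtain f where f: "u = pr f" "f : FS1" "hc m f = f" using u by (auto simp: U_hpart)
  have "hc n f = (if n = m then f else 0)" using hc_hc[of n m f] unfolding f(3) .
  then show ?thesis unfolding f(1) hp[OF f(2)] by (cases "m = n") (auto simp: U_zero)
 qed
 show "\<exists>T F. finite T & (\<forall>n\<in>T. F n : hp U n) & u = (\<Oplus>\<^bsub>U\<^esub>n\<in>T. F n)" if u: "u : car U" for u
 proof -
  obtain f where f: "u = pr f" "f : FS1" using u by (auto simp: U_carrier)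
  obtain T where T: "finite T" "f = (\<Sum>n\<in>T. hc n f)" using hc_sum[OF FS1_FS[OF f(2)]] by blast
  have "u = (\<Oplus>\<^bsub>U\<^esub>n\<in>T. pr (hc n f))" using U_finsum[OF T(1), of "%n. hc n f"] FS1_hc[OF f(2)] T(2) f(1) by simp
  moreover have "pr (hc n f) : hp U n" for n unfolding U_hpart by (rule imageI) (simp add: FS1_hc[OF f(2)] hc_hc)
  ultimately show ?thesis using T(1) by (intro exI[of _ T] exI[of _ "%n. pr (hc n f)"]) simp
 qed
qed

lemma U_smult_FS1: "a : car A ==> f : FS1 ==> a \<odot>\<^sub>U pr f = pr (al a ** f) & al a ** f : FS1"
 using U_smult FS1_FS wideal_left[OF FS1_wideal _ al_FS] by blast

lemma pr_K: "f - g : K ==> f : FS1 ==> g : FS1 ==> pr f = pr g"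
 using pr_eq FS1_FS by blast

lemma U_module: "graded_module A U"
 unfolding graded_module_def
proof (intro conjI ballI allI)
 show "graded_group U" by (rule U_graded)
 note FSadd = wideal_add[OF FS1_wideal]
 fix a b u assume a: "a : car A" and u: "u : car U"
 obtain f where f: "u = pr f" "f : FS1" using u by (auto simp: U_carrier)
 note F = FS1_FS[OF f(2)]
 show "a \<odot>\<^sub>U u : car U" using U_smult_FS1[OF a f(2)] f(1) by (auto simp: U_carrier)
 assume b: "b : car A"
 note sa = U_smult_FS1[OF a f(2)] and sb = U_smult_FS1[OF b f(2)]
 have "pr (al (a \<oplus> b) ** f) = pr (al a ** f + al b ** f)"
  by (rule pr_K) (use K_right_cong[OF al_add_K[OF a b] F] U_smult_FS1[OF A.a_closed[OF a b] f(2)] sa sb FSadd in \<open>auto simp: cm_distrib\<close>)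
 then show "(a \<oplus> b) \<odot>\<^sub>U u = a \<odot>\<^sub>U u \<oplus>\<^sub>U b \<odot>\<^sub>U u"
  using U_smult_FS1[OF A.a_closed[OF a b] f(2)] sa sb FS1_FS by (simp add: f(1) U_add)
 note sab = U_smult_FS1[OF a conjunct2[OF sb]]
 have "pr (al (a \<otimes> b) ** f) = pr (al a ** (al b ** f))"
  by (rule pr_K) (use K_right_cong[OF K_sym[OF al_mult[OF a b]] F] U_smult_FS1[OF A.m_closed[OF a b] f(2)] sab in \<open>auto simp: cm_assoc\<close>)
 then show "(a \<otimes> b) \<odot>\<^sub>U u = a \<odot>\<^sub>U (b \<odot>\<^sub>U u)"
  using U_smult_FS1[OF A.m_closed[OF a b] f(2)] sb sab by (simp add: f(1))
next
 fix a u v assume a: "a : car A" and uv: "u : car U" "v : car U"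
 obtain f g where f: "u = pr f" "f : FS1" "v = pr g" "g : FS1" using uv by (auto simp: U_carrier)
 show "a \<odot>\<^sub>U (u \<oplus>\<^sub>U v) = a \<odot>\<^sub>U u \<oplus>\<^sub>U a \<odot>\<^sub>U v"
  using U_smult_FS1[OF a f(2)] U_smult_FS1[OF a f(4)] U_smult_FS1[OF a wideal_add[OF FS1_wideal f(2,4)]] f FS1_FS
  by (simp add: U_add cm_distrib)
next
 fix u assume "u : car U"
 then obtain f where f: "u = pr f" "f : FS1" by (auto simp: U_carrier)
 have "pr (al \<one> ** f) = pr f" by (rule pr_K[OF al_one]) (use f U_smult_FS1 in auto)
 then show "\<one> \<odot>\<^sub>U u = u" using U_smult_FS1[OF A.one_closed f(2)] f by simp
next
 fix n m a u assume a: "a : hp A n" and "u : hp U m"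
 then obtain f where f: "u = pr f" "f : FS1" "hc m f = f" by (auto simp: U_hpart)
 have l: "wA n a : FS" using a by simp
 have w: "wA n a ** f : FS1" by (rule wideal_left[OF FS1_wideal f(2) l])
 have "pr (al a ** f) = pr (wA n a ** f)"
  by (rule pr_K[OF K_right_cong[OF al_K[OF a] FS1_FS[OF f(2)]]]) (use w U_smult_FS1[OF A_hcarr[OF a] f(2)] in auto)
 moreover have "hc (n + m) (wA n a ** f) = wA n a ** f" using f(3) FS1_FS[OF f(2)] by (simp add: hc_letter_left)
 ultimately show "a \<odot>\<^sub>U u : hp U (n + m)"
  using U_smult_FS1[OF A_hcarr[OF a] f(2)] w by (auto simp: f(1) U_hpart)
qed

text \<open>Y is free on words, so the composite of f with the map from Y to \<open>U\<close> lifts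
  through p once values on words are chosen, in the degrees of the words. Restricting this lift
  along the action on 1 gives a lift of f, as the composite from \<open>U\<close> through Y back to
  \<open>U\<close> is the identity.\<close>

theorem U_projective: "graded_projective TYPE('p) TYPE('q) A U"
 unfolding graded_projective_def
proof (intro conjI allI impI)
 show "graded_module A U" by (rule U_module)
 fix N :: "('a, 'p) gmod" and Q :: "('a, 'q) gmod" and p f
 assume H: "graded_module A N & graded_module A Q & graded_module_hom A N Q p & degreewise_surj N Q p & graded_module_hom A U Q f"
 then have N: "graded_group N" "!!a x. a : car A ==> x : car N ==> a \<odot>\<^sub>N x : car N"
  "!!a b x. a : car A ==> b : car A ==> x : car N ==> (a \<oplus> b) \<odot>\<^sub>N x = a \<odot>\<^sub>N x \<oplus>\<^sub>N b \<odot>\<^sub>N x"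
  "!!a x y. a : car A ==> x : car N ==> y : car N ==> a \<odot>\<^sub>N (x \<oplus>\<^sub>N y) = a \<odot>\<^sub>N x \<oplus>\<^sub>N a \<odot>\<^sub>N y"
  "!!a b x. a : car A ==> b : car A ==> x : car N ==> (a \<otimes> b) \<odot>\<^sub>N x = a \<odot>\<^sub>N (b \<odot>\<^sub>N x)"
  "!!n m a x. a : hp A n ==> x : hp N m ==> a \<odot>\<^sub>N x : hp N (n + m)"
  and Q: "graded_group Q" and p: "graded_module_hom A N Q p" and surj: "degreewise_surj N Q p" and f: "graded_module_hom A U Q f"
  by (simp_all add: graded_module_def)
 have pf: "!!x y. x : car N ==> y : car N ==> p (x \<oplus>\<^sub>N y) = p x \<oplus>\<^sub>Q p y"
  "!!a x. a : car A ==> x : car N ==> p (a \<odot>\<^sub>N x) = a \<odot>\<^sub>Q p x"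
  "!!x y. x : car U ==> y : car U ==> f (x \<oplus>\<^sub>U y) = f x \<oplus>\<^sub>Q f y"
  "!!a x. a : car A ==> x : car U ==> f (a \<odot>\<^sub>U x) = a \<odot>\<^sub>Q f x"
  "!!n x. x : hp U n ==> f x : hp Q n"
  using p f by (simp_all add: graded_module_hom_def)
 interpret N: abelian_group N by (rule graded_group_abelian[OF N(1)])
 interpret Q: abelian_group Q by (rule graded_group_abelian[OF Q])
 have "\<exists>x. x : hp N (wdeg w) & p x = f (pr (kw w))" for w
 proof -
  have "pr (kw w) : hp U (wdeg w)" unfolding U_hpart by (rule imageI) (simp add: kw_FS1 hc_kw)
  from pf(5)[OF this] surj show ?thesis unfolding degreewise_surj_def by (metis (no_types, lifting) imageE)
 qed
 then obtain q where q: "!!w. q w : hp N (wdeg w)" "!!w. p (q w) = f (pr (kw w))" by metis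
 have qc: "q w : car N" for w by (rule hpart_carrier[OF N(1) q(1)])
 have z: "\<zero> \<odot>\<^sub>N x = \<zero>\<^sub>N" if "x : car N" for x
  using N(3)[of "\<zero>" "\<zero>" x] N(2)[of "\<zero>" x] that by (metis A.l_zero A.zero_closed N.add.l_cancel_one')
 define t where "t y w = dA (lookup y w) \<odot>\<^sub>N q w" for y w
 have tc: "t y w : car N" for y w unfolding t_def by (rule N(2)) (simp_all add: qc)
 define hs where "hs y = (\<Oplus>\<^bsub>N\<^esub>w\<in>keys y. t y w)" for y
 have hs_sup: "hs y = (\<Oplus>\<^bsub>N\<^esub>w\<in>T. t y w)" if "finite T" "keys y <= T" for y T
  unfolding hs_def by (rule N.add.finprod_mono_neutral_cong_left) (use that tc in \<open>auto simp: t_def in_keys_iff z qc\<close>)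
 have hs_c: "hs y : car N" for y unfolding hs_def using tc by (intro N.finsum_closed) auto
 have hs_add: "hs (y + y') = hs y \<oplus>\<^sub>N hs y'" for y y'
 proof -
  let ?T = "keys y \<union> keys y'"
  have T: "finite ?T" by simp
  have tt: "t (y + y') w = t y w \<oplus>\<^sub>N t y' w" for w by (simp add: t_def lookup_add totA N(3) qc)
  have "hs (y + y') = (\<Oplus>\<^bsub>N\<^esub>w\<in>?T. t y w \<oplus>\<^sub>N t y' w)"
   unfolding hs_sup[OF T Poly_Mapping.keys_add[of y y']] by (rule N.finsum_cong') (auto simp: tt tc)
  also have "\<dots> = hs y \<oplus>\<^sub>N hs y'"
   using hs_sup[OF T, of y] hs_sup[OF T, of y'] tc by (simp add: N.finsum_addf)
  finally show ?thesis .
 qed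
 have hs_sm: "hs (smY (eA a) y) = a \<odot>\<^sub>N hs y" if a: "a : car A" for a y
 proof -
  have k: "keys (smY (eA a) y) <= keys y" by (auto simp: in_keys_iff lookup_smY am_lin)
  have "hs (smY (eA a) y) = (\<Oplus>\<^bsub>N\<^esub>w\<in>keys y. a \<odot>\<^sub>N t y w)"
   unfolding hs_sup[OF finite_keys k]
  proof (rule N.finsum_cong')
   show "t (smY (eA a) y) w = a \<odot>\<^sub>N t y w" for w using a by (simp add: t_def lookup_smY am_def N(5) qc)
  qed (use a N(2) tc in auto)
  also have "\<dots> = a \<odot>\<^sub>N hs y" unfolding hs_def
   by (rule additive_finsum(1)[symmetric]) (use a N(2,4) tc N.abelian_group_axioms in auto)
  finally show ?thesis .
 qed
 have hs_h: "hs y : hp N n" if y: "HY n y" for y n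
  unfolding hs_def
 proof (rule hpart_finsum[OF N(1)])
  fix w
  have "HA (n - wdeg w) (lookup y w)" using y by (simp add: HY_def)
  then have "dA (lookup y w) : hp A (n - wdeg w)" by (auto simp: HA_def)
  from N(6)[OF this q(1)[of w]] show "t y w : hp N n" by (simp add: t_def)
 qed simp
 have lift: "p (hs (Act g Y1)) = f (pr g)" if g: "g : FS1" for g
 proof -
  let ?y = "Act g Y1" and ?T = "keys (Act g Y1)"
  let ?k = "%w. al (dA (lookup (Act g Y1) w)) ** kw w"
  have fin: "finite ?T" by simp
  have k: "?k w : FS1" for w by (rule kap_term_FS1)
  have kc: "pr (?k w) : car U" for w unfolding U_carrier by (rule imageI[OF k])
  have kk: "pr (kw w) : car U" for w unfolding U_carrier by (rule imageI[OF kw_FS1])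
  have fc: "u : car U ==> f u : car Q" for u by (rule graded_module_hom_closed[OF U_graded Q f])
  have pc: "x : car N ==> p x : car Q" for x by (rule graded_module_hom_closed[OF N(1) Q p])
  have "p (hs ?y) = (\<Oplus>\<^bsub>Q\<^esub>w\<in>?T. p (t ?y w))"
   unfolding hs_def by (rule additive_finsum(1)[OF N.abelian_group_axioms Q.abelian_group_axioms fin tc pc pf(1)])
  also have "\<dots> = (\<Oplus>\<^bsub>Q\<^esub>w\<in>?T. f (pr (?k w)))"
  proof (rule Q.finsum_cong')
   show "p (t ?y w) = f (pr (?k w))" for w
    using U_smult_FS1[OF totA(1) kw_FS1, of "lookup (Act g Y1) w" w] pf(4)[OF totA(1) kk, of "lookup (Act g Y1) w" w]
    by (simp add: t_def pf(2) qc q(2))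
  qed (use fc kc in auto)
  also have "\<dots> = f (\<Oplus>\<^bsub>U\<^esub>w\<in>?T. pr (?k w))"
   by (rule additive_finsum(1)[OF U_group Q.abelian_group_axioms fin kc fc pf(3), symmetric])
  also have "(\<Oplus>\<^bsub>U\<^esub>w\<in>?T. pr (?k w)) = pr (kap ?y)"
   unfolding kap_def by (rule U_finsum[OF fin k])
  also have "pr (kap ?y) = pr g" by (rule pr_K[OF kap_Act_Y1[OF g] kap_FS1 g])
  finally show ?thesis .
 qed
 \<comment> \<open>The choice made by \<open>rep\<close> does not matter: elements of
   \<open>K\<close> act on 1 by zero.\<close>
 define h where "h u = hs (Act (rep u) Y1)" for u
 have h: "h (pr g) = hs (Act g Y1)" if "g : FS1" for g
  using Act_K_eq[of "rep (pr g)" g] rep[OF that] that FS1_FS by (simp add: h_def)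
 have "graded_module_hom A U N h"
  unfolding graded_module_hom_def
 proof (intro conjI allI ballI)
  fix n u assume "u : hp U n"
  then obtain g where g: "u = pr g" "g : FS1" "hc n g = g" by (auto simp: U_hpart)
  show "h u : hp N n" unfolding g(1) h[OF g(2)] by (rule hs_h[OF HY_Act[OF FS1_FS[OF g(2)] g(3)]])
 next
  fix u v assume "u : car U" "v : car U"
  then obtain g g' where g: "u = pr g" "g : FS1" "v = pr g'" "g' : FS1" by (auto simp: U_carrier)
  show "h (u \<oplus>\<^sub>U v) = h u \<oplus>\<^sub>N h v"
   using g FS1_FS h[OF wideal_add[OF FS1_wideal g(2,4)]] by (simp add: U_add h Act_add hs_add)
 next
  fix a u assume a: "a : car A" and "u : car U"
  then obtain g where g: "u = pr g" "g : FS1" by (auto simp: U_carrier)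
  show "h (a \<odot>\<^sub>U u) = a \<odot>\<^sub>N h u"
   using g U_smult_FS1[OF a g(2)] FS1_FS[OF g(2)] a by (simp add: h Act_al hs_sm)
 qed
 moreover have "\<forall>u\<in>car U. p (h u) = f u"
 proof
  fix u assume "u : car U"
  then obtain g where g: "u = pr g" "g : FS1" by (auto simp: U_carrier)
  show "p (h u) = f u" unfolding g(1) h[OF g(2)] by (rule lift[OF g(2)])
 qed
 ultimately show "\<exists>h. graded_module_hom A U N h & (\<forall>x\<in>car U. p (h x) = f x)" by (intro exI[of _ h] conjI)
qed

end

theorem mainTheorem7:
  fixes A :: "(complex, 'a) dgmod" and G :: "('a, 'g) algebroid"
  assumes "cofibrant_cdga A" and "connective A" and "cofibrant_lie_algebroid A G"
  shows "(\<exists>!\<phi>. canonical_map A G \<phi>) \<and>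
         (\<forall>\<phi>. canonical_map A G \<phi> \<longrightarrow> graded_dg_algebra_iso A (Sym A G) (grU A G) \<phi>) \<and>
         graded_projective TYPE('p) TYPE('q) A (UEA A G)"
proof -
 interpret algebroid_loc A G
  by unfold_locales (use assms in \<open>simp_all add: cofibrant_cdga_def cofibrant_lie_algebroid_def\<close>)
 show ?thesis
 proof (rule G_section[OF assms(3)])
  fix s assume s: "!!n x. x : hp G n ==> s x : Fs & HY n (s x) & rY (s x) = eG x"
   "!!x y. x : car G ==> y : car G ==> s (x \<oplus>\<^sub>G y) = s x + s y"
   "!!a x. a : car A ==> x : car G ==> s (a \<odot>\<^sub>G x) = smY (eA a) (s x)"
   "!!x y. x : car G ==> y : car G ==> s (bracket G x y) = br (s x) (s y)"
  have iso: "graded_dg_algebra_iso A (Sym A G) (grU A G) phi"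
   by (rule flat_data.PBW_iso[OF section_flat_data[OF s]])
  have "section_loc A G s"
   by (intro section_loc.intro section_loc_axioms.intro algebroid_loc_axioms s)
  then have proj: "graded_projective TYPE('p) TYPE('q) A (UEA A G)" by (rule section_loc.U_projective)
  show ?thesis
  proof (intro conjI allI impI proj)
   show "\<exists>!\<phi>. canonical_map A G \<phi>"
    by (rule ex1I[of _ phi]) (rule phi_canonical, rule canonical_unique[OF _ phi_canonical])
   show "graded_dg_algebra_iso A (Sym A G) (grU A G) \<phi>" if "canonical_map A G \<phi>" for \<phi>
    unfolding canonical_unique[OF that phi_canonical] by (rule iso)
  qed
 qed
qed

end
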